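(* Let $G$ be a finite group and $V$ an $n$-dimensional complex representation of $G$. Then the smash product $\mathbb{C}[V]\# G$ is a derivation-quotient algebra of order $n-2$ (over the semisimple algebra $S=\mathbb{C}G$ with $S$-bimodule $U=V^*\otimes_{\mathbb{C}}\mathbb{C}G$), i.e. $\mathbb{C}[V]\# G\cong \mathcal{D}(\Omega,n-2)$, for a superpotential $\Omega\in T_{\mathbb{C}G}U$ of degree $n$ (a twisted superpotential if the image of $G$ is not contained in $SL(V)\cong SL_n$). The same is true for the corresponding Morita equivalent path algebra with relations: $e(\mathbb{C}[V]\# G)e\cong\mathcal{D}(\Phi,n-2)$ for a superpotential (twisted if the image of $G$ is not contained in $SL(V)$) $\Phi$ of degree $n$ in the path algebra $\mathbb{C}Q$ of the McKay quiver $Q$.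
   Context: $\mathbb{C}[V]$ is the ring of polynomial functions on $V$; for an algebra $R$ with $G$-action by automorphisms, $R\#G=R\otimes_{\mathbb{C}}\mathbb{C}G$ with product $(r_1\otimes g_1)(r_2\otimes g_2)=r_1(g_1\cdot r_2)\otimes g_1g_2$. $U=V^*\otimes_{\mathbb{C}}\mathbb{C}G$ is a $\mathbb{C}G$-bimodule via $g(v\otimes x)h=gv\otimes gxh$, and $T_{\mathbb{C}}V^*\#G\cong T_{\mathbb{C}G}U$. The trace on $\mathbb{C}G\cong\bigoplus_i \mathrm{Mat}_{\dim S_i}(\mathbb{C})$ (sum over the simple representations $S_i$) is the sum of the standard matrix traces. Corresponding path algebra: choose $e=\sum_i e_i$, where the $e_i\in\mathbb{C}G$ are orthogonal minimal idempotents, one for each simple representation, with $S_i\cong\mathbb{C}Ge_i$, chosen so that $e^\tau=e$, where $\tau(g)=\det(g)\,g$ on $\mathbb{C}G$. Then $e(\mathbb{C}[V]\# G)e$ is Morita equivalent to $\mathbb{C}[V]\#G$, and $e(T_{\mathbb{C}G}U)e\cong\mathbb{C}Q$, where $Q$ is the McKay quiver: vertices $e_i$, and the number of arrows from $e_i$ to $e_j$ is $\dim e_jUe_i=\dim \mathrm{Hom}_{\mathbb{C}G}(S_j,V^*\otimes S_i)$. For a quiver, $S=\mathbb{C}^{Q_0}$, every vertex has trace $1$, and the bimodule is the span of the arrows. General definitions. Let $S$ be a finite-dimensional semisimple $\mathbb{C}$-algebra with a fixed nondegenerate trace $\mathrm{Tr}:S\to\mathbb{C}$, and $V$ a finite-dimensional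 $S$-bimodule (here $V$ is a generic name; above it is $U$ or the arrow space). $V^*=\mathrm{Hom}_{\mathbb{C}}(V,\mathbb{C})$ with $(s_1\psi s_2)(w)=\psi(s_2ws_1)$. For $\psi\in V^*$, $w\in V$, $[\psi w]\in S$ and $[w\psi]\in S$ are defined by $\mathrm{Tr}([\psi w]s)=\psi(ws)$ and $\mathrm{Tr}(s[w\psi])=\psi(sw)$ for all $s\in S$. Tensor powers are over $S$. Set $[\psi\, w_1\otimes\cdots\otimes w_l]=[\psi w_1]w_2\otimes\cdots\otimes w_l$, $[w_1\otimes\cdots\otimes w_l\,\psi]=w_1\otimes\cdots\otimes w_{l-1}[w_l\psi]$, and $[\phi_1\otimes\cdots\otimes\phi_k\, w]=[\phi_1[\phi_2\cdots[\phi_kw]\cdots]]$; $(V^{\otimes k})^*$ is identified with $(V^* )^{\otimes k}$. A superpotential of degree $n$ is $\omega\in V^{\otimes n}$ with $s\omega=\omega s$ for all $s\in S$ and $[\psi\omega]=(-1)^{n-1}[\omega\psi]$ for all $\psi\in V^*$. For a graded $\mathbb{C}$-algebra automorphism $\tau$ of $T_SV$ preserving the trace, a twisted superpotential of degree $n$ is $\omega\in V^{\otimes n}$ with $s^\tau\omega=\omega s$ for all $s\in S$ and $[\psi^{\tau^*}\omega]=(-1)^{n-1}[\omega\psi]$ for all $\psi\in V^*$, where $\psi^{\tau^*}=\psi\circ\tau^{-1}$ (in the path algebra case: $\omega$ is a combination of paths invariant under $a_1\cdots a_n\mapsto(-1)^{n-1}\tau(a_n)a_1\cdots a_{n-1}$).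 Let $W_{n-k}\subset V^{\otimes(n-k)}$ be the span of all $[\psi\omega x]$, $\psi\in(V^{\otimes k})^*$, $x\in S$. The derivation-quotient algebra of order $k$ is $\mathcal{D}(\omega,k)=T_SV/\langle W_{n-k}\rangle$ (for path algebras: $\mathbb{C}Q$ modulo the partial derivatives $\partial_p\omega$ over paths $p$ of length $k$, where $\partial_pq=r$ if $q=pr$ and $0$ otherwise). *)

theory Defs
  imports
    "HOL-Analysis.Analysis"
    "HOL-Algebra.Algebra"
    "HOL-Algebra.Algebraic_Closure_Type"
    "HOL-Library.Function_Algebras"
    "HOL-Library.Poly_Mapping"
    "Jordan_Normal_Form.Matrix"
    "Graph_Theory.Digraph"
begin

section \<open>Complex algebras\<close>

text \<open>
  A (not necessarily commutative) complex algebra is a \<^type>\<open>module\<close> record over the complex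
  numbers, which carries a ring structure together with the scalar multiplication. The locale
  \<^locale>\<open>algebra\<close> of the library is not used because it requires commutativity.
\<close>

type_synonym 'a calgebra = "(complex, 'a) module"

definition lin_span :: "'a calgebra \<Rightarrow> 'a set \<Rightarrow> 'a set" where
  "lin_span A Z = \<Inter>{M. Z \<subseteq> M \<and> submodule M (ring_of_type_algebra :: complex ring) A}"

definition alg_iso :: "'a calgebra \<Rightarrow> 'b calgebra \<Rightarrow> ('a \<Rightarrow> 'b) set" where
  "alg_iso A B = {f \<in> ring_iso A B. \<forall>c. \<forall>a\<in>carrier A. f (c \<odot>\<^bsub>A\<^esub> a) = c \<odot>\<^bsub>B\<^esub> f a}"

definition alg_isomorphic :: "'a calgebra \<Rightarrow> 'b calgebra \<Rightarrow> bool" where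
  "alg_isomorphic A B \<longleftrightarrow> alg_iso A B \<noteq> {}"

definition alg_quot :: "'a calgebra \<Rightarrow> 'a set \<Rightarrow> 'a set calgebra" where
  "alg_quot A I =
    \<lparr>carrier = carrier (A Quot I), monoid.mult = monoid.mult (A Quot I), monoid.one = monoid.one (A Quot I),
     ring.zero = ring.zero (A Quot I), ring.add = ring.add (A Quot I),
     smult = (\<lambda>c Z. \<Union>a\<in>Z. I +>\<^bsub>A\<^esub> (c \<odot>\<^bsub>A\<^esub> a))\<rparr>"

definition corner :: "'a calgebra \<Rightarrow> 'a \<Rightarrow> 'a calgebra" where
  "corner A e = A\<lparr>carrier := {e \<otimes>\<^bsub>A\<^esub> a \<otimes>\<^bsub>A\<^esub> e | a. a \<in> carrier A}, monoid.one := e\<rparr>"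

definition matrix_blocks :: "nat \<Rightarrow> (nat \<Rightarrow> nat) \<Rightarrow> (nat \<Rightarrow> complex mat) calgebra" where
  "matrix_blocks m d =
    \<lparr>carrier = (\<Pi>\<^sub>E i\<in>{..<m}. carrier_mat (d i) (d i)),
     monoid.mult = (\<lambda>Z Y. \<lambda>i\<in>{..<m}. Z i * Y i), monoid.one = (\<lambda>i\<in>{..<m}. 1\<^sub>m (d i)),
     ring.zero = (\<lambda>i\<in>{..<m}. 0\<^sub>m (d i) (d i)), ring.add = (\<lambda>Z Y. \<lambda>i\<in>{..<m}. Z i + Y i),
     smult = (\<lambda>c Z. \<lambda>i\<in>{..<m}. c \<cdot>\<^sub>m Z i)\<rparr>"

text \<open>
  The trace on a semisimple algebra that is the sum of the standard matrix traces under a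
  Wedderburn decomposition. It does not depend on the decomposition.
\<close>

definition sum_of_matrix_traces :: "'a calgebra \<Rightarrow> ('a \<Rightarrow> complex) \<Rightarrow> bool" where
  "sum_of_matrix_traces A Tr \<longleftrightarrow>
    (\<exists>m d \<theta>. (\<forall>i<m. 0 < d i) \<and> \<theta> \<in> alg_iso A (matrix_blocks m d) \<and>
      (\<forall>x\<in>carrier A. Tr x = (\<Sum>i<m. \<Sum>j<d i. \<theta> x i $$ (j, j))))"

section \<open>Bimodules and tensor algebras\<close>

record ('s, 'v) bimodule =
  bcarrier :: "'v set"
  badd :: "'v \<Rightarrow> 'v \<Rightarrow> 'v"
  bscale :: "complex \<Rightarrow> 'v \<Rightarrow> 'v"
  lact :: "'s \<Rightarrow> 'v \<Rightarrow> 'v"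
  ract :: "'v \<Rightarrow> 's \<Rightarrow> 'v"

definition bdual :: "('s, 'v) bimodule \<Rightarrow> ('v \<Rightarrow> complex) set" where
  "bdual V = {\<psi>. (\<forall>v\<in>bcarrier V. \<forall>w\<in>bcarrier V. \<psi> (badd V v w) = \<psi> v + \<psi> w) \<and>
                  (\<forall>c. \<forall>v\<in>bcarrier V. \<psi> (bscale V c v) = c * \<psi> v)}"

text \<open>
  The tensor algebra is the direct sum of the tensor powers of \<open>V\<close> over \<open>S\<close>, the power of
  degree 0 being \<open>S\<close>. It is built as the space of formal linear combinations of pure tensors
  (an element of \<open>S\<close>, or a nonempty list standing for \<open>v\<^sub>1 \<otimes> \<dots> \<otimes> v\<^sub>l\<close>), modulo the linear span of
  the relations making the list multilinear and balanced over \<open>S\<close>. \<open>Tensor []\<close> is junk.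
\<close>

datatype ('s, 'v) pure_tensor = Scalar 's | Tensor "'v list"

type_synonym ('s, 'v) formal = "('s, 'v) pure_tensor \<Rightarrow>\<^sub>0 complex"

definition pure_tensors :: "'s set \<Rightarrow> 'v set \<Rightarrow> ('s, 'v) pure_tensor set" where
  "pure_tensors A B = Scalar ` A \<union> {Tensor vs | vs. vs \<noteq> [] \<and> set vs \<subseteq> B}"

fun tensor_degree :: "('s, 'v) pure_tensor \<Rightarrow> nat" where
  "tensor_degree (Scalar s) = 0"
| "tensor_degree (Tensor vs) = length vs"

fun pure_mult ::
  "'s calgebra \<Rightarrow> ('s, 'v) bimodule \<Rightarrow> ('s, 'v) pure_tensor \<Rightarrow> ('s, 'v) pure_tensor \<Rightarrow> ('s, 'v) pure_tensor"
where
  "pure_mult S V (Scalar s) (Scalar t) = Scalar (s \<otimes>\<^bsub>S\<^esub> t)"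
| "pure_mult S V (Scalar s) (Tensor vs) = Tensor (lact V s (hd vs) # tl vs)"
| "pure_mult S V (Tensor vs) (Scalar t) = Tensor (butlast vs @ [ract V (last vs) t])"
| "pure_mult S V (Tensor vs) (Tensor ws) = Tensor (vs @ ws)"

definition formal_scale :: "complex \<Rightarrow> ('s, 'v) formal \<Rightarrow> ('s, 'v) formal" where
  "formal_scale c f = Poly_Mapping.map (\<lambda>x. c * x) f"

definition formal_algebra :: "'s calgebra \<Rightarrow> ('s, 'v) bimodule \<Rightarrow> ('s, 'v) formal calgebra" where
  "formal_algebra S V =
    \<lparr>carrier = {f. Poly_Mapping.keys f \<subseteq> pure_tensors (carrier S) (bcarrier V)},
     monoid.mult = (\<lambda>f g. \<Sum>p\<in>Poly_Mapping.keys f. \<Sum>q\<in>Poly_Mapping.keys g.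
        Poly_Mapping.single (pure_mult S V p q) (Poly_Mapping.lookup f p * Poly_Mapping.lookup g q)),
     monoid.one = Poly_Mapping.single (Scalar \<one>\<^bsub>S\<^esub>) 1,
     ring.zero = 0, ring.add = (+), smult = formal_scale\<rparr>"

abbreviation pt :: "('s, 'v) pure_tensor \<Rightarrow> ('s, 'v) formal" where
  "pt p \<equiv> Poly_Mapping.single p 1"

definition tensor_relations :: "'s calgebra \<Rightarrow> ('s, 'v) bimodule \<Rightarrow> ('s, 'v) formal set" where
  "tensor_relations S V =
     {pt (Scalar (s \<oplus>\<^bsub>S\<^esub> t)) - pt (Scalar s) - pt (Scalar t) | s t. s \<in> carrier S \<and> t \<in> carrier S}
   \<union> {pt (Scalar (c \<odot>\<^bsub>S\<^esub> s)) - formal_scale c (pt (Scalar s)) | c s. s \<in> carrier S}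
   \<union> {pt (Tensor (us @ badd V v w # vs)) - pt (Tensor (us @ v # vs)) - pt (Tensor (us @ w # vs))
       | us v w vs. set us \<subseteq> bcarrier V \<and> set vs \<subseteq> bcarrier V \<and> v \<in> bcarrier V \<and> w \<in> bcarrier V}
   \<union> {pt (Tensor (us @ bscale V c v # vs)) - formal_scale c (pt (Tensor (us @ v # vs)))
       | us c v vs. set us \<subseteq> bcarrier V \<and> set vs \<subseteq> bcarrier V \<and> v \<in> bcarrier V}
   \<union> {pt (Tensor (us @ ract V v s # w # vs)) - pt (Tensor (us @ v # lact V s w # vs))
       | us v s w vs. set us \<subseteq> bcarrier V \<and> set vs \<subseteq> bcarrier V \<and>
          v \<in> bcarrier V \<and> w \<in> bcarrier V \<and> s \<in> carrier S}"

definition tensor_kernel :: "'s calgebra \<Rightarrow> ('s, 'v) bimodule \<Rightarrow> ('s, 'v) formal set" where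
  "tensor_kernel S V = lin_span (formal_algebra S V) (tensor_relations S V)"

definition tensor_class :: "'s calgebra \<Rightarrow> ('s, 'v) bimodule \<Rightarrow> ('s, 'v) formal \<Rightarrow> ('s, 'v) formal set" where
  "tensor_class S V f = tensor_kernel S V +>\<^bsub>formal_algebra S V\<^esub> f"

definition tensor_algebra :: "'s calgebra \<Rightarrow> ('s, 'v) bimodule \<Rightarrow> ('s, 'v) formal set calgebra" where
  "tensor_algebra S V = alg_quot (formal_algebra S V) (tensor_kernel S V)"

definition tensor_power :: "'s calgebra \<Rightarrow> ('s, 'v) bimodule \<Rightarrow> nat \<Rightarrow> ('s, 'v) formal set set" where
  "tensor_power S V d = {tensor_class S V f | f.
     f \<in> carrier (formal_algebra S V) \<and> (\<forall>p\<in>Poly_Mapping.keys f. tensor_degree p = d)}"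

definition scalar_emb :: "'s calgebra \<Rightarrow> ('s, 'v) bimodule \<Rightarrow> 's \<Rightarrow> ('s, 'v) formal set" where
  "scalar_emb S V s = tensor_class S V (pt (Scalar s))"

definition vector_emb :: "'s calgebra \<Rightarrow> ('s, 'v) bimodule \<Rightarrow> 'v \<Rightarrow> ('s, 'v) formal set" where
  "vector_emb S V v = tensor_class S V (pt (Tensor [v]))"

section \<open>Superpotentials and derivation-quotient algebras\<close>

definition lpair :: "'s calgebra \<Rightarrow> ('s \<Rightarrow> complex) \<Rightarrow> ('s, 'v) bimodule \<Rightarrow> ('v \<Rightarrow> complex) \<Rightarrow> 'v \<Rightarrow> 's" where
  "lpair S Tr V \<psi> w =
    (THE a. a \<in> carrier S \<and> (\<forall>s\<in>carrier S. Tr (a \<otimes>\<^bsub>S\<^esub> s) = \<psi> (ract V w s)))"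

definition rpair :: "'s calgebra \<Rightarrow> ('s \<Rightarrow> complex) \<Rightarrow> ('s, 'v) bimodule \<Rightarrow> 'v \<Rightarrow> ('v \<Rightarrow> complex) \<Rightarrow> 's" where
  "rpair S Tr V w \<psi> =
    (THE a. a \<in> carrier S \<and> (\<forall>s\<in>carrier S. Tr (s \<otimes>\<^bsub>S\<^esub> a) = \<psi> (lact V s w)))"

text \<open>Both contractions are extended by 0 to degree 0, where they are never used.\<close>

fun lcontract_pure ::
  "'s calgebra \<Rightarrow> ('s \<Rightarrow> complex) \<Rightarrow> ('s, 'v) bimodule \<Rightarrow> ('v \<Rightarrow> complex) \<Rightarrow> ('s, 'v) pure_tensor \<Rightarrow> ('s, 'v) formal"
where
  "lcontract_pure S Tr V \<psi> (Tensor [w]) = pt (Scalar (lpair S Tr V \<psi> w))"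
| "lcontract_pure S Tr V \<psi> (Tensor (w # v # vs)) = pt (Tensor (lact V (lpair S Tr V \<psi> w) v # vs))"
| "lcontract_pure S Tr V \<psi> _ = 0"

text \<open>Here \<open>vs\<close> is read from the right end.\<close>

fun rcontract_rev ::
  "'s calgebra \<Rightarrow> ('s \<Rightarrow> complex) \<Rightarrow> ('s, 'v) bimodule \<Rightarrow> ('v \<Rightarrow> complex) \<Rightarrow> 'v list \<Rightarrow> ('s, 'v) formal"
where
  "rcontract_rev S Tr V \<psi> [w] = pt (Scalar (rpair S Tr V w \<psi>))"
| "rcontract_rev S Tr V \<psi> (w # v # vs) = pt (Tensor (rev (ract V v (rpair S Tr V w \<psi>) # vs)))"
| "rcontract_rev S Tr V \<psi> [] = 0"

fun rcontract_pure ::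
  "'s calgebra \<Rightarrow> ('s \<Rightarrow> complex) \<Rightarrow> ('s, 'v) bimodule \<Rightarrow> ('v \<Rightarrow> complex) \<Rightarrow> ('s, 'v) pure_tensor \<Rightarrow> ('s, 'v) formal"
where
  "rcontract_pure S Tr V \<psi> (Tensor vs) = rcontract_rev S Tr V \<psi> (rev vs)"
| "rcontract_pure S Tr V \<psi> (Scalar s) = 0"

text \<open>
  The map on the tensor algebra induced by a map on pure tensors. The union is over the
  representatives of a class, all of which give the same class.
\<close>

definition induced_map ::
  "'s calgebra \<Rightarrow> ('s, 'v) bimodule \<Rightarrow> (('s, 'v) pure_tensor \<Rightarrow> ('s, 'v) formal)
    \<Rightarrow> ('s, 'v) formal set \<Rightarrow> ('s, 'v) formal set"
where
  "induced_map S V h Z =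
    (\<Union>f\<in>Z. tensor_class S V (\<Sum>p\<in>Poly_Mapping.keys f. formal_scale (Poly_Mapping.lookup f p) (h p)))"

definition lcontract ::
  "'s calgebra \<Rightarrow> ('s \<Rightarrow> complex) \<Rightarrow> ('s, 'v) bimodule \<Rightarrow> ('v \<Rightarrow> complex) \<Rightarrow> ('s, 'v) formal set \<Rightarrow> ('s, 'v) formal set"
where
  "lcontract S Tr V \<psi> = induced_map S V (lcontract_pure S Tr V \<psi>)"

definition rcontract ::
  "'s calgebra \<Rightarrow> ('s \<Rightarrow> complex) \<Rightarrow> ('s, 'v) bimodule \<Rightarrow> ('s, 'v) formal set \<Rightarrow> ('v \<Rightarrow> complex) \<Rightarrow> ('s, 'v) formal set"
where
  "rcontract S Tr V Z \<psi> = induced_map S V (rcontract_pure S Tr V \<psi>) Z"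

definition superpotential ::
  "'s calgebra \<Rightarrow> ('s \<Rightarrow> complex) \<Rightarrow> ('s, 'v) bimodule \<Rightarrow> nat \<Rightarrow> ('s, 'v) formal set \<Rightarrow> bool"
where
  "superpotential S Tr V n \<omega> \<longleftrightarrow>
    \<omega> \<in> tensor_power S V n \<and>
    (\<forall>s\<in>carrier S.
       scalar_emb S V s \<otimes>\<^bsub>tensor_algebra S V\<^esub> \<omega> = \<omega> \<otimes>\<^bsub>tensor_algebra S V\<^esub> scalar_emb S V s) \<and>
    (\<forall>\<psi>\<in>bdual V.
       lcontract S Tr V \<psi> \<omega> = (-1) ^ (n - 1) \<odot>\<^bsub>tensor_algebra S V\<^esub> rcontract S Tr V \<omega> \<psi>)"

definition graded_automorphism ::
  "'s calgebra \<Rightarrow> ('s \<Rightarrow> complex) \<Rightarrow> ('s, 'v) bimodule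
    \<Rightarrow> (('s, 'v) formal set \<Rightarrow> ('s, 'v) formal set) \<Rightarrow> bool"
where
  "graded_automorphism S Tr V \<tau> \<longleftrightarrow>
    \<tau> \<in> alg_iso (tensor_algebra S V) (tensor_algebra S V) \<and>
    (\<forall>d. \<tau> ` tensor_power S V d = tensor_power S V d) \<and>
    (\<forall>s\<in>carrier S. \<forall>t\<in>carrier S. \<tau> (scalar_emb S V s) = scalar_emb S V t \<longrightarrow> Tr t = Tr s)"

text \<open>\<open>\<psi> \<circ> \<tau>\<inverse>\<close>, where \<open>V\<close> is identified with the degree 1 part of the tensor algebra.\<close>

definition twist_dual ::
  "'s calgebra \<Rightarrow> ('s, 'v) bimodule \<Rightarrow> (('s, 'v) formal set \<Rightarrow> ('s, 'v) formal set)
    \<Rightarrow> ('v \<Rightarrow> complex) \<Rightarrow> 'v \<Rightarrow> complex"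
where
  "twist_dual S V \<tau> \<psi> v =
    \<psi> (THE u. u \<in> bcarrier V \<and> \<tau> (vector_emb S V u) = vector_emb S V v)"

definition twisted_superpotential ::
  "'s calgebra \<Rightarrow> ('s \<Rightarrow> complex) \<Rightarrow> ('s, 'v) bimodule \<Rightarrow> (('s, 'v) formal set \<Rightarrow> ('s, 'v) formal set)
    \<Rightarrow> nat \<Rightarrow> ('s, 'v) formal set \<Rightarrow> bool"
where
  "twisted_superpotential S Tr V \<tau> n \<omega> \<longleftrightarrow>
    graded_automorphism S Tr V \<tau> \<and>
    \<omega> \<in> tensor_power S V n \<and>
    (\<forall>s\<in>carrier S.
       \<tau> (scalar_emb S V s) \<otimes>\<^bsub>tensor_algebra S V\<^esub> \<omega> = \<omega> \<otimes>\<^bsub>tensor_algebra S V\<^esub> scalar_emb S V s) \<and>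
    (\<forall>\<psi>\<in>bdual V.
       lcontract S Tr V (twist_dual S V \<tau> \<psi>) \<omega> =
         (-1) ^ (n - 1) \<odot>\<^bsub>tensor_algebra S V\<^esub> rcontract S Tr V \<omega> \<psi>)"

text \<open>
  Contraction with a pure tensor \<open>\<phi>\<^sub>1 \<otimes> \<dots> \<otimes> \<phi>\<^sub>k\<close> of functionals, \<open>\<phi>\<^sub>k\<close> being applied first. For \<open>k = 0\<close>
  the functional lives on \<open>S\<close>; it is of the form \<open>\<lambda>x. Tr (a x)\<close> and acts as left multiplication
  by \<open>a\<close>.
\<close>

fun multi_contract ::
  "'s calgebra \<Rightarrow> ('s \<Rightarrow> complex) \<Rightarrow> ('s, 'v) bimodule \<Rightarrow> ('s, 'v \<Rightarrow> complex) pure_tensor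
    \<Rightarrow> ('s, 'v) formal set \<Rightarrow> ('s, 'v) formal set"
where
  "multi_contract S Tr V (Scalar a) Z = scalar_emb S V a \<otimes>\<^bsub>tensor_algebra S V\<^esub> Z"
| "multi_contract S Tr V (Tensor \<phi>s) Z = foldr (lcontract S Tr V) \<phi>s Z"

definition derivative_space ::
  "'s calgebra \<Rightarrow> ('s \<Rightarrow> complex) \<Rightarrow> ('s, 'v) bimodule \<Rightarrow> ('s, 'v) formal set \<Rightarrow> nat \<Rightarrow> ('s, 'v) formal set set"
where
  "derivative_space S Tr V \<omega> k = lin_span (tensor_algebra S V)
    {multi_contract S Tr V \<phi> (\<omega> \<otimes>\<^bsub>tensor_algebra S V\<^esub> scalar_emb S V x) | \<phi> x.
       \<phi> \<in> pure_tensors (carrier S) (bdual V) \<and> tensor_degree \<phi> = k \<and> x \<in> carrier S}"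

definition derivation_quotient ::
  "'s calgebra \<Rightarrow> ('s \<Rightarrow> complex) \<Rightarrow> ('s, 'v) bimodule \<Rightarrow> ('s, 'v) formal set \<Rightarrow> nat
    \<Rightarrow> ('s, 'v) formal set set calgebra"
where
  "derivation_quotient S Tr V \<omega> k =
    alg_quot (tensor_algebra S V) (Idl\<^bsub>tensor_algebra S V\<^esub> (derivative_space S Tr V \<omega> k))"

section \<open>Group algebras, smash products and representations\<close>

text \<open>The function \<open>x\<close> stands for \<open>\<Sum>g. x(g) g\<close>; the group is finite in all uses.\<close>

definition group_algebra :: "('g, 'm) monoid_scheme \<Rightarrow> ('g \<Rightarrow> complex) calgebra" where
  "group_algebra G =
    \<lparr>carrier = {x. \<forall>g. g \<notin> carrier G \<longrightarrow> x g = 0},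
     monoid.mult = (\<lambda>x y g. if g \<in> carrier G
        then \<Sum>h\<in>carrier G. x h * y (inv\<^bsub>G\<^esub> h \<otimes>\<^bsub>G\<^esub> g) else 0),
     monoid.one = (\<lambda>g. if g = \<one>\<^bsub>G\<^esub> then 1 else 0),
     ring.zero = 0, ring.add = (+), smult = (\<lambda>c x g. c * x g)\<rparr>"

definition group_elem :: "'g \<Rightarrow> 'g \<Rightarrow> complex" where
  "group_elem g = (\<lambda>h. if h = g then 1 else 0)"

text \<open>The function \<open>x\<close> stands for \<open>\<Sum>g. x(g) \<otimes> g\<close>.\<close>

definition smash_product ::
  "'r calgebra \<Rightarrow> ('g, 'm) monoid_scheme \<Rightarrow> ('g \<Rightarrow> 'r \<Rightarrow> 'r) \<Rightarrow> ('g \<Rightarrow> 'r) calgebra"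
where
  "smash_product R G act =
    \<lparr>carrier = {x. (\<forall>g\<in>carrier G. x g \<in> carrier R) \<and> (\<forall>g. g \<notin> carrier G \<longrightarrow> x g = \<zero>\<^bsub>R\<^esub>)},
     monoid.mult = (\<lambda>x y g. if g \<in> carrier G
        then \<Oplus>\<^bsub>R\<^esub>h\<in>carrier G. x h \<otimes>\<^bsub>R\<^esub> act h (y (inv\<^bsub>G\<^esub> h \<otimes>\<^bsub>G\<^esub> g)) else \<zero>\<^bsub>R\<^esub>),
     monoid.one = (\<lambda>g. if g = \<one>\<^bsub>G\<^esub> then \<one>\<^bsub>R\<^esub> else \<zero>\<^bsub>R\<^esub>),
     ring.zero = (\<lambda>g. \<zero>\<^bsub>R\<^esub>), ring.add = (\<lambda>x y g. x g \<oplus>\<^bsub>R\<^esub> y g), smult = (\<lambda>c x g. c \<odot>\<^bsub>R\<^esub> x g)\<rparr>"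

definition representation :: "('g, 'm) monoid_scheme \<Rightarrow> ('g \<Rightarrow> complex^'n^'n) \<Rightarrow> bool" where
  "representation G \<rho> \<longleftrightarrow>
    \<rho> \<one>\<^bsub>G\<^esub> = Finite_Cartesian_Product.mat 1 \<and>
    (\<forall>g\<in>carrier G. \<forall>h\<in>carrier G. \<rho> (g \<otimes>\<^bsub>G\<^esub> h) = \<rho> g ** \<rho> h)"

definition function_action ::
  "('g, 'm) monoid_scheme \<Rightarrow> ('g \<Rightarrow> complex^'n^'n) \<Rightarrow> 'g \<Rightarrow> (complex^'n \<Rightarrow> complex) \<Rightarrow> complex^'n \<Rightarrow> complex"
where
  "function_action G \<rho> g p = (\<lambda>v. p (\<rho> (inv\<^bsub>G\<^esub> g) *v v))"

inductive_set polynomial_functions :: "(complex^'n \<Rightarrow> complex) set" where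
  "(\<lambda>v. c) \<in> polynomial_functions"
| "(\<lambda>v. vec_nth v i) \<in> polynomial_functions"
| "p \<in> polynomial_functions \<Longrightarrow> q \<in> polynomial_functions \<Longrightarrow> (\<lambda>v. p v + q v) \<in> polynomial_functions"
| "p \<in> polynomial_functions \<Longrightarrow> q \<in> polynomial_functions \<Longrightarrow> (\<lambda>v. p v * q v) \<in> polynomial_functions"

definition polynomial_ring :: "(complex^'n \<Rightarrow> complex) calgebra" where
  "polynomial_ring =
    \<lparr>carrier = polynomial_functions, monoid.mult = (\<lambda>p q v. p v * q v), monoid.one = (\<lambda>v. 1),
     ring.zero = 0, ring.add = (+), smult = (\<lambda>c p v. c * p v)\<rparr>"

definition polynomial_smash ::
  "('g, 'm) monoid_scheme \<Rightarrow> ('g \<Rightarrow> complex^'n^'n) \<Rightarrow> ('g \<Rightarrow> complex^'n \<Rightarrow> complex) calgebra"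
where
  "polynomial_smash G \<rho> = smash_product polynomial_ring G (function_action G \<rho>)"

definition group_algebra_emb :: "('g \<Rightarrow> complex) \<Rightarrow> 'g \<Rightarrow> complex^'n \<Rightarrow> complex" where
  "group_algebra_emb x = (\<lambda>g v. x g)"

text \<open>
  The bimodule \<open>V\<^sup>* \<otimes> \<complex>G\<close>; the function \<open>u\<close> stands for \<open>\<Sum>g. u(g) \<otimes> g\<close> with linear
  functionals \<open>u(g)\<close>, and \<open>h (f \<otimes> g) k = hf \<otimes> hgk\<close>.
\<close>

definition mckay_bimodule ::
  "('g, 'm) monoid_scheme \<Rightarrow> ('g \<Rightarrow> complex^'n^'n) \<Rightarrow> ('g \<Rightarrow> complex, 'g \<Rightarrow> complex^'n \<Rightarrow> complex) bimodule"
where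
  "mckay_bimodule G \<rho> =
    \<lparr>bcarrier = {u. (\<forall>g\<in>carrier G. Vector_Spaces.linear (*s) (*) (u g)) \<and>
                    (\<forall>g. g \<notin> carrier G \<longrightarrow> u g = 0)},
     badd = (+),
     bscale = (\<lambda>c u g v. c * u g v),
     lact = (\<lambda>x u g v. if g \<in> carrier G
        then \<Sum>h\<in>carrier G. x h * function_action G \<rho> h (u (inv\<^bsub>G\<^esub> h \<otimes>\<^bsub>G\<^esub> g)) v else 0),
     ract = (\<lambda>u x g v. if g \<in> carrier G
        then \<Sum>h\<in>carrier G. u h v * x (inv\<^bsub>G\<^esub> h \<otimes>\<^bsub>G\<^esub> g) else 0)\<rparr>"

section \<open>The McKay quiver\<close>

definition irreducible_rep :: "('g, 'm) monoid_scheme \<Rightarrow> nat \<Rightarrow> ('g \<Rightarrow> complex mat) \<Rightarrow> bool" where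
  "irreducible_rep G d \<sigma> \<longleftrightarrow>
    0 < d \<and> \<sigma> \<in> carrier G \<rightarrow> carrier_mat d d \<and> \<sigma> \<one>\<^bsub>G\<^esub> = 1\<^sub>m d \<and>
    (\<forall>g\<in>carrier G. \<forall>h\<in>carrier G. \<sigma> (g \<otimes>\<^bsub>G\<^esub> h) = \<sigma> g * \<sigma> h) \<and>
    (\<forall>M. submodule M (ring_of_type_algebra :: complex ring) (module_vec TYPE(complex) d) \<and>
         (\<forall>g\<in>carrier G. \<forall>x\<in>M. \<sigma> g *\<^sub>v x \<in> M) \<longrightarrow> M = {0\<^sub>v d} \<or> M = carrier_vec d)"

definition left_ideal_iso_rep ::
  "('g, 'm) monoid_scheme \<Rightarrow> ('g \<Rightarrow> complex) \<Rightarrow> nat \<Rightarrow> ('g \<Rightarrow> complex mat) \<Rightarrow> bool"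
where
  "left_ideal_iso_rep G e d \<sigma> \<longleftrightarrow>
    (let A = group_algebra G; L = {x \<otimes>\<^bsub>A\<^esub> e | x. x \<in> carrier A} in
     \<exists>f. bij_betw f L (carrier_vec d) \<and>
         (\<forall>x\<in>L. \<forall>y\<in>L. f (x \<oplus>\<^bsub>A\<^esub> y) = f x + f y) \<and>
         (\<forall>c. \<forall>x\<in>L. f (c \<odot>\<^bsub>A\<^esub> x) = c \<cdot>\<^sub>v f x) \<and>
         (\<forall>g\<in>carrier G. \<forall>x\<in>L. f (group_elem g \<otimes>\<^bsub>A\<^esub> x) = \<sigma> g *\<^sub>v f x))"

definition minimal_idempotent :: "'a calgebra \<Rightarrow> 'a \<Rightarrow> bool" where
  "minimal_idempotent A e \<longleftrightarrow>
    e \<in> carrier A \<and> e \<noteq> \<zero>\<^bsub>A\<^esub> \<and> e \<otimes>\<^bsub>A\<^esub> e = e \<and>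
    (\<forall>f\<in>carrier A. f \<otimes>\<^bsub>A\<^esub> f = f \<and> e \<otimes>\<^bsub>A\<^esub> f = f \<and> f \<otimes>\<^bsub>A\<^esub> e = f \<longrightarrow> f = \<zero>\<^bsub>A\<^esub> \<or> f = e)"

definition simple_idempotents :: "('g, 'm) monoid_scheme \<Rightarrow> ('g \<Rightarrow> complex) set \<Rightarrow> bool" where
  "simple_idempotents G E \<longleftrightarrow>
    (\<forall>e\<in>E. minimal_idempotent (group_algebra G) e) \<and>
    (\<forall>e\<in>E. \<forall>f\<in>E. e \<noteq> f \<longrightarrow> e \<otimes>\<^bsub>group_algebra G\<^esub> f = \<zero>\<^bsub>group_algebra G\<^esub>) \<and>
    (\<forall>d \<sigma>. irreducible_rep G d \<sigma> \<longrightarrow> (\<exists>!e. e \<in> E \<and> left_ideal_iso_rep G e d \<sigma>))"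

definition det_twist :: "('g \<Rightarrow> complex^'n^'n) \<Rightarrow> ('g \<Rightarrow> complex) \<Rightarrow> 'g \<Rightarrow> complex" where
  "det_twist \<rho> x = (\<lambda>g. det (\<rho> g) * x g)"

text \<open>
  Paths are composed from right to left: an arrow \<open>a\<close> from \<open>i\<close> to \<open>j\<close> satisfies \<open>a = j a i\<close>.
  The path algebra of \<open>Q\<close> is the tensor algebra of the arrow bimodule over the vertex algebra.
\<close>

definition vertex_algebra :: "('q, 'a) pre_digraph \<Rightarrow> ('q \<Rightarrow> complex) calgebra" where
  "vertex_algebra Q =
    \<lparr>carrier = {x. \<forall>i. i \<notin> verts Q \<longrightarrow> x i = 0},
     monoid.mult = (\<lambda>x y i. x i * y i), monoid.one = (\<lambda>i. if i \<in> verts Q then 1 else 0),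
     ring.zero = 0, ring.add = (+), smult = (\<lambda>c x i. c * x i)\<rparr>"

definition vertex_trace :: "('q, 'a) pre_digraph \<Rightarrow> ('q \<Rightarrow> complex) \<Rightarrow> complex" where
  "vertex_trace Q x = (\<Sum>i\<in>verts Q. x i)"

definition arrow_bimodule :: "('q, 'a) pre_digraph \<Rightarrow> ('q \<Rightarrow> complex, 'a \<Rightarrow> complex) bimodule" where
  "arrow_bimodule Q =
    \<lparr>bcarrier = {u. \<forall>a. a \<notin> arcs Q \<longrightarrow> u a = 0}, badd = (+), bscale = (\<lambda>c u a. c * u a),
     lact = (\<lambda>x u a. x (head Q a) * u a), ract = (\<lambda>u x a. u a * x (tail Q a))\<rparr>"

text \<open>The arrows from \<open>e\<close> to \<open>f\<close> are numbered by the natural numbers below \<open>dim fUe\<close>.\<close>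

definition mckay_quiver ::
  "('g, 'm) monoid_scheme \<Rightarrow> ('g \<Rightarrow> complex^'n^'n) \<Rightarrow> ('g \<Rightarrow> complex) set
    \<Rightarrow> ('g \<Rightarrow> complex, ('g \<Rightarrow> complex) \<times> ('g \<Rightarrow> complex) \<times> nat) pre_digraph"
where
  "mckay_quiver G \<rho> E =
    (let U = mckay_bimodule G \<rho> in
     \<lparr>verts = E,
      arcs = {(e, f, k). e \<in> E \<and> f \<in> E \<and>
        k < vector_space.dim (bscale U) {lact U f (ract U u e) | u. u \<in> bcarrier U}},
      tail = (\<lambda>(e, f, k). e), head = (\<lambda>(e, f, k). f)\<rparr>)"

end

(*
  Let A be the crossed product of the functions on V with G, and let S = CG and U be its parts of
  functions that are constant and linear on V. Antisymmetrising x_1 ... x_n gives an element Omega_0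
  of the n-th tensor power of U over S on which G acts through the determinant, so that Omega_0 is a
  superpotential twisted by tau for the trace lambda "coefficient of the identity". The trace of the
  statement is s |-> lambda (w' s) for a central unit w' fixed by tau; this rescales contractions by
  w = 1/w', and the potential to take is w Omega_0.

  Contracting w Omega_0 with n - 2 functionals yields the commutators of the coordinates x_i, so the
  ideal they generate lets every tensor be rewritten as a combination of ordered words x_I g.
  Conversely all such contractions are antisymmetric in the two remaining letters and vanish in A.
  Since the monomials times group elements are linearly independent in A, the quotient embeds in A.

  Both claims are the case of a full tau-invariant idempotent e of S: e = 1 for the smash product,
  e = e_1 + ... + e_m for the path algebra. Writing 1 as the sum of p_k e q_k, the maps
  x |-> (q_k x p_l) turn computations over S and U into computations with matrices over the tensor
  algebra of e U e over e S e, where the argument above applies. For the path algebra, the required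
  facts on CG come from its matrix units: a minimal idempotent has trace 1, generates the simple module
  of its block, and e S e is the span of the e_i.
*)

theory Submission
  imports Defs "HOL-Computational_Algebra.Polynomial"
begin

section \<open>Formal linear combinations\<close>

text \<open>Their matrices with entries e q_k x_i p_l e are, and rules such as moving a group
  element past a letter hold for the matrices as they hold for the x_i. The price appears in the
  contractions: a functional on e U e sees one entry at a time, so removing one given letter takes
  one functional for each k, summed over k.

  A functional is only complex linear, and its pairing with U has values in S through the trace. For
  lambda the coefficient of [psi u] at h is psi(u h^-1); with this formula the superpotential
  identity becomes Cramer's rule for the matrices of G acting on the determinant. The passage to the
  other trace needs more than a central unit w: since w does not commute with U, it must occur
  inside the potential, and it must be fixed by tau for the two ways of writing it there, on the
  left and on the right, to agree. The latter holds because tau permutes the minimal idempotents of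
  CG and thus preserves the trace of the statement.\<close>

lemma lookup_formal_scale [simp]: "Poly_Mapping.lookup (formal_scale c f) p = c * Poly_Mapping.lookup f p"
  unfolding formal_scale_def by (simp add: Poly_Mapping.map.rep_eq when_def)

interpretation formal: vector_space formal_scale
  by unfold_locales (auto intro!: poly_mapping_eqI simp: lookup_add algebra_simps)

lemma formal_scale_single [simp]:
  "formal_scale c (Poly_Mapping.single p d) = Poly_Mapping.single p (c * d)"
  by (rule poly_mapping_eqI) (simp add: lookup_single when_def)

text \<open>The scalar multiplication of the target is a parameter because the target is either a
  space of formal combinations again or the crossed product.\<close>

definition lin_ext :: "(complex \<Rightarrow> 'b \<Rightarrow> 'b) \<Rightarrow> ('a \<Rightarrow> 'b) \<Rightarrow> ('a \<Rightarrow>\<^sub>0 complex) \<Rightarrow> 'b::ab_group_add" where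
  "lin_ext sc h f = (\<Sum>p\<in>Poly_Mapping.keys f. sc (Poly_Mapping.lookup f p) (h p))"

text \<open>The supports of f, g and f + g differ; over a common finite set additivity becomes
  termwise.\<close>

lemma lin_ext_superset:
  assumes "vector_space sc" "finite A" "Poly_Mapping.keys f \<subseteq> A"
  shows "lin_ext sc h f = (\<Sum>p\<in>A. sc (Poly_Mapping.lookup f p) (h p))"
proof -
  interpret vector_space sc by fact
  show ?thesis unfolding lin_ext_def using assms
    by (intro sum.mono_neutral_left) (auto simp: in_keys_iff)
qed

lemma linear_lin_ext:
  fixes h :: "('s, 'v) pure_tensor \<Rightarrow> 'b::ab_group_add"
  assumes "vector_space sc"
  shows "Vector_Spaces.linear formal_scale sc (lin_ext sc h)"
proof -
  interpret v: vector_space sc by fact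
  show ?thesis unfolding Vector_Spaces.linear_iff
  proof (intro conjI allI)
    fix f g :: "('s, 'v) formal"
    let ?A = "Poly_Mapping.keys f \<union> Poly_Mapping.keys g"
    have "Poly_Mapping.keys (f + g) \<subseteq> ?A" by (rule Poly_Mapping.keys_add)
    then show "lin_ext sc h (f + g) = lin_ext sc h f + lin_ext sc h g"
      by (simp add: lin_ext_superset[OF assms, of ?A] lookup_add v.scale_left_distrib sum.distrib)
  next
    fix c and f :: "('s, 'v) formal"
    have "Poly_Mapping.keys (formal_scale c f) \<subseteq> Poly_Mapping.keys f"
      by (auto simp: in_keys_iff)
    then show "lin_ext sc h (formal_scale c f) = sc c (lin_ext sc h f)"
      by (simp add: lin_ext_superset[OF assms, of "Poly_Mapping.keys f"] v.scale_sum_right)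
  qed unfold_locales
qed

lemma lin_ext_single [simp]:
  assumes "vector_space sc"
  shows "lin_ext sc h (Poly_Mapping.single p c) = sc c (h p)"
proof -
  interpret v: vector_space sc by fact
  show ?thesis by (simp add: lin_ext_def)
qed

lemma formal_vector_space: "vector_space (formal_scale :: _ \<Rightarrow> ('s,'v) formal \<Rightarrow> _)" ..

abbreviation fext :: "(('s, 'v) pure_tensor \<Rightarrow> ('t, 'w) formal) \<Rightarrow> ('s, 'v) formal \<Rightarrow> ('t, 'w) formal" where
  "fext \<equiv> lin_ext formal_scale"

lemmas fext_linear = linear_lin_ext[OF formal_vector_space]

interpretation formal_pair: vector_space_pair formal_scale formal_scale ..

lemma fext_simps [simp]:
  "fext h (f + g) = fext h f + fext h g"
  "fext h (f - g) = fext h f - fext h g"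
  "fext h (- f) = - fext h f"
  "fext h 0 = 0"
  "fext h (formal_scale c f) = formal_scale c (fext h f)"
  "fext h (sum F A) = (\<Sum>x\<in>A. fext h (F x))"
  "fext h (Poly_Mapping.single p c) = formal_scale c (h p)"
  using fext_linear[of h] formal_vector_space
  by (simp_all add: formal_pair.linear_add formal_pair.linear_diff formal_pair.linear_neg
    formal_pair.linear_0 formal_pair.linear_scale formal_pair.linear_sum lin_ext_single[OF formal_vector_space])

lemma fext_pt [simp]: "fext pt f = f"
  unfolding lin_ext_def
  by (rule poly_mapping_eqI)
     (simp add: lookup_sum lookup_single when_def in_keys_iff)

lemma fext_pointwise:
  "fext (\<lambda>p. h p + k p) f = fext h f + fext k f"
  "fext (\<lambda>p. formal_scale c (h p)) f = formal_scale c (fext h f)"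
  "fext (\<lambda>p. h p - k p) f = fext h f - fext k f"
  unfolding lin_ext_def
  by (auto simp: formal.scale_right_distrib sum.distrib formal.scale_sum_right mult.commute
     formal.scale_right_diff_distrib sum_subtractf intro!: sum.cong)

lemma fext_cong: "(\<And>p. p \<in> Poly_Mapping.keys f \<Longrightarrow> h p = k p) \<Longrightarrow> fext h f = fext k f"
  unfolding lin_ext_def by (rule sum.cong) auto

lemma fext_in_subspace:
  assumes "formal.subspace M" "\<And>p. p \<in> Poly_Mapping.keys f \<Longrightarrow> h p \<in> M"
  shows "fext h f \<in> M"
  unfolding lin_ext_def using assms by (intro formal.subspace_sum formal.subspace_scale) auto

lemma (in vector_space) subspace_linear_preimage:
  assumes "Vector_Spaces.linear s2 scale f" "subspace M"
  shows "module.subspace s2 (f -` M)"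
proof -
  from assms(1) interpret Vector_Spaces.linear s2 scale f .
  show ?thesis by (rule subspace_vimage) fact
qed

lemma fext_vimage_subspace: "formal.subspace M \<Longrightarrow> formal.subspace (fext h -` M)"
  by (rule formal.subspace_linear_preimage[OF fext_linear])

lemma fext_span_subset:
  assumes "formal.subspace M" "\<And>z. z \<in> Z \<Longrightarrow> fext h z \<in> M" "f \<in> formal.span Z"
  shows "fext h f \<in> M"
proof -
  have "formal.span Z \<subseteq> fext h -` M"
    using assms(1,2) by (intro formal.span_minimal fext_vimage_subspace) auto
  then show ?thesis using assms(3) by auto
qed

text \<open>Extend a basis of K to a basis of the whole space and let \<open>nf\<close> kill the
  basis vectors in K and fix the others. Then f - nf f lies in K for basis vectors, hence
  always.\<close>

lemma complement_projection:
  fixes K :: "('s, 'v) formal set"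
  assumes "formal.subspace K"
  shows "\<exists>nf. Vector_Spaces.linear formal_scale formal_scale nf \<and>
    (\<forall>f. nf f = 0 \<longleftrightarrow> f \<in> K) \<and> (\<forall>f. f - nf f \<in> K)"
proof -
  obtain B where B: "B \<subseteq> K" "formal.independent B" "K \<subseteq> formal.span B"
    using formal.basis_exists by metis
  define B' where "B' = formal.extend_basis B"
  have B': "formal.independent B'" "formal.span B' = UNIV" "B \<subseteq> B'"
    using formal.independent_extend_basis[OF B(2)] formal.span_extend_basis[OF B(2)]
      formal.extend_basis_superset[OF B(2)] by (auto simp: B'_def)
  define nf where "nf = formal_pair.construct B' (\<lambda>b. if b \<in> B then 0 else b)"
  have lin: "Vector_Spaces.linear formal_scale formal_scale nf"
    unfolding nf_def by (rule formal_pair.linear_construct) (rule B')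
  have nf_basis: "nf b = (if b \<in> B then 0 else b)" if "b \<in> B'" for b
    unfolding nf_def using that B' by (simp add: formal_pair.construct_basis)
  have diff: "f - nf f \<in> K" for f
  proof -
    have "Vector_Spaces.linear formal_scale formal_scale (\<lambda>f. f - nf f)"
      using formal_pair.linear_compose_sub[OF formal.linear_id lin] by simp
    then have "formal.subspace ((\<lambda>f. f - nf f) -` K)"
      using formal.subspace_linear_preimage assms by blast
    moreover have "B' \<subseteq> (\<lambda>f. f - nf f) -` K"
      using nf_basis B(1) formal.subspace_0[OF assms] by auto
    ultimately have "formal.span B' \<subseteq> (\<lambda>f. f - nf f) -` K"
      by (simp add: formal.span_minimal)
    then show ?thesis using B'(2) by auto
  qed
  have "nf f = 0" if "f \<in> K" for f
  proof -
    have "f \<in> formal.span B" using B(3) that by auto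
    then have "f \<in> formal.span B" .
    then show ?thesis
    proof (induction rule: formal.span_induct_alt)
      case base then show ?case using lin by (simp add: formal_pair.linear_0)
    next
      case (step c x y)
      then show ?case using lin nf_basis[of x] B'(3)
        by (auto simp: formal_pair.linear_add formal_pair.linear_scale)
    qed
  qed
  moreover have "f \<in> K" if "nf f = 0" for f using diff[of f] that by simp
  ultimately show ?thesis using lin diff by blast
qed

section \<open>The tensor algebra of a bimodule\<close>

lemma last_butlast_subset:
  "set vs \<subseteq> B \<Longrightarrow> vs \<noteq> [] \<Longrightarrow> last vs \<in> B" "set vs \<subseteq> B \<Longrightarrow> x \<in> set (butlast vs) \<Longrightarrow> x \<in> B"
  by (auto dest: in_set_butlastD simp: subset_iff)

text \<open>Bare equations on the carriers, so that an S and a V embedded in an associative algebra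
  inherit all of them by injectivity of the embedding.\<close>

locale calg_bimodule =
  fixes S :: "'s calgebra" and V :: "('s, 'v) bimodule"
  assumes S_closed:
      "\<And>s t. s \<in> carrier S \<Longrightarrow> t \<in> carrier S \<Longrightarrow> s \<otimes>\<^bsub>S\<^esub> t \<in> carrier S"
      "\<And>s t. s \<in> carrier S \<Longrightarrow> t \<in> carrier S \<Longrightarrow> s \<oplus>\<^bsub>S\<^esub> t \<in> carrier S"
      "\<one>\<^bsub>S\<^esub> \<in> carrier S"
      "\<And>c s. s \<in> carrier S \<Longrightarrow> c \<odot>\<^bsub>S\<^esub> s \<in> carrier S"
    and S_alg:
      "\<And>r s t. r \<in> carrier S \<Longrightarrow> s \<in> carrier S \<Longrightarrow> t \<in> carrier S \<Longrightarrow> (r \<otimes>\<^bsub>S\<^esub> s) \<otimes>\<^bsub>S\<^esub> t = r \<otimes>\<^bsub>S\<^esub> (s \<otimes>\<^bsub>S\<^esub> t)"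
      "\<And>s. s \<in> carrier S \<Longrightarrow> \<one>\<^bsub>S\<^esub> \<otimes>\<^bsub>S\<^esub> s = s"
      "\<And>s. s \<in> carrier S \<Longrightarrow> s \<otimes>\<^bsub>S\<^esub> \<one>\<^bsub>S\<^esub> = s"
      "\<And>r s t. r \<in> carrier S \<Longrightarrow> s \<in> carrier S \<Longrightarrow> t \<in> carrier S \<Longrightarrow> (r \<oplus>\<^bsub>S\<^esub> s) \<otimes>\<^bsub>S\<^esub> t = r \<otimes>\<^bsub>S\<^esub> t \<oplus>\<^bsub>S\<^esub> s \<otimes>\<^bsub>S\<^esub> t"
      "\<And>r s t. r \<in> carrier S \<Longrightarrow> s \<in> carrier S \<Longrightarrow> t \<in> carrier S \<Longrightarrow> t \<otimes>\<^bsub>S\<^esub> (r \<oplus>\<^bsub>S\<^esub> s) = t \<otimes>\<^bsub>S\<^esub> r \<oplus>\<^bsub>S\<^esub> t \<otimes>\<^bsub>S\<^esub> s"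
      "\<And>c s t. s \<in> carrier S \<Longrightarrow> t \<in> carrier S \<Longrightarrow> (c \<odot>\<^bsub>S\<^esub> s) \<otimes>\<^bsub>S\<^esub> t = c \<odot>\<^bsub>S\<^esub> (s \<otimes>\<^bsub>S\<^esub> t)"
      "\<And>c s t. s \<in> carrier S \<Longrightarrow> t \<in> carrier S \<Longrightarrow> t \<otimes>\<^bsub>S\<^esub> (c \<odot>\<^bsub>S\<^esub> s) = c \<odot>\<^bsub>S\<^esub> (t \<otimes>\<^bsub>S\<^esub> s)"
    and V_closed:
      "\<And>v w. v \<in> bcarrier V \<Longrightarrow> w \<in> bcarrier V \<Longrightarrow> badd V v w \<in> bcarrier V"
      "\<And>c v. v \<in> bcarrier V \<Longrightarrow> bscale V c v \<in> bcarrier V"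
      "\<And>s v. s \<in> carrier S \<Longrightarrow> v \<in> bcarrier V \<Longrightarrow> lact V s v \<in> bcarrier V"
      "\<And>s v. s \<in> carrier S \<Longrightarrow> v \<in> bcarrier V \<Longrightarrow> ract V v s \<in> bcarrier V"
    and V_bimod:
      "\<And>s v w. s \<in> carrier S \<Longrightarrow> v \<in> bcarrier V \<Longrightarrow> w \<in> bcarrier V \<Longrightarrow> lact V s (badd V v w) = badd V (lact V s v) (lact V s w)"
      "\<And>s v w. s \<in> carrier S \<Longrightarrow> v \<in> bcarrier V \<Longrightarrow> w \<in> bcarrier V \<Longrightarrow> ract V (badd V v w) s = badd V (ract V v s) (ract V w s)"
      "\<And>s c v. s \<in> carrier S \<Longrightarrow> v \<in> bcarrier V \<Longrightarrow> lact V s (bscale V c v) = bscale V c (lact V s v)"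
      "\<And>s c v. s \<in> carrier S \<Longrightarrow> v \<in> bcarrier V \<Longrightarrow> ract V (bscale V c v) s = bscale V c (ract V v s)"
      "\<And>s t v. s \<in> carrier S \<Longrightarrow> t \<in> carrier S \<Longrightarrow> v \<in> bcarrier V \<Longrightarrow> lact V (s \<oplus>\<^bsub>S\<^esub> t) v = badd V (lact V s v) (lact V t v)"
      "\<And>s t v. s \<in> carrier S \<Longrightarrow> t \<in> carrier S \<Longrightarrow> v \<in> bcarrier V \<Longrightarrow> ract V v (s \<oplus>\<^bsub>S\<^esub> t) = badd V (ract V v s) (ract V v t)"
      "\<And>s c v. s \<in> carrier S \<Longrightarrow> v \<in> bcarrier V \<Longrightarrow> lact V (c \<odot>\<^bsub>S\<^esub> s) v = bscale V c (lact V s v)"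
      "\<And>s c v. s \<in> carrier S \<Longrightarrow> v \<in> bcarrier V \<Longrightarrow> ract V v (c \<odot>\<^bsub>S\<^esub> s) = bscale V c (ract V v s)"
      "\<And>s t v. s \<in> carrier S \<Longrightarrow> t \<in> carrier S \<Longrightarrow> v \<in> bcarrier V \<Longrightarrow> lact V (s \<otimes>\<^bsub>S\<^esub> t) v = lact V s (lact V t v)"
      "\<And>s t v. s \<in> carrier S \<Longrightarrow> t \<in> carrier S \<Longrightarrow> v \<in> bcarrier V \<Longrightarrow> ract V v (s \<otimes>\<^bsub>S\<^esub> t) = ract V (ract V v s) t"
      "\<And>v. v \<in> bcarrier V \<Longrightarrow> lact V \<one>\<^bsub>S\<^esub> v = v"
      "\<And>v. v \<in> bcarrier V \<Longrightarrow> ract V v \<one>\<^bsub>S\<^esub> = v"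
      "\<And>s t v. s \<in> carrier S \<Longrightarrow> t \<in> carrier S \<Longrightarrow> v \<in> bcarrier V \<Longrightarrow> ract V (lact V s v) t = lact V s (ract V v t)"
begin

abbreviation "PT \<equiv> pure_tensors (carrier S) (bcarrier V)"
abbreviation "FC \<equiv> carrier (formal_algebra S V)"
abbreviation "TK \<equiv> tensor_kernel S V"
abbreviation "TA \<equiv> tensor_algebra S V"
abbreviation "cls \<equiv> tensor_class S V"

definition fm :: "('s, 'v) formal \<Rightarrow> ('s, 'v) formal \<Rightarrow> ('s, 'v) formal" where
  "fm f g = f \<otimes>\<^bsub>formal_algebra S V\<^esub> g"

lemma PT_cases:
  assumes "p \<in> PT"
  obtains s where "p = Scalar s" "s \<in> carrier S"
  | v vs where "p = Tensor (v # vs)" "v \<in> bcarrier V" "set vs \<subseteq> bcarrier V"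
proof -
  from assms consider s where "p = Scalar s" "s \<in> carrier S" | vs where "p = Tensor vs" "vs \<noteq> []" "set vs \<subseteq> bcarrier V"
    unfolding pure_tensors_def by blast
  then show thesis using that by cases (simp, metis list.exhaust insert_subset list.simps(15))
qed

lemma PT_simps [simp]:
  "Scalar s \<in> PT \<longleftrightarrow> s \<in> carrier S" "Tensor vs \<in> PT \<longleftrightarrow> vs \<noteq> [] \<and> set vs \<subseteq> bcarrier V"
  unfolding pure_tensors_def by auto

lemma FC_iff: "f \<in> FC \<longleftrightarrow> Poly_Mapping.keys f \<subseteq> PT"
  by (simp add: formal_algebra_def)

lemma subspace_FC: "formal.subspace FC"
  unfolding formal.subspace_def
  by (auto dest!: subsetD[OF Poly_Mapping.keys_add] simp: FC_iff) (auto simp: in_keys_iff subset_iff)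

lemma pt_FC [simp]: "Poly_Mapping.single p 1 \<in> FC \<longleftrightarrow> p \<in> PT"
  by (simp add: FC_iff)

lemma fm_eq: "fm f g = fext (\<lambda>p. fext (\<lambda>q. pt (pure_mult S V p q)) g) f"
  unfolding fm_def formal_algebra_def lin_ext_def
  by (simp add: formal.scale_sum_right)

lemma fm_simps [simp]:
  "fm (f + f') g = fm f g + fm f' g" "fm (f - f') g = fm f g - fm f' g" "fm 0 g = 0" "fm (- f) g = - fm f g"
  "fm (formal_scale c f) g = formal_scale c (fm f g)"
  "fm f (g + g') = fm f g + fm f g'" "fm f (g - g') = fm f g - fm f g'" "fm f 0 = 0"
  "fm f (formal_scale c g) = formal_scale c (fm f g)"
  by (simp_all add: fm_eq fext_pointwise) (simp add: lin_ext_def)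

lemma fm_pt [simp]: "fm (pt p) (pt q) = pt (pure_mult S V p q)"
  by (simp add: fm_eq)

lemma fm_pt_left: "fm (pt p) f = fext (\<lambda>q. pt (pure_mult S V p q)) f"
  by (simp add: fm_eq)

lemma fm_pt_right: "fm f (pt q) = fext (\<lambda>p. pt (pure_mult S V p q)) f"
  by (simp add: fm_eq)

lemma pure_mult_PT: "p \<in> PT \<Longrightarrow> q \<in> PT \<Longrightarrow> pure_mult S V p q \<in> PT"
  by (erule PT_cases; erule PT_cases)
     (auto simp: S_closed V_closed split: if_splits intro: last_butlast_subset)

text \<open>Linear identities are proved with M the set of their solutions, multilinear ones in one
  argument at a time.\<close>

lemma FC_induct [consumes 1, case_names subspace pt]:
  assumes "f \<in> FC" "formal.subspace M" "\<And>p. p \<in> PT \<Longrightarrow> pt p \<in> M"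
  shows "f \<in> M"
proof -
  have "fext pt f \<in> M" using assms by (intro fext_in_subspace) (auto simp: FC_iff)
  then show ?thesis by simp
qed

lemma FC_fext: "f \<in> FC \<Longrightarrow> (\<And>p. p \<in> PT \<Longrightarrow> h p \<in> FC) \<Longrightarrow> fext h f \<in> FC"
  by (intro fext_in_subspace subspace_FC) (auto simp: FC_iff)

lemma fm_FC [intro]: "f \<in> FC \<Longrightarrow> g \<in> FC \<Longrightarrow> fm f g \<in> FC"
  unfolding fm_eq by (intro FC_fext) (auto simp: pure_mult_PT)

lemma formal_algebra_sel [simp]:
  "\<one>\<^bsub>formal_algebra S V\<^esub> = pt (Scalar \<one>\<^bsub>S\<^esub>)" "\<zero>\<^bsub>formal_algebra S V\<^esub> = 0"
  "f \<oplus>\<^bsub>formal_algebra S V\<^esub> g = f + g" "c \<odot>\<^bsub>formal_algebra S V\<^esub> f = formal_scale c f"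
  by (simp_all add: formal_algebra_def)

lemma group_FA: "group (add_monoid (formal_algebra S V))"
proof (rule groupI)
  fix f assume "f \<in> carrier (add_monoid (formal_algebra S V))"
  then show "\<exists>g\<in>carrier (add_monoid (formal_algebra S V)). g \<otimes>\<^bsub>add_monoid (formal_algebra S V)\<^esub> f = \<one>\<^bsub>add_monoid (formal_algebra S V)\<^esub>"
    using formal.subspace_neg[OF subspace_FC] by (intro bexI[of _ "- f"]) auto
qed (use subspace_FC in \<open>auto simp: formal.subspace_add formal.subspace_0 add.assoc\<close>)

lemma submodule_FA_iff:
  "submodule M (ring_of_type_algebra :: complex ring) (formal_algebra S V) \<longleftrightarrow> M \<subseteq> FC \<and> formal.subspace M"
proof
  assume "submodule M (ring_of_type_algebra :: complex ring) (formal_algebra S V)"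
  then interpret submodule M "ring_of_type_algebra :: complex ring" "formal_algebra S V" .
  show "M \<subseteq> FC \<and> formal.subspace M"
    using subset m_closed one_closed smult_closed
    by (auto simp: formal.subspace_def ring_of_type_algebra_def)
next
  assume M: "M \<subseteq> FC \<and> formal.subspace M"
  interpret group "add_monoid (formal_algebra S V)" by (rule group_FA)
  have "inv\<^bsub>add_monoid (formal_algebra S V)\<^esub> x = - x" if "x \<in> M" for x
    using that M formal.subspace_neg[OF subspace_FC] by (intro inv_equality) auto
  then show "submodule M (ring_of_type_algebra :: complex ring) (formal_algebra S V)"
    using M by (unfold_locales) (auto simp: formal.subspace_def formal.subspace_neg)
qed

text \<open>A submodule in the sense of the library is a subspace contained in \<open>FC\<close>,
  and \<open>FC\<close> is itself a subspace containing Z; so intersecting over submodules or over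
  all subspaces gives the same set.\<close>

lemma lin_span_FA: "Z \<subseteq> FC \<Longrightarrow> lin_span (formal_algebra S V) Z = formal.span Z"
  unfolding lin_span_def submodule_FA_iff
  using formal.span_minimal[OF _ subspace_FC, of Z]
  by (intro antisym Inter_lower Inter_greatest) (auto simp: formal.span_superset intro: formal.span_base dest: formal.span_minimal)

lemma rel_FC: "tensor_relations S V \<subseteq> FC"
proof -
  have *: "r \<in> PT \<Longrightarrow> pt p - pt q - pt r \<in> FC" "pt p - formal_scale c (pt q) \<in> FC" "pt p - pt q \<in> FC" if "p \<in> PT" "q \<in> PT" for p q r c
    using that by (auto intro!: formal.subspace_diff formal.subspace_scale subspace_FC simp del: formal_scale_single)
  show ?thesis unfolding tensor_relations_def
    by (safe; intro *; simp add: S_closed V_closed)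
qed

lemma TK_span: "TK = formal.span (tensor_relations S V)"
  unfolding tensor_kernel_def by (rule lin_span_FA) (rule rel_FC)

lemma subspace_TK: "formal.subspace TK"
  unfolding TK_span by (rule formal.subspace_span)

lemma TK_FC: "TK \<subseteq> FC"
  unfolding TK_span using rel_FC subspace_FC by (rule formal.span_minimal)

lemmas TK_closed = formal.subspace_add[OF subspace_TK] formal.subspace_diff[OF subspace_TK]
  formal.subspace_scale[OF subspace_TK] formal.subspace_0[OF subspace_TK] formal.subspace_neg[OF subspace_TK]
  formal.subspace_sum[OF subspace_TK]
lemmas FC_closed = formal.subspace_add[OF subspace_FC] formal.subspace_diff[OF subspace_FC]
  formal.subspace_scale[OF subspace_FC] formal.subspace_0[OF subspace_FC] formal.subspace_neg[OF subspace_FC]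
  formal.subspace_sum[OF subspace_FC]

lemma TK_rel:
  "s \<in> carrier S \<Longrightarrow> t \<in> carrier S \<Longrightarrow> pt (Scalar (s \<oplus>\<^bsub>S\<^esub> t)) - pt (Scalar s) - pt (Scalar t) \<in> TK"
  "s \<in> carrier S \<Longrightarrow> pt (Scalar (c \<odot>\<^bsub>S\<^esub> s)) - formal_scale c (pt (Scalar s)) \<in> TK"
  "set us \<subseteq> bcarrier V \<Longrightarrow> set vs \<subseteq> bcarrier V \<Longrightarrow> v \<in> bcarrier V \<Longrightarrow> w \<in> bcarrier V \<Longrightarrow>
    pt (Tensor (us @ badd V v w # vs)) - pt (Tensor (us @ v # vs)) - pt (Tensor (us @ w # vs)) \<in> TK"
  "set us \<subseteq> bcarrier V \<Longrightarrow> set vs \<subseteq> bcarrier V \<Longrightarrow> v \<in> bcarrier V \<Longrightarrow>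
    pt (Tensor (us @ bscale V c v # vs)) - formal_scale c (pt (Tensor (us @ v # vs))) \<in> TK"
  "set us \<subseteq> bcarrier V \<Longrightarrow> set vs \<subseteq> bcarrier V \<Longrightarrow> v \<in> bcarrier V \<Longrightarrow> w \<in> bcarrier V \<Longrightarrow> s \<in> carrier S \<Longrightarrow>
    pt (Tensor (us @ ract V v s # w # vs)) - pt (Tensor (us @ v # lact V s w # vs)) \<in> TK"
  unfolding TK_span
      apply (rule formal.span_base, unfold tensor_relations_def Un_iff mem_Collect_eq, rule disjI1, rule disjI1, rule disjI1, rule disjI1, intro exI conjI, rule refl, assumption+)
     apply (rule formal.span_base, unfold tensor_relations_def Un_iff mem_Collect_eq, rule disjI1, rule disjI1, rule disjI1, rule disjI2, intro exI conjI, rule refl, assumption+)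
    apply (rule formal.span_base, unfold tensor_relations_def Un_iff mem_Collect_eq, rule disjI1, rule disjI1, rule disjI2, intro exI conjI, rule refl, assumption+)
   apply (rule formal.span_base, unfold tensor_relations_def Un_iff mem_Collect_eq, rule disjI1, rule disjI2, intro exI conjI, rule refl, assumption+)
  apply (rule formal.span_base, unfold tensor_relations_def Un_iff mem_Collect_eq, rule disjI2, intro exI conjI, rule refl, assumption+)
  done

lemmas TK_rel_hd = TK_rel(3-5)[of "[]", simplified]

lemma rel_cases [consumes 1, case_names sadd sscale add scale balanced]:
  assumes "f \<in> tensor_relations S V"
  obtains s t where "s \<in> carrier S" "t \<in> carrier S" "f = pt (Scalar (s \<oplus>\<^bsub>S\<^esub> t)) - pt (Scalar s) - pt (Scalar t)"
  | c s where "s \<in> carrier S" "f = pt (Scalar (c \<odot>\<^bsub>S\<^esub> s)) - formal_scale c (pt (Scalar s))"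
  | us vs v w where "set us \<subseteq> bcarrier V" "set vs \<subseteq> bcarrier V" "v \<in> bcarrier V" "w \<in> bcarrier V"
     "f = pt (Tensor (us @ badd V v w # vs)) - pt (Tensor (us @ v # vs)) - pt (Tensor (us @ w # vs))"
  | us vs v c where "set us \<subseteq> bcarrier V" "set vs \<subseteq> bcarrier V" "v \<in> bcarrier V"
     "f = pt (Tensor (us @ bscale V c v # vs)) - formal_scale c (pt (Tensor (us @ v # vs)))"
  | us vs v w s where "set us \<subseteq> bcarrier V" "set vs \<subseteq> bcarrier V" "v \<in> bcarrier V" "w \<in> bcarrier V" "s \<in> carrier S"
     "f = pt (Tensor (us @ ract V v s # w # vs)) - pt (Tensor (us @ v # lact V s w # vs))"
  using assms unfolding tensor_relations_def Un_iff mem_Collect_eq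
  by (elim disjE exE conjE) (rule that, assumption+)+

lemma fext_TK:
  assumes "formal.subspace M" "\<And>f. f \<in> tensor_relations S V \<Longrightarrow> fext h f \<in> M" "f \<in> TK"
  shows "fext h f \<in> M"
  by (rule fext_span_subset[OF assms(1,2) assms(3)[unfolded TK_span]])

section \<open>The span of the relations as a two-sided ideal\<close>

lemma PT_rcases:
  assumes "p \<in> PT"
  obtains s where "p = Scalar s" "s \<in> carrier S"
  | v vs where "p = Tensor (vs @ [v])" "v \<in> bcarrier V" "set vs \<subseteq> bcarrier V"
proof -
  from assms consider s where "p = Scalar s" "s \<in> carrier S" | vs where "p = Tensor vs" "vs \<noteq> []" "set vs \<subseteq> bcarrier V"
    unfolding pure_tensors_def by blast
  then show thesis
  proof cases
    case (2 vs) then show thesis using that(2) by (cases vs rule: rev_cases) auto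
  qed (use that in blast)
qed

lemma pure_mult_snoc [simp]:
  "pure_mult S V (Tensor (us @ [v])) (Scalar t) = Tensor (us @ [ract V v t])"
  "pure_mult S V (Tensor (us @ [v])) (Tensor ws) = Tensor (us @ v # ws)"
  by (cases us; cases ws; simp add: butlast_append)+

lemma pure_mult_Tensor2: "vs \<noteq> [] \<Longrightarrow> pure_mult S V (Tensor us) (Tensor vs) = Tensor (us @ vs)"
  by (cases us; cases vs) auto

text \<open>Left multiplication by a pure tensor turns each defining relation into another one. A
  scalar changes only the first letter, so the cases depend on whether the relation lives in that
  letter; a tensor turns the relations between scalars into linearity in its last letter.\<close>

lemma fm_TK_left:
  assumes "p \<in> PT" "k \<in> TK"
  shows "fm (pt p) k \<in> TK"
  unfolding fm_pt_left
proof (rule fext_TK[OF subspace_TK _ assms(2)])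
  fix f assume f: "f \<in> tensor_relations S V"
  show "fext (\<lambda>q. pt (pure_mult S V p q)) f \<in> TK"
    using assms(1)
  proof (cases rule: PT_rcases)
    case (1 r)
    from f show ?thesis
    proof (cases rule: rel_cases)
      case (sadd s t)
      then show ?thesis using 1 TK_rel(1)[of "r \<otimes>\<^bsub>S\<^esub> s" "r \<otimes>\<^bsub>S\<^esub> t"] by (simp add: S_alg S_closed)
    next
      case (sscale c s)
      then show ?thesis using 1 TK_rel(2)[of "r \<otimes>\<^bsub>S\<^esub> s" c] by (simp add: S_alg S_closed)
    next
      case (add us vs v w)
      then show ?thesis using 1 TK_rel(3)[of "lact V r (hd us) # tl us" vs v w]
         TK_rel(3)[of "[]" vs "lact V r v" "lact V r w"]
        by (cases us) (simp_all add: V_bimod V_closed)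
    next
      case (scale us vs v c)
      then show ?thesis using 1 TK_rel(4)[of "lact V r (hd us) # tl us" vs v c]
         TK_rel(4)[of "[]" vs "lact V r v" c]
        by (cases us) (simp_all add: V_bimod V_closed)
    next
      case (balanced us vs v w s)
      then show ?thesis using 1 TK_rel(5)[of "lact V r (hd us) # tl us" vs v w s]
         TK_rel(5)[of "[]" vs "lact V r v" w s]
        by (cases us) (simp_all add: V_bimod V_closed)
    qed
  next
    case (2 z zs)
    from f show ?thesis
    proof (cases rule: rel_cases)
      case (sadd s t)
      then show ?thesis using 2 TK_rel(3)[of zs "[]" "ract V z s" "ract V z t"] by (simp add: V_bimod V_closed)
    next
      case (sscale c s)
      then show ?thesis using 2 TK_rel(4)[of zs "[]" "ract V z s" c] by (simp add: V_bimod V_closed)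
    next
      case (add us vs v w)
      then show ?thesis using 2 TK_rel(3)[of "zs @ z # us" vs v w] by simp
    next
      case (scale us vs v c)
      then show ?thesis using 2 TK_rel(4)[of "zs @ z # us" vs v c] by simp
    next
      case (balanced us vs v w s)
      then show ?thesis using 2 TK_rel(5)[of "zs @ z # us" vs v w s] by simp
    qed
  qed
qed

lemma fm_TK_right:
  assumes "p \<in> PT" "k \<in> TK"
  shows "fm k (pt p) \<in> TK"
  unfolding fm_pt_right
proof (rule fext_TK[OF subspace_TK _ assms(2)])
  fix f assume f: "f \<in> tensor_relations S V"
  show "fext (\<lambda>q. pt (pure_mult S V q p)) f \<in> TK"
    using assms(1)
  proof (cases rule: PT_cases)
    case (1 r)
    from f show ?thesis
    proof (cases rule: rel_cases)
      case (sadd s t)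
      then show ?thesis using 1 TK_rel(1)[of "s \<otimes>\<^bsub>S\<^esub> r" "t \<otimes>\<^bsub>S\<^esub> r"] by (simp add: S_alg S_closed)
    next
      case (sscale c s)
      then show ?thesis using 1 TK_rel(2)[of "s \<otimes>\<^bsub>S\<^esub> r" c] by (simp add: S_alg S_closed)
    next
      case (add us vs v w)
      then show ?thesis using 1 TK_rel(3)[of us "butlast vs @ [ract V (last vs) r]" v w]
         TK_rel(3)[of us "[]" "ract V v r" "ract V w r"]
        by (cases vs rule: rev_cases) (simp_all add: V_bimod V_closed butlast_append)
    next
      case (scale us vs v c)
      then show ?thesis using 1 TK_rel(4)[of us "butlast vs @ [ract V (last vs) r]" v c]
         TK_rel(4)[of us "[]" "ract V v r" c]
        by (cases vs rule: rev_cases) (simp_all add: V_bimod V_closed butlast_append)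
    next
      case (balanced us vs v w s)
      then show ?thesis using 1 TK_rel(5)[of us "butlast vs @ [ract V (last vs) r]" v w s]
         TK_rel(5)[of us "[]" v "ract V w r" s]
        by (cases vs rule: rev_cases) (simp_all add: V_bimod V_closed butlast_append)
    qed
  next
    case (2 z zs)
    from f show ?thesis
    proof (cases rule: rel_cases)
      case (sadd s t)
      then show ?thesis using 2 TK_rel(3)[of "[]" zs "lact V s z" "lact V t z"] by (simp add: V_bimod V_closed)
    next
      case (sscale c s)
      then show ?thesis using 2 TK_rel(4)[of "[]" zs "lact V s z" c] by (simp add: V_bimod V_closed)
    next
      case (add us vs v w)
      then show ?thesis using 2 TK_rel(3)[of us "vs @ z # zs" v w] by (simp add: pure_mult_Tensor2)
    next
      case (scale us vs v c)
      then show ?thesis using 2 TK_rel(4)[of us "vs @ z # zs" v c] by (simp add: pure_mult_Tensor2)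
    next
      case (balanced us vs v w s)
      then show ?thesis using 2 TK_rel(5)[of us "vs @ z # zs" v w s] by (simp add: pure_mult_Tensor2)
    qed
  qed
qed

lemma fm_TK:
  assumes "f \<in> FC" "k \<in> TK"
  shows "fm f k \<in> TK" "fm k f \<in> TK"
proof -
  have *: "formal.subspace {f. fm f k \<in> TK}" "formal.subspace {f. fm k f \<in> TK}"
    by (auto intro!: formal.subspaceI simp: TK_closed)
  show "fm f k \<in> TK" "fm k f \<in> TK"
    using FC_induct[OF assms(1) *(1)] FC_induct[OF assms(1) *(2)] fm_TK_left fm_TK_right assms(2) by auto
qed

text \<open>The two sides are literally equal except for a scalar s between two tensors: then they
  end in v s \<otimes> w and v \<otimes> s w, which differ by a balancing relation.\<close>

lemma pure_mult_assoc:
  assumes p: "p \<in> PT" and q: "q \<in> PT" and r: "r \<in> PT"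
  shows "pt (pure_mult S V (pure_mult S V p q) r) - pt (pure_mult S V p (pure_mult S V q r)) \<in> TK"
  using q
proof (cases rule: PT_cases)
  case (1 s)
  from p show ?thesis
  proof (cases rule: PT_rcases)
    case p: (1 s')
    from r show ?thesis using 1 p by (cases rule: PT_cases) (simp_all add: S_alg V_bimod TK_closed)
  next
    case p: (2 z zs)
    from r show ?thesis using 1 p TK_rel(5)[of zs _ z _ s] by (cases rule: PT_cases) (simp_all add: V_bimod TK_closed)
  qed
next
  case (2 v vs)
  from r show ?thesis
  proof (cases rule: PT_cases)
    case (1 t)
    from p show ?thesis using 1 2
      by (cases rule: PT_cases; cases vs rule: rev_cases) (simp_all add: V_bimod TK_closed butlast_append)
  next
    case r: (2 w ws)
    from p show ?thesis using 2 r by (cases rule: PT_cases) (simp_all add: TK_closed)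
  qed
qed

lemma fm_assoc:
  assumes "f \<in> FC" "g \<in> FC" "h \<in> FC"
  shows "fm (fm f g) h - fm f (fm g h) \<in> TK"
proof -
  let ?D = "\<lambda>f g h. fm (fm f g) h - fm f (fm g h)"
  have sub: "formal.subspace {f. ?D f g h \<in> TK}" "formal.subspace {g. ?D f g h \<in> TK}" "formal.subspace {h. ?D f g h \<in> TK}" for f g h
  proof -
    have A: "?D (x + y) g h = ?D x g h + ?D y g h" "?D f (x + y) h = ?D f x h + ?D f y h" "?D f g (x + y) = ?D f g x + ?D f g y" for x y
      by simp_all
    have B: "?D (formal_scale c x) g h = formal_scale c (?D x g h)" "?D f (formal_scale c x) h = formal_scale c (?D f x h)"
      "?D f g (formal_scale c x) = formal_scale c (?D f g x)" for x c
      by (simp_all add: formal.scale_right_diff_distrib)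
    have Z: "?D 0 g h = 0" "?D f 0 h = 0" "?D f g 0 = 0" by simp_all
    show "formal.subspace {f. ?D f g h \<in> TK}" "formal.subspace {g. ?D f g h \<in> TK}" "formal.subspace {h. ?D f g h \<in> TK}"
      by (rule formal.subspaceI; simp only: mem_Collect_eq A B Z TK_closed)+
  qed
  have "?D (pt p) (pt q) (pt r) \<in> TK" if "p \<in> PT" "q \<in> PT" "r \<in> PT" for p q r
    using pure_mult_assoc[OF that] by simp
  then have "?D (pt p) (pt q) h \<in> TK" if "p \<in> PT" "q \<in> PT" for p q
    using FC_induct[OF assms(3) sub(3), of "pt p" "pt q"] that by blast
  then have "?D (pt p) g h \<in> TK" if "p \<in> PT" for p
    using FC_induct[OF assms(2) sub(2), of "pt p" h] that by blast
  then show ?thesis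
    using FC_induct[OF assms(1) sub(1), of g h] by blast
qed

end

lemma UN_const_on: "t \<in> A \<Longrightarrow> (\<And>a. a \<in> A \<Longrightarrow> F a = F t) \<Longrightarrow> (\<Union>a\<in>A. F a) = F t"
  by blast

context calg_bimodule
begin

text \<open>
  A linear choice of representatives of the classes of the tensor algebra; with it the tensor algebra
  is computed in the formal combinations, the product being \<open>om\<close>.
\<close>

definition nf :: "('s, 'v) formal \<Rightarrow> ('s, 'v) formal" where
  "nf = (SOME nf. Vector_Spaces.linear formal_scale formal_scale nf \<and>
    (\<forall>f. nf f = 0 \<longleftrightarrow> f \<in> TK) \<and> (\<forall>f. f - nf f \<in> TK))"

lemma nf_spec: "Vector_Spaces.linear formal_scale formal_scale nf"
    "nf f = 0 \<longleftrightarrow> f \<in> TK" "f - nf f \<in> TK"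
  using someI_ex[OF complement_projection[OF subspace_TK]] unfolding nf_def by blast+

lemma nf_linear [simp]:
  "nf (f + g) = nf f + nf g" "nf (f - g) = nf f - nf g" "nf 0 = 0" "nf (- f) = - nf f"
  "nf (formal_scale c f) = formal_scale c (nf f)"
proof -
  interpret nf: Vector_Spaces.linear formal_scale formal_scale nf by (rule nf_spec)
  show "nf (f + g) = nf f + nf g" "nf (f - g) = nf f - nf g" "nf 0 = 0" "nf (- f) = - nf f"
    "nf (formal_scale c f) = formal_scale c (nf f)"
    by (simp_all add: nf.add nf.diff nf.zero nf.neg nf.scale)
qed

lemma nf_eq_iff: "nf f = nf g \<longleftrightarrow> f - g \<in> TK"
  using nf_spec(2)[of "f - g"] by simp

lemma nf_nf [simp]: "nf (nf f) = nf f"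
  using nf_spec(3)[of f] nf_eq_iff[of f "nf f"] by simp

lemma nf_FC [simp, intro]: "f \<in> FC \<Longrightarrow> nf f \<in> FC"
  using FC_closed(2)[of f "f - nf f"] TK_FC nf_spec(3)[of f] by auto

definition om :: "('s, 'v) formal \<Rightarrow> ('s, 'v) formal \<Rightarrow> ('s, 'v) formal" where
  "om f g = nf (fm f g)"

lemma om_FC: "f \<in> FC \<Longrightarrow> g \<in> FC \<Longrightarrow> om f g \<in> FC"
  unfolding om_def by auto

lemma om_nf_absorb [simp]:
  assumes "f \<in> FC" "g \<in> FC"
  shows "om (nf f) g = om f g" "om f (nf g) = om f g" "nf (om f g) = om f g"
proof -
  have "fm f g - fm (nf f) g \<in> TK" "fm f g - fm f (nf g) \<in> TK"
    using fm_TK(2)[OF assms(2) nf_spec(3)[of f]] fm_TK(1)[OF assms(1) nf_spec(3)[of g]] by simp_all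
  then show "om (nf f) g = om f g" "om f (nf g) = om f g"
    unfolding om_def nf_eq_iff[symmetric] by simp_all
  show "nf (om f g) = om f g" by (simp add: om_def)
qed

lemma om_assoc:
  assumes "f \<in> FC" "g \<in> FC" "h \<in> FC"
  shows "om (om f g) h = om f (om g h)"
proof -
  have "om (om f g) h = nf (fm (fm f g) h)" "om f (om g h) = nf (fm f (fm g h))"
    using om_nf_absorb(1)[OF fm_FC[OF assms(1,2)] assms(3)] om_nf_absorb(2)[OF assms(1) fm_FC[OF assms(2,3)]]
    by (simp_all only: om_def)
  then show ?thesis using fm_assoc[OF assms] by (simp add: nf_eq_iff)
qed

lemma om_bilinear [simp]:
  "om (f + f') g = om f g + om f' g" "om f (g + g') = om f g + om f g'"
  "om (formal_scale c f) g = formal_scale c (om f g)" "om f (formal_scale c g) = formal_scale c (om f g)"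
  by (simp_all add: om_def)

section \<open>Computing in the quotient by representatives\<close>

lemma cls_eq: "cls f = (\<lambda>k. k + f) ` TK"
  unfolding tensor_class_def a_r_coset_def r_coset_def by auto

lemma cls_eq_iff: "cls f = cls g \<longleftrightarrow> f - g \<in> TK"
proof
  assume "cls f = cls g"
  moreover have "f \<in> cls f" unfolding cls_eq using TK_closed(4) by force
  ultimately show "f - g \<in> TK" unfolding cls_eq by auto
next
  have *: "cls f \<subseteq> cls g" if "f - g \<in> TK" for f g
    unfolding cls_eq
  proof (rule image_subsetI)
    fix k assume "k \<in> TK"
    then have "k + (f - g) \<in> TK" using that by (rule TK_closed(1))
    then show "k + f \<in> (\<lambda>k. k + g) ` TK" by (rule rev_image_eqI) simp
  qed
  assume "f - g \<in> TK"
  then show "cls f = cls g" using *[of f g] *[of g f] TK_closed(5)[of "f - g"] by auto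
qed

lemma cls_nf [simp]: "cls (nf f) = cls f"
  using nf_spec(3)[of f] TK_closed(5)[of "f - nf f"] by (simp add: cls_eq_iff)

lemma cls_eq_nf: "cls f = cls g \<longleftrightarrow> nf f = nf g"
  by (simp add: cls_eq_iff nf_eq_iff)

lemma mem_cls: "h \<in> cls f \<longleftrightarrow> h - f \<in> TK"
  unfolding cls_eq by (auto intro: image_eqI[of _ _ "h - f"])

lemma carrier_TA: "carrier TA = cls ` FC"
  by (auto simp: tensor_algebra_def alg_quot_def FactRing_def A_RCOSETS_def RCOSETS_def tensor_class_def a_r_coset_def)

lemma TA_sel:
  "\<one>\<^bsub>TA\<^esub> = cls (pt (Scalar \<one>\<^bsub>S\<^esub>))" "\<zero>\<^bsub>TA\<^esub> = cls 0"
  by (simp_all add: tensor_algebra_def alg_quot_def FactRing_def tensor_class_def)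
     (simp add: tensor_class_def[symmetric] cls_eq)

lemma cls_add: "cls f \<oplus>\<^bsub>TA\<^esub> cls g = cls (f + g)"
proof -
  have "cls f \<oplus>\<^bsub>TA\<^esub> cls g = {h + k |h k. h \<in> cls f \<and> k \<in> cls g}"
    by (auto simp: tensor_algebra_def alg_quot_def FactRing_def set_add_def set_mult_def)
  also have "\<dots> = cls (f + g)"
  proof (intro Set.set_eqI iffI)
    fix x assume "x \<in> {h + k |h k. h \<in> cls f \<and> k \<in> cls g}"
    then obtain h k where x: "x = h + k" and hk: "h - f \<in> TK" "k - g \<in> TK" by (auto simp: mem_cls)
    have "(h - f) + (k - g) \<in> TK" using hk by (rule TK_closed(1))
    then show "x \<in> cls (f + g)" by (simp add: x mem_cls algebra_simps)
  next
    fix x assume "x \<in> cls (f + g)"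
    then have "x - g - f \<in> TK" by (simp add: mem_cls algebra_simps)
    then have "x - g \<in> cls f" "g \<in> cls g" "x = (x - g) + g" using TK_closed(4) by (simp_all add: mem_cls)
    then show "x \<in> {h + k |h k. h \<in> cls f \<and> k \<in> cls g}" by blast
  qed
  finally show ?thesis .
qed

lemma cls_mult:
  assumes "f \<in> FC" "g \<in> FC"
  shows "cls f \<otimes>\<^bsub>TA\<^esub> cls g = cls (fm f g)"
proof -
  have "cls (fm f' g') = cls (fm f g)" if "f' \<in> cls f" "g' \<in> cls g" for f' g'
  proof -
    have d: "f' - f \<in> TK" "g' - g \<in> TK" using that by (auto simp: mem_cls)
    then have "g' \<in> FC" using assms(2) TK_FC FC_closed(1)[of "g' - g" g] by auto
    then have "fm (f' - f) g' + fm f (g' - g) \<in> TK"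
      using d assms by (intro TK_closed(1) fm_TK)
    then show ?thesis by (simp add: cls_eq_iff)
  qed
  moreover have "f \<in> cls f" "g \<in> cls g" using TK_closed(4) by (simp_all add: mem_cls)
  ultimately have "(\<Union>a\<in>cls f. \<Union>b\<in>cls g. cls (fm a b)) = cls (fm f g)" by blast
  then show ?thesis
    by (simp add: tensor_algebra_def alg_quot_def FactRing_def rcoset_mult_def fm_def tensor_class_def)
qed

lemma cls_smult: "c \<odot>\<^bsub>TA\<^esub> cls f = cls (formal_scale c f)"
proof -
  have "cls (formal_scale c f') = cls (formal_scale c f)" if "f' \<in> cls f" for f'
    using that TK_closed(3)[of "f' - f" c] by (simp add: cls_eq_iff mem_cls formal.scale_right_diff_distrib)
  moreover have "f \<in> cls f" using TK_closed(4) by (simp add: mem_cls)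
  ultimately have "(\<Union>a\<in>cls f. cls (formal_scale c a)) = cls (formal_scale c f)" by blast
  then show ?thesis
    by (simp add: tensor_algebra_def alg_quot_def tensor_class_def)
qed

lemma pt_one_FC: "pt (Scalar \<one>\<^bsub>S\<^esub>) \<in> FC" using S_closed by simp

lemma fm_one:
  assumes "f \<in> FC"
  shows "fm (pt (Scalar \<one>\<^bsub>S\<^esub>)) f = f" "fm f (pt (Scalar \<one>\<^bsub>S\<^esub>)) = f"
proof -
  have 1: "pure_mult S V (Scalar \<one>\<^bsub>S\<^esub>) p = p" if "p \<in> PT" for p
    using that by (cases rule: PT_cases) (simp_all add: S_alg V_bimod)
  have 2: "pure_mult S V p (Scalar \<one>\<^bsub>S\<^esub>) = p" if "p \<in> PT" for p
    using that by (cases rule: PT_rcases) (simp_all add: S_alg V_bimod)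
  have k: "p \<in> PT" if "p \<in> Poly_Mapping.keys f" for p using assms that by (auto simp: FC_iff)
  have "fext (\<lambda>q. pt (pure_mult S V (Scalar \<one>\<^bsub>S\<^esub>) q)) f = fext pt f" "fext (\<lambda>q. pt (pure_mult S V q (Scalar \<one>\<^bsub>S\<^esub>))) f = fext pt f"
    by (rule fext_cong; simp add: 1 2 k)+
  then show "fm (pt (Scalar \<one>\<^bsub>S\<^esub>)) f = f" "fm f (pt (Scalar \<one>\<^bsub>S\<^esub>)) = f"
    by (simp_all add: fm_pt_left fm_pt_right)
qed

lemma ring_TA: "ring TA"
proof (rule ringI)
  show "abelian_group TA"
  proof (rule abelian_groupI)
    fix x assume "x \<in> carrier TA"
    then obtain f where "x = cls f" "f \<in> FC" by (auto simp: carrier_TA)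
    then show "\<exists>y\<in>carrier TA. y \<oplus>\<^bsub>TA\<^esub> x = \<zero>\<^bsub>TA\<^esub>"
      by (intro bexI[of _ "cls (- f)"]) (auto simp: carrier_TA cls_add TA_sel FC_closed)
  qed (auto simp: carrier_TA cls_add TA_sel FC_closed add_ac)
  show "monoid TA"
  proof (rule monoidI)
    fix x y z assume "x \<in> carrier TA" "y \<in> carrier TA" "z \<in> carrier TA"
    then obtain f g h where "x = cls f" "y = cls g" "z = cls h" "f \<in> FC" "g \<in> FC" "h \<in> FC" by (auto simp: carrier_TA)
    then show "x \<otimes>\<^bsub>TA\<^esub> y \<otimes>\<^bsub>TA\<^esub> z = x \<otimes>\<^bsub>TA\<^esub> (y \<otimes>\<^bsub>TA\<^esub> z)"
      by (simp add: cls_mult fm_FC cls_eq_iff fm_assoc)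
  next
    fix x assume "x \<in> carrier TA"
    then obtain f where "x = cls f" "f \<in> FC" by (auto simp: carrier_TA)
    then show "\<one>\<^bsub>TA\<^esub> \<otimes>\<^bsub>TA\<^esub> x = x" "x \<otimes>\<^bsub>TA\<^esub> \<one>\<^bsub>TA\<^esub> = x"
      by (simp_all add: TA_sel cls_mult[OF pt_one_FC] cls_mult[OF _ pt_one_FC] fm_one)
  next
    show "\<one>\<^bsub>TA\<^esub> \<in> carrier TA" unfolding carrier_TA TA_sel using pt_one_FC by (rule imageI)
  qed (auto simp: carrier_TA cls_mult fm_FC)
qed (auto simp: carrier_TA cls_mult cls_add FC_closed fm_FC)

lemma TA_smult_closed: "x \<in> carrier TA \<Longrightarrow> c \<odot>\<^bsub>TA\<^esub> x \<in> carrier TA"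
  by (auto simp: carrier_TA cls_smult FC_closed)

lemma TA_smult_assoc:
  "x \<in> carrier TA \<Longrightarrow> y \<in> carrier TA \<Longrightarrow> (c \<odot>\<^bsub>TA\<^esub> x) \<otimes>\<^bsub>TA\<^esub> y = c \<odot>\<^bsub>TA\<^esub> (x \<otimes>\<^bsub>TA\<^esub> y)"
  by (auto simp: carrier_TA cls_smult cls_mult FC_closed fm_FC)

lemma induced_map_cls:
  assumes "\<And>k. k \<in> TK \<Longrightarrow> fext h k \<in> TK"
  shows "induced_map S V h (cls f) = cls (fext h f)"
proof -
  have "cls (fext h f') = cls (fext h f)" if "f' \<in> cls f" for f'
    using that assms[of "f' - f"] by (simp add: cls_eq_iff mem_cls)
  moreover have "f \<in> cls f" using TK_closed(4) by (simp add: mem_cls)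
  ultimately have "(\<Union>f\<in>cls f. cls (fext h f)) = cls (fext h f)" by blast
  then show ?thesis unfolding induced_map_def lin_ext_def .
qed

lemma a_inv_cls: "f \<in> FC \<Longrightarrow> inv\<^bsub>add_monoid TA\<^esub> (cls f) = cls (- f)"
proof -
  interpret ring TA by (rule ring_TA)
  show "f \<in> FC \<Longrightarrow> inv\<^bsub>add_monoid TA\<^esub> (cls f) = cls (- f)"
    by (rule group.inv_equality[OF a_group]) (simp_all add: cls_add TA_sel carrier_TA FC_closed)
qed

section \<open>Subspaces and ideals of the quotient through their preimages\<close>

lemma submodule_TA_pre:
  assumes "submodule M (ring_of_type_algebra :: complex ring) TA"
  shows "formal.subspace {f \<in> FC. cls f \<in> M}" "TK \<subseteq> {f \<in> FC. cls f \<in> M}"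
proof -
  interpret submodule M "ring_of_type_algebra :: complex ring" TA by fact
  have zero: "cls 0 \<in> M" using one_closed by (simp add: TA_sel)
  show "formal.subspace {f \<in> FC. cls f \<in> M}"
  proof (rule formal.subspaceI)
    show "0 \<in> {f \<in> FC. cls f \<in> M}" using zero by (simp add: FC_closed)
    show "x + y \<in> {f \<in> FC. cls f \<in> M}" if "x \<in> {f \<in> FC. cls f \<in> M}" "y \<in> {f \<in> FC. cls f \<in> M}" for x y
      using that m_closed[of "cls x" "cls y"] by (simp add: FC_closed cls_add)
    show "formal_scale c x \<in> {f \<in> FC. cls f \<in> M}" if "x \<in> {f \<in> FC. cls f \<in> M}" for c x
      using that smult_closed[of c "cls x"] by (simp add: FC_closed cls_smult ring_of_type_algebra_def)
  qed
  show "TK \<subseteq> {f \<in> FC. cls f \<in> M}"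
  proof
    fix k assume "k \<in> TK"
    moreover from this have "cls k = cls 0" by (simp add: cls_eq_iff)
    ultimately show "k \<in> {f \<in> FC. cls f \<in> M}" using zero TK_FC by auto
  qed
qed

lemma submodule_TA_image:
  assumes "formal.subspace J" "J \<subseteq> FC"
  shows "submodule (cls ` J) (ring_of_type_algebra :: complex ring) TA"
proof (intro submodule.intro subgroup.intro submodule_axioms.intro)
  show "cls ` J \<subseteq> carrier (add_monoid TA)" using assms(2) by (auto simp: carrier_TA)
  fix x y c assume xy: "x \<in> cls ` J"
  then obtain f where f: "x = cls f" "f \<in> J" by auto
  show "inv\<^bsub>add_monoid TA\<^esub> x \<in> cls ` J"
    using f assms(2) a_inv_cls[of f] formal.subspace_neg[OF assms(1)] by (auto simp: subset_iff)
  show "c \<odot>\<^bsub>TA\<^esub> x \<in> cls ` J"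
    using f formal.subspace_scale[OF assms(1)] by (auto simp: cls_smult)
  assume "y \<in> cls ` J"
  then show "x \<otimes>\<^bsub>add_monoid TA\<^esub> y \<in> cls ` J"
    using f formal.subspace_add[OF assms(1)] by (auto simp: cls_add)
next
  show "\<one>\<^bsub>add_monoid TA\<^esub> \<in> cls ` J"
    using formal.subspace_0[OF assms(1)] by (simp add: TA_sel)
qed

lemma lin_span_TA_pre:
  "formal.subspace {f \<in> FC. cls f \<in> lin_span TA Z}" "f \<in> FC \<Longrightarrow> cls f \<in> Z \<Longrightarrow> cls f \<in> lin_span TA Z"
proof -
  have eq: "{f \<in> FC. cls f \<in> lin_span TA Z} =
     FC \<inter> \<Inter>{{f \<in> FC. cls f \<in> M} |M. Z \<subseteq> M \<and> submodule M (ring_of_type_algebra :: complex ring) TA}"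
    unfolding lin_span_def by blast
  show "formal.subspace {f \<in> FC. cls f \<in> lin_span TA Z}"
    unfolding eq by (intro formal.subspace_inter subspace_FC formal.subspace_Inter) (auto intro: submodule_TA_pre)
  show "cls f \<in> Z \<Longrightarrow> cls f \<in> lin_span TA Z" by (auto simp: lin_span_def)
qed

lemma lin_span_TA_subset:
  assumes "formal.subspace J" "J \<subseteq> FC" "Z \<subseteq> cls ` J"
  shows "lin_span TA Z \<subseteq> cls ` J"
  unfolding lin_span_def using submodule_TA_image[OF assms(1,2)] assms(3) by blast

text \<open>A ring ideal is closed under complex scalars because c x = (c 1) x; this makes linear
  algebra applicable to ideals generated in the sense of rings.\<close>

lemma ideal_TA_pre:
  assumes "ideal I TA"
  shows "formal.subspace {f \<in> FC. cls f \<in> I}" "TK \<subseteq> {f \<in> FC. cls f \<in> I}"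
    and "f \<in> FC \<Longrightarrow> g \<in> FC \<Longrightarrow> cls f \<in> I \<Longrightarrow> cls (fm g f) \<in> I"
    and "f \<in> FC \<Longrightarrow> g \<in> FC \<Longrightarrow> cls f \<in> I \<Longrightarrow> cls (fm f g) \<in> I"
    and "x \<in> I \<Longrightarrow> c \<odot>\<^bsub>TA\<^esub> x \<in> I"
proof -
  interpret ideal I TA by fact
  have sub: "c \<odot>\<^bsub>TA\<^esub> x \<in> I" if "x \<in> I" for c x
  proof -
    have x: "x \<in> carrier TA" using that a_subset by auto
    have "c \<odot>\<^bsub>TA\<^esub> \<one>\<^bsub>TA\<^esub> \<otimes>\<^bsub>TA\<^esub> x \<in> I"
      using that by (intro I_l_closed TA_smult_closed) auto
    then show ?thesis using x by (simp add: TA_smult_assoc)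
  qed
  then show "x \<in> I \<Longrightarrow> c \<odot>\<^bsub>TA\<^esub> x \<in> I" .
  have "submodule I (ring_of_type_algebra :: complex ring) TA"
    by (intro submodule.intro submodule_axioms.intro) (use a_subgroup sub in auto)
  from submodule_TA_pre[OF this] show "formal.subspace {f \<in> FC. cls f \<in> I}" "TK \<subseteq> {f \<in> FC. cls f \<in> I}" .
  show "f \<in> FC \<Longrightarrow> g \<in> FC \<Longrightarrow> cls f \<in> I \<Longrightarrow> cls (fm g f) \<in> I"
    using I_l_closed[of "cls f" "cls g"] by (simp add: cls_mult carrier_TA)
  show "f \<in> FC \<Longrightarrow> g \<in> FC \<Longrightarrow> cls f \<in> I \<Longrightarrow> cls (fm f g) \<in> I"
    using I_r_closed[of "cls f" "cls g"] by (simp add: cls_mult carrier_TA)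
qed

text \<open>First isomorphism theorem with the homomorphism given on formal combinations. The
  induced map goes from the quotient to B; the isomorphism asked for runs the other way, so its
  inverse is the map shown to respect scalars.\<close>

lemma quotient_iso:
  fixes ev :: "('s, 'v) formal \<Rightarrow> 'b::ab_group_add" and B :: "'b calgebra"
  assumes I: "ideal I TA"
    and pi_add: "\<And>f g. ev (f + g) = ev f + ev g"
    and pi_scale: "\<And>c f. f \<in> FC \<Longrightarrow> ev (formal_scale c f) = c \<odot>\<^bsub>B\<^esub> ev f"
    and pi_mult: "\<And>f g. f \<in> FC \<Longrightarrow> g \<in> FC \<Longrightarrow> ev (fm f g) = ev f \<otimes>\<^bsub>B\<^esub> ev g"
    and pi_one: "ev (pt (Scalar \<one>\<^bsub>S\<^esub>)) = \<one>\<^bsub>B\<^esub>"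
    and pi_TK: "\<And>k. k \<in> TK \<Longrightarrow> ev k = 0"
    and B: "\<And>x y. x \<oplus>\<^bsub>B\<^esub> y = x + y" "\<zero>\<^bsub>B\<^esub> = 0" "carrier B = ev ` FC"
    and ker: "\<And>f. f \<in> FC \<Longrightarrow> cls f \<in> I \<longleftrightarrow> ev f = 0"
  shows "alg_isomorphic B (alg_quot TA I)"
proof -
  interpret TA: ring TA by (rule ring_TA)
  interpret I: ideal I TA by (rule I)
  define ph where "ph Z = ev (SOME f. f \<in> Z)" for Z
  have ph: "ph (cls f) = ev f" for f
  proof -
    have "f \<in> cls f" using TK_closed(4) by (simp add: mem_cls)
    then have "(SOME g. g \<in> cls f) \<in> cls f" by (rule someI)
    then have "ev (((SOME g. g \<in> cls f) - f) + f) = ev f"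
      unfolding pi_add by (simp add: pi_TK mem_cls)
    then show ?thesis by (simp add: ph_def)
  qed
  have hom: "ph \<in> Ring.ring_hom TA B"
  proof (rule ring_hom_memI)
    show "ph x \<in> carrier B" if "x \<in> carrier TA" for x using that by (auto simp: carrier_TA ph B(3))
    show "ph (x \<otimes>\<^bsub>TA\<^esub> y) = ph x \<otimes>\<^bsub>B\<^esub> ph y" "ph (x \<oplus>\<^bsub>TA\<^esub> y) = ph x \<oplus>\<^bsub>B\<^esub> ph y"
      if "x \<in> carrier TA" "y \<in> carrier TA" for x y
      using that by (auto simp: carrier_TA ph B(1) pi_add pi_mult cls_mult cls_add)
    show "ph \<one>\<^bsub>TA\<^esub> = \<one>\<^bsub>B\<^esub>" by (simp add: TA_sel ph pi_one)
  qed
  have pi0: "ev 0 = 0" using pi_TK TK_closed(4) by blast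
  have im: "ph ` carrier TA = carrier B" by (simp add: carrier_TA image_image ph B)
  \<comment> \<open>B obtains its ring laws as a homomorphic image of the tensor algebra.\<close>
  have "ring (B\<lparr>carrier := ph ` carrier TA, zero := ph \<zero>\<^bsub>TA\<^esub>\<rparr>)"
    by (rule TA.ring_hom_imp_img_ring[OF hom])
  moreover have "B\<lparr>carrier := ph ` carrier TA, zero := ph \<zero>\<^bsub>TA\<^esub>\<rparr> = B"
    by (simp add: im TA_sel ph pi0 B(2)[symmetric])
  ultimately have "ring B" by simp
  then interpret B: ring B .
  interpret h: ring_hom_ring TA B ph
    by (rule ring_hom_ringI2[OF ring_TA B.ring_axioms hom])
  have kerI: "a_kernel TA B ph = I"
  proof -
    have sub: "I \<subseteq> cls ` FC" using I.a_subset by (simp add: carrier_TA)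
    have "ph x = \<zero>\<^bsub>B\<^esub> \<longleftrightarrow> x \<in> I" if "x \<in> cls ` FC" for x
      using that by (clarsimp simp: ph B(2) ker)
    then show ?thesis unfolding a_kernel_def' carrier_TA using sub by blast
  qed
  let ?g = "\<lambda>Y. the_elem (ph ` Y)"
  have iso: "?g \<in> ring_iso (TA Quot I) B"
    using h.FactRing_iso_set_aux unfolding kerI im by simp
  have inv: "inv_into (carrier (TA Quot I)) ?g \<in> ring_iso B (TA Quot I)"
    using ring_iso_set_sym[OF I.quotient_is_ring iso] .
  have inv_eq: "inv_into (carrier (TA Quot I)) ?g (ph t) = I +>\<^bsub>TA\<^esub> t" if "t \<in> carrier TA" for t
  proof -
    have "?g (I +>\<^bsub>TA\<^esub> t) = ph t" using h.the_elem_simp[OF that] unfolding kerI .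
    moreover have "I +>\<^bsub>TA\<^esub> t \<in> carrier (TA Quot I)"
      using that by (auto simp: FactRing_def A_RCOSETS_def RCOSETS_def a_r_coset_def)
    moreover have "inj_on ?g (carrier (TA Quot I))"
      using iso unfolding ring_iso_def bij_betw_def by auto
    ultimately show ?thesis by (intro inv_into_f_eq)
  qed
  \<comment> \<open>The scalar multiplication of the quotient is a union over all representatives;
    it is a single coset because I is closed under scalars.\<close>
  have smult: "(\<Union>a\<in>I +>\<^bsub>TA\<^esub> t. I +>\<^bsub>TA\<^esub> (c \<odot>\<^bsub>TA\<^esub> a)) = I +>\<^bsub>TA\<^esub> (c \<odot>\<^bsub>TA\<^esub> t)" if t: "t \<in> carrier TA" for c t
  proof -
    have "I +>\<^bsub>TA\<^esub> (c \<odot>\<^bsub>TA\<^esub> a) = I +>\<^bsub>TA\<^esub> (c \<odot>\<^bsub>TA\<^esub> t)" if "a \<in> I +>\<^bsub>TA\<^esub> t" for a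
    proof -
      from that obtain i where i: "i \<in> I" "a = i \<oplus>\<^bsub>TA\<^esub> t" by (auto simp: a_r_coset_def r_coset_def)
      have "c \<odot>\<^bsub>TA\<^esub> a = c \<odot>\<^bsub>TA\<^esub> i \<oplus>\<^bsub>TA\<^esub> c \<odot>\<^bsub>TA\<^esub> t"
        using i t I.a_subset by (auto simp: carrier_TA cls_add cls_smult formal.scale_right_distrib subset_iff image_iff)
      moreover have "c \<odot>\<^bsub>TA\<^esub> i \<in> I" using i(1) by (rule ideal_TA_pre(5)[OF I])
      ultimately have "c \<odot>\<^bsub>TA\<^esub> a \<in> I +>\<^bsub>TA\<^esub> (c \<odot>\<^bsub>TA\<^esub> t)" by (auto simp: a_r_coset_def r_coset_def)
      then show ?thesis using TA.a_repr_independence[OF _ TA_smult_closed[OF t] I.a_subgroup] by simp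
    qed
    then show ?thesis by (rule UN_const_on[OF I.a_rcos_self[OF t]])
  qed
  have "inv_into (carrier (TA Quot I)) ?g \<in> alg_iso B (alg_quot TA I)"
    unfolding alg_iso_def
  proof (intro CollectI conjI allI ballI)
    show "inv_into (carrier (TA Quot I)) ?g \<in> ring_iso B (alg_quot TA I)"
      using inv unfolding ring_iso_def Ring.ring_hom_def by (simp add: alg_quot_def)
    fix c b assume "b \<in> carrier B"
    then obtain f where b: "b = ph (cls f)" "f \<in> FC" by (auto simp: B ph)
    have "c \<odot>\<^bsub>B\<^esub> b = ph (c \<odot>\<^bsub>TA\<^esub> cls f)" using b by (simp add: ph cls_smult pi_scale)
    then show "inv_into (carrier (TA Quot I)) ?g (c \<odot>\<^bsub>B\<^esub> b) = c \<odot>\<^bsub>alg_quot TA I\<^esub> inv_into (carrier (TA Quot I)) ?g b"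
      using b smult[of "cls f" c] by (simp add: inv_eq carrier_TA FC_closed cls_smult alg_quot_def)
  qed
  then show ?thesis unfolding alg_isomorphic_def by blast
qed

subsection \<open>Graded automorphisms\<close>

text \<open>An algebra endomorphism f0 of S and a linear map f1 of V that is semilinear over it: the
  parts of degrees 0 and 1 that determine a graded endomorphism of the tensor algebra.\<close>

definition bimodule_endo :: "('s \<Rightarrow> 's) \<Rightarrow> ('v \<Rightarrow> 'v) \<Rightarrow> bool" where
  "bimodule_endo f0 f1 \<longleftrightarrow>
    f0 ` carrier S \<subseteq> carrier S \<and> f1 ` bcarrier V \<subseteq> bcarrier V \<and>
    f0 \<one>\<^bsub>S\<^esub> = \<one>\<^bsub>S\<^esub> \<and>
    (\<forall>s\<in>carrier S. \<forall>t\<in>carrier S. f0 (s \<oplus>\<^bsub>S\<^esub> t) = f0 s \<oplus>\<^bsub>S\<^esub> f0 t \<and> f0 (s \<otimes>\<^bsub>S\<^esub> t) = f0 s \<otimes>\<^bsub>S\<^esub> f0 t) \<and>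
    (\<forall>c. \<forall>s\<in>carrier S. f0 (c \<odot>\<^bsub>S\<^esub> s) = c \<odot>\<^bsub>S\<^esub> f0 s) \<and>
    (\<forall>v\<in>bcarrier V. \<forall>w\<in>bcarrier V. f1 (badd V v w) = badd V (f1 v) (f1 w)) \<and>
    (\<forall>c. \<forall>v\<in>bcarrier V. f1 (bscale V c v) = bscale V c (f1 v)) \<and>
    (\<forall>s\<in>carrier S. \<forall>v\<in>bcarrier V. f1 (lact V s v) = lact V (f0 s) (f1 v) \<and> f1 (ract V v s) = ract V (f1 v) (f0 s))"

fun endo_pure :: "('s \<Rightarrow> 's) \<Rightarrow> ('v \<Rightarrow> 'v) \<Rightarrow> ('s, 'v) pure_tensor \<Rightarrow> ('s, 'v) pure_tensor" where
  "endo_pure f0 f1 (Scalar s) = Scalar (f0 s)"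
| "endo_pure f0 f1 (Tensor vs) = Tensor (map f1 vs)"

definition endo_map :: "('s \<Rightarrow> 's) \<Rightarrow> ('v \<Rightarrow> 'v) \<Rightarrow> ('s, 'v) formal set \<Rightarrow> ('s, 'v) formal set" where
  "endo_map f0 f1 = induced_map S V (\<lambda>p. pt (endo_pure f0 f1 p))"

context
  fixes f0 f1 assumes endo: "bimodule_endo f0 f1"
begin

lemma endo_simps:
  "s \<in> carrier S \<Longrightarrow> f0 s \<in> carrier S" "v \<in> bcarrier V \<Longrightarrow> f1 v \<in> bcarrier V" "f0 \<one>\<^bsub>S\<^esub> = \<one>\<^bsub>S\<^esub>"
  "s \<in> carrier S \<Longrightarrow> t \<in> carrier S \<Longrightarrow> f0 (s \<oplus>\<^bsub>S\<^esub> t) = f0 s \<oplus>\<^bsub>S\<^esub> f0 t"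
  "s \<in> carrier S \<Longrightarrow> t \<in> carrier S \<Longrightarrow> f0 (s \<otimes>\<^bsub>S\<^esub> t) = f0 s \<otimes>\<^bsub>S\<^esub> f0 t"
  "s \<in> carrier S \<Longrightarrow> f0 (c \<odot>\<^bsub>S\<^esub> s) = c \<odot>\<^bsub>S\<^esub> f0 s"
  "v \<in> bcarrier V \<Longrightarrow> w \<in> bcarrier V \<Longrightarrow> f1 (badd V v w) = badd V (f1 v) (f1 w)"
  "v \<in> bcarrier V \<Longrightarrow> f1 (bscale V c v) = bscale V c (f1 v)"
  "s \<in> carrier S \<Longrightarrow> v \<in> bcarrier V \<Longrightarrow> f1 (lact V s v) = lact V (f0 s) (f1 v)"
  "s \<in> carrier S \<Longrightarrow> v \<in> bcarrier V \<Longrightarrow> f1 (ract V v s) = ract V (f1 v) (f0 s)"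
  using endo unfolding bimodule_endo_def by blast+

lemma endo_set: "set vs \<subseteq> bcarrier V \<Longrightarrow> f1 ` set vs \<subseteq> bcarrier V"
  using endo_simps(2) by blast

lemma endo_pure_PT: "p \<in> PT \<Longrightarrow> endo_pure f0 f1 p \<in> PT"
  by (cases p) (simp_all add: endo_simps endo_set)

abbreviation "ef \<equiv> fext (\<lambda>p. pt (endo_pure f0 f1 p))"

lemma ef_TK:
  assumes "k \<in> TK"
  shows "ef k \<in> TK"
proof (rule fext_TK[OF subspace_TK _ assms])
  fix f assume "f \<in> tensor_relations S V"
  then show "ef f \<in> TK"
  proof (cases rule: rel_cases)
    case (sadd s t)
    then show ?thesis using TK_rel(1)[of "f0 s" "f0 t"] by (simp add: endo_simps)
  next
    case (sscale c s)
    then show ?thesis using TK_rel(2)[of "f0 s" c] by (simp add: endo_simps)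
  next
    case (add us vs v w)
    then show ?thesis using TK_rel(3)[of "map f1 us" "map f1 vs" "f1 v" "f1 w"] by (simp add: endo_simps endo_set)
  next
    case (scale us vs v c)
    then show ?thesis using TK_rel(4)[of "map f1 us" "map f1 vs" "f1 v" c] by (simp add: endo_simps endo_set)
  next
    case (balanced us vs v w s)
    then show ?thesis using TK_rel(5)[of "map f1 us" "map f1 vs" "f1 v" "f1 w" "f0 s"] by (simp add: endo_simps endo_set)
  qed
qed

lemma endo_map_cls: "endo_map f0 f1 (cls f) = cls (ef f)"
  unfolding endo_map_def by (rule induced_map_cls) (rule ef_TK)

lemma ef_FC: "f \<in> FC \<Longrightarrow> ef f \<in> FC"
  by (rule FC_fext) (simp_all add: endo_pure_PT)

lemma endo_pure_mult:
  assumes "p \<in> PT" "q \<in> PT"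
  shows "endo_pure f0 f1 (pure_mult S V p q) = pure_mult S V (endo_pure f0 f1 p) (endo_pure f0 f1 q)"
  using assms(2)
proof (cases rule: PT_cases)
  case (1 s)
  from assms(1) show ?thesis using 1 by (cases rule: PT_rcases) (simp_all add: endo_simps)
next
  case (2 v vs)
  from assms(1) show ?thesis using 2 by (cases rule: PT_cases) (simp_all add: endo_simps)
qed

lemma ef_fm:
  assumes "f \<in> FC" "g \<in> FC"
  shows "ef (fm f g) = fm (ef f) (ef g)"
proof -
  have sub: "formal.subspace {f. ef (fm f g) = fm (ef f) (ef g)}" "formal.subspace {g. ef (fm f g) = fm (ef f) (ef g)}" for f g
    by (auto intro!: formal.subspaceI)
  have "ef (fm (pt p) (pt q)) = fm (ef (pt p)) (ef (pt q))" if "p \<in> PT" "q \<in> PT" for p q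
    using endo_pure_mult[OF that] by simp
  then have "ef (fm (pt p) g) = fm (ef (pt p)) (ef g)" if "p \<in> PT" for p
    using FC_induct[OF assms(2) sub(2)[of "pt p"]] that by blast
  then show ?thesis using FC_induct[OF assms(1) sub(1)[of g]] by blast
qed

end

lemma ef_inverse:
  assumes "bimodule_endo f0 f1" "bimodule_endo g0 g1"
    and "\<And>s. s \<in> carrier S \<Longrightarrow> g0 (f0 s) = s" "\<And>v. v \<in> bcarrier V \<Longrightarrow> g1 (f1 v) = v"
    and "f \<in> FC"
  shows "fext (\<lambda>p. pt (endo_pure g0 g1 p)) (fext (\<lambda>p. pt (endo_pure f0 f1 p)) f) = f"
proof -
  have sub: "formal.subspace {f. fext (\<lambda>p. pt (endo_pure g0 g1 p)) (fext (\<lambda>p. pt (endo_pure f0 f1 p)) f) = f}"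
    by (auto intro!: formal.subspaceI)
  have "endo_pure g0 g1 (endo_pure f0 f1 p) = p" if "p \<in> PT" for p
    using that assms(3,4) by (cases p) (auto simp: map_idI subset_iff)
  then show ?thesis using FC_induct[OF assms(5) sub] by simp
qed

lemma keys_fext_endo:
  assumes "f \<in> FC" "\<forall>p\<in>Poly_Mapping.keys f. tensor_degree p = d" "bimodule_endo f0 f1"
  shows "\<forall>p\<in>Poly_Mapping.keys (fext (\<lambda>p. pt (endo_pure f0 f1 p)) f). tensor_degree p = d"
proof -
  have sub: "formal.subspace {f :: ('s, 'v) formal. \<forall>p\<in>Poly_Mapping.keys f. tensor_degree p = d}"
  proof -
    have eq: "{f. \<forall>p\<in>Poly_Mapping.keys f. tensor_degree p = d} =
      {f :: ('s, 'v) formal. \<forall>p. tensor_degree p \<noteq> d \<longrightarrow> Poly_Mapping.lookup f p = 0}"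
      by (auto simp: in_keys_iff)
    show ?thesis unfolding eq by (rule formal.subspaceI) (simp_all add: lookup_add)
  qed
  have deg: "tensor_degree (endo_pure f0 f1 p) = tensor_degree p" for p :: "('s, 'v) pure_tensor" by (cases p) auto
  have "fext (\<lambda>p. pt (endo_pure f0 f1 p)) f \<in> {f. \<forall>p\<in>Poly_Mapping.keys f. tensor_degree p = d}"
    by (rule fext_in_subspace[OF sub]) (use assms(2) deg in auto)
  then show ?thesis by simp
qed

text \<open>The inverse pair induces the inverse map. Both maps send each tensor power into itself,
  which upgrades the inclusion of the image to an equality.\<close>

lemma endo_map_alg_iso:
  assumes e: "bimodule_endo f0 f1" "bimodule_endo g0 g1"
    and "\<And>s. s \<in> carrier S \<Longrightarrow> g0 (f0 s) = s" "\<And>v. v \<in> bcarrier V \<Longrightarrow> g1 (f1 v) = v"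
    and "\<And>s. s \<in> carrier S \<Longrightarrow> f0 (g0 s) = s" "\<And>v. v \<in> bcarrier V \<Longrightarrow> f1 (g1 v) = v"
  shows "endo_map f0 f1 \<in> alg_iso TA TA"
    and "endo_map f0 f1 ` tensor_power S V d = tensor_power S V d"
proof -
  note inv = ef_inverse[OF e assms(3,4)] ef_inverse[OF e(2,1) assms(5,6)]
  have inv': "endo_map g0 g1 (endo_map f0 f1 x) = x" "endo_map f0 f1 (endo_map g0 g1 x) = x" if "x \<in> carrier TA" for x
    using that by (auto simp: carrier_TA endo_map_cls e inv ef_FC)
  have cl: "endo_map f0 f1 x \<in> carrier TA" "endo_map g0 g1 x \<in> carrier TA" if "x \<in> carrier TA" for x
    using that by (auto simp: carrier_TA endo_map_cls e ef_FC)
  have "bij_betw (endo_map f0 f1) (carrier TA) (carrier TA)"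
    by (rule bij_betw_byWitness[of _ "endo_map g0 g1"]) (use inv' cl in auto)
  moreover have "endo_map f0 f1 \<in> Ring.ring_hom TA TA"
  proof (rule ring_hom_memI)
    show "endo_map f0 f1 x \<in> carrier TA" if "x \<in> carrier TA" for x using cl(1)[OF that] .
    show "endo_map f0 f1 (x \<otimes>\<^bsub>TA\<^esub> y) = endo_map f0 f1 x \<otimes>\<^bsub>TA\<^esub> endo_map f0 f1 y"
      "endo_map f0 f1 (x \<oplus>\<^bsub>TA\<^esub> y) = endo_map f0 f1 x \<oplus>\<^bsub>TA\<^esub> endo_map f0 f1 y"
      if xy: "x \<in> carrier TA" "y \<in> carrier TA" for x y
    proof -
      obtain f g where "x = cls f" "y = cls g" "f \<in> FC" "g \<in> FC" using xy by (auto simp: carrier_TA)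
      then show "endo_map f0 f1 (x \<otimes>\<^bsub>TA\<^esub> y) = endo_map f0 f1 x \<otimes>\<^bsub>TA\<^esub> endo_map f0 f1 y"
        "endo_map f0 f1 (x \<oplus>\<^bsub>TA\<^esub> y) = endo_map f0 f1 x \<oplus>\<^bsub>TA\<^esub> endo_map f0 f1 y"
        by (simp_all add: cls_mult cls_add endo_map_cls e ef_FC ef_fm)
    qed
    show "endo_map f0 f1 \<one>\<^bsub>TA\<^esub> = \<one>\<^bsub>TA\<^esub>" by (simp add: TA_sel endo_map_cls e endo_simps(3)[OF e(1)])
  qed
  moreover have "endo_map f0 f1 (c \<odot>\<^bsub>TA\<^esub> x) = c \<odot>\<^bsub>TA\<^esub> endo_map f0 f1 x" if "x \<in> carrier TA" for c x
    using that by (auto simp: carrier_TA cls_smult endo_map_cls e)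
  ultimately show "endo_map f0 f1 \<in> alg_iso TA TA" unfolding alg_iso_def ring_iso_def by auto
  have sub: "endo_map f0 f1 ` tensor_power S V d \<subseteq> tensor_power S V d" if "bimodule_endo f0 f1" for f0 f1
  proof
    fix y assume "y \<in> endo_map f0 f1 ` tensor_power S V d"
    then obtain f where f: "y = endo_map f0 f1 (cls f)" "f \<in> FC" "\<forall>p\<in>Poly_Mapping.keys f. tensor_degree p = d"
      unfolding tensor_power_def by blast
    then have "y = cls (fext (\<lambda>p. pt (endo_pure f0 f1 p)) f)" by (simp only: endo_map_cls[OF that])
    then show "y \<in> tensor_power S V d"
      unfolding tensor_power_def using ef_FC[OF that f(2)] keys_fext_endo[OF f(2,3) that] by blast
  qed
  have "x \<in> endo_map f0 f1 ` tensor_power S V d" if "x \<in> tensor_power S V d" for x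
  proof (rule image_eqI)
    show "endo_map g0 g1 x \<in> tensor_power S V d" using sub[OF e(2)] that by auto
    show "x = endo_map f0 f1 (endo_map g0 g1 x)"
      using that inv'(2) by (auto simp: tensor_power_def carrier_TA)
  qed
  then show "endo_map f0 f1 ` tensor_power S V d = tensor_power S V d" using sub[OF e(1)] by auto
qed

end

section \<open>Contractions\<close>

text \<open>\<open>Tr_represent\<close> and \<open>Tr_nondeg\<close> together say that a |-> Tr(a _)
  is a bijection from S onto its dual. This is the form of nondegeneracy that makes the descriptions
  in \<open>lpair\<close> and \<open>rpair\<close> defined, without a dimension count.\<close>

locale traced_bimodule = calg_bimodule +
  fixes Tr
  assumes Tr_add: "s \<in> carrier S \<Longrightarrow> t \<in> carrier S \<Longrightarrow> Tr (s \<oplus>\<^bsub>S\<^esub> t) = Tr s + Tr t"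
    and Tr_smult: "s \<in> carrier S \<Longrightarrow> Tr (c \<odot>\<^bsub>S\<^esub> s) = c * Tr s"
    and Tr_comm: "s \<in> carrier S \<Longrightarrow> t \<in> carrier S \<Longrightarrow> Tr (s \<otimes>\<^bsub>S\<^esub> t) = Tr (t \<otimes>\<^bsub>S\<^esub> s)"
    and Tr_represent: "(\<And>s t. s \<in> carrier S \<Longrightarrow> t \<in> carrier S \<Longrightarrow> f (s \<oplus>\<^bsub>S\<^esub> t) = f s + f t) \<Longrightarrow>
      (\<And>c s. s \<in> carrier S \<Longrightarrow> f (c \<odot>\<^bsub>S\<^esub> s) = c * f s) \<Longrightarrow>
      \<exists>a\<in>carrier S. \<forall>s\<in>carrier S. Tr (a \<otimes>\<^bsub>S\<^esub> s) = f s"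
    and Tr_nondeg: "a \<in> carrier S \<Longrightarrow> b \<in> carrier S \<Longrightarrow>
      (\<And>s. s \<in> carrier S \<Longrightarrow> Tr (a \<otimes>\<^bsub>S\<^esub> s) = Tr (b \<otimes>\<^bsub>S\<^esub> s)) \<Longrightarrow> a = b"
begin

abbreviation "lp \<equiv> lpair S Tr V"
abbreviation "rp \<equiv> rpair S Tr V"
abbreviation "lc \<psi> \<equiv> fext (lcontract_pure S Tr V \<psi>)"
abbreviation "rc \<psi> \<equiv> fext (rcontract_pure S Tr V \<psi>)"

lemma lpair_eqI:
  assumes "a \<in> carrier S" "\<And>s. s \<in> carrier S \<Longrightarrow> Tr (a \<otimes>\<^bsub>S\<^esub> s) = \<psi> (ract V w s)"
  shows "lp \<psi> w = a"
  unfolding lpair_def by (rule the_equality) (use assms Tr_nondeg in auto)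

lemma rpair_eqI:
  assumes "a \<in> carrier S" "\<And>s. s \<in> carrier S \<Longrightarrow> Tr (s \<otimes>\<^bsub>S\<^esub> a) = \<psi> (lact V s w)"
  shows "rp w \<psi> = a"
  unfolding rpair_def
proof (rule the_equality)
  fix b assume b: "b \<in> carrier S \<and> (\<forall>s\<in>carrier S. Tr (s \<otimes>\<^bsub>S\<^esub> b) = \<psi> (lact V s w))"
  show "b = a" by (rule Tr_nondeg) (use b assms in \<open>auto simp: Tr_comm[of b] Tr_comm[of a]\<close>)
qed (use assms in auto)

context
  fixes \<psi> assumes psi: "\<psi> \<in> bdual V"
begin

lemma psi_simps: "v \<in> bcarrier V \<Longrightarrow> w \<in> bcarrier V \<Longrightarrow> \<psi> (badd V v w) = \<psi> v + \<psi> w"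
  "v \<in> bcarrier V \<Longrightarrow> \<psi> (bscale V c v) = c * \<psi> v"
  using psi by (auto simp: bdual_def)

lemma lpair_props:
  assumes "v \<in> bcarrier V"
  shows "lp \<psi> v \<in> carrier S" "s \<in> carrier S \<Longrightarrow> Tr (lp \<psi> v \<otimes>\<^bsub>S\<^esub> s) = \<psi> (ract V v s)"
proof -
  have "\<exists>a\<in>carrier S. \<forall>s\<in>carrier S. Tr (a \<otimes>\<^bsub>S\<^esub> s) = \<psi> (ract V v s)"
    by (rule Tr_represent) (simp_all add: assms V_bimod V_closed psi_simps)
  then obtain a where a: "a \<in> carrier S" "\<And>s. s \<in> carrier S \<Longrightarrow> Tr (a \<otimes>\<^bsub>S\<^esub> s) = \<psi> (ract V v s)" by auto
  then have "lp \<psi> v = a" by (rule lpair_eqI)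
  then show "lp \<psi> v \<in> carrier S" "s \<in> carrier S \<Longrightarrow> Tr (lp \<psi> v \<otimes>\<^bsub>S\<^esub> s) = \<psi> (ract V v s)" using a by auto
qed

lemma rpair_props:
  assumes "v \<in> bcarrier V"
  shows "rp v \<psi> \<in> carrier S" "s \<in> carrier S \<Longrightarrow> Tr (s \<otimes>\<^bsub>S\<^esub> rp v \<psi>) = \<psi> (lact V s v)"
proof -
  have "\<exists>a\<in>carrier S. \<forall>s\<in>carrier S. Tr (a \<otimes>\<^bsub>S\<^esub> s) = \<psi> (lact V s v)"
    by (rule Tr_represent) (simp_all add: assms V_bimod V_closed psi_simps)
  then obtain a where a: "a \<in> carrier S" "\<And>s. s \<in> carrier S \<Longrightarrow> Tr (a \<otimes>\<^bsub>S\<^esub> s) = \<psi> (lact V s v)" by auto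
  then have "rp v \<psi> = a" by (intro rpair_eqI) (simp_all add: Tr_comm[of _ a])
  then show "rp v \<psi> \<in> carrier S" "s \<in> carrier S \<Longrightarrow> Tr (s \<otimes>\<^bsub>S\<^esub> rp v \<psi>) = \<psi> (lact V s v)" using a by (auto simp: Tr_comm[of _ a])
qed

lemma lpair_simps:
  assumes "v \<in> bcarrier V"
  shows "w \<in> bcarrier V \<Longrightarrow> lp \<psi> (badd V v w) = lp \<psi> v \<oplus>\<^bsub>S\<^esub> lp \<psi> w"
    "lp \<psi> (bscale V c v) = c \<odot>\<^bsub>S\<^esub> lp \<psi> v"
    "s \<in> carrier S \<Longrightarrow> lp \<psi> (ract V v s) = lp \<psi> v \<otimes>\<^bsub>S\<^esub> s"
  by (rule lpair_eqI; simp add: assms S_closed S_alg V_bimod V_closed Tr_add Tr_smult lpair_props psi_simps)+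

lemma rpair_simps:
  assumes "v \<in> bcarrier V"
  shows "w \<in> bcarrier V \<Longrightarrow> rp (badd V v w) \<psi> = rp v \<psi> \<oplus>\<^bsub>S\<^esub> rp w \<psi>"
    "rp (bscale V c v) \<psi> = c \<odot>\<^bsub>S\<^esub> rp v \<psi>"
    "s \<in> carrier S \<Longrightarrow> rp (lact V s v) \<psi> = s \<otimes>\<^bsub>S\<^esub> rp v \<psi>"
proof -
  show "w \<in> bcarrier V \<Longrightarrow> rp (badd V v w) \<psi> = rp v \<psi> \<oplus>\<^bsub>S\<^esub> rp w \<psi>"
    "rp (bscale V c v) \<psi> = c \<odot>\<^bsub>S\<^esub> rp v \<psi>"
    by (rule rpair_eqI; simp add: assms S_closed S_alg V_bimod V_closed Tr_add Tr_smult rpair_props psi_simps)+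
  assume s: "s \<in> carrier S"
  show "rp (lact V s v) \<psi> = s \<otimes>\<^bsub>S\<^esub> rp v \<psi>"
  proof (rule rpair_eqI)
    fix t assume t: "t \<in> carrier S"
    show "Tr (t \<otimes>\<^bsub>S\<^esub> (s \<otimes>\<^bsub>S\<^esub> rp v \<psi>)) = \<psi> (lact V t (lact V s v))"
      using rpair_props(2)[OF assms, of "t \<otimes>\<^bsub>S\<^esub> s"] s t by (simp add: S_closed S_alg V_bimod assms rpair_props(1))
  qed (simp add: s S_closed rpair_props assms)
qed

lemma rcontract_pure_snoc [simp]:
  "rcontract_pure S Tr V \<psi> (Tensor (us @ [v, w])) = pt (Tensor (us @ [ract V v (rp w \<psi>)]))"
  by simp

text \<open>Something happens only to relations in the first letter: they need linearity of the
  pairing and, for v s \<otimes> w against v \<otimes> s w, its right linearity [psi (v s)] =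
  [psi v] s. Any other relation becomes one of the same kind.\<close>

lemma lc_TK:
  assumes "k \<in> TK"
  shows "lc \<psi> k \<in> TK"
proof (rule fext_TK[OF subspace_TK _ assms])
  fix f assume "f \<in> tensor_relations S V"
  then show "lc \<psi> f \<in> TK"
  proof (cases rule: rel_cases)
    case (sadd s t)
    then show ?thesis by (simp add: TK_closed)
  next
    case (sscale c s)
    then show ?thesis by (simp add: TK_closed)
  next
    case (add us vs v w)
    show ?thesis
    proof (cases us)
      case Nil
      show ?thesis
      proof (cases vs)
        case Nil
        then show ?thesis using add \<open>us = []\<close> TK_rel(1)[of "lp \<psi> v" "lp \<psi> w"] by (simp add: lpair_props lpair_simps)
      next
        case (Cons a as)
        then show ?thesis using add \<open>us = []\<close> TK_rel(3)[of "[]" as "lact V (lp \<psi> v) a" "lact V (lp \<psi> w) a"]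
          by (simp add: lpair_props lpair_simps V_bimod V_closed)
      qed
    next
      case (Cons a as)
      then show ?thesis using add TK_rel(3)[of "[]" vs "lact V (lp \<psi> a) v" "lact V (lp \<psi> a) w"]
          TK_rel(3)[of "lact V (lp \<psi> a) (hd as) # tl as" vs v w]
        by (cases as) (simp_all add: lpair_props V_bimod V_closed)
    qed
  next
    case (scale us vs v c)
    show ?thesis
    proof (cases us)
      case Nil
      then show ?thesis using scale TK_rel(2)[of "lp \<psi> v" c] TK_rel(4)[of "[]" "tl vs" "lact V (lp \<psi> v) (hd vs)" c]
        by (cases vs) (simp_all add: lpair_props lpair_simps V_bimod V_closed)
    next
      case (Cons a as)
      then show ?thesis using scale TK_rel(4)[of "[]" vs "lact V (lp \<psi> a) v" c]
          TK_rel(4)[of "lact V (lp \<psi> a) (hd as) # tl as" vs v c]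
        by (cases as) (simp_all add: lpair_props V_bimod V_closed)
    qed
  next
    case (balanced us vs v w s)
    show ?thesis
    proof (cases us)
      case Nil
      then show ?thesis using balanced by (simp add: lpair_props lpair_simps V_bimod TK_closed)
    next
      case (Cons a as)
      then show ?thesis using balanced TK_rel(5)[of "[]" vs "lact V (lp \<psi> a) v" w s]
          TK_rel(5)[of "lact V (lp \<psi> a) (hd as) # tl as" vs v w s]
        by (cases as) (simp_all add: lpair_props V_bimod V_closed)
    qed
  qed
qed

lemma rc_TK:
  assumes "k \<in> TK"
  shows "rc \<psi> k \<in> TK"
proof (rule fext_TK[OF subspace_TK _ assms])
  fix f assume "f \<in> tensor_relations S V"
  then show "rc \<psi> f \<in> TK"
  proof (cases rule: rel_cases)
    case (sadd s t)
    then show ?thesis by (simp add: TK_closed)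
  next
    case (sscale c s)
    then show ?thesis by (simp add: TK_closed)
  next
    case (add us vs v w)
    show ?thesis
    proof (cases vs rule: rev_cases)
      case Nil
      then show ?thesis using add TK_rel(1)[of "rp v \<psi>" "rp w \<psi>"]
         TK_rel(3)[of "butlast us" "[]" "ract V (last us) (rp v \<psi>)" "ract V (last us) (rp w \<psi>)"]
        by (cases us rule: rev_cases) (simp_all add: rpair_props rpair_simps V_bimod V_closed)
    next
      case (snoc as a)
      then show ?thesis using add TK_rel(3)[of us "[]" "ract V v (rp a \<psi>)" "ract V w (rp a \<psi>)"]
          TK_rel(3)[of us "butlast as @ [ract V (last as) (rp a \<psi>)]" v w]
        by (cases as rule: rev_cases) (simp_all add: rpair_props V_bimod V_closed)
    qed
  next
    case (scale us vs v c)
    show ?thesis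
    proof (cases vs rule: rev_cases)
      case Nil
      then show ?thesis using scale TK_rel(2)[of "rp v \<psi>" c]
         TK_rel(4)[of "butlast us" "[]" "ract V (last us) (rp v \<psi>)" c]
        by (cases us rule: rev_cases) (simp_all add: rpair_props rpair_simps V_bimod V_closed)
    next
      case (snoc as a)
      then show ?thesis using scale TK_rel(4)[of us "[]" "ract V v (rp a \<psi>)" c]
          TK_rel(4)[of us "butlast as @ [ract V (last as) (rp a \<psi>)]" v c]
        by (cases as rule: rev_cases) (simp_all add: rpair_props V_bimod V_closed)
    qed
  next
    case (balanced us vs v w s)
    show ?thesis
    proof (cases vs rule: rev_cases)
      case Nil
      then show ?thesis using balanced by (simp add: rpair_props rpair_simps V_bimod TK_closed)
    next
      case (snoc as a)
      then show ?thesis using balanced TK_rel(5)[of us "[]" v "ract V w (rp a \<psi>)" s]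
          TK_rel(5)[of us "butlast as @ [ract V (last as) (rp a \<psi>)]" v w s]
        by (cases as rule: rev_cases) (simp_all add: rpair_props V_bimod V_closed)
    qed
  qed
qed

lemma lc_FC: "f \<in> FC \<Longrightarrow> lc \<psi> f \<in> FC"
proof (rule FC_fext)
  fix p assume "p \<in> PT"
  then show "lcontract_pure S Tr V \<psi> p \<in> FC"
  proof (cases rule: PT_cases)
    case (2 v vs)
    then show ?thesis by (cases vs) (simp_all add: lpair_props V_closed)
  qed (simp add: FC_closed)
qed

lemma lcontract_cls: "lcontract S Tr V \<psi> (cls f) = cls (lc \<psi> f)"
  unfolding lcontract_def by (rule induced_map_cls) (rule lc_TK)

lemma rcontract_cls: "rcontract S Tr V (cls f) \<psi> = cls (rc \<psi> f)"
  unfolding rcontract_def by (rule induced_map_cls) (rule rc_TK)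

text \<open>The form in which contractions are handed to the computation with the potential;
  together with linearity it determines them on tensors of positive degree.\<close>

lemma lc_fm:
  assumes "v \<in> bcarrier V" "f \<in> FC"
  shows "lc \<psi> (fm (pt (Tensor [v])) f) = fm (pt (Scalar (lp \<psi> v))) f"
proof -
  have sub: "formal.subspace {f. lc \<psi> (fm (pt (Tensor [v])) f) = fm (pt (Scalar (lp \<psi> v))) f}"
    by (auto intro!: formal.subspaceI)
  have "lc \<psi> (fm (pt (Tensor [v])) (pt p)) = fm (pt (Scalar (lp \<psi> v))) (pt p)" if "p \<in> PT" for p
    using that by (cases rule: PT_cases) (simp_all add: assms lpair_simps)
  then show ?thesis using FC_induct[OF assms(2) sub] by blast
qed

lemma rc_fm:
  assumes "v \<in> bcarrier V" "f \<in> FC"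
  shows "rc \<psi> (fm f (pt (Tensor [v]))) = fm f (pt (Scalar (rp v \<psi>)))"
proof -
  have sub: "formal.subspace {f. rc \<psi> (fm f (pt (Tensor [v]))) = fm f (pt (Scalar (rp v \<psi>)))}"
    by (auto intro!: formal.subspaceI)
  have "rc \<psi> (fm (pt p) (pt (Tensor [v]))) = fm (pt p) (pt (Scalar (rp v \<psi>)))" if "p \<in> PT" for p
    using that by (cases rule: PT_rcases) (simp_all add: assms rpair_simps)
  then show ?thesis using FC_induct[OF assms(2) sub] by blast
qed

lemma nf_lc_nf [simp]: "nf (lc \<psi> (nf f)) = nf (lc \<psi> f)" "nf (rc \<psi> (nf f)) = nf (rc \<psi> f)"
  using lc_TK[OF nf_spec(3)[of f]] rc_TK[OF nf_spec(3)[of f]] by (simp_all add: nf_spec(2)[symmetric])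

end

end

section \<open>The crossed product of functions with a finite group\<close>

type_synonym ('g, 'n) gfun = "'g \<Rightarrow> complex^'n \<Rightarrow> complex"

definition gscale :: "complex \<Rightarrow> ('g, 'n) gfun \<Rightarrow> ('g, 'n) gfun" where
  "gscale c x = (\<lambda>g v. c * x g v)"

interpretation gfun: vector_space "gscale :: complex \<Rightarrow> ('g, 'n::finite) gfun \<Rightarrow> _"
  by unfold_locales (auto simp: gscale_def fun_eq_iff algebra_simps)

lemma gscale_apply [simp]: "gscale c x g v = c * x g v"
  by (simp add: gscale_def)

lemma sum_apply2: "(\<Sum>a\<in>A. f a) g v = (\<Sum>a\<in>A. f a g v)"
  by (induction A rule: infinite_finite_induct) auto

definition gel :: "'g \<Rightarrow> ('g, 'n::finite) gfun" where
  "gel g = (\<lambda>h v. if h = g then 1 else 0)"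

locale finite_rep = group G for G :: "('g, 'm) monoid_scheme" (structure) +
  fixes \<rho> :: "'g \<Rightarrow> complex^'n^'n"
  assumes fin: "finite (carrier G)" and rep: "representation G \<rho>"
begin

abbreviation (input) e1 where "e1 \<equiv> (gel \<one> :: ('g, 'n) gfun)"

lemma rho_one [simp]: "\<rho> \<one> = Finite_Cartesian_Product.mat 1"
  and rho_mult: "g \<in> carrier G \<Longrightarrow> h \<in> carrier G \<Longrightarrow> \<rho> (g \<otimes> h) = \<rho> g ** \<rho> h"
  using rep by (auto simp: representation_def)

text \<open>Arbitrary functions on V are allowed as coefficients, h acting by f(h^-1 v). The product
  is then total on the type and associative without side conditions; the polynomial smash product is
  a subset closed under it.\<close>

definition sm :: "('g, 'n) gfun \<Rightarrow> ('g, 'n) gfun \<Rightarrow> ('g, 'n) gfun" (infixl "\<star>" 70) where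
  "x \<star> y = (\<lambda>g v. if g \<in> carrier G then \<Sum>h\<in>carrier G. x h v * y (inv h \<otimes> g) (\<rho> (inv h) *v v) else 0)"

definition Fn :: "('g, 'n) gfun set" where
  "Fn = {x. \<forall>g. g \<notin> carrier G \<longrightarrow> x g = 0}"

lemma bij_left_translate: "k \<in> carrier G \<Longrightarrow> bij_betw (\<lambda>h. inv k \<otimes> h) (carrier G) (carrier G)"
  by (rule bij_betw_byWitness[of _ "\<lambda>h. k \<otimes> h"]) (auto simp: m_assoc[symmetric])

lemma sm_assoc: "(x \<star> y) \<star> z = x \<star> (y \<star> z)"
proof (intro ext)
  fix g v
  show "((x \<star> y) \<star> z) g v = (x \<star> (y \<star> z)) g v"
  proof (cases "g \<in> carrier G")
    case g: True
    have "((x \<star> y) \<star> z) g v =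
      (\<Sum>h\<in>carrier G. \<Sum>k\<in>carrier G. x k v * y (inv k \<otimes> h) (\<rho> (inv k) *v v) * z (inv h \<otimes> g) (\<rho> (inv h) *v v))"
      using g by (simp add: sm_def sum_distrib_right)
    also have "\<dots> = (\<Sum>k\<in>carrier G. \<Sum>h\<in>carrier G. x k v * y (inv k \<otimes> h) (\<rho> (inv k) *v v) * z (inv h \<otimes> g) (\<rho> (inv h) *v v))"
      by (rule sum.swap)
    \<comment> \<open>Substitution of l = k^-1 h in the inner sum.\<close>
    also have "\<dots> = (\<Sum>k\<in>carrier G. \<Sum>l\<in>carrier G. x k v * y l (\<rho> (inv k) *v v) *
         z (inv l \<otimes> (inv k \<otimes> g)) (\<rho> (inv l) *v (\<rho> (inv k) *v v)))"
    proof (rule sum.cong[OF refl])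
      fix k assume k: "k \<in> carrier G"
      have *: "x k v * y (inv k \<otimes> h) (\<rho> (inv k) *v v) * z (inv h \<otimes> g) (\<rho> (inv h) *v v) =
        (\<lambda>l. x k v * y l (\<rho> (inv k) *v v) * z (inv l \<otimes> (inv k \<otimes> g)) (\<rho> (inv l) *v (\<rho> (inv k) *v v))) (inv k \<otimes> h)"
        if h: "h \<in> carrier G" for h
      proof -
        have "inv (inv k \<otimes> h) = inv h \<otimes> k" using k h by (simp add: inv_mult_group)
        moreover have "inv h \<otimes> k \<otimes> (inv k \<otimes> g) = inv h \<otimes> g" "inv h \<otimes> k \<otimes> inv k = inv h"
          using k h g by (simp_all add: m_assoc) (simp_all add: m_assoc[symmetric])
        moreover have "\<rho> (inv h \<otimes> k) *v (\<rho> (inv k) *v v) = \<rho> (inv h) *v v"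
          using k h rho_mult[of "inv h \<otimes> k" "inv k"] \<open>inv h \<otimes> k \<otimes> inv k = inv h\<close>
          by (simp add: matrix_vector_mul_assoc)
        ultimately show ?thesis by simp
      qed
      show "(\<Sum>h\<in>carrier G. x k v * y (inv k \<otimes> h) (\<rho> (inv k) *v v) * z (inv h \<otimes> g) (\<rho> (inv h) *v v)) =
        (\<Sum>l\<in>carrier G. x k v * y l (\<rho> (inv k) *v v) * z (inv l \<otimes> (inv k \<otimes> g)) (\<rho> (inv l) *v (\<rho> (inv k) *v v)))"
        by (subst sum.reindex_bij_betw[OF bij_left_translate[OF k], symmetric]) (rule sum.cong[OF refl *])
    qed
    also have "\<dots> = (x \<star> (y \<star> z)) g v"
      using g by (simp add: sm_def sum_distrib_left mult.assoc)
    finally show ?thesis .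
  qed (simp add: sm_def)
qed

lemma sm_linear [simp]:
  "(x + x') \<star> y = x \<star> y + x' \<star> y" "x \<star> (y + y') = x \<star> y + x \<star> y'"
  "(x - x') \<star> y = x \<star> y - x' \<star> y" "x \<star> (y - y') = x \<star> y - x \<star> y'"
  "gscale c x \<star> y = gscale c (x \<star> y)" "x \<star> gscale c y = gscale c (x \<star> y)" "0 \<star> x = 0" "x \<star> 0 = 0"
  by (auto simp: sm_def fun_eq_iff algebra_simps sum.distrib sum_subtractf sum_distrib_left)

lemma sm_sum: "sum f A \<star> y = (\<Sum>a\<in>A. f a \<star> y)" "y \<star> sum f A = (\<Sum>a\<in>A. y \<star> f a)"
  by (induction A rule: infinite_finite_induct) auto

lemma sm_Fn [simp]: "x \<star> y \<in> Fn"
  by (simp add: Fn_def sm_def fun_eq_iff)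

lemma gel_sm: "k \<in> carrier G \<Longrightarrow> (gel k \<star> x) g v = (if g \<in> carrier G then x (inv k \<otimes> g) (\<rho> (inv k) *v v) else 0)"
proof -
  assume k: "k \<in> carrier G"
  have "(\<Sum>h\<in>carrier G. gel k h v * x (inv h \<otimes> g) (\<rho> (inv h) *v v)) =
     (\<Sum>h\<in>carrier G. if h = k then x (inv k \<otimes> g) (\<rho> (inv k) *v v) else 0)"
    by (rule sum.cong) (auto simp: gel_def)
  then show ?thesis using k fin by (simp add: sm_def)
qed

lemma sm_gel: "k \<in> carrier G \<Longrightarrow> (x \<star> gel k) g v = (if g \<in> carrier G then x (g \<otimes> inv k) v else 0)"
proof -
  assume k: "k \<in> carrier G"
  have "(\<Sum>h\<in>carrier G. x h v * gel k (inv h \<otimes> g) (\<rho> (inv h) *v v)) =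
     (\<Sum>h\<in>carrier G. if h = g \<otimes> inv k then x (g \<otimes> inv k) v else 0)" if g: "g \<in> carrier G"
  proof (rule sum.cong[OF refl])
    fix h assume h: "h \<in> carrier G"
    have "inv h \<otimes> g = k \<longleftrightarrow> h = g \<otimes> inv k"
      using inv_solve_left[of k h g] inv_solve_right[of h g k] g h k by auto
    then show "x h v * gel k (inv h \<otimes> g) (\<rho> (inv h) *v v) = (if h = g \<otimes> inv k then x (g \<otimes> inv k) v else 0)"
      by (simp add: gel_def)
  qed
  then show ?thesis using k fin by (simp add: sm_def)
qed

lemma sm_one [simp]: "x \<in> Fn \<Longrightarrow> e1 \<star> x = x" "x \<in> Fn \<Longrightarrow> x \<star> e1 = x"
  by (auto simp: fun_eq_iff gel_sm sm_gel Fn_def)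

lemma gel_mult: "g \<in> carrier G \<Longrightarrow> h \<in> carrier G \<Longrightarrow> gel g \<star> gel h = gel (g \<otimes> h)"
proof (intro ext)
  fix k v assume gh: "g \<in> carrier G" "h \<in> carrier G"
  then show "(gel g \<star> gel h) k v = gel (g \<otimes> h) k v"
    using inv_solve_left[of h g k] gel_sm[of g "gel h" k v] by (auto simp: gel_def)
qed

definition SA :: "('g, 'n) gfun set" where
  "SA = {x \<in> Fn. \<forall>g v. x g v = x g 0}"

definition UA :: "('g, 'n) gfun set" where
  "UA = {x \<in> Fn. \<forall>g\<in>carrier G. Vector_Spaces.linear (*s) (*) (x g)}"

lemma linear_fun_iff:
  "Vector_Spaces.linear (*s) (*) (f :: complex^'n \<Rightarrow> complex) \<longleftrightarrow>
    (\<forall>v w. f (v + w) = f v + f w) \<and> (\<forall>c v. f (c *s v) = c * f v)"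
proof -
  have "vector_space ((*s) :: complex \<Rightarrow> complex^'n \<Rightarrow> _)" "vector_space ((*) :: complex \<Rightarrow> complex \<Rightarrow> _)"
    by (unfold_locales, auto simp: vec.scale_right_distrib vec.scale_left_distrib algebra_simps)
  then show ?thesis by (simp add: Vector_Spaces.linear_iff)
qed

lemma SA_Fn: "x \<in> SA \<Longrightarrow> x \<in> Fn" and UA_Fn: "x \<in> UA \<Longrightarrow> x \<in> Fn"
  by (auto simp: SA_def UA_def)

lemma SA_iff: "x \<in> SA \<longleftrightarrow> (\<exists>c. x = (\<lambda>g v. c g) \<and> (\<forall>g. g \<notin> carrier G \<longrightarrow> c g = 0))"
proof
  assume "x \<in> SA"
  then show "\<exists>c. x = (\<lambda>g v. c g) \<and> (\<forall>g. g \<notin> carrier G \<longrightarrow> c g = 0)"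
    by (intro exI[of _ "\<lambda>g. x g 0"]) (force simp: SA_def Fn_def fun_eq_iff)
qed (auto simp: SA_def Fn_def fun_eq_iff)

lemma SA_cases: "x \<in> SA \<Longrightarrow> (\<And>c. x = (\<lambda>g v. c g) \<Longrightarrow> (\<And>g. g \<notin> carrier G \<Longrightarrow> c g = 0) \<Longrightarrow> thesis) \<Longrightarrow> thesis"
  unfolding SA_iff by blast

lemma subspace_SA: "gfun.subspace SA"
proof (rule gfun.subspaceI)
  show "x + y \<in> SA" if "x \<in> SA" "y \<in> SA" for x y
    using that by (elim SA_cases) (auto simp: SA_def Fn_def fun_eq_iff)
  show "gscale c x \<in> SA" if "x \<in> SA" for c x
    using that by (elim SA_cases) (auto simp: SA_def Fn_def fun_eq_iff)
qed (auto simp: SA_def Fn_def fun_eq_iff)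

lemma subspace_UA: "gfun.subspace UA"
  by (rule gfun.subspaceI; auto simp: UA_def Fn_def fun_eq_iff linear_fun_iff algebra_simps)

lemma subspace_Fn: "gfun.subspace Fn"
  by (rule gfun.subspaceI; auto simp: Fn_def fun_eq_iff)

lemma gel_SA [simp]: "g \<in> carrier G \<Longrightarrow> gel g \<in> SA"
  by (auto simp: SA_def Fn_def gel_def fun_eq_iff)

lemma SA_mult [simp]: "x \<in> SA \<Longrightarrow> y \<in> SA \<Longrightarrow> x \<star> y \<in> SA"
  by (elim SA_cases) (auto simp: SA_def sm_def Fn_def fun_eq_iff)

lemma SA_eval: "x \<in> SA \<Longrightarrow> x g v = x g 0" unfolding SA_def by blast

lemma SA_UA [simp]: "s \<in> SA \<Longrightarrow> u \<in> UA \<Longrightarrow> s \<star> u \<in> UA"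
  and UA_SA [simp]: "s \<in> SA \<Longrightarrow> u \<in> UA \<Longrightarrow> u \<star> s \<in> UA"
proof -
  assume s: "s \<in> SA" and u: "u \<in> UA"
  have u1: "u g (v + w) = u g v + u g w" "u g (c *s v) = c * u g v" if "g \<in> carrier G" for g v w c
    using u that by (auto simp: UA_def linear_fun_iff)
  obtain c where c: "s = (\<lambda>g v. c g)" using s by (elim SA_cases)
  have "(s \<star> u) g (v + w) = (s \<star> u) g v + (s \<star> u) g w" "(s \<star> u) g (d *s v) = d * (s \<star> u) g v" if "g \<in> carrier G" for g v w d
    using that by (simp_all add: sm_def c matrix_vector_right_distrib vector_scalar_commute u1 distrib_left sum.distrib sum_distrib_left)
      (simp add: mult.left_commute)
  then show "s \<star> u \<in> UA" by (simp add: UA_def linear_fun_iff)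
  have "(u \<star> s) g (v + w) = (u \<star> s) g v + (u \<star> s) g w" "(u \<star> s) g (d *s v) = d * (u \<star> s) g v" if "g \<in> carrier G" for g v w d
    using that by (simp_all add: sm_def c u1 distrib_right sum.distrib sum_distrib_left mult.assoc)
  then show "u \<star> s \<in> UA" by (simp add: UA_def linear_fun_iff)
qed

definition Xv :: "'n \<Rightarrow> ('g, 'n) gfun" where
  "Xv i = (\<lambda>g v. if g = \<one> then v $ i else 0)"

lemma Xv_UA [simp]: "Xv i \<in> UA"
  by (auto simp: UA_def Fn_def Xv_def fun_eq_iff linear_fun_iff)

lemma Xv_sm: "(Xv i \<star> x) g v = (if g \<in> carrier G then v $ i * x g v else 0)"
proof -
  have "(\<Sum>h\<in>carrier G. Xv i h v * x (inv h \<otimes> g) (\<rho> (inv h) *v v)) =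
     (\<Sum>h\<in>carrier G. if h = \<one> then v $ i * x g v else 0)" if "g \<in> carrier G"
    by (rule sum.cong) (auto simp: Xv_def that)
  then show ?thesis using fin by (simp add: sm_def)
qed

text \<open>Since g acts on functions by f(g^-1 v), it sends x_i to the linear form given by the
  i-th row of \<rho>(g^-1). This is the rule for moving group elements to the right of
  words.\<close>

lemma gel_Xv: "g \<in> carrier G \<Longrightarrow> gel g \<star> Xv i = (\<Sum>j\<in>UNIV. gscale (\<rho> (inv g) $ i $ j) (Xv j \<star> gel g))"
proof (intro ext)
  fix h v assume g: "g \<in> carrier G"
  have "inv g \<otimes> h = \<one> \<longleftrightarrow> h = g" if "h \<in> carrier G"
    using inv_solve_left[of \<one> g h] g that by auto
  moreover have "(gel g \<star> Xv i) h v = (if h \<in> carrier G then Xv i (inv g \<otimes> h) (\<rho> (inv g) *v v) else 0)"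
    using g by (rule gel_sm)
  moreover have "(\<Sum>j\<in>UNIV. gscale (\<rho> (inv g) $ i $ j) (Xv j \<star> gel g)) h v =
      (\<Sum>j\<in>UNIV. \<rho> (inv g) $ i $ j * (if h \<in> carrier G then v $ j * gel g h v else 0))"
    by (simp add: sum_apply2 Xv_sm)
  ultimately show "(gel g \<star> Xv i) h v = (\<Sum>j\<in>UNIV. gscale (\<rho> (inv g) $ i $ j) (Xv j \<star> gel g)) h v"
    by (simp add: gel_def Xv_def matrix_vector_mult_def)
qed

lemma SA_decomp: "s \<in> SA \<Longrightarrow> s = (\<Sum>g\<in>carrier G. gscale (s g 0) (gel g))"
proof (intro ext)
  fix g and v :: "complex^'n" assume s: "s \<in> SA"
  have "(\<Sum>h\<in>carrier G. s h 0 * gel h g v) = (\<Sum>h\<in>carrier G. if h = g then s g 0 else 0)"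
    by (rule sum.cong) (auto simp: gel_def)
  then show "s g v = (\<Sum>g\<in>carrier G. gscale (s g 0) (gel g)) g v"
    using s fin by (elim SA_cases) (simp add: sum_apply2)
qed

lemma UA_decomp:
  "u \<in> UA \<Longrightarrow> u = (\<Sum>g\<in>carrier G. \<Sum>i\<in>UNIV. gscale (u g (axis i 1)) (Xv i \<star> gel g))"
proof (intro ext)
  fix g v assume u: "u \<in> UA"
  have "u g v = (\<Sum>i\<in>UNIV. u g (axis i 1) * v $ i)" if g: "g \<in> carrier G"
  proof -
    have u1: "u g (v + w) = u g v + u g w" "u g (c *s v) = c * u g v" for v w c
      using u g by (auto simp: UA_def linear_fun_iff)
    have u0: "u g 0 = 0" using u1(1)[of 0 0] by simp
    have us: "u g (sum f A) = (\<Sum>a\<in>A. u g (f a))" for f and A :: "'n set"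
      by (induction A rule: infinite_finite_induct) (simp_all add: u0 u1)
    have "u g v = u g (\<Sum>i\<in>UNIV. v $ i *s axis i 1)" by (simp add: basis_expansion)
    then show ?thesis by (simp add: us u1 mult.commute)
  qed
  moreover have "(\<Sum>h\<in>carrier G. \<Sum>i\<in>UNIV. u h (axis i 1) * ((Xv i \<star> gel h) g v)) =
    (\<Sum>h\<in>carrier G. if h = g then \<Sum>i\<in>UNIV. u g (axis i 1) * v $ i else 0)"
    by (rule sum.cong) (auto simp: Xv_sm gel_def intro!: sum.neutral sum.cong)
  ultimately show "u g v = (\<Sum>g\<in>carrier G. \<Sum>i\<in>UNIV. gscale (u g (axis i 1)) (Xv i \<star> gel g)) g v"
    using u fin by (auto simp: sum_apply2 UA_def Fn_def)
qed

subsection \<open>The standard trace and the determinant twist\<close>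

definition lam :: "('g, 'n) gfun \<Rightarrow> complex" where "lam x = x \<one> 0"

lemma lam_linear [simp]: "lam (x + y) = lam x + lam y" "lam (gscale c x) = c * lam x"
  by (simp_all add: lam_def)

lemma lam_sum: "lam (sum f A) = (\<Sum>a\<in>A. lam (f a))"
  by (simp add: lam_def sum_apply2)

lemma lam_sm: "x \<in> SA \<Longrightarrow> y \<in> SA \<Longrightarrow> lam (x \<star> y) = (\<Sum>h\<in>carrier G. x h 0 * y (inv h) 0)"
  by (elim SA_cases) (simp add: lam_def sm_def)

lemma lam_comm: "x \<in> SA \<Longrightarrow> y \<in> SA \<Longrightarrow> lam (x \<star> y) = lam (y \<star> x)"
proof -
  assume "x \<in> SA" "y \<in> SA"
  moreover have "bij_betw (\<lambda>h. inv h) (carrier G) (carrier G)"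
    by (rule bij_betw_byWitness[of _ "\<lambda>h. inv h"]) auto
  then have "(\<Sum>h\<in>carrier G. x h 0 * y (inv h) 0) = (\<Sum>h\<in>carrier G. x (inv h) 0 * y (inv (inv h)) 0)"
    by (rule sum.reindex_bij_betw[symmetric])
  ultimately show ?thesis by (simp add: lam_sm mult.commute)
qed

lemma lam_gel: "x \<in> SA \<Longrightarrow> h \<in> carrier G \<Longrightarrow> lam (x \<star> gel (inv h)) = x h 0"
  by (simp add: lam_def sm_gel)

text \<open>The component at g is multiplied by det(g). The coordinates x_i are fixed, and since det
  is a character of G this is an algebra automorphism, with inverse \<open>itw\<close> on
  \<open>Fn\<close>.\<close>

definition tw :: "('g, 'n) gfun \<Rightarrow> ('g, 'n) gfun" where "tw x = (\<lambda>g v. det (\<rho> g) * x g v)"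
definition itw :: "('g, 'n) gfun \<Rightarrow> ('g, 'n) gfun" where "itw x = (\<lambda>g v. det (\<rho> (inv g)) * x g v)"

lemma det_inv: "g \<in> carrier G \<Longrightarrow> det (\<rho> g) * det (\<rho> (inv g)) = 1"
proof -
  assume "g \<in> carrier G"
  then have "det (\<rho> g) * det (\<rho> (inv g)) = det (\<rho> (g \<otimes> inv g))"
    using rho_mult[OF \<open>g \<in> carrier G\<close> inv_closed[OF \<open>g \<in> carrier G\<close>]] by (simp only: det_mul)
  also have "\<dots> = det (Finite_Cartesian_Product.mat 1 :: complex^'n^'n)"
    using \<open>g \<in> carrier G\<close> by simp
  also have "\<dots> = 1" by (rule det_I)
  finally show ?thesis .
qed

lemma twist_linear [simp]:
  "tw (x + y) = tw x + tw y" "tw (gscale c x) = gscale c (tw x)" "itw (x + y) = itw x + itw y" "itw (gscale c x) = gscale c (itw x)"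
  by (auto simp: tw_def itw_def fun_eq_iff algebra_simps)

lemma twist_mult: "tw (x \<star> y) = tw x \<star> tw y" "itw (x \<star> y) = itw x \<star> itw y"
proof -
  have d: "det (\<rho> g) = det (\<rho> h) * det (\<rho> (inv h \<otimes> g))" "det (\<rho> (inv g)) = det (\<rho> (inv h)) * det (\<rho> (inv (inv h \<otimes> g)))"
    if "g \<in> carrier G" "h \<in> carrier G" for g h
  proof -
    have "g = h \<otimes> (inv h \<otimes> g)" using that by (simp add: m_assoc[symmetric])
    then have "\<rho> g = \<rho> h ** \<rho> (inv h \<otimes> g)" using that by (metis inv_closed m_closed rho_mult)
    then show 1: "det (\<rho> g) = det (\<rho> h) * det (\<rho> (inv h \<otimes> g))" by (simp add: det_mul)
    have "inv g = inv (inv h \<otimes> g) \<otimes> inv h" using that by (simp add: inv_mult_group m_assoc)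
    then have "\<rho> (inv g) = \<rho> (inv (inv h \<otimes> g)) ** \<rho> (inv h)" using that by (metis inv_closed m_closed rho_mult)
    then show "det (\<rho> (inv g)) = det (\<rho> (inv h)) * det (\<rho> (inv (inv h \<otimes> g)))" by (simp add: det_mul)
  qed
  have "tw (x \<star> y) g v = (tw x \<star> tw y) g v" "itw (x \<star> y) g v = (itw x \<star> itw y) g v" for g v
  proof -
    have *: "det (\<rho> g) * (x h v * y (inv h \<otimes> g) (\<rho> (inv h) *v v)) =
        det (\<rho> h) * x h v * (det (\<rho> (inv h \<otimes> g)) * y (inv h \<otimes> g) (\<rho> (inv h) *v v))"
      "det (\<rho> (inv g)) * (x h v * y (inv h \<otimes> g) (\<rho> (inv h) *v v)) =
        det (\<rho> (inv h)) * x h v * (det (\<rho> (inv (inv h \<otimes> g))) * y (inv h \<otimes> g) (\<rho> (inv h) *v v))"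
      if "g \<in> carrier G" "h \<in> carrier G" for h
      by (subst d[OF that], simp only: mult_ac)+
    show "tw (x \<star> y) g v = (tw x \<star> tw y) g v" "itw (x \<star> y) g v = (itw x \<star> itw y) g v"
    proof -
      show "tw (x \<star> y) g v = (tw x \<star> tw y) g v"
      proof (cases "g \<in> carrier G")
        case True
        show ?thesis unfolding tw_def sm_def if_P[OF True] sum_distrib_left by (rule sum.cong[OF refl *(1)[OF True]])
      qed (simp add: tw_def sm_def)
      show "itw (x \<star> y) g v = (itw x \<star> itw y) g v"
      proof (cases "g \<in> carrier G")
        case True
        show ?thesis unfolding itw_def sm_def if_P[OF True] sum_distrib_left by (rule sum.cong[OF refl *(2)[OF True]])
      qed (simp add: itw_def sm_def)
    qed
  qed
  then show "tw (x \<star> y) = tw x \<star> tw y" "itw (x \<star> y) = itw x \<star> itw y" by (simp_all add: fun_eq_iff)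
qed

lemma twist_inverse [simp]: "x \<in> Fn \<Longrightarrow> tw (itw x) = x" "x \<in> Fn \<Longrightarrow> itw (tw x) = x"
proof -
  have "det (\<rho> g) * (det (\<rho> (inv g)) * a) = a" "det (\<rho> (inv g)) * (det (\<rho> g) * a) = a" if "g \<in> carrier G" for g a
  proof -
    have *: "b * c = 1 \<Longrightarrow> b * (c * a) = a" for b c :: complex by (simp add: mult.assoc[symmetric])
    show "det (\<rho> g) * (det (\<rho> (inv g)) * a) = a" "det (\<rho> (inv g)) * (det (\<rho> g) * a) = a"
      by (rule *[OF det_inv[OF that]]) (rule *, subst mult.commute, rule det_inv[OF that])
  qed
  then have "tw (itw x) g v = x g v" "itw (tw x) g v = x g v" if "x \<in> Fn" for g v
    using that by (cases "g \<in> carrier G"; simp add: tw_def itw_def Fn_def)+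
  then show "x \<in> Fn \<Longrightarrow> tw (itw x) = x" "x \<in> Fn \<Longrightarrow> itw (tw x) = x"
    by (simp_all add: fun_eq_iff)
qed

lemma twist_closed [simp]:
  "x \<in> SA \<Longrightarrow> tw x \<in> SA" "x \<in> SA \<Longrightarrow> itw x \<in> SA" "u \<in> UA \<Longrightarrow> tw u \<in> UA" "u \<in> UA \<Longrightarrow> itw u \<in> UA"
  by (elim SA_cases, simp add: SA_def Fn_def tw_def itw_def fun_eq_iff)+
     (simp_all add: UA_def tw_def itw_def Fn_def fun_eq_iff linear_fun_iff algebra_simps)

lemma lam_twist [simp]: "lam (tw x) = lam x" "lam (itw x) = lam x"
  by (simp_all add: lam_def tw_def itw_def)

lemma twist_gel: "tw (gel g) = gscale (det (\<rho> g)) (gel g)" "itw (gel g) = gscale (det (\<rho> (inv g))) (gel g)"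
  by (auto simp: tw_def itw_def gel_def fun_eq_iff)

end

section \<open>Determinants of lists of rows\<close>

text \<open>
  \<open>dl vs\<close> is the determinant with rows \<open>vs\<close> (for a list of full length), so \<open>eps\<close> of a word of full
  length is its sign as a permutation of the coordinates, and 0 if a letter is repeated.
\<close>

definition num :: "'n::finite \<Rightarrow> nat" where
  "num = (SOME f. bij_betw f UNIV {..<CARD('n)})"

lemma bij_num: "bij_betw (num :: 'n::finite \<Rightarrow> nat) UNIV {..<CARD('n)}"
  unfolding num_def using someI_ex[OF ex_bij_betw_finite_nat[OF finite_class.finite_UNIV]] by (simp add: lessThan_atLeast0)

lemma num_less [simp]: "num (a :: 'n::finite) < CARD('n)"
  using bij_num by (auto simp: bij_betw_def)

lemma num_inj: "num a = num b \<longleftrightarrow> a = b"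
  using bij_num by (auto simp: bij_betw_def inj_on_def)

lemma num_surj: "k < CARD('n::finite) \<Longrightarrow> \<exists>a::'n. num a = k"
  using bij_num[where 'n='n] unfolding bij_betw_def by (metis imageE lessThan_iff)

definition dl :: "(complex^'n) list \<Rightarrow> complex" where
  "dl vs = det (\<chi> a. vs ! num a)"

definition ax :: "'n \<Rightarrow> complex^'n" where "ax i = axis i 1"

definition eps :: "'n::finite list \<Rightarrow> complex" where
  "eps w = dl (map ax w)"

lemma dl_row:
  fixes us :: "(complex^'n) list"
  assumes "length us < CARD('n)" "num k = length us"
  shows "dl (us @ x # vs) = det (\<chi> a. if a = k then x else (us @ 0 # vs) ! num a)"
proof -
  have "(us @ x # vs) ! num a = (if a = k then x else (us @ 0 # vs) ! num a)" for a :: 'n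
    using assms(2) num_inj[of a k] by (auto simp: nth_append nth_Cons')
  then show ?thesis by (simp add: dl_def)
qed

lemma dl_linear:
  fixes us :: "(complex^'n) list"
  assumes "length us < CARD('n)" "finite A"
  shows "dl (us @ (\<Sum>i\<in>A. c i *s x i) # vs) = (\<Sum>i\<in>A. c i * dl (us @ x i # vs))"
proof -
  obtain k :: 'n where k: "num k = length us" using num_surj assms(1) by blast
  show ?thesis
    by (simp add: dl_row[OF assms(1) k] det_linear_row_sum[OF assms(2)] det_row_mul)
qed

lemma dl_swap:
  fixes us :: "(complex^'n) list"
  assumes "Suc (length us) < CARD('n)"
  shows "dl (us @ x # y # vs) = - dl (us @ y # x # vs)"
proof -
  obtain k l :: 'n where k: "num k = length us" and l: "num l = Suc (length us)"
    using num_surj[where 'n='n] assms by (meson Suc_lessD)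
  have kl: "k \<noteq> l" using k l by auto
  let ?A = "\<chi> a. (us @ y # x # vs) ! num a"
  let ?p = "Transposition.transpose k l"
  have p: "?p permutes UNIV" by (rule permutes_swap_id) auto
  have "(us @ x # y # vs) ! num a = ?A $ ?p a" for a
  proof -
    consider "a = k" | "a = l" | "a \<noteq> k" "a \<noteq> l" by blast
    then show ?thesis
    proof cases
      case 3
      then have "num a \<noteq> length us" "num a \<noteq> Suc (length us)" using k l num_inj by metis+
      then show ?thesis using 3 by (auto simp: nth_append nth_Cons' Transposition.transpose_def)
    qed (auto simp: k l nth_append)
  qed
  then have "dl (us @ x # y # vs) = det (\<chi> a. ?A $ ?p a)" by (simp add: dl_def)
  also have "\<dots> = of_int (sign ?p) * det ?A" by (rule det_permute_rows[OF p])
  also have "\<dots> = - dl (us @ y # x # vs)" using kl by (simp add: sign_swap_id dl_def)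
  finally show ?thesis .
qed

lemma dl_rotate:
  fixes us :: "(complex^'n) list"
  assumes "length us + Suc (length vs) = CARD('n)"
  shows "dl (us @ x # vs) = (-1) ^ length vs * dl (us @ vs @ [x])"
  using assms
proof (induction vs arbitrary: us)
  case (Cons y vs)
  have "dl (us @ x # y # vs) = - dl ((us @ [y]) @ x # vs)"
    using Cons.prems dl_swap[of us x y vs] by simp
  then show ?case using Cons.IH[of "us @ [y]"] Cons.prems by simp
qed simp

lemma eps_rotate:
  assumes "Suc (length w) = CARD('n)"
  shows "eps (i # w) = (-1) ^ length w * eps (w @ [i :: 'n::finite])"
  using dl_rotate[of "[]" "map ax w" "ax i"] assms by (simp add: eps_def)

lemma eps_swap:
  assumes "length w + 2 = CARD('n)"
  shows "eps (w @ [i, j]) = - eps (w @ [j, i :: 'n::finite])"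
  using dl_swap[of "map ax w" "ax i" "ax j" "[]"] assms by (simp add: eps_def)

lemma eps_not_distinct:
  fixes w :: "'n::finite list"
  assumes "length w = CARD('n)" "\<not> distinct w"
  shows "eps w = 0"
proof -
  obtain a b where ab: "a < CARD('n)" "b < CARD('n)" "a \<noteq> b" "w ! a = w ! b"
    using assms by (auto simp: distinct_conv_nth)
  then obtain k l :: 'n where kl: "num k = a" "num l = b" using num_surj by meson
  show ?thesis unfolding eps_def dl_def
    by (rule det_identical_rows[of k l]) (use ab kl assms(1) in \<open>auto simp: Finite_Cartesian_Product.row_def\<close>)
qed

text \<open>The row of a letter j is M e_j, so the matrix is A M^T, where A has the rows e_j and
  determinant \<open>eps w\<close>.\<close>

lemma dl_matrix:
  fixes w :: "'n::finite list"
  assumes "length w = CARD('n)"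
  shows "dl (map (\<lambda>j. \<Sum>i\<in>UNIV. M $ i $ j *s ax i) w) = det M * eps w"
proof -
  have 1: "(\<Sum>i\<in>UNIV. M $ i $ j *s ax i) $ b = M $ b $ j" for b j
    by (simp add: ax_def axis_def if_distrib cong: if_cong)
  have 2: "(\<Sum>c\<in>UNIV. ax k $ c * M $ b $ c) = M $ b $ k" for b k
    by (simp add: ax_def axis_def if_distrib if_distribR cong: if_cong)
  let ?A = "\<chi> a :: 'n. map ax w ! num a"
  have "num a < length w" for a :: 'n using assms by simp
  note nm = nth_map[OF this]
  have "(\<chi> a :: 'n. map (\<lambda>j. \<Sum>i\<in>UNIV. M $ i $ j *s ax i) w ! num a) = ?A ** Finite_Cartesian_Product.transpose M"
    unfolding Finite_Cartesian_Product.vec_eq_iff matrix_matrix_mult_def Finite_Cartesian_Product.transpose_def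
    unfolding vec_lambda_beta nm 1 2 by simp
  then have "dl (map (\<lambda>j. \<Sum>i\<in>UNIV. M $ i $ j *s ax i) w) = det (?A ** Finite_Cartesian_Product.transpose M)"
    unfolding dl_def by (rule arg_cong)
  also have "\<dots> = det ?A * det (Finite_Cartesian_Product.transpose M)" by (rule det_mul)
  also have "det (Finite_Cartesian_Product.transpose M) = det M" by (rule det_transpose)
  finally show ?thesis by (simp only: mult.commute eps_def dl_def)
qed

text \<open>The reference word w0 lists all letters in the order of \<open>num\<close> and has sign
  1. As w has no repetition, some M maps the basis vector of its k-th letter to that of the k-th
  letter of w0, so det M * eps w = 1.\<close>

lemma eps_distinct:
  fixes w :: "'n::finite list"
  assumes "length w = CARD('n)" "distinct w"
  shows "eps w \<noteq> 0"
proof -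
  define w0 where "w0 = map (inv_into UNIV num :: nat \<Rightarrow> 'n) [0..<CARD('n)]"
  have inj: "inj (num :: 'n \<Rightarrow> nat)" using bij_num by (auto simp: bij_betw_def)
  have inv: "num (inv_into UNIV num k :: 'n) = k" if "k < CARD('n)" for k
    using num_surj[OF that] by (metis f_inv_into_f rangeI)
  have "map ax w0 ! num a = ax a" for a
    by (simp add: w0_def inv_f_f[OF inj])
  then have "(\<chi> a. map ax w0 ! num a) = (Finite_Cartesian_Product.mat 1 :: complex^'n^'n)"
    by (auto simp: Finite_Cartesian_Product.vec_eq_iff ax_def axis_def Finite_Cartesian_Product.mat_def)
  then have one: "eps w0 = 1" by (simp add: eps_def dl_def det_I)
  define M :: "complex^'n^'n" where "M = (\<chi> i j. if j = w ! num i then 1 else 0)"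
  have "(\<Sum>i\<in>UNIV. M $ i $ (w ! k) *s ax i) = ax (w0 ! k)" if k: "k < CARD('n)" for k
  proof -
    have "w ! k = w ! num i \<longleftrightarrow> i = inv_into UNIV num k" for i :: 'n
    proof
      assume "w ! k = w ! num i"
      then have "k = num i" using nth_eq_iff_index_eq[OF assms(2)] k assms(1) by simp
      then show "i = inv_into UNIV num k" by (simp add: inv_f_f[OF inj])
    next
      assume "i = inv_into UNIV num k"
      then have "num i = k" using inv[OF k] by simp
      then show "w ! k = w ! num i" by simp
    qed
    then have "M $ i $ (w ! k) = (if i = inv_into UNIV num k then 1 else 0)" for i
      unfolding M_def vec_lambda_beta by simp
    then have "(\<Sum>i\<in>UNIV. M $ i $ (w ! k) *s ax i) = (\<Sum>i\<in>UNIV. if i = inv_into UNIV num k then ax i else 0)"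
      by (intro sum.cong[OF refl]) simp
    then show ?thesis using k by (simp add: w0_def)
  qed
  then have "map (\<lambda>j. \<Sum>i\<in>UNIV. M $ i $ j *s ax i) w = map ax w0"
    using assms(1) by (intro nth_equalityI) (auto simp: w0_def)
  then have "det M * eps w = 1" using dl_matrix[OF assms(1), of M] one by (simp add: eps_def)
  then show ?thesis by auto
qed

section \<open>The tensor algebra of a full corner\<close>

text \<open>
  An algebra of elements \<open>RC\<close> containing the images \<open>n0\<close> and \<open>n1\<close> of the corners of \<open>S\<close> and \<open>U\<close> cut out by
  \<open>e\<close>. The index \<open>r\<close> is a row and column in addition to those of the decomposition of 1: there
  \<open>p\<close> and \<open>q\<close> are 1, so it holds the elements of the corner themselves.
\<close>

locale corner_model = finite_rep G \<rho> for G :: "('g, 'm) monoid_scheme" (structure) and \<rho> :: "'g \<Rightarrow> complex^'n^'n" +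
  fixes sc :: "complex \<Rightarrow> 'r::ab_group_add \<Rightarrow> 'r"
    and om :: "'r \<Rightarrow> 'r \<Rightarrow> 'r" (infixl "\<odot>\<odot>" 70)
    and RC :: "'r set"
    and n0 n1 :: "('g, 'n) gfun \<Rightarrow> 'r"
    and e :: "('g, 'n) gfun" and r :: nat and p q :: "nat \<Rightarrow> ('g, 'n) gfun"
  assumes sc: "vector_space sc"
    and RC: "module.subspace sc RC"
    and om_RC: "\<And>x y. x \<in> RC \<Longrightarrow> y \<in> RC \<Longrightarrow> x \<odot>\<odot> y \<in> RC"
    and om_linear: "\<And>x x' y. (x + x') \<odot>\<odot> y = x \<odot>\<odot> y + x' \<odot>\<odot> y" "\<And>x y y'. x \<odot>\<odot> (y + y') = x \<odot>\<odot> y + x \<odot>\<odot> y'"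
      "\<And>c x y. sc c x \<odot>\<odot> y = sc c (x \<odot>\<odot> y)" "\<And>c x y. x \<odot>\<odot> sc c y = sc c (x \<odot>\<odot> y)"
    and om_assoc: "\<And>x y z. x \<in> RC \<Longrightarrow> y \<in> RC \<Longrightarrow> z \<in> RC \<Longrightarrow> (x \<odot>\<odot> y) \<odot>\<odot> z = x \<odot>\<odot> (y \<odot>\<odot> z)"
    and n_RC: "\<And>s. s \<in> SA \<Longrightarrow> n0 s \<in> RC" "\<And>u. u \<in> UA \<Longrightarrow> n1 u \<in> RC"
    and n_add: "\<And>s t. s \<in> SA \<Longrightarrow> t \<in> SA \<Longrightarrow> n0 (s + t) = n0 s + n0 t" "\<And>s t. s \<in> UA \<Longrightarrow> t \<in> UA \<Longrightarrow> n1 (s + t) = n1 s + n1 t"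
    and n_scale: "\<And>c s. s \<in> SA \<Longrightarrow> n0 (gscale c s) = sc c (n0 s)" "\<And>c u. u \<in> UA \<Longrightarrow> n1 (gscale c u) = sc c (n1 u)"
    and n_cut: "\<And>s. s \<in> SA \<Longrightarrow> n0 (e \<star> s \<star> e) = n0 s" "\<And>u. u \<in> UA \<Longrightarrow> n1 (e \<star> u \<star> e) = n1 u"
    and n_mult: "\<And>s t. s \<in> SA \<Longrightarrow> t \<in> SA \<Longrightarrow> n0 s \<odot>\<odot> n0 t = n0 (s \<star> e \<star> t)"
      "\<And>s u. s \<in> SA \<Longrightarrow> u \<in> UA \<Longrightarrow> n0 s \<odot>\<odot> n1 u = n1 (s \<star> e \<star> u)"
      "\<And>s u. s \<in> SA \<Longrightarrow> u \<in> UA \<Longrightarrow> n1 u \<odot>\<odot> n0 s = n1 (u \<star> e \<star> s)"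
    and e_SA [simp]: "e \<in> SA" and e_idem: "e \<star> e = e" and tw_e: "tw e = e"
    and pq_SA [simp]: "\<And>k. p k \<in> SA" "\<And>k. q k \<in> SA"
    and full: "(\<Sum>k<r. p k \<star> e \<star> q k) = gel \<one>"
    and pq_r: "p r = gel \<one>" "q r = gel \<one>"
begin

sublocale R: vector_space sc by (rule sc)

lemma om_zero [simp]: "0 \<odot>\<odot> x = 0" "x \<odot>\<odot> 0 = 0"
  using om_linear(1)[of 0 0 x] om_linear(2)[of x 0 0] by simp_all

lemma om_sum: "sum f A \<odot>\<odot> y = (\<Sum>a\<in>A. f a \<odot>\<odot> y)" "y \<odot>\<odot> sum f A = (\<Sum>a\<in>A. y \<odot>\<odot> f a)"
  by (induction A rule: infinite_finite_induct) (simp_all add: om_linear)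

lemma n0_sum:
  assumes "finite A" "\<And>a. a \<in> A \<Longrightarrow> f a \<in> SA"
  shows "n0 (\<Sum>a\<in>A. gscale (c a) (f a)) = (\<Sum>a\<in>A. sc (c a) (n0 (f a)))"
  using assms
proof (induction A)
  case empty
  show ?case using n_scale(1)[OF e_SA, of 0] by (simp only: sum.empty gfun.scale_zero_left R.scale_zero_left)
next
  case (insert a A)
  have "(\<Sum>a\<in>A. gscale (c a) (f a)) \<in> SA" "gscale (c a) (f a) \<in> SA" "f a \<in> SA"
    using insert.prems by (auto intro!: gfun.subspace_sum[OF subspace_SA] gfun.subspace_scale[OF subspace_SA])
  then show ?case
    using insert by (simp only: sum.insert n_add n_scale insert_iff simp_thms)
qed

lemma n1_sum:
  assumes "finite A" "\<And>a. a \<in> A \<Longrightarrow> f a \<in> UA"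
  shows "n1 (\<Sum>a\<in>A. gscale (c a) (f a)) = (\<Sum>a\<in>A. sc (c a) (n1 (f a)))"
  using assms
proof (induction A)
  case empty
  show ?case using n_scale(2)[OF Xv_UA, of 0] by (simp only: sum.empty gfun.scale_zero_left R.scale_zero_left)
next
  case (insert a A)
  have "(\<Sum>a\<in>A. gscale (c a) (f a)) \<in> UA" "gscale (c a) (f a) \<in> UA" "f a \<in> UA"
    using insert.prems by (auto intro!: gfun.subspace_sum[OF subspace_UA] gfun.subspace_scale[OF subspace_UA])
  then show ?case
    using insert by (simp only: sum.insert n_add n_scale insert_iff simp_thms)
qed

lemma n_sum1: "finite A \<Longrightarrow> (\<And>a. a \<in> A \<Longrightarrow> f a \<in> SA) \<Longrightarrow> n0 (sum f A) = (\<Sum>a\<in>A. n0 (f a))"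
   "finite A \<Longrightarrow> (\<And>a. a \<in> A \<Longrightarrow> f a \<in> UA) \<Longrightarrow> n1 (sum f A) = (\<Sum>a\<in>A. n1 (f a))"
  using n0_sum[of A f "\<lambda>_. 1"] n1_sum[of A f "\<lambda>_. 1"] by simp_all

lemma full_insert: "x \<in> Fn \<Longrightarrow> (\<Sum>k<r. a \<star> p k \<star> e \<star> (q k \<star> x)) = a \<star> x"
proof -
  assume x: "x \<in> Fn"
  have "(\<Sum>k<r. a \<star> p k \<star> e \<star> (q k \<star> x)) = a \<star> ((\<Sum>k<r. p k \<star> e \<star> q k) \<star> x)"
    by (simp only: sm_sum sm_assoc)
  then show ?thesis using x by (simp only: full sm_one)
qed

lemma n_absorb: "s \<in> SA \<Longrightarrow> n0 (e \<star> s) = n0 s" "s \<in> SA \<Longrightarrow> n0 (s \<star> e) = n0 s"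
   "u \<in> UA \<Longrightarrow> n1 (e \<star> u) = n1 u" "u \<in> UA \<Longrightarrow> n1 (u \<star> e) = n1 u"
proof -
  have "e \<star> (e \<star> s) \<star> e = e \<star> s \<star> e" "e \<star> (s \<star> e) \<star> e = e \<star> s \<star> e" for s
    by (simp_all add: sm_assoc e_idem) (simp_all add: sm_assoc[symmetric] e_idem)
  then show "s \<in> SA \<Longrightarrow> n0 (e \<star> s) = n0 s" "s \<in> SA \<Longrightarrow> n0 (s \<star> e) = n0 s"
   "u \<in> UA \<Longrightarrow> n1 (e \<star> u) = n1 u" "u \<in> UA \<Longrightarrow> n1 (u \<star> e) = n1 u"
    using n_cut(1)[of "e \<star> s"] n_cut(1)[of "s \<star> e"] n_cut(1)[of s] n_cut(2)[of "e \<star> u"] n_cut(2)[of "u \<star> e"] n_cut(2)[of u]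
    by simp_all
qed

text \<open>A product of two corner elements acquires one e in the middle; summed over the
  decomposition of 1 the inserted p_j e q_j disappear.\<close>

lemma insert_00: "a \<in> SA \<Longrightarrow> b \<in> SA \<Longrightarrow> (\<Sum>j<r. n0 (a \<star> p j) \<odot>\<odot> n0 (q j \<star> b)) = n0 (a \<star> b)"
  and insert_01: "a \<in> SA \<Longrightarrow> u \<in> UA \<Longrightarrow> (\<Sum>j<r. n0 (a \<star> p j) \<odot>\<odot> n1 (q j \<star> u)) = n1 (a \<star> u)"
  and insert_10: "u \<in> UA \<Longrightarrow> b \<in> SA \<Longrightarrow> (\<Sum>j<r. n1 (u \<star> p j) \<odot>\<odot> n0 (q j \<star> b)) = n1 (u \<star> b)"
  using n_sum1(1)[of "{..<r}" "\<lambda>j. a \<star> p j \<star> e \<star> (q j \<star> b)"] n_sum1(2)[of "{..<r}" "\<lambda>j. a \<star> p j \<star> e \<star> (q j \<star> u)"]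
    n_sum1(2)[of "{..<r}" "\<lambda>j. u \<star> p j \<star> e \<star> (q j \<star> b)"]
  by (simp_all add: n_mult full_insert SA_Fn UA_Fn)

subsection \<open>Matrices over the tensor algebra\<close>

definition msc :: "complex \<Rightarrow> (nat \<Rightarrow> nat \<Rightarrow> 'r) \<Rightarrow> nat \<Rightarrow> nat \<Rightarrow> 'r" where
  "msc c A = (\<lambda>k l. sc c (A k l))"

text \<open>The inner index runs below r only. Row and column r are thus never summed over: they are
  carried along for reading off elements of the corner.\<close>

definition mm :: "(nat \<Rightarrow> nat \<Rightarrow> 'r) \<Rightarrow> (nat \<Rightarrow> nat \<Rightarrow> 'r) \<Rightarrow> nat \<Rightarrow> nat \<Rightarrow> 'r" (infixl "\<diamondop>" 70) where
  "A \<diamondop> B = (\<lambda>k l. \<Sum>j<r. A k j \<odot>\<odot> B j l)"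

definition RM :: "(nat \<Rightarrow> nat \<Rightarrow> 'r) set" where "RM = {A. \<forall>k l. A k l \<in> RC}"

sublocale M: vector_space msc
  by unfold_locales (auto simp: msc_def fun_eq_iff R.scale_right_distrib R.scale_left_distrib)

lemma sum_entry: "(\<Sum>a\<in>A. f a) k l = (\<Sum>a\<in>A. f a k l :: 'r)"
  by (induction A rule: infinite_finite_induct) auto

lemma msc_entry: "msc c A k l = sc c (A k l)" by (simp add: msc_def)

lemma mm_linear [simp]: "(A + A') \<diamondop> B = A \<diamondop> B + A' \<diamondop> B" "A \<diamondop> (B + B') = A \<diamondop> B + A \<diamondop> B'"
  "msc c A \<diamondop> B = msc c (A \<diamondop> B)" "A \<diamondop> msc c B = msc c (A \<diamondop> B)" "0 \<diamondop> A = 0" "A \<diamondop> 0 = 0"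
  by (auto simp: mm_def msc_def fun_eq_iff om_linear sum.distrib R.scale_sum_right)

lemma mm_sum: "sum f I \<diamondop> B = (\<Sum>a\<in>I. f a \<diamondop> B)" "B \<diamondop> sum f I = (\<Sum>a\<in>I. B \<diamondop> f a)"
  by (induction I rule: infinite_finite_induct) auto

lemma mm_diff: "(A - A') \<diamondop> B = A \<diamondop> B - A' \<diamondop> B" "B \<diamondop> (A - A') = B \<diamondop> A - B \<diamondop> A'"
  using mm_linear(1)[of "A - A'" A' B] mm_linear(2)[of B "A - A'" A'] by (simp_all del: mm_linear)

lemma subspace_RM: "M.subspace RM"
  using RC by (auto simp: RM_def M.subspace_def R.subspace_def msc_entry)

lemma mm_RM [simp]: "A \<in> RM \<Longrightarrow> B \<in> RM \<Longrightarrow> A \<diamondop> B \<in> RM"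
  by (auto simp: RM_def mm_def intro!: R.subspace_sum[OF RC] om_RC)

lemma mm_assoc: "A \<in> RM \<Longrightarrow> B \<in> RM \<Longrightarrow> C \<in> RM \<Longrightarrow> (A \<diamondop> B) \<diamondop> C = A \<diamondop> (B \<diamondop> C)"
proof (intro ext)
  fix k l assume "A \<in> RM" "B \<in> RM" "C \<in> RM"
  then have *: "(A k i \<odot>\<odot> B i j) \<odot>\<odot> C j l = A k i \<odot>\<odot> (B i j \<odot>\<odot> C j l)" for i j
    by (auto simp: RM_def intro: om_assoc)
  show "(A \<diamondop> B \<diamondop> C) k l = (A \<diamondop> (B \<diamondop> C)) k l"
    unfolding mm_def om_sum * by (rule sum.swap)
qed

definition m0 :: "('g, 'n) gfun \<Rightarrow> nat \<Rightarrow> nat \<Rightarrow> 'r" where "m0 s = (\<lambda>k l. n0 (q k \<star> s \<star> p l))"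
definition m1 :: "('g, 'n) gfun \<Rightarrow> nat \<Rightarrow> nat \<Rightarrow> 'r" where "m1 u = (\<lambda>k l. n1 (q k \<star> u \<star> p l))"

lemma m_RM [simp]: "s \<in> SA \<Longrightarrow> m0 s \<in> RM" "u \<in> UA \<Longrightarrow> m1 u \<in> RM"
  by (auto simp: RM_def m0_def m1_def intro: n_RC)

lemma m_mult:
  "s \<in> SA \<Longrightarrow> t \<in> SA \<Longrightarrow> m0 s \<diamondop> m0 t = m0 (s \<star> t)"
  "s \<in> SA \<Longrightarrow> u \<in> UA \<Longrightarrow> m0 s \<diamondop> m1 u = m1 (s \<star> u)"
  "s \<in> SA \<Longrightarrow> u \<in> UA \<Longrightarrow> m1 u \<diamondop> m0 s = m1 (u \<star> s)"
proof -
  show "s \<in> SA \<Longrightarrow> t \<in> SA \<Longrightarrow> m0 s \<diamondop> m0 t = m0 (s \<star> t)"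
    using insert_00[of "q _ \<star> s" "t \<star> p _"] by (simp add: mm_def m0_def sm_assoc fun_eq_iff)
  show "s \<in> SA \<Longrightarrow> u \<in> UA \<Longrightarrow> m0 s \<diamondop> m1 u = m1 (s \<star> u)"
    using insert_01[of "q _ \<star> s" "u \<star> p _"] by (simp add: mm_def m0_def m1_def sm_assoc fun_eq_iff)
  show "s \<in> SA \<Longrightarrow> u \<in> UA \<Longrightarrow> m1 u \<diamondop> m0 s = m1 (u \<star> s)"
    using insert_10[of "q _ \<star> u" "s \<star> p _"] by (simp add: mm_def m0_def m1_def sm_assoc fun_eq_iff)
qed

lemma m0_sum: "finite A \<Longrightarrow> (\<And>a. a \<in> A \<Longrightarrow> f a \<in> SA) \<Longrightarrow> m0 (\<Sum>a\<in>A. gscale (c a) (f a)) = (\<Sum>a\<in>A. msc (c a) (m0 (f a)))"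
  using n0_sum[of A "\<lambda>a. q _ \<star> f a \<star> p _" c] by (simp add: m0_def fun_eq_iff sum_entry msc_entry sm_sum)

lemma m1_sum: "finite A \<Longrightarrow> (\<And>a. a \<in> A \<Longrightarrow> f a \<in> UA) \<Longrightarrow> m1 (\<Sum>a\<in>A. gscale (c a) (f a)) = (\<Sum>a\<in>A. msc (c a) (m1 (f a)))"
  using n1_sum[of A "\<lambda>a. q _ \<star> f a \<star> p _" c] by (simp add: m1_def fun_eq_iff sum_entry msc_entry sm_sum)

lemma m0_decomp: "s \<in> SA \<Longrightarrow> m0 s = (\<Sum>g\<in>carrier G. msc (s g 0) (m0 (gel g)))"
  using m0_sum[OF fin, of gel "\<lambda>g. s g 0"] SA_decomp[of s] by simp

lemma m1_decomp: "u \<in> UA \<Longrightarrow> m1 u = (\<Sum>g\<in>carrier G. \<Sum>i\<in>UNIV. msc (u g (axis i 1)) (m1 (Xv i) \<diamondop> m0 (gel g)))"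
proof -
  assume u: "u \<in> UA"
  have "m1 u = m1 (\<Sum>x\<in>carrier G \<times> UNIV. gscale (u (fst x) (axis (snd x) 1)) (Xv (snd x) \<star> gel (fst x)))"
    using UA_decomp[OF u] by (simp add: sum.cartesian_product case_prod_unfold)
  also have "\<dots> = (\<Sum>x\<in>carrier G \<times> UNIV. msc (u (fst x) (axis (snd x) 1)) (m1 (Xv (snd x) \<star> gel (fst x))))"
    by (rule m1_sum) (use fin in auto)
  also have "\<dots> = (\<Sum>x\<in>carrier G \<times> UNIV. msc (u (fst x) (axis (snd x) 1)) (m1 (Xv (snd x)) \<diamondop> m0 (gel (fst x))))"
    by (rule sum.cong) (auto simp: m_mult)
  finally show ?thesis by (simp add: sum.cartesian_product case_prod_unfold)
qed

text \<open>The image of 1 is the matrix with entries e q_k p_l e, an idempotent that need not be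
  the identity matrix; these are the matrices on which it acts as a unit.\<close>

definition unital :: "(nat \<Rightarrow> nat \<Rightarrow> 'r) set" where
  "unital = {A \<in> RM. m0 (gel \<one>) \<diamondop> A = A \<and> A \<diamondop> m0 (gel \<one>) = A}"

lemma subspace_unital: "M.subspace unital"
  using subspace_RM by (auto simp: unital_def M.subspace_def)

lemma m_unital [simp]: "s \<in> SA \<Longrightarrow> m0 s \<in> unital" "u \<in> UA \<Longrightarrow> m1 u \<in> unital"
  by (simp_all add: unital_def m_mult SA_Fn UA_Fn)

lemma unital_RM: "A \<in> unital \<Longrightarrow> A \<in> RM" by (simp add: unital_def)

lemma mm_unital [simp]: "A \<in> unital \<Longrightarrow> B \<in> unital \<Longrightarrow> A \<diamondop> B \<in> unital"
proof -
  assume A: "A \<in> unital" and B: "B \<in> unital"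
  have "m0 (gel \<one>) \<diamondop> (A \<diamondop> B) = (m0 (gel \<one>) \<diamondop> A) \<diamondop> B" "(A \<diamondop> B) \<diamondop> m0 (gel \<one>) = A \<diamondop> (B \<diamondop> m0 (gel \<one>))"
    using A B by (simp_all add: unital_RM mm_assoc)
  then show ?thesis using A B by (simp add: unital_def)
qed

text \<open>For unital A, row r is the sum of the n0 (p j) times row j, because q r = 1. Multiplying
  by \<open>n0 s\<close> turns p_j into s e p_j, which is entry (r, j) of the matrix of s e.\<close>

lemma n0_mult_entry: "s \<in> SA \<Longrightarrow> A \<in> unital \<Longrightarrow> n0 s \<odot>\<odot> A r l = (m0 (s \<star> e) \<diamondop> A) r l"
  and n1_mult_entry: "u \<in> UA \<Longrightarrow> A \<in> unital \<Longrightarrow> n1 u \<odot>\<odot> A r l = (m1 (u \<star> e) \<diamondop> A) r l"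
  and entry_mult_n0: "s \<in> SA \<Longrightarrow> A \<in> unital \<Longrightarrow> A l r \<odot>\<odot> n0 s = (A \<diamondop> m0 (e \<star> s)) l r"
proof -
  assume A: "A \<in> unital"
  have A1: "A r l = (\<Sum>j<r. n0 (p j) \<odot>\<odot> A j l)" "A l r = (\<Sum>j<r. A l j \<odot>\<odot> n0 (q j))"
  proof -
    have "A r l = (m0 (gel \<one>) \<diamondop> A) r l" "A l r = (A \<diamondop> m0 (gel \<one>)) l r" using A by (simp_all add: unital_def)
    then show "A r l = (\<Sum>j<r. n0 (p j) \<odot>\<odot> A j l)" "A l r = (\<Sum>j<r. A l j \<odot>\<odot> n0 (q j))"
      by (simp_all add: mm_def m0_def pq_r SA_Fn)
  qed
  have AR: "A k j \<in> RC" for k j using A by (auto simp: unital_def RM_def)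
  show "s \<in> SA \<Longrightarrow> n0 s \<odot>\<odot> A r l = (m0 (s \<star> e) \<diamondop> A) r l"
    unfolding A1 om_sum mm_def
    by (rule sum.cong[OF refl]) (simp add: om_assoc[symmetric] n_RC AR n_mult m0_def pq_r SA_Fn)
  show "u \<in> UA \<Longrightarrow> n1 u \<odot>\<odot> A r l = (m1 (u \<star> e) \<diamondop> A) r l"
    unfolding A1 om_sum mm_def
    by (rule sum.cong[OF refl]) (simp add: om_assoc[symmetric] n_RC AR n_mult m1_def pq_r SA_Fn UA_Fn)
  show "s \<in> SA \<Longrightarrow> A l r \<odot>\<odot> n0 s = (A \<diamondop> m0 (e \<star> s)) l r"
    unfolding A1 om_sum mm_def
    by (rule sum.cong[OF refl]) (simp add: om_assoc n_RC AR n_mult m0_def pq_r SA_Fn sm_assoc)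
qed

lemma absorb_entry: "s \<in> SA \<Longrightarrow> (m0 (e \<star> s) \<diamondop> A) r l = (m0 s \<diamondop> A) r l"
  "s \<in> SA \<Longrightarrow> (A \<diamondop> m0 (s \<star> e)) l r = (A \<diamondop> m0 s) l r"
  using n_absorb(1)[of "s \<star> p _"] n_absorb(2)[of "q _ \<star> s"] by (simp_all add: mm_def m0_def pq_r SA_Fn sm_assoc)

text \<open>Every entry of A is an (r, r) entry of a two-sided multiple of A, so statements about
  all entries reduce to that one.\<close>

lemma entry_shift:
  assumes A: "A \<in> unital"
  shows "A k l = (m0 (q k) \<diamondop> A \<diamondop> m0 (p l)) r r"
proof -
  have L: "(m0 (q k) \<diamondop> B) r j = (m0 (gel \<one>) \<diamondop> B) k j" for B j
    by (simp add: mm_def m0_def pq_r SA_Fn)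
  have R: "(B \<diamondop> m0 (p l)) j r = (B \<diamondop> m0 (gel \<one>)) j l" for B j
    by (simp add: mm_def m0_def pq_r SA_Fn)
  have "(m0 (q k) \<diamondop> A \<diamondop> m0 (p l)) r r = (m0 (q k) \<diamondop> A \<diamondop> m0 (gel \<one>)) r l" by (rule R)
  also have "\<dots> = (m0 (q k) \<diamondop> A) r l" using A by (simp add: mm_assoc unital_RM) (simp add: unital_def)
  also have "\<dots> = (m0 (gel \<one>) \<diamondop> A) k l" by (rule L)
  finally show ?thesis using A by (simp add: unital_def)
qed

subsection \<open>Words\<close>

text \<open>\<open>TS l a\<close> is the sum of a(x) x_1 ... x_l over all words x of length l, as a
  matrix over the corner.\<close>

primrec TS :: "nat \<Rightarrow> ('n list \<Rightarrow> complex) \<Rightarrow> nat \<Rightarrow> nat \<Rightarrow> 'r" where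
  "TS 0 a = msc (a []) (m0 (gel \<one>))"
| "TS (Suc l) a = (\<Sum>j\<in>UNIV. m1 (Xv j) \<diamondop> TS l (\<lambda>w. a (j # w)))"

text \<open>The coefficient at a word after h has been moved from the left of all letters to their
  right.\<close>

primrec tr :: "'g \<Rightarrow> 'n list \<Rightarrow> ('n list \<Rightarrow> complex) \<Rightarrow> complex" where
  "tr h [] a = a []"
| "tr h (j # w) a = (\<Sum>i\<in>UNIV. \<rho> (inv h) $ i $ j * tr h w (\<lambda>w. a (i # w)))"

lemma TS_unital [simp]: "TS l a \<in> unital"
proof (induction l arbitrary: a)
  case 0
  show ?case unfolding TS.simps by (rule M.subspace_scale[OF subspace_unital]) simp
next
  case (Suc l)
  show ?case unfolding TS.simps by (rule M.subspace_sum[OF subspace_unital]) (simp add: Suc)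
qed

lemma TS_RM [simp]: "TS l a \<in> RM" by (rule unital_RM[OF TS_unital])

lemma TS_scale: "TS l (\<lambda>w. c * a w) = msc c (TS l a)"
proof (induction l arbitrary: a)
  case 0
  show ?case by (simp only: TS.simps M.scale_scale)
next
  case (Suc l)
  have "TS l (\<lambda>w. c * a (j # w)) = msc c (TS l (\<lambda>w. a (j # w)))" for j by (rule Suc)
  then show ?case by (simp only: TS.simps mm_linear M.scale_sum_right)
qed

lemma TS_sum: "TS l (\<lambda>w. \<Sum>i\<in>A. f i w) = (\<Sum>i\<in>A. TS l (f i))"
proof (induction l arbitrary: f)
  case 0
  show ?case by (simp only: TS.simps M.scale_sum_left)
next
  case (Suc l)
  have "TS l (\<lambda>w. \<Sum>i\<in>A. f i (j # w)) = (\<Sum>i\<in>A. TS l (\<lambda>w. f i (j # w)))" for j by (rule Suc)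
  then show ?case by (simp only: TS.simps mm_sum) (rule sum.swap)
qed

lemma TS_cong:
  assumes "\<And>w. length w = l \<Longrightarrow> a w = b w"
  shows "TS l a = TS l b"
  using assms
proof (induction l arbitrary: a b)
  case 0
  then show ?case by simp
next
  case (Suc l)
  have "TS l (\<lambda>w. a (j # w)) = TS l (\<lambda>w. b (j # w))" for j
    by (rule Suc.IH) (simp add: Suc.prems)
  then show ?case by (simp only: TS.simps)
qed

text \<open>The definition splits off the first letter; contraction from the right needs the last
  one.\<close>

lemma TS_snoc: "TS (Suc l) a = (\<Sum>i\<in>UNIV. TS l (\<lambda>w. a (w @ [i])) \<diamondop> m1 (Xv i))"
proof (induction l arbitrary: a)
  case 0
  show ?case by (simp only: TS.simps mm_linear m_mult gel_SA one_closed Xv_UA append.simps sm_one UA_Fn)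
next
  case (Suc l)
  have "TS (Suc l) (\<lambda>w. a (j # w)) = (\<Sum>i\<in>UNIV. TS l (\<lambda>w. a (j # w @ [i])) \<diamondop> m1 (Xv i))" for j
    unfolding Suc append_Cons ..
  then have "TS (Suc (Suc l)) a = (\<Sum>j\<in>UNIV. m1 (Xv j) \<diamondop> (\<Sum>i\<in>UNIV. TS l (\<lambda>w. a (j # w @ [i])) \<diamondop> m1 (Xv i)))"
    by (simp only: TS.simps(2)[of "Suc l"])
  also have "\<dots> = (\<Sum>i\<in>UNIV. \<Sum>j\<in>UNIV. m1 (Xv j) \<diamondop> (TS l (\<lambda>w. a (j # w @ [i])) \<diamondop> m1 (Xv i)))"
    by (simp only: mm_sum) (rule sum.swap)
  also have "\<dots> = (\<Sum>i\<in>UNIV. TS (Suc l) (\<lambda>w. a (w @ [i])) \<diamondop> m1 (Xv i))"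
    by (simp only: TS.simps mm_sum mm_assoc TS_RM m_RM Xv_UA append_Cons)
  finally show ?case .
qed

lemma gel_TS:
  assumes h: "h \<in> carrier G"
  shows "m0 (gel h) \<diamondop> TS l a = TS l (\<lambda>w. tr h w a) \<diamondop> m0 (gel h)"
proof (induction l arbitrary: a)
  case 0
  show ?case using h by (simp only: TS.simps tr.simps mm_linear m_mult gel_SA one_closed sm_one SA_Fn)
next
  case (Suc l)
  have X: "m0 (gel h) \<diamondop> m1 (Xv i) = (\<Sum>j\<in>UNIV. msc (\<rho> (inv h) $ i $ j) (m1 (Xv j) \<diamondop> m0 (gel h)))" for i
  proof -
    have "m0 (gel h) \<diamondop> m1 (Xv i) = m1 (\<Sum>j\<in>UNIV. gscale (\<rho> (inv h) $ i $ j) (Xv j \<star> gel h))"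
      using h by (simp only: m_mult gel_SA Xv_UA gel_Xv)
    also have "\<dots> = (\<Sum>j\<in>UNIV. msc (\<rho> (inv h) $ i $ j) (m1 (Xv j \<star> gel h)))"
      by (rule m1_sum) (use h in auto)
    finally show ?thesis using h by (simp only: m_mult gel_SA Xv_UA)
  qed
  note R = TS_RM m_RM Xv_UA gel_SA[OF h]
  have "m0 (gel h) \<diamondop> TS (Suc l) a = (\<Sum>i\<in>UNIV. (m0 (gel h) \<diamondop> m1 (Xv i)) \<diamondop> TS l (\<lambda>w. a (i # w)))"
    by (simp only: TS.simps mm_sum mm_assoc R)
  also have "\<dots> = (\<Sum>i\<in>UNIV. \<Sum>j\<in>UNIV. msc (\<rho> (inv h) $ i $ j) (m1 (Xv j) \<diamondop> (m0 (gel h) \<diamondop> TS l (\<lambda>w. a (i # w)))))"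
    by (simp only: X mm_sum mm_linear mm_assoc R)
  also have "\<dots> = (\<Sum>j\<in>UNIV. \<Sum>i\<in>UNIV. msc (\<rho> (inv h) $ i $ j) (m1 (Xv j) \<diamondop> (TS l (\<lambda>w. tr h w (\<lambda>w. a (i # w))) \<diamondop> m0 (gel h))))"
    unfolding Suc by (rule sum.swap)
  also have "\<dots> = TS (Suc l) (\<lambda>w. tr h w a) \<diamondop> m0 (gel h)"
    by (simp only: TS.simps tr.simps TS_sum TS_scale mm_sum mm_linear mm_assoc R)
  finally show ?case .
qed

text \<open>Multilinearity, one row at a time; \<open>us\<close> collects the rows that have already
  been expanded in basis vectors.\<close>

lemma eps_tr_aux:
  fixes us :: "(complex^'n) list"
  shows "length us + length w = CARD('n) \<Longrightarrow>
   tr h w (\<lambda>w'. dl (us @ map ax w')) = dl (us @ map (\<lambda>j. \<Sum>i\<in>UNIV. \<rho> (inv h) $ i $ j *s ax i) w)"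
proof (induction w arbitrary: us)
  case (Cons j w)
  have "tr h w (\<lambda>w'. dl (us @ ax i # map ax w')) = dl (us @ ax i # map (\<lambda>j. \<Sum>i\<in>UNIV. \<rho> (inv h) $ i $ j *s ax i) w)" for i
    using Cons.IH[of "us @ [ax i]"] Cons.prems by simp
  then show ?case using Cons.prems by (simp add: dl_linear)
qed simp

lemma eps_tr: "length w = CARD('n) \<Longrightarrow> tr h w eps = det (\<rho> (inv h)) * eps w"
  using eps_tr_aux[of "[]" w h] dl_matrix[of w "\<rho> (inv h)"] by (simp add: eps_def[abs_def])

abbreviation "Om \<equiv> TS CARD('n) eps"

text \<open>For a group element this is the semi-invariance of the determinant, g Om = det(g^-1) Om
  g; the factor is absorbed by \<open>tw\<close>.\<close>

lemma Om_comm: "s \<in> SA \<Longrightarrow> Om \<diamondop> m0 s = m0 (tw s) \<diamondop> Om"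
proof -
  assume s: "s \<in> SA"
  have g: "m0 (gel g) \<diamondop> Om = msc (det (\<rho> (inv g))) (Om \<diamondop> m0 (gel g))" if "g \<in> carrier G" for g
  proof -
    have "TS CARD('n) (\<lambda>w. tr g w eps) = TS CARD('n) (\<lambda>w. det (\<rho> (inv g)) * eps w)" by (rule TS_cong) (simp add: eps_tr)
    then show ?thesis using that by (simp add: gel_TS TS_scale)
  qed
  have "m0 (tw s) \<diamondop> Om = (\<Sum>g\<in>carrier G. msc (det (\<rho> g) * s g 0) (m0 (gel g) \<diamondop> Om))"
    by (simp only: m0_decomp[OF twist_closed(1)[OF s]] mm_sum mm_linear) (simp only: tw_def)
  also have "\<dots> = (\<Sum>g\<in>carrier G. msc (s g 0) (Om \<diamondop> m0 (gel g)))"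
    by (rule sum.cong) (auto simp: g mult.assoc[symmetric] mult.commute[of _ "s _ _"] det_inv)
  also have "\<dots> = Om \<diamondop> m0 s"
    by (simp only: m0_decomp[OF s] mm_sum mm_linear)
  finally show ?thesis by simp
qed

lemma itw_e: "itw e = e"
  using twist_inverse(2)[of e] tw_e by (simp add: SA_Fn)

end

section \<open>Pairings of functionals on U with values in S\<close>

context finite_rep
begin

text \<open>The elements [f u] and [u f] of S for the trace \<open>lam\<close>: since
  \<open>lam\<close> reads the coefficient of the identity, the coefficient at h is found by
  multiplying with h^-1 before applying f.\<close>

definition Lam :: "(('g, 'n) gfun \<Rightarrow> complex) \<Rightarrow> ('g, 'n) gfun \<Rightarrow> ('g, 'n) gfun" where
  "Lam f u = (\<lambda>h v. if h \<in> carrier G then f (u \<star> gel (inv h)) else 0)"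

definition Lamr :: "(('g, 'n) gfun \<Rightarrow> complex) \<Rightarrow> ('g, 'n) gfun \<Rightarrow> ('g, 'n) gfun" where
  "Lamr f u = (\<lambda>h v. if h \<in> carrier G then f (gel (inv h) \<star> u) else 0)"

lemma Lam_SA [simp]: "Lam f u \<in> SA" "Lamr f u \<in> SA"
  by (auto simp: SA_def Fn_def Lam_def Lamr_def fun_eq_iff)

definition lin_on_UA :: "(('g, 'n) gfun \<Rightarrow> complex) \<Rightarrow> bool" where
  "lin_on_UA f \<longleftrightarrow> (\<forall>u\<in>UA. \<forall>v\<in>UA. f (u + v) = f u + f v) \<and> (\<forall>c. \<forall>u\<in>UA. f (gscale c u) = c * f u)"

lemma lin_on_UA_sum:
  assumes "lin_on_UA f" "\<And>a. a \<in> A \<Longrightarrow> u a \<in> UA" "finite A"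
  shows "f (\<Sum>a\<in>A. gscale (c a) (u a)) = (\<Sum>a\<in>A. c a * f (u a))"
  using assms(3,2)
proof (induction A)
  case empty
  have "f (gscale 0 0) = 0 * f 0"
    using assms(1) gfun.subspace_0[OF subspace_UA] unfolding lin_on_UA_def by blast
  then show ?case by (simp only: sum.empty gfun.scale_zero_left mult_zero_left)
next
  case (insert a A)
  have "gscale (c a) (u a) \<in> UA" "(\<Sum>a\<in>A. gscale (c a) (u a)) \<in> UA" "u a \<in> UA"
    using insert.prems by (auto intro!: gfun.subspace_sum[OF subspace_UA] gfun.subspace_scale[OF subspace_UA])
  then have 1: "f (gscale (c a) (u a) + (\<Sum>a\<in>A. gscale (c a) (u a))) = c a * f (u a) + f (\<Sum>a\<in>A. gscale (c a) (u a))"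
    using assms(1) unfolding lin_on_UA_def by simp
  have 2: "f (\<Sum>a\<in>A. gscale (c a) (u a)) = (\<Sum>a\<in>A. c a * f (u a))"
    by (rule insert.IH) (rule insert.prems, rule insertI2)
  show ?case unfolding sum.insert[OF insert.hyps(1,2)] 1 2 ..
qed

lemma SA_induct_sum: "s \<in> SA \<Longrightarrow> x \<star> s = (\<Sum>g\<in>carrier G. gscale (s g 0) (x \<star> gel g))"
  "s \<in> SA \<Longrightarrow> s \<star> x = (\<Sum>g\<in>carrier G. gscale (s g 0) (gel g \<star> x))"
proof -
  assume s: "s \<in> SA"
  have "x \<star> s = x \<star> (\<Sum>g\<in>carrier G. gscale (s g 0) (gel g))" "s \<star> x = (\<Sum>g\<in>carrier G. gscale (s g 0) (gel g)) \<star> x"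
    using SA_decomp[OF s] by simp_all
  then show "x \<star> s = (\<Sum>g\<in>carrier G. gscale (s g 0) (x \<star> gel g))" "s \<star> x = (\<Sum>g\<in>carrier G. gscale (s g 0) (gel g \<star> x))"
    by (simp_all only: sm_sum sm_linear)
qed

lemma Lam_mult:
  assumes f: "lin_on_UA f" and u: "u \<in> UA" and s: "s \<in> SA"
  shows "Lam f (u \<star> s) = Lam f u \<star> s" "Lamr f (s \<star> u) = s \<star> Lamr f u"
proof -
  have "Lam f (u \<star> s) h v = (Lam f u \<star> s) h v" "Lamr f (s \<star> u) h v = (s \<star> Lamr f u) h v" if h: "h \<in> carrier G" for h v
  proof -
    have "u \<star> s \<star> gel (inv h) = (\<Sum>g\<in>carrier G. gscale (s g 0) (u \<star> gel (g \<otimes> inv h)))"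
    proof -
      have "u \<star> s \<star> gel (inv h) = (\<Sum>g\<in>carrier G. gscale (s g 0) (u \<star> gel g \<star> gel (inv h)))"
        by (simp only: SA_induct_sum(1)[OF s, of u] sm_sum sm_linear)
      also have "\<dots> = (\<Sum>g\<in>carrier G. gscale (s g 0) (u \<star> gel (g \<otimes> inv h)))"
        using h by (intro sum.cong refl) (simp add: sm_assoc gel_mult)
      finally show ?thesis .
    qed
    then have "Lam f (u \<star> s) h v = (\<Sum>g\<in>carrier G. s g 0 * f (u \<star> gel (g \<otimes> inv h)))"
      using h u fin by (simp add: Lam_def lin_on_UA_sum[OF f])
    also have "\<dots> = (\<Sum>g\<in>carrier G. s g 0 * (Lam f u \<star> gel g) h v)"
      by (intro sum.cong refl) (use h in \<open>simp add: sm_gel Lam_def inv_mult_group\<close>)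
    also have "\<dots> = (Lam f u \<star> s) h v"
      by (subst SA_induct_sum(1)[OF s]) (simp add: sum_apply2)
    finally show "Lam f (u \<star> s) h v = (Lam f u \<star> s) h v" .
    have "gel (inv h) \<star> (s \<star> u) = (\<Sum>g\<in>carrier G. gscale (s g 0) (gel (inv h \<otimes> g) \<star> u))"
    proof -
      have "gel (inv h) \<star> (s \<star> u) = (\<Sum>g\<in>carrier G. gscale (s g 0) (gel (inv h) \<star> (gel g \<star> u)))"
        by (simp only: SA_induct_sum(2)[OF s, of u] sm_sum sm_linear)
      also have "\<dots> = (\<Sum>g\<in>carrier G. gscale (s g 0) (gel (inv h \<otimes> g) \<star> u))"
        using h by (intro sum.cong refl) (simp add: sm_assoc[symmetric] gel_mult)
      finally show ?thesis .
    qed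
    then have "Lamr f (s \<star> u) h v = (\<Sum>g\<in>carrier G. s g 0 * f (gel (inv h \<otimes> g) \<star> u))"
      using h u fin by (simp add: Lamr_def lin_on_UA_sum[OF f])
    also have "\<dots> = (\<Sum>g\<in>carrier G. s g 0 * (gel g \<star> Lamr f u) h v)"
      by (intro sum.cong refl) (use h in \<open>simp add: gel_sm Lamr_def inv_mult_group\<close>)
    also have "\<dots> = (s \<star> Lamr f u) h v"
      by (subst SA_induct_sum(2)[OF s]) (simp add: sum_apply2)
    finally show "Lamr f (s \<star> u) h v = (s \<star> Lamr f u) h v" .
  qed
  moreover have "Lam f (u \<star> s) h v = (Lam f u \<star> s) h v" "Lamr f (s \<star> u) h v = (s \<star> Lamr f u) h v" if "h \<notin> carrier G" for h v
    using that by (simp_all add: Lam_def Lamr_def sm_def)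
  ultimately show "Lam f (u \<star> s) = Lam f u \<star> s" "Lamr f (s \<star> u) = s \<star> Lamr f u"
    by (intro ext; blast)+
qed

lemma gel_one_right [simp]: "u \<in> UA \<Longrightarrow> u \<star> gel \<one> = u" "u \<in> UA \<Longrightarrow> gel \<one> \<star> u = u"
  by (simp_all add: UA_Fn)

lemma lam_Lam:
  assumes "lin_on_UA f" "u \<in> UA" "s \<in> SA"
  shows "lam (Lam f u \<star> s) = f (u \<star> s)" "lam (s \<star> Lamr f u) = f (s \<star> u)"
  unfolding Lam_mult[OF assms, symmetric] using assms by (simp_all add: lam_def Lam_def Lamr_def)

lemma lam_represent:
  assumes add: "\<And>x y. x \<in> SA \<Longrightarrow> y \<in> SA \<Longrightarrow> F (x + y) = F x + F y"
    and sc: "\<And>c x. x \<in> SA \<Longrightarrow> F (gscale c x) = c * F x"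
  shows "\<exists>y\<in>SA. \<forall>x\<in>SA. lam (y \<star> x) = F x"
proof -
  \<comment> \<open>Under \<open>lam\<close> the basis element h is dual to h^-1.\<close>
  define y :: "('g, 'n) gfun" where "y = (\<lambda>h v. if h \<in> carrier G then F (gel (inv h)) else 0)"
  have y: "y \<in> SA" by (auto simp: SA_def Fn_def y_def fun_eq_iff)
  have F: "F (\<Sum>g\<in>A. gscale (c g) (gel g)) = (\<Sum>g\<in>A. c g * F (gel g))" if "finite A" "A \<subseteq> carrier G" for A c
    using that
  proof (induction A)
    case empty
    have "F (gscale 0 0) = 0 * F 0" by (rule sc) (rule gfun.subspace_0[OF subspace_SA])
    then show ?case by (simp only: gfun.scale_zero_left mult_zero_left sum.empty)
  next
    case (insert g A)
    have "gscale (c g) (gel g) \<in> SA" "(\<Sum>g\<in>A. gscale (c g) (gel g)) \<in> SA" "gel g \<in> (SA :: ('g, 'n) gfun set)"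
      using insert.prems by (auto intro!: gfun.subspace_sum[OF subspace_SA] gfun.subspace_scale[OF subspace_SA])
    then have "F (gscale (c g) (gel g) + (\<Sum>g\<in>A. gscale (c g) (gel g))) = c g * F (gel g) + F (\<Sum>g\<in>A. gscale (c g) (gel g))"
      by (simp only: add sc)
    then show ?case using insert by (simp only: sum.insert insert_subset simp_thms)
  qed
  have "lam (y \<star> x) = F x" if x: "x \<in> SA" for x
  proof -
    have "lam (y \<star> x) = (\<Sum>g\<in>carrier G. x g 0 * lam (y \<star> gel g))"
      by (simp only: SA_induct_sum(1)[OF x] lam_sum lam_linear)
    also have "\<dots> = (\<Sum>g\<in>carrier G. x g 0 * F (gel g))"
    proof (rule sum.cong[OF refl])
      fix g assume g: "g \<in> carrier G"
      then have "lam (y \<star> gel g) = y (inv g) 0" using lam_gel[OF y, of "inv g"] by simp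
      then show "x g 0 * lam (y \<star> gel g) = x g 0 * F (gel g)" using g by (simp add: y_def)
    qed
    also have "\<dots> = F (\<Sum>g\<in>carrier G. gscale (x g 0) (gel g))" by (rule F[OF fin subset_refl, symmetric])
    finally show ?thesis by (simp only: SA_decomp[OF x, symmetric])
  qed
  then show ?thesis using y by blast
qed

text \<open>Coordinates of U over S: a linear functional is evaluated at the i-th basis vector, so u
  is the sum of the x_i co_i(u).\<close>

definition co :: "'n \<Rightarrow> ('g, 'n) gfun \<Rightarrow> ('g, 'n) gfun" where
  "co i u = (\<lambda>h v. if h \<in> carrier G then u h (axis i 1) else 0)"

lemma co_SA [simp]: "co i u \<in> SA"
  by (auto simp: SA_def Fn_def co_def fun_eq_iff)

lemma co_linear: "co i (u + v) = co i u + co i v" "co i (gscale c u) = gscale c (co i u)"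
  by (auto simp: co_def fun_eq_iff)

lemma co_Xv: "s \<in> SA \<Longrightarrow> co i (Xv j \<star> s) = (if i = j then s else 0)"
  by (elim SA_cases) (auto simp: co_def Xv_sm fun_eq_iff axis_def)

lemma itw_Xv_gel: "h \<in> carrier G \<Longrightarrow> itw (Xv i \<star> gel (inv h)) = gscale (det (\<rho> h)) (Xv i \<star> gel (inv h))"
proof -
  assume h: "h \<in> carrier G"
  have "itw (Xv i) = Xv i" by (auto simp: itw_def Xv_def fun_eq_iff)
  then show ?thesis using h by (simp add: twist_mult twist_gel)
qed

end

section \<open>The potential\<close>

text \<open>D stands for the functionals on the bimodule and \<open>hat\<close> for their extension
  to U along u |-> e u e. The contractions enter through linearity and their effect on a first or
  last letter, where they differ from \<open>Lam\<close> and \<open>Lamr\<close> by the weight w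
  between the two traces.\<close>

locale corner_pot = corner_model G \<rho> sc om RC n0 n1 e r p q
  for G :: "('g, 'm) monoid_scheme" (structure) and \<rho> :: "'g \<Rightarrow> complex^'n^'n"
    and sc :: "complex \<Rightarrow> 'r::ab_group_add \<Rightarrow> 'r" and om RC n0 n1 e r p q +
  fixes w w' :: "('g, 'n) gfun"
    and D :: "'f set" and hat :: "'f \<Rightarrow> ('g, 'n) gfun \<Rightarrow> complex"
    and lcF rcF :: "'f \<Rightarrow> 'r \<Rightarrow> 'r"
  assumes w_SA [simp]: "w \<in> SA" "w' \<in> SA" and ww': "w \<star> w' = gel \<one>" "w' \<star> w = gel \<one>"
    and w_central: "\<And>s. s \<in> SA \<Longrightarrow> w \<star> s = s \<star> w" and tw_w: "tw w = w"
    and hat_lin: "\<And>\<phi>. \<phi> \<in> D \<Longrightarrow> lin_on_UA (hat \<phi>)"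
    and hat_surj: "\<And>\<psi>. lin_on_UA \<psi> \<Longrightarrow> \<exists>\<phi>\<in>D. \<forall>u\<in>UA. hat \<phi> u = \<psi> (e \<star> u \<star> e)"
    and lc_linear: "\<And>\<phi> x y. \<phi> \<in> D \<Longrightarrow> lcF \<phi> (x + y) = lcF \<phi> x + lcF \<phi> y" "\<And>\<phi> c x. \<phi> \<in> D \<Longrightarrow> lcF \<phi> (sc c x) = sc c (lcF \<phi> x)"
    and rc_linear: "\<And>\<phi> x y. \<phi> \<in> D \<Longrightarrow> rcF \<phi> (x + y) = rcF \<phi> x + rcF \<phi> y" "\<And>\<phi> c x. \<phi> \<in> D \<Longrightarrow> rcF \<phi> (sc c x) = sc c (rcF \<phi> x)"
    and lc_om: "\<And>\<phi> u t. \<phi> \<in> D \<Longrightarrow> u \<in> UA \<Longrightarrow> t \<in> RC \<Longrightarrow> lcF \<phi> (om (n1 u) t) = om (n0 (w \<star> Lam (hat \<phi>) u)) t"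
    and rc_om: "\<And>\<phi> u t. \<phi> \<in> D \<Longrightarrow> u \<in> UA \<Longrightarrow> t \<in> RC \<Longrightarrow> rcF \<phi> (om t (n1 u)) = om t (n0 (Lamr (hat \<phi>) u \<star> w))"
begin

lemma w'_central: "s \<in> SA \<Longrightarrow> w' \<star> s = s \<star> w'"
proof -
  assume s: "s \<in> SA"
  have "w' \<star> s = w' \<star> (s \<star> w) \<star> w'" using s by (simp add: sm_assoc ww' SA_Fn)
  also have "\<dots> = (w' \<star> w) \<star> s \<star> w'" using w_central[OF s] by (simp add: sm_assoc)
  finally show ?thesis using s by (simp add: ww' SA_Fn)
qed

lemma e_w': "e \<star> w' = w' \<star> e"
  by (rule w'_central[OF e_SA, symmetric])

lemma lcF_sum: "\<phi> \<in> D \<Longrightarrow> lcF \<phi> (sum f A) = (\<Sum>a\<in>A. lcF \<phi> (f a))"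
  and rcF_sum: "\<phi> \<in> D \<Longrightarrow> rcF \<phi> (sum f A) = (\<Sum>a\<in>A. rcF \<phi> (f a))"
proof -
  assume p: "\<phi> \<in> D"
  have "lcF \<phi> 0 = 0" "rcF \<phi> 0 = 0" using lc_linear(2)[OF p, of 0 0] rc_linear(2)[OF p, of 0 0] by simp_all
  then show "lcF \<phi> (sum f A) = (\<Sum>a\<in>A. lcF \<phi> (f a))" "rcF \<phi> (sum f A) = (\<Sum>a\<in>A. rcF \<phi> (f a))"
    by (induction A rule: infinite_finite_induct) (simp_all add: p lc_linear rc_linear)
qed

text \<open>Row r of the matrix of u has entries u p_j. As \<open>Lam\<close> is right linear over
  S, each p_j splits off after the contraction, which therefore acts on the matrix product as it
  does on u alone.\<close>

lemma lcF_entry: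
  assumes p: "\<phi> \<in> D" and u: "u \<in> UA" and A: "A \<in> RM"
  shows "lcF \<phi> ((m1 u \<diamondop> A) r l) = (m0 (w \<star> Lam (hat \<phi>) u) \<diamondop> A) r l"
proof -
  have "lcF \<phi> ((m1 u \<diamondop> A) r l) = (\<Sum>j<r. lcF \<phi> (om (n1 (u \<star> p j)) (A j l)))"
    using u by (simp add: mm_def lcF_sum[OF p] m1_def pq_r)
  also have "\<dots> = (\<Sum>j<r. om (n0 (w \<star> Lam (hat \<phi>) u \<star> p j)) (A j l))"
    using A u by (intro sum.cong refl) (simp add: lc_om[OF p] RM_def Lam_mult[OF hat_lin[OF p]] sm_assoc)
  finally show ?thesis by (simp add: mm_def m0_def pq_r SA_Fn)
qed

lemma rcF_entry:
  assumes p: "\<phi> \<in> D" and u: "u \<in> UA" and A: "A \<in> RM"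
  shows "rcF \<phi> ((A \<diamondop> m1 u) k r) = (A \<diamondop> m0 (Lamr (hat \<phi>) u \<star> w)) k r"
proof -
  have "rcF \<phi> ((A \<diamondop> m1 u) k r) = (\<Sum>j<r. rcF \<phi> (om (A k j) (n1 (q j \<star> u))))"
    using u by (simp add: mm_def rcF_sum[OF p] m1_def pq_r)
  also have "\<dots> = (\<Sum>j<r. om (A k j) (n0 (q j \<star> (Lamr (hat \<phi>) u \<star> w))))"
    using A u by (intro sum.cong refl) (simp add: rc_om[OF p] RM_def Lam_mult[OF hat_lin[OF p]] sm_assoc)
  finally show ?thesis by (simp add: mm_def m0_def pq_r SA_Fn)
qed

text \<open>For \<open>Om\<close> itself the two contractions would have the shapes w y and y w, and
  w, though central in S, does not pass letters. Since w Om = Om w, the choice of w Om turns both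
  into w y w.\<close>

definition Omega :: 'r where "Omega = (m0 w \<diamondop> Om) r r"

lemma Om_w: "m0 w \<diamondop> Om = Om \<diamondop> m0 w"
  using Om_comm[of w] by (simp add: tw_w)

lemma Om_Omega: "s \<in> SA \<Longrightarrow> om Omega (n0 s) = (m0 w \<diamondop> Om \<diamondop> m0 (e \<star> s)) r r"
  unfolding Omega_def by (rule entry_mult_n0) simp_all

text \<open>The weight is central and fixed by the twist, so the twisted commutation of
  \<open>Om\<close> carries over. The conditions on s say that it lies in e S e.\<close>

lemma Omega_twist:
  assumes s: "s \<in> SA" "e \<star> s = s" "s \<star> e = s"
  shows "om (n0 (tw s)) Omega = om Omega (n0 s)"
proof -
  have tws: "tw s \<star> e = tw s" using s(3) twist_mult(1)[of s e] by (simp add: tw_e)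
  have "om (n0 (tw s)) Omega = (m0 (tw s) \<diamondop> (m0 w \<diamondop> Om)) r r"
    unfolding Omega_def using s by (subst n0_mult_entry) (simp_all add: tws)
  also have "m0 (tw s) \<diamondop> (m0 w \<diamondop> Om) = m0 w \<diamondop> (m0 (tw s) \<diamondop> Om)"
    using s w_central[of "tw s"] by (simp add: mm_assoc[symmetric] m_mult)
  also have "\<dots> = m0 w \<diamondop> Om \<diamondop> m0 (e \<star> s)" using s by (simp add: Om_comm mm_assoc)
  finally show ?thesis using s by (simp add: Om_Omega)
qed

end

section \<open>The superpotential identity\<close>

context corner_model
begin

text \<open>Let T_k be the transform of eps(k _) in the remaining letters. Semi-invariance in all n
  letters says that the sum over k of \<rho>(h^-1)_kj T_k is det(h^-1) eps(j _). Inverting the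
  matrix, as in Cramer's rule, isolates T_i.\<close>

lemma gel_TS_partial:
  assumes h: "h \<in> carrier G" and N: "CARD('n) = Suc N"
  shows "msc (det (\<rho> h)) (m0 (gel h) \<diamondop> TS N (\<lambda>x. eps (i # x))) =
    (\<Sum>j\<in>UNIV. msc (vec_nth (vec_nth (\<rho> h) j) i) (TS N (\<lambda>x. eps (j # x)) \<diamondop> m0 (gel h)))"
proof -
  have pw: "det (\<rho> h) * tr h x (\<lambda>x. eps (i # x)) = (\<Sum>j\<in>UNIV. vec_nth (vec_nth (\<rho> h) j) i * eps (j # x))" if x: "length x = N" for x
  proof -
    define T where "T k = tr h x (\<lambda>x. eps (k # x))" for k
    have T: "(\<Sum>k\<in>UNIV. vec_nth (vec_nth (\<rho> (inv h)) k) j * T k) = det (\<rho> (inv h)) * eps (j # x)" for j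
      using eps_tr[of "j # x" h] x N by (simp add: T_def)
    have "\<rho> (inv h) ** \<rho> h = Finite_Cartesian_Product.mat 1"
      using h rho_mult[of "inv h" h] by simp
    then have "vec_nth (vec_nth (\<rho> (inv h) ** \<rho> h) k) i = (if k = i then 1 else 0)" for k
      by (simp add: Finite_Cartesian_Product.mat_def)
    then have inv: "(\<Sum>j\<in>UNIV. vec_nth (vec_nth (\<rho> (inv h)) k) j * vec_nth (vec_nth (\<rho> h) j) i) = (if k = i then 1 else 0)" for k
      by (simp add: matrix_matrix_mult_def)
    have "(\<Sum>j\<in>UNIV. vec_nth (vec_nth (\<rho> h) j) i * eps (j # x)) =
       (\<Sum>j\<in>UNIV. vec_nth (vec_nth (\<rho> h) j) i * (det (\<rho> h) * (\<Sum>k\<in>UNIV. vec_nth (vec_nth (\<rho> (inv h)) k) j * T k)))"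
      unfolding T mult.assoc[symmetric] by (simp add: mult.assoc det_inv[OF h] mult.left_commute[of _ "det _"])
    also have "\<dots> = (\<Sum>j\<in>UNIV. \<Sum>k\<in>UNIV. det (\<rho> h) * T k * (vec_nth (vec_nth (\<rho> (inv h)) k) j * vec_nth (vec_nth (\<rho> h) j) i))"
      by (simp add: sum_distrib_left mult_ac)
    also have "\<dots> = (\<Sum>k\<in>UNIV. det (\<rho> h) * T k * (\<Sum>j\<in>UNIV. vec_nth (vec_nth (\<rho> (inv h)) k) j * vec_nth (vec_nth (\<rho> h) j) i))"
      unfolding sum_distrib_left by (rule sum.swap)
    also have "\<dots> = det (\<rho> h) * T i" unfolding inv by (simp add: if_distrib cong: if_cong)
    finally show ?thesis by (simp add: T_def)
  qed
  have "msc (det (\<rho> h)) (m0 (gel h) \<diamondop> TS N (\<lambda>x. eps (i # x))) = TS N (\<lambda>x. det (\<rho> h) * tr h x (\<lambda>x. eps (i # x))) \<diamondop> m0 (gel h)"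
    by (simp only: gel_TS[OF h] TS_scale mm_linear)
  also have "TS N (\<lambda>x. det (\<rho> h) * tr h x (\<lambda>x. eps (i # x))) = TS N (\<lambda>x. \<Sum>j\<in>UNIV. vec_nth (vec_nth (\<rho> h) j) i * eps (j # x))"
    by (rule TS_cong) (rule pw)
  finally show ?thesis by (simp only: TS_sum TS_scale mm_sum mm_linear)
qed

text \<open>Both sides are linear in the numbers f(x_i h^-1). On the left they come with det(h) h;
  moving h to the right of the remaining letters produces exactly the matrix entries that express
  h^-1 x_j through the x_i h^-1.\<close>

lemma Lam_identity:
  assumes f: "lin_on_UA f" and N: "CARD('n) = Suc N"
  shows "(\<Sum>i\<in>UNIV. m0 (tw (Lam f (Xv i))) \<diamondop> TS N (\<lambda>x. eps (i # x))) =
    (\<Sum>j\<in>UNIV. TS N (\<lambda>x. eps (j # x)) \<diamondop> m0 (Lamr f (Xv j)))"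
proof -
  define O' where "O' j = TS N (\<lambda>x. eps (j # x))" for j
  define B where "B i h = f (Xv i \<star> gel (inv h))" for i h
  have tw: "m0 (tw (Lam f (Xv i))) = (\<Sum>h\<in>carrier G. msc (B i h) (msc (det (\<rho> h)) (m0 (gel h))))" for i
    unfolding m0_decomp[OF twist_closed(1)[OF Lam_SA(1)]]
    by (rule sum.cong) (simp_all add: tw_def Lam_def B_def mult.commute)
  have lr: "Lamr f (Xv j) h 0 = (\<Sum>i\<in>UNIV. B i h * vec_nth (vec_nth (\<rho> h) j) i)" if h: "h \<in> carrier G" for j h
  proof -
    have "gel (inv h) \<star> Xv j = (\<Sum>i\<in>UNIV. gscale (vec_nth (vec_nth (\<rho> (inv (inv h))) j) i) (Xv i \<star> gel (inv h)))"
      using h by (intro gel_Xv) simp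
    then show ?thesis using h by (simp add: Lamr_def B_def lin_on_UA_sum[OF f] mult.commute)
  qed
  have "(\<Sum>i\<in>UNIV. m0 (tw (Lam f (Xv i))) \<diamondop> O' i) =
     (\<Sum>i\<in>UNIV. \<Sum>h\<in>carrier G. msc (B i h) (msc (det (\<rho> h)) (m0 (gel h) \<diamondop> O' i)))"
    by (simp only: tw mm_sum mm_linear)
  also have "\<dots> = (\<Sum>i\<in>UNIV. \<Sum>h\<in>carrier G. \<Sum>j\<in>UNIV. msc (B i h * vec_nth (vec_nth (\<rho> h) j) i) (O' j \<diamondop> m0 (gel h)))"
    by (intro sum.cong refl) (simp only: O'_def gel_TS_partial[OF _ N] M.scale_sum_right M.scale_scale)
  also have "\<dots> = (\<Sum>h\<in>carrier G. \<Sum>i\<in>UNIV. \<Sum>j\<in>UNIV. msc (B i h * vec_nth (vec_nth (\<rho> h) j) i) (O' j \<diamondop> m0 (gel h)))"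
    by (rule sum.swap)
  also have "\<dots> = (\<Sum>h\<in>carrier G. \<Sum>j\<in>UNIV. \<Sum>i\<in>UNIV. msc (B i h * vec_nth (vec_nth (\<rho> h) j) i) (O' j \<diamondop> m0 (gel h)))"
    by (rule sum.cong[OF refl], rule sum.swap)
  also have "\<dots> = (\<Sum>h\<in>carrier G. \<Sum>j\<in>UNIV. msc (Lamr f (Xv j) h 0) (O' j \<diamondop> m0 (gel h)))"
    by (intro sum.cong refl) (simp only: lr M.scale_sum_left)
  also have "\<dots> = (\<Sum>j\<in>UNIV. \<Sum>h\<in>carrier G. msc (Lamr f (Xv j) h 0) (O' j \<diamondop> m0 (gel h)))"
    by (rule sum.swap)
  also have "\<dots> = (\<Sum>j\<in>UNIV. O' j \<diamondop> m0 (Lamr f (Xv j)))"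
    by (simp only: m0_decomp[OF Lam_SA(2)] mm_sum mm_linear)
  finally show ?thesis unfolding O'_def .
qed

end

context corner_pot
begin

lemma Omega_superpotential:
  assumes p: "\<phi> \<in> D" "\<phi>' \<in> D" and tw: "\<And>u. u \<in> UA \<Longrightarrow> hat \<phi>' u = hat \<phi> (itw u)"
  shows "lcF \<phi>' Omega = sc ((-1) ^ (CARD('n) - 1)) (rcF \<phi> Omega)"
proof -
  obtain N where N: "CARD('n) = Suc N" using zero_less_card_finite[where 'a='n] unfolding gr0_conv_Suc by blast
  define O' where "O' j = TS N (\<lambda>x. eps (j # x))" for j
  have O': "O' j \<in> unital" "O' j \<in> RM" for j by (simp_all add: O'_def)
  \<comment> \<open>The inverse twist fixes x_i and multiplies h^-1 by det(h), so twisting the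
    functional applies \<open>tw\<close> to the pairing.\<close>
  have L: "Lam (hat \<phi>') (Xv i) = tw (Lam (hat \<phi>) (Xv i))" for i
  proof (intro ext)
    fix h v
    show "Lam (hat \<phi>') (Xv i) h v = tw (Lam (hat \<phi>) (Xv i)) h v"
    proof (cases "h \<in> carrier G")
      case True
      have "hat \<phi> (gscale (det (\<rho> h)) (Xv i \<star> gel (inv h))) = det (\<rho> h) * hat \<phi> (Xv i \<star> gel (inv h))"
        using hat_lin[OF p(1)] True by (simp add: lin_on_UA_def)
      then show ?thesis using True by (simp add: Lam_def tw_def tw itw_Xv_gel)
    qed (simp add: Lam_def tw_def)
  qed
  \<comment> \<open>The potential is read as Om w here and as w Om for the right contraction; in
    either case the weight coming from the contraction lands on the opposite side.\<close>
  have "Om \<diamondop> m0 w = (\<Sum>i\<in>UNIV. m1 (Xv i) \<diamondop> (O' i \<diamondop> m0 w))"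
    unfolding N by (simp only: TS.simps mm_sum O'_def mm_assoc TS_RM m_RM Xv_UA w_SA)
  then have "Omega = (\<Sum>i\<in>UNIV. (m1 (Xv i) \<diamondop> (O' i \<diamondop> m0 w)) r r)"
    unfolding Omega_def Om_w by (simp only: sum_entry)
  then have "lcF \<phi>' Omega = (\<Sum>i\<in>UNIV. (m0 (w \<star> tw (Lam (hat \<phi>) (Xv i))) \<diamondop> (O' i \<diamondop> m0 w)) r r)"
    by (simp only: lcF_sum[OF p(2)] lcF_entry[OF p(2)] Xv_UA mm_RM m_RM w_SA O' L)
  also have "\<dots> = (m0 w \<diamondop> (\<Sum>i\<in>UNIV. m0 (tw (Lam (hat \<phi>) (Xv i))) \<diamondop> O' i) \<diamondop> m0 w) r r"
    by (simp only: mm_sum sum_entry m_mult(1)[symmetric] w_SA twist_closed Lam_SA mm_assoc m_RM mm_RM O')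
  also have "(\<Sum>i\<in>UNIV. m0 (tw (Lam (hat \<phi>) (Xv i))) \<diamondop> O' i) = (\<Sum>j\<in>UNIV. O' j \<diamondop> m0 (Lamr (hat \<phi>) (Xv j)))"
    unfolding O'_def by (rule Lam_identity[OF hat_lin[OF p(1)] N])
  finally have lhs0: "lcF \<phi>' Omega = (m0 w \<diamondop> (\<Sum>j\<in>UNIV. O' j \<diamondop> m0 (Lamr (hat \<phi>) (Xv j))) \<diamondop> m0 w) r r" .
  have lhs: "lcF \<phi>' Omega = (\<Sum>j\<in>UNIV. (m0 w \<diamondop> O' j \<diamondop> m0 (Lamr (hat \<phi>) (Xv j) \<star> w)) r r)"
    unfolding lhs0 mm_sum sum_entry
    by (rule sum.cong[OF refl]) (simp only: m_mult(1)[symmetric] w_SA Lam_SA mm_assoc m_RM mm_RM O')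
  \<comment> \<open>The sign of the superpotential condition: the last letter is moved past the N =
    n - 1 others.\<close>
  have "TS N (\<lambda>x. eps (x @ [i])) = msc ((-1) ^ N) (O' i)" for i
    unfolding O'_def TS_scale[symmetric]
    by (rule TS_cong) (use eps_rotate[of _ i] N in \<open>simp add: power_mult_distrib[symmetric] mult.assoc[symmetric]\<close>)
  then have "Om = (\<Sum>i\<in>UNIV. msc ((-1) ^ N) (O' i \<diamondop> m1 (Xv i)))"
    unfolding N TS_snoc by (simp only: mm_linear)
  then have "Omega = (\<Sum>i\<in>UNIV. sc ((-1) ^ N) ((m0 w \<diamondop> O' i \<diamondop> m1 (Xv i)) r r))"
    unfolding Omega_def by (simp only: mm_sum mm_linear sum_entry msc_entry mm_assoc m_RM w_SA O' Xv_UA)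
  then have "rcF \<phi> Omega = (\<Sum>j\<in>UNIV. sc ((-1) ^ N) ((m0 w \<diamondop> O' j \<diamondop> m0 (Lamr (hat \<phi>) (Xv j) \<star> w)) r r))"
    by (simp only: rcF_sum[OF p(1)] rc_linear[OF p(1)] rcF_entry[OF p(1)] Xv_UA mm_RM m_RM w_SA O')
  then have "rcF \<phi> Omega = sc ((-1) ^ N) (lcF \<phi>' Omega)" unfolding lhs by (simp only: R.scale_sum_right)
  then have "sc ((-1) ^ N) (rcF \<phi> Omega) = sc (((-1) * (-1)) ^ N) (lcF \<phi>' Omega)"
    by (simp only: R.scale_scale power_mult_distrib)
  then show ?thesis by (simp add: N)
qed

subsection \<open>Iterated contractions of the potential\<close>

lemma m0_sum1: "finite A \<Longrightarrow> (\<And>a. a \<in> A \<Longrightarrow> f a \<in> SA) \<Longrightarrow> m0 (sum f A) = (\<Sum>a\<in>A. m0 (f a))"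
  using m0_sum[of A f "\<lambda>_. 1"] by (simp only: gfun.scale_one M.scale_one)

text \<open>The factor s moves to the right of \<open>Om\<close> as its inverse twist and w is
  cancelled by w'. What remains is a right multiple of the potential, the shape in which it enters
  the derivative space.\<close>

lemma Om_base:
  assumes s: "s \<in> SA"
  shows "(m0 s \<diamondop> Om) r r = om Omega (n0 (w' \<star> itw (e \<star> s)))"
proof -
  define y where "y = itw (e \<star> s)"
  have ees: "e \<star> (e \<star> s) = e \<star> s" by (simp only: sm_assoc[symmetric] e_idem)
  have y: "y \<in> SA" "tw y = e \<star> s" using s by (simp_all add: y_def SA_Fn)
  have ey: "e \<star> y = y"
    unfolding y_def by (subst twist_mult(2)[of e "e \<star> s", unfolded itw_e, symmetric]) (simp only: ees)
  have "w \<star> (e \<star> (w' \<star> y)) = w \<star> (e \<star> w') \<star> y" by (simp only: sm_assoc)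
  also have "\<dots> = (w \<star> w') \<star> (e \<star> y)" by (simp only: e_w' sm_assoc)
  also have "\<dots> = y" using y by (simp add: ww' ey SA_Fn)
  finally have wy: "w \<star> (e \<star> (w' \<star> y)) = y" .
  have "om Omega (n0 (w' \<star> y)) = (m0 w \<diamondop> Om \<diamondop> m0 (e \<star> (w' \<star> y))) r r"
    using y by (intro Om_Omega) simp
  also have "m0 w \<diamondop> Om \<diamondop> m0 (e \<star> (w' \<star> y)) = Om \<diamondop> m0 (w \<star> (e \<star> (w' \<star> y)))"
    using y by (simp add: Om_w mm_assoc m_mult)
  also have "\<dots> = m0 (e \<star> s) \<diamondop> Om" using y Om_comm[of y] by (simp only: wy)
  finally show ?thesis using absorb_entry(1)[OF s] by (simp add: y_def)
qed

text \<open>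
  Contracting with the functional dual to a coordinate strips the first letter off the words of the
  potential; \<open>DS l\<close> stands for the span of the \<open>l\<close>-fold contractions.
\<close>

lemma contracted_span:
  assumes sub: "\<And>l. R.subspace (DS l)"
    and base: "\<And>x. x \<in> SA \<Longrightarrow> om Omega (n0 x) \<in> DS 0"
    and step: "\<And>l \<phi> t. t \<in> DS l \<Longrightarrow> t \<in> RC \<Longrightarrow> \<phi> \<in> D \<Longrightarrow> lcF \<phi> t \<in> DS (Suc l)"
  shows "length c = l \<Longrightarrow> l \<le> CARD('n) \<Longrightarrow> s \<in> SA \<Longrightarrow>
    (m0 s \<diamondop> TS (CARD('n) - l) (\<lambda>x. eps (c @ x))) r r \<in> DS l"
proof (induction l arbitrary: c s)
  case 0
  then show ?case by (simp add: Om_base base)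
next
  case (Suc l)
  obtain c0 i where c: "c = c0 @ [i]" "length c0 = l"
    using Suc.prems(1) by (cases c rule: rev_cases) auto
  define N where "N = CARD('n) - Suc l"
  have N: "CARD('n) - l = Suc N" using Suc.prems(2) by (simp add: N_def)
  define T where "T j = TS N (\<lambda>x. eps (c0 @ j # x))" for j
  have T: "T j \<in> RM" "T j \<in> unital" for j by (simp_all add: T_def)
  have T0: "TS (CARD('n) - l) (\<lambda>x. eps (c0 @ x)) = (\<Sum>j\<in>UNIV. m1 (Xv j) \<diamondop> T j)"
    unfolding N T_def TS.simps ..
  note s = Suc.prems(3)
  \<comment> \<open>\<open>Th\<close> reads the coordinate at x_i. The factor w' s is chosen so
    that, once the contraction has multiplied by w, exactly e s stands in front of
    \<open>T i\<close>.\<close>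
  define Th where "Th u = lam (w' \<star> s \<star> co i u)" for u
  have Th: "lin_on_UA Th"
    unfolding lin_on_UA_def Th_def by (simp add: co_linear)
  \<comment> \<open>Functionals in D see only e u e, so \<open>Th\<close> itself is not among them.
    Contracting q_k u with the functional u |-> Th (p_k e u e) and summing over k has the same
    effect, by the decomposition of 1.\<close>
  have "\<exists>\<phi>\<in>D. \<forall>u\<in>UA. hat \<phi> u = Th (p k \<star> (e \<star> u \<star> e))" for k
  proof (rule hat_surj)
    show "lin_on_UA (\<lambda>u. Th (p k \<star> u))"
      using Th unfolding lin_on_UA_def by simp
  qed
  then obtain ph where ph: "\<And>k. ph k \<in> D" "\<And>k u. u \<in> UA \<Longrightarrow> hat (ph k) u = Th (p k \<star> (e \<star> u \<star> e))"
    by metis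
  have mem: "(\<Sum>k<r. lcF (ph k) ((m0 (q k) \<diamondop> (\<Sum>j\<in>UNIV. m1 (Xv j) \<diamondop> T j)) r r)) \<in> DS (Suc l)"
  proof (rule R.subspace_sum[OF sub step])
    fix k assume "k \<in> {..<r}"
    show "(m0 (q k) \<diamondop> (\<Sum>j\<in>UNIV. m1 (Xv j) \<diamondop> T j)) r r \<in> DS l"
      using Suc.IH[OF c(2) _ pq_SA(2)[of k]] Suc.prems(2) unfolding T0 by simp
    have "m0 (q k) \<diamondop> (\<Sum>j\<in>UNIV. m1 (Xv j) \<diamondop> T j) \<in> RM"
      unfolding T0[symmetric] by simp
    then show "(m0 (q k) \<diamondop> (\<Sum>j\<in>UNIV. m1 (Xv j) \<diamondop> T j)) r r \<in> RC" by (auto simp: RM_def)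
  qed (rule ph)
  have LamS: "(\<Sum>k<r. Lam (hat (ph k)) (q k \<star> Xv j)) = (if j = i then e \<star> w' \<star> s else 0)" for j
  proof (intro ext)
    fix h v
    show "(\<Sum>k<r. Lam (hat (ph k)) (q k \<star> Xv j)) h v = (if j = i then e \<star> w' \<star> s else 0) h v"
    proof (cases "h \<in> carrier G")
      case h: True
      define x where "x = gel (inv h) \<star> e"
      have x: "x \<in> SA" using h by (simp add: x_def)
      have "(\<Sum>k<r. Lam (hat (ph k)) (q k \<star> Xv j)) h v = (\<Sum>k<r. Th (gscale 1 (gel \<one> \<star> p k \<star> e \<star> (q k \<star> (Xv j \<star> x)))))"
        unfolding sum_apply2 using h
        by (intro sum.cong refl) (simp add: Lam_def ph(2) x_def sm_assoc SA_Fn)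
      also have "\<dots> = Th (\<Sum>k<r. gscale 1 (gel \<one> \<star> p k \<star> e \<star> (q k \<star> (Xv j \<star> x))))"
        by (subst lin_on_UA_sum[OF Th]) (simp_all add: x)
      also have "(\<Sum>k<r. gscale 1 (gel \<one> \<star> p k \<star> e \<star> (q k \<star> (Xv j \<star> x)))) = gel \<one> \<star> (Xv j \<star> x)"
        by (simp only: gfun.scale_one full_insert sm_Fn)
      also have "Th (gel \<one> \<star> (Xv j \<star> x)) = lam (w' \<star> s \<star> (if i = j then x else 0))"
        using x by (simp add: Th_def co_Xv)
      also have "\<dots> = (if j = i then e \<star> w' \<star> s else 0) h v"
      proof (cases "i = j")
        case True
        have "lam (w' \<star> s \<star> x) = lam ((w' \<star> s \<star> gel (inv h)) \<star> e)" by (simp only: x_def sm_assoc)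
        also have "\<dots> = lam (e \<star> w' \<star> s \<star> gel (inv h))"
          using h s by (subst lam_comm) (simp_all add: sm_assoc)
        also have "\<dots> = (e \<star> w' \<star> s) h v"
          using h s SA_eval[of "e \<star> w' \<star> s" h v] by (subst lam_gel) simp_all
        finally show ?thesis using True by simp
      qed (simp add: lam_def)
      finally show ?thesis .
    next
      case False
      have "(e \<star> w' \<star> s) h v = 0" using False by (simp add: sm_def)
      then show ?thesis using False by (simp add: sum_apply2 Lam_def)
    qed
  qed
  have "(\<Sum>k<r. lcF (ph k) ((m0 (q k) \<diamondop> (\<Sum>j\<in>UNIV. m1 (Xv j) \<diamondop> T j)) r r)) =
      (\<Sum>k<r. \<Sum>j\<in>UNIV. lcF (ph k) ((m1 (q k \<star> Xv j) \<diamondop> T j) r r))"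
    by (simp only: mm_sum sum_entry lcF_sum[OF ph(1)] m_mult(2)[symmetric] pq_SA Xv_UA mm_assoc m_RM T)
  also have "\<dots> = (\<Sum>k<r. \<Sum>j\<in>UNIV. (m0 (w \<star> Lam (hat (ph k)) (q k \<star> Xv j)) \<diamondop> T j) r r)"
    by (simp only: lcF_entry[OF ph(1)] SA_UA pq_SA Xv_UA T)
  also have "\<dots> = (\<Sum>j\<in>UNIV. \<Sum>k<r. (m0 (w \<star> Lam (hat (ph k)) (q k \<star> Xv j)) \<diamondop> T j) r r)"
    by (rule sum.swap)
  also have "\<dots> = (\<Sum>j\<in>UNIV. (m0 (w \<star> (\<Sum>k<r. Lam (hat (ph k)) (q k \<star> Xv j))) \<diamondop> T j) r r)"
  proof (rule sum.cong[OF refl])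
    fix j
    have "m0 (w \<star> (\<Sum>k<r. Lam (hat (ph k)) (q k \<star> Xv j))) = (\<Sum>k<r. m0 (w \<star> Lam (hat (ph k)) (q k \<star> Xv j)))"
      unfolding sm_sum by (rule m0_sum1) simp_all
    then show "(\<Sum>k<r. (m0 (w \<star> Lam (hat (ph k)) (q k \<star> Xv j)) \<diamondop> T j) r r) =
       (m0 (w \<star> (\<Sum>k<r. Lam (hat (ph k)) (q k \<star> Xv j))) \<diamondop> T j) r r"
      by (simp only: mm_sum sum_entry)
  qed
  also have "\<dots> = (\<Sum>j\<in>UNIV. if j = i then (m0 (w \<star> (e \<star> w' \<star> s)) \<diamondop> T i) r r else 0)"
  proof (rule sum.cong[OF refl])
    fix j
    have "m0 0 = 0" using m0_sum1[of "{}" "\<lambda>_. e"] by simp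
    then have "(m0 (w \<star> 0) \<diamondop> T j) r r = 0"
      by (simp only: sm_linear mm_linear zero_fun_apply)
    then show "(m0 (w \<star> (\<Sum>k<r. Lam (hat (ph k)) (q k \<star> Xv j))) \<diamondop> T j) r r =
        (if j = i then (m0 (w \<star> (e \<star> w' \<star> s)) \<diamondop> T i) r r else 0)"
      unfolding LamS by (cases "j = i") (simp_all only: if_True if_False refl)
  qed
  also have "\<dots> = (m0 (w \<star> (e \<star> w' \<star> s)) \<diamondop> T i) r r" by simp
  also have "w \<star> (e \<star> w' \<star> s) = e \<star> s"
  proof -
    have "w \<star> (e \<star> w' \<star> s) = (w \<star> w') \<star> (e \<star> s)" by (simp only: e_w' sm_assoc)
    then show ?thesis by (simp add: ww')
  qed
  also have "(m0 (e \<star> s) \<diamondop> T i) r r = (m0 s \<diamondop> T i) r r" using s by (rule absorb_entry)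
  also have "T i = TS (CARD('n) - Suc l) (\<lambda>x. eps (c @ x))" by (simp add: T_def N_def c)
  finally show ?case using mem by (simp only:)
qed

section \<open>Commutators of the coordinates\<close>

definition cmt :: "'n \<Rightarrow> 'n \<Rightarrow> nat \<Rightarrow> nat \<Rightarrow> 'r" where
  "cmt i j = m1 (Xv i) \<diamondop> m1 (Xv j) - m1 (Xv j) \<diamondop> m1 (Xv i)"

lemma cmt_RM [simp]: "cmt i j \<in> RM" "cmt i j \<in> unital"
  unfolding cmt_def by (auto intro!: M.subspace_diff[OF subspace_RM] M.subspace_diff[OF subspace_unital])

lemma TS2: "TS 2 a = (\<Sum>i\<in>UNIV. \<Sum>j\<in>UNIV. msc (a [i, j]) (m1 (Xv i) \<diamondop> m1 (Xv j)))"
proof -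
  have "TS 2 a = (\<Sum>i\<in>UNIV. m1 (Xv i) \<diamondop> (\<Sum>j\<in>UNIV. m1 (Xv j) \<diamondop> msc (a [i, j]) (m0 (gel \<one>))))"
    unfolding numeral_2_eq_2 by (simp only: TS.simps)
  then show ?thesis
    by (simp only: mm_sum mm_linear m_mult gel_SA one_closed Xv_UA gel_one_right)
qed

text \<open>All letters except i and j are used up in c, so only the two orders of i and j give
  words without repetition, and these have opposite signs.\<close>

lemma TS2_eps:
  assumes ij: "i \<noteq> j" and c: "distinct c" "set c = UNIV - {i, j}"
  shows "length c = CARD('n) - 2" "TS 2 (\<lambda>x. eps (c @ x)) = msc (eps (c @ [i, j])) (cmt i j)" "eps (c @ [i, j]) \<noteq> 0"
proof -
  have "length c = card (UNIV - {i, j})" using c distinct_card by metis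
  also have "\<dots> = CARD('n) - 2" using ij by (simp add: card_Diff_subset)
  finally show len: "length c = CARD('n) - 2" .
  have "card {i, j} \<le> CARD('n)" by (rule card_mono) auto
  then have len2: "length c + 2 = CARD('n)" using ij len by simp
  show "eps (c @ [i, j]) \<noteq> 0"
    by (rule eps_distinct) (use c ij len2 in auto)
  have sw: "eps (c @ [j, i]) = - eps (c @ [i, j])" using eps_swap[OF len2] .
  have z: "eps (c @ [a, b]) = 0" if "(a, b) \<noteq> (i, j)" "(a, b) \<noteq> (j, i)" for a b
    by (rule eps_not_distinct) (use that c len2 in auto)
  let ?f = "\<lambda>x. msc (eps (c @ [fst x, snd x])) (m1 (Xv (fst x)) \<diamondop> m1 (Xv (snd x)))"
  have "TS 2 (\<lambda>x. eps (c @ x)) = (\<Sum>x\<in>UNIV. ?f x)"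
    unfolding TS2 by (simp only: sum.cartesian_product case_prod_unfold UNIV_Times_UNIV)
  also have "\<dots> = (\<Sum>x\<in>{(i, j), (j, i)}. ?f x)"
  proof (rule sum.mono_neutral_right)
    show "\<forall>x\<in>UNIV - {(i, j), (j, i)}. ?f x = 0"
    proof
      fix x assume "x \<in> UNIV - {(i, j), (j, i)}"
      then have "eps (c @ [fst x, snd x]) = 0" by (intro z) (auto simp: prod_eq_iff)
      then show "?f x = 0" by (simp only: M.scale_zero_left)
    qed
  qed auto
  also have "\<dots> = ?f (i, j) + ?f (j, i)" using ij by simp
  also have "\<dots> = msc (eps (c @ [i, j])) (cmt i j)"
    by (simp only: fst_conv snd_conv sw cmt_def M.scale_right_diff_distrib M.scale_minus_left) simp
  finally show "TS 2 (\<lambda>x. eps (c @ x)) = msc (eps (c @ [i, j])) (cmt i j)" .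
qed

text \<open>The contractions yield commutators with a factor of S on the left only, whereas an entry
  of a commutator also has p_l on the right. Conjugation by g preserves the span of the commutators,
  so that factor can be moved to the left.\<close>

lemma cmt_gel:
  assumes g: "g \<in> carrier G"
  shows "cmt i j \<diamondop> m0 (gel g) = (\<Sum>a\<in>UNIV. \<Sum>b\<in>UNIV. msc (vec_nth (vec_nth (\<rho> g) i) a * vec_nth (vec_nth (\<rho> g) j) b) (m0 (gel g) \<diamondop> cmt a b))"
proof -
  note R = m_RM Xv_UA gel_SA[OF g] mm_RM
  have X: "m1 (Xv i) \<diamondop> m0 (gel g) = (\<Sum>a\<in>UNIV. msc (vec_nth (vec_nth (\<rho> g) i) a) (m0 (gel g) \<diamondop> m1 (Xv a)))" for i
  proof -
    have "Xv i \<star> gel g = gel g \<star> (gel (inv g) \<star> Xv i) \<star> gel g"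
    proof -
      have "gel g \<star> (gel (inv g) \<star> Xv i) \<star> gel g = (gel g \<star> gel (inv g)) \<star> (Xv i \<star> gel g)" by (simp only: sm_assoc)
      then show ?thesis using g by (simp add: gel_mult)
    qed
    also have "\<dots> = gel g \<star> (\<Sum>a\<in>UNIV. gscale (vec_nth (vec_nth (\<rho> (inv (inv g))) i) a) (Xv a \<star> gel (inv g))) \<star> gel g"
      using g by (subst gel_Xv) simp_all
    also have "\<dots> = (\<Sum>a\<in>UNIV. gscale (vec_nth (vec_nth (\<rho> g) i) a) (gel g \<star> (Xv a \<star> (gel (inv g) \<star> gel g))))"
      using g by (simp only: sm_sum sm_linear sm_assoc inv_inv)
    also have "\<dots> = (\<Sum>a\<in>UNIV. gscale (vec_nth (vec_nth (\<rho> g) i) a) (gel g \<star> Xv a))"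
      using g by (simp add: gel_mult)
    finally have "m1 (Xv i \<star> gel g) = (\<Sum>a\<in>UNIV. msc (vec_nth (vec_nth (\<rho> g) i) a) (m1 (gel g \<star> Xv a)))"
      using g by (simp only: m1_sum finite SA_UA gel_SA Xv_UA)
    then show ?thesis by (simp only: m_mult R)
  qed
  have XX: "m1 (Xv i) \<diamondop> m1 (Xv j) \<diamondop> m0 (gel g) = (\<Sum>a\<in>UNIV. \<Sum>b\<in>UNIV. msc (vec_nth (vec_nth (\<rho> g) i) a * vec_nth (vec_nth (\<rho> g) j) b)
     (m0 (gel g) \<diamondop> (m1 (Xv a) \<diamondop> m1 (Xv b))))" for i j
  proof -
    have "m1 (Xv i) \<diamondop> m1 (Xv j) \<diamondop> m0 (gel g) =
      (\<Sum>b\<in>UNIV. msc (vec_nth (vec_nth (\<rho> g) j) b) (m1 (Xv i) \<diamondop> m0 (gel g) \<diamondop> m1 (Xv b)))"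
      by (simp only: mm_assoc R X[of j] mm_sum mm_linear)
    also have "\<dots> = (\<Sum>b\<in>UNIV. \<Sum>a\<in>UNIV. msc (vec_nth (vec_nth (\<rho> g) i) a * vec_nth (vec_nth (\<rho> g) j) b)
     (m0 (gel g) \<diamondop> (m1 (Xv a) \<diamondop> m1 (Xv b))))"
      by (simp only: X[of i] mm_sum mm_linear mm_assoc R M.scale_sum_right M.scale_scale mult.commute)
    also have "\<dots> = (\<Sum>a\<in>UNIV. \<Sum>b\<in>UNIV. msc (vec_nth (vec_nth (\<rho> g) i) a * vec_nth (vec_nth (\<rho> g) j) b)
     (m0 (gel g) \<diamondop> (m1 (Xv a) \<diamondop> m1 (Xv b))))"
      by (rule sum.swap)
    finally show ?thesis .
  qed
  have XX': "m1 (Xv j) \<diamondop> m1 (Xv i) \<diamondop> m0 (gel g) = (\<Sum>a\<in>UNIV. \<Sum>b\<in>UNIV. msc (vec_nth (vec_nth (\<rho> g) i) a * vec_nth (vec_nth (\<rho> g) j) b)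
     (m0 (gel g) \<diamondop> (m1 (Xv b) \<diamondop> m1 (Xv a))))"
    unfolding XX by (subst sum.swap) (simp only: mult.commute)
  show ?thesis
    unfolding cmt_def mm_diff XX[of i j] XX' M.scale_right_diff_distrib sum_subtractf ..
qed

text \<open>Contracting away every letter other than i and j leaves eps(c i j) times the commutator,
  and this coefficient is nonzero.\<close>

lemma cmt_span:
  assumes sub: "\<And>l. R.subspace (DS l)"
    and base: "\<And>x. x \<in> SA \<Longrightarrow> om Omega (n0 x) \<in> DS 0"
    and step: "\<And>l \<phi> t. t \<in> DS l \<Longrightarrow> t \<in> RC \<Longrightarrow> \<phi> \<in> D \<Longrightarrow> lcF \<phi> t \<in> DS (Suc l)"
    and n: "CARD('n) \<ge> 2"
  shows "cmt i j k l \<in> DS (CARD('n) - 2)"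
proof -
  have 1: "(m0 s \<diamondop> cmt i j) r r \<in> DS (CARD('n) - 2)" if s: "s \<in> SA" for s i j
  proof (cases "i = j")
    case True
    then have "(m0 s \<diamondop> cmt i j) r r = 0" by (simp only: cmt_def diff_self mm_linear zero_fun_apply)
    then show ?thesis using R.subspace_0[OF sub] by (simp only:)
  next
    case False
    obtain c where c: "set c = UNIV - {i, j}" "distinct c" using finite_distinct_list[OF finite[of "UNIV - {i, j}"]] by blast
    note t = TS2_eps[OF False c(2,1)]
    have "CARD('n) - (CARD('n) - 2) = 2" using n by simp
    then have "(m0 s \<diamondop> msc (eps (c @ [i, j])) (cmt i j)) r r \<in> DS (CARD('n) - 2)"
      using contracted_span[of DS, OF sub base step t(1) diff_le_self s] unfolding t(2)[symmetric] by (simp only:)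
    then have "sc (eps (c @ [i, j])) ((m0 s \<diamondop> cmt i j) r r) \<in> DS (CARD('n) - 2)"
      by (simp only: mm_linear msc_entry)
    then have "sc (1 / eps (c @ [i, j])) (sc (eps (c @ [i, j])) ((m0 s \<diamondop> cmt i j) r r)) \<in> DS (CARD('n) - 2)"
      by (rule R.subspace_scale[OF sub])
    then show ?thesis using t(3) by simp
  qed
  have "cmt i j k l = (m0 (q k) \<diamondop> cmt i j \<diamondop> m0 (p l)) r r" by (rule entry_shift) simp
  also have "m0 (q k) \<diamondop> cmt i j \<diamondop> m0 (p l) = (\<Sum>g\<in>carrier G. msc (p l g 0) (m0 (q k) \<diamondop> (cmt i j \<diamondop> m0 (gel g))))"
    by (subst m0_decomp[of "p l"], simp, unfold mm_sum mm_linear, rule sum.cong[OF refl]) (simp add: mm_assoc)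
  also have "\<dots> = (\<Sum>g\<in>carrier G. msc (p l g 0) (\<Sum>a\<in>UNIV. \<Sum>b\<in>UNIV.
      msc (vec_nth (vec_nth (\<rho> g) i) a * vec_nth (vec_nth (\<rho> g) j) b) (m0 (q k \<star> gel g) \<diamondop> cmt a b)))"
  proof (rule sum.cong[OF refl])
    fix g assume g: "g \<in> carrier G"
    have "m0 (q k) \<diamondop> (m0 (gel g) \<diamondop> cmt a b) = m0 (q k \<star> gel g) \<diamondop> cmt a b" for a b
      using g by (simp add: mm_assoc[symmetric] m_mult)
    then show "msc (p l g 0) (m0 (q k) \<diamondop> (cmt i j \<diamondop> m0 (gel g))) = msc (p l g 0) (\<Sum>a\<in>UNIV. \<Sum>b\<in>UNIV.
      msc (vec_nth (vec_nth (\<rho> g) i) a * vec_nth (vec_nth (\<rho> g) j) b) (m0 (q k \<star> gel g) \<diamondop> cmt a b))"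
      by (simp only: cmt_gel[OF g] mm_sum mm_linear)
  qed
  finally have eq: "cmt i j k l = (\<Sum>g\<in>carrier G. sc (p l g 0) (\<Sum>a\<in>UNIV. \<Sum>b\<in>UNIV.
      sc (vec_nth (vec_nth (\<rho> g) i) a * vec_nth (vec_nth (\<rho> g) j) b) ((m0 (q k \<star> gel g) \<diamondop> cmt a b) r r)))"
    by (simp only: sum_entry msc_entry)
  show ?thesis unfolding eq
    by (intro R.subspace_sum[OF sub] R.subspace_scale[OF sub] 1) simp
qed

text \<open>
  Spans the \<open>l\<close>-fold contractions from above: they are antisymmetric in the remaining letters.
\<close>

definition QS :: "nat \<Rightarrow> 'r set" where
  "QS l = R.span {(m0 a \<diamondop> TS (CARD('n) - l) (\<lambda>x. eps (c @ x)) \<diamondop> m0 y) r r | a c y. a \<in> SA \<and> y \<in> SA \<and> length c = l}"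

lemma QS_0: "a \<in> SA \<Longrightarrow> x \<in> SA \<Longrightarrow> om (n0 a) (om Omega (n0 x)) \<in> QS 0"
proof -
  assume a: "a \<in> SA" and x: "x \<in> SA"
  have "om (n0 a) (om Omega (n0 x)) = (m0 (a \<star> e) \<diamondop> (m0 w \<diamondop> Om \<diamondop> m0 (e \<star> x))) r r"
    using a x by (simp add: Om_Omega n0_mult_entry)
  also have "\<dots> = (m0 (a \<star> e \<star> w) \<diamondop> TS (CARD('n) - 0) (\<lambda>x. eps ([] @ x)) \<diamondop> m0 (e \<star> x)) r r"
    using a x by (simp add: mm_assoc m_mult(1)[symmetric])
  finally have eq: "om (n0 a) (om Omega (n0 x)) =
      (m0 (a \<star> e \<star> w) \<diamondop> TS (CARD('n) - 0) (\<lambda>x. eps ([] @ x)) \<diamondop> m0 (e \<star> x)) r r" .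
  show ?thesis unfolding QS_def eq
    by (rule R.span_base, rule CollectI, rule exI[of _ "a \<star> e \<star> w"], rule exI[of _ "[]"], rule exI[of _ "e \<star> x"]) (simp add: a x)
qed

lemma QS_0': "x \<in> SA \<Longrightarrow> om Omega (n0 x) \<in> QS 0"
proof -
  assume x: "x \<in> SA"
  have "om Omega (n0 x) = (m0 w \<diamondop> TS (CARD('n) - 0) (\<lambda>x. eps ([] @ x)) \<diamondop> m0 (e \<star> x)) r r"
    using x by (simp add: Om_Omega)
  then have eq: "om Omega (n0 x) = (m0 w \<diamondop> TS (CARD('n) - 0) (\<lambda>x. eps ([] @ x)) \<diamondop> m0 (e \<star> x)) r r" .
  show ?thesis unfolding QS_def eq
    by (rule R.span_base, rule CollectI, rule exI[of _ w], rule exI[of _ "[]"], rule exI[of _ "e \<star> x"]) (simp add: x)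
qed

text \<open>A left factor a is absorbed in the first letter: a x_j is an element of U and is
  contracted as such, which leaves a new factor of S before the next letter.\<close>

lemma QS_step:
  assumes p: "\<phi> \<in> D" and l: "l < CARD('n)" and t: "t \<in> QS l"
  shows "lcF \<phi> t \<in> QS (Suc l)"
proof -
  have gen: "lcF \<phi> ((m0 a \<diamondop> TS (CARD('n) - l) (\<lambda>x. eps (c @ x)) \<diamondop> m0 y) r r) \<in> QS (Suc l)"
    if a: "a \<in> SA" and y: "y \<in> SA" and c: "length c = l" for a y c
  proof -
    define N where "N = CARD('n) - Suc l"
    have N: "CARD('n) - l = Suc N" using l by (simp add: N_def)
    define T where "T j = TS N (\<lambda>x. eps (c @ j # x))" for j
    have T: "T j \<in> RM" for j by (simp add: T_def)
    have "(m0 a \<diamondop> TS (CARD('n) - l) (\<lambda>x. eps (c @ x)) \<diamondop> m0 y) r r = (\<Sum>j\<in>UNIV. (m1 (a \<star> Xv j) \<diamondop> (T j \<diamondop> m0 y)) r r)"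
      unfolding N TS.simps T_def[symmetric]
      by (simp only: mm_sum sum_entry m_mult(2)[symmetric] a y Xv_UA mm_assoc m_RM mm_RM T)
    then have "lcF \<phi> ((m0 a \<diamondop> TS (CARD('n) - l) (\<lambda>x. eps (c @ x)) \<diamondop> m0 y) r r) =
      (\<Sum>j\<in>UNIV. (m0 (w \<star> Lam (hat \<phi>) (a \<star> Xv j)) \<diamondop> (T j \<diamondop> m0 y)) r r)"
      by (simp only: lcF_sum[OF p] lcF_entry[OF p] SA_UA a y Xv_UA m_RM mm_RM T)
    also have "\<dots> = (\<Sum>j\<in>UNIV. (m0 (w \<star> Lam (hat \<phi>) (a \<star> Xv j)) \<diamondop> TS (CARD('n) - Suc l) (\<lambda>x. eps ((c @ [j]) @ x)) \<diamondop> m0 y) r r)"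
      using y by (simp add: mm_assoc T_def N_def)
    also have "\<dots> \<in> QS (Suc l)"
      unfolding QS_def
    proof (intro R.span_sum R.span_base CollectI exI conjI)
      show "w \<star> Lam (hat \<phi>) (a \<star> Xv j) \<in> SA" "y \<in> SA" "length (c @ [j]) = Suc l" for j using y c by simp_all
    qed (rule refl)
    finally show ?thesis .
  qed
  from t show ?thesis unfolding QS_def[of l]
  proof (induction rule: R.span_induct_alt)
    case base
    have "lcF \<phi> 0 = 0" using lc_linear(2)[OF p, of 0 0] by (simp only: R.scale_zero_left)
    then show ?case using R.span_zero unfolding QS_def by (simp only:)
  next
    case (step c x y)
    then have "lcF \<phi> x \<in> QS (Suc l)" using gen by blast
    then show ?case using step(2) unfolding QS_def
      by (simp only: lc_linear[OF p] R.span_add R.span_scale)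
  qed
qed

end

section \<open>Linear independence of monomials\<close>

lemma digits_unique:
  fixes N :: nat
  assumes "\<And>k. k < n \<Longrightarrow> d k < N" "\<And>k. k < n \<Longrightarrow> d' k < N"
    and "(\<Sum>k<n. d k * N ^ k) = (\<Sum>k<n. d' k * N ^ k)" "k < n"
  shows "d k = d' k"
  using assms
proof (induction n arbitrary: d d' k)
  case (Suc n)
  have split: "(\<Sum>k<Suc n. f k * N ^ k) = f 0 + N * (\<Sum>k<n. f (Suc k) * N ^ k)" for f :: "nat \<Rightarrow> nat"
    unfolding sum.lessThan_Suc_shift by (simp add: sum_distrib_left mult_ac)
  have eq: "d 0 + N * (\<Sum>k<n. d (Suc k) * N ^ k) = d' 0 + N * (\<Sum>k<n. d' (Suc k) * N ^ k)"
    using Suc.prems(3) unfolding split .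
  have lt: "d 0 < N" "d' 0 < N" using Suc.prems(1,2) by auto
  have "(d 0 + N * (\<Sum>k<n. d (Suc k) * N ^ k)) mod N = (d' 0 + N * (\<Sum>k<n. d' (Suc k) * N ^ k)) mod N"
    using eq by (rule arg_cong)
  then have d0: "d 0 = d' 0" using lt by simp
  then have eq': "(\<Sum>k<n. d (Suc k) * N ^ k) = (\<Sum>k<n. d' (Suc k) * N ^ k)" using eq lt by simp
  show ?case
  proof (cases k)
    case 0 then show ?thesis using d0 by simp
  next
    case (Suc j)
    then show ?thesis
      using Suc.IH[of "\<lambda>k. d (Suc k)" "\<lambda>k. d' (Suc k)" j] Suc.prems(1,2,4) eq' by simp
  qed
qed simp

definition wmon :: "'n list \<Rightarrow> complex^'n \<Rightarrow> complex" where
  "wmon w v = prod_list (map (\<lambda>i. vec_nth v i) w)"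

lemma wmon_mset: "mset w = mset w' \<Longrightarrow> wmon w = wmon w'"
  unfolding wmon_def fun_eq_iff by (metis mset_map prod_mset_prod_list)

lemma sum_list_count:
  fixes f :: "'n::finite \<Rightarrow> nat"
  shows "sum_list (map f w) = (\<Sum>i\<in>UNIV. count (mset w) i * f i)"
proof (induction w)
  case (Cons j w)
  have "(\<Sum>i\<in>UNIV. count (mset (j # w)) i * f i) = (\<Sum>i\<in>UNIV. count (mset w) i * f i + (if i = j then f j else 0))"
    by (rule sum.cong) auto
  then show ?case using Cons by (simp add: sum.distrib)
qed simp

text \<open>
  Substituting \<open>t ^ N ^ i\<close> for the \<open>i\<close>-th coordinate, with \<open>N\<close> larger than all exponents, separates
  monomials by the base \<open>N\<close> expansion of the exponent of \<open>t\<close>.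
\<close>

lemma monomials_independent:
  fixes W :: "'n::finite list set"
  assumes fin: "finite W" and inj: "inj_on mset W"
    and zero: "\<And>v. (\<Sum>w\<in>W. c w * wmon w v) = 0" and w0: "w0 \<in> W"
  shows "c w0 = 0"
proof -
  define N where "N = Suc (\<Sum>w\<in>W. length w)"
  have N: "count (mset w) i < N" if "w \<in> W" for w i
  proof -
    have "count (mset w) i \<le> length w" by (metis count_le_size size_mset)
    also have "\<dots> \<le> (\<Sum>w\<in>W. length w)" using fin that by (intro member_le_sum) auto
    finally show ?thesis by (simp add: N_def)
  qed
  define code where "code w = sum_list (map (\<lambda>i. N ^ num i) w)" for w :: "'n list"
  have inj_num: "inj (num :: 'n \<Rightarrow> nat)" using bij_num[where 'n='n] unfolding bij_betw_def by blast
  have code: "code w = (\<Sum>k<CARD('n). count (mset w) (inv_into UNIV num k) * N ^ k)" for w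
    using sum.reindex_bij_betw[OF bij_num[where 'n='n], of "\<lambda>k. count (mset w) (inv_into UNIV num k) * N ^ k"]
    unfolding code_def sum_list_count inv_f_f[OF inj_num] .
  have code_inj: "w = w'" if "w \<in> W" "w' \<in> W" "code w = code w'" for w w'
  proof -
    have "count (mset w) i = count (mset w') i" for i
    proof -
      have "count (mset w) (inv_into UNIV num (num i)) = count (mset w') (inv_into UNIV num (num i))"
        by (rule digits_unique[of "CARD('n)" "\<lambda>k. count (mset w) (inv_into UNIV num k)" N
            "\<lambda>k. count (mset w') (inv_into UNIV num k)" "num i"])
          (simp_all only: N[OF that(1)] N[OF that(2)] code[symmetric] that(3) num_less)
      then show ?thesis by (simp only: inv_f_f[OF inj_num])
    qed
    then have "mset w = mset w'" by (rule multiset_eqI)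
    then show ?thesis using inj that by (auto dest: inj_onD)
  qed
  define P where "P = (\<Sum>w\<in>W. Polynomial.monom (c w) (code w))"
  have "poly P t = 0" for t
  proof -
    define v :: "complex^'n" where "v = (\<chi> i. t ^ (N ^ num i))"
    have "wmon w v = t ^ code w" for w
      by (induction w) (simp_all add: wmon_def v_def code_def power_add)
    then show ?thesis using zero[of v] by (simp add: P_def poly_sum poly_monom)
  qed
  then have "P = 0" using poly_all_0_iff_0 by blast
  then have "0 = poly.coeff P (code w0)" by simp
  also have "\<dots> = (\<Sum>w\<in>W. if w = w0 then c w0 else 0)"
    unfolding P_def Polynomial.coeff_sum using code_inj[OF _ w0] by (intro sum.cong) auto
  also have "\<dots> = c w0" using fin w0 by simp
  finally show ?thesis by simp
qed

context finite_rep
begin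

definition mon :: "'n list \<Rightarrow> 'g \<Rightarrow> ('g, 'n) gfun" where
  "mon x g = foldr (\<lambda>i y. Xv i \<star> y) x (gel g)"

lemma mon_simps [simp]: "mon [] g = gel g" "mon (i # x) g = Xv i \<star> mon x g"
  by (simp_all add: mon_def)

lemma mon_eval: "g \<in> carrier G \<Longrightarrow> mon x g h v = (if h = g then wmon x v else 0)"
proof (induction x arbitrary: h)
  case Nil
  then show ?case by (simp add: gel_def wmon_def)
next
  case (Cons i x)
  then show ?case unfolding mon_simps Xv_sm by (simp add: wmon_def)
qed

lemma mon_mset: "g \<in> carrier G \<Longrightarrow> mset x = mset y \<Longrightarrow> mon x g = mon y g"
  by (intro ext) (simp only: mon_eval wmon_mset[of x y])

text \<open>At the point with all coordinates 1 every monomial has the value 1, so the support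
  determines the group element; for the exponents, two different monomials would be linearly
  independent. Only the order of the letters is lost.\<close>

lemma mon_eqD:
  assumes "mon x g = mon y h" "g \<in> carrier G" "h \<in> carrier G"
  shows "g = h" "mset x = mset y"
proof -
  have one: "wmon z (\<chi> i. 1) = 1" for z :: "'n list" by (induction z) (simp_all add: wmon_def)
  have e: "(if k = g then wmon x v else 0) = (if k = h then wmon y v else 0)" for k v
    using arg_cong[OF assms(1), of "\<lambda>f. f k v"] unfolding mon_eval[OF assms(2)] mon_eval[OF assms(3)] .
  show gh: "g = h"
  proof (rule ccontr)
    assume "g \<noteq> h"
    then have "wmon x (\<chi> i. 1) = 0" using e[of g "\<chi> i. 1"] by (simp only: if_True if_False refl)
    then show False unfolding one by simp
  qed
  have eq: "wmon x v = wmon y v" for v using e[of g v] unfolding gh by (simp only: if_True refl)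
  show "mset x = mset y"
  proof (rule ccontr)
    assume ne: "mset x \<noteq> mset y"
    then have xy: "x \<noteq> y" by (rule contrapos_nn) (rule arg_cong)
    have inj: "inj_on mset {x, y}" using ne unfolding inj_on_def by (metis insertE singletonD)
    have "(\<Sum>w\<in>{x, y}. (if w = x then 1 else - 1 :: complex) * wmon w v) = 0" for v
      using xy[symmetric] by (simp only: sum.insert finite.intros insert_iff empty_iff xy simp_thms if_True if_False sum.empty eq[of v]) simp
    from monomials_independent[OF _ inj this, of x] show False by simp
  qed
qed

definition mons :: "('g, 'n) gfun set" where "mons = {mon x g | x g. g \<in> carrier G}"

lemma mons_independent: "gfun.independent mons"
  unfolding gfun.independent_explicit_module
proof (intro allI impI)
  fix t u b0 assume t: "finite t" "t \<subseteq> mons" and sum0: "(\<Sum>b\<in>t. gscale (u b) b) = 0" and b0: "b0 \<in> t"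
  have monsE: "\<exists>x g. b = mon x g \<and> g \<in> carrier G" if "b \<in> t" for b
    using subsetD[OF t(2) that] unfolding mons_def mem_Collect_eq .
  obtain x0 g0 where b0x: "b0 = mon x0 g0" "g0 \<in> carrier G" using monsE[OF b0] by (elim exE conjE)
  \<comment> \<open>Evaluating at the group element g0 of b0 removes the terms with other group
    elements and leaves a relation between monomials.\<close>
  define t0 where "t0 = {b \<in> t. \<exists>x. b = mon x g0}"
  define wd where "wd b = (SOME x. b = mon x g0)" for b
  have wd: "b = mon (wd b) g0" if "b \<in> t0" for b
  proof -
    have "\<exists>x. b = mon x g0" using that unfolding t0_def mem_Collect_eq by (rule conjunct2)
    then show ?thesis unfolding wd_def by (rule someI_ex)
  qed
  have ft0: "finite t0" using t(1) by (simp add: t0_def)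
  have wd_inj: "inj_on wd t0"
  proof (rule inj_onI)
    fix b b' assume b: "b \<in> t0" "b' \<in> t0" and eq: "wd b = wd b'"
    show "b = b'" by (rule trans[OF wd[OF b(1)], unfolded eq, OF wd[OF b(2), symmetric]])
  qed
  have zero: "(\<Sum>b\<in>t0. u b * wmon (wd b) v) = 0" for v
  proof -
    have "0 = (\<Sum>b\<in>t. gscale (u b) b) g0 v" using sum0 by simp
    also have "\<dots> = (\<Sum>b\<in>t. u b * b g0 v)" by (simp add: sum_apply2)
    also have "\<dots> = (\<Sum>b\<in>t0. u b * b g0 v)"
    proof (rule sum.mono_neutral_right)
      show "\<forall>b\<in>t - t0. u b * b g0 v = 0"
      proof
        fix b assume b: "b \<in> t - t0"
        then obtain x g where x: "b = mon x g" "g \<in> carrier G" using monsE[of b] by (elim DiffE exE conjE) blast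
        have "g \<noteq> g0"
        proof
          assume "g = g0"
          then have "\<exists>x. b = mon x g0" using x(1) by (intro exI[of _ x]) (simp only:)
          then show False using b unfolding t0_def by simp
        qed
        then show "u b * b g0 v = 0" unfolding x(1) by (simp add: mon_eval[OF x(2)])
      qed
    qed (use t in \<open>auto simp: t0_def\<close>)
    also have "\<dots> = (\<Sum>b\<in>t0. u b * wmon (wd b) v)"
    proof (rule sum.cong[OF refl])
      fix b assume "b \<in> t0"
      then have "b g0 v = mon (wd b) g0 g0 v" by (rule arg_cong[OF wd, of _ "\<lambda>z. z g0 v"])
      then show "u b * b g0 v = u b * wmon (wd b) v" using b0x(2) by (simp add: mon_eval)
    qed
    finally show ?thesis by simp
  qed
  have "(\<lambda>x. u (mon x g0)) (wd b0) = 0"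
  proof (rule monomials_independent[of "wd ` t0"])
    show "finite (wd ` t0)" using ft0 by simp
    show "inj_on mset (wd ` t0)"
    proof (rule inj_onI)
      fix x y assume "x \<in> wd ` t0" "y \<in> wd ` t0" and m: "mset x = mset y"
      then obtain b b' where b: "x = wd b" "y = wd b'" "b \<in> t0" "b' \<in> t0" by blast
      have "mon x g0 = mon y g0" by (rule mon_mset[OF b0x(2) m])
      then have "b = b'"
        unfolding b(1,2) by (rule trans[OF trans[OF wd[OF b(3)]] wd[OF b(4), symmetric]])
      then show "x = y" by (simp only: b(1,2))
    qed
    show "(\<Sum>x\<in>wd ` t0. u (mon x g0) * wmon x v) = 0" for v
    proof -
      have "(\<Sum>x\<in>wd ` t0. u (mon x g0) * wmon x v) = (\<Sum>b\<in>t0. u (mon (wd b) g0) * wmon (wd b) v)"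
        using sum.reindex[OF wd_inj] by (simp only: o_def)
      also have "\<dots> = (\<Sum>b\<in>t0. u b * wmon (wd b) v)"
        by (rule sum.cong[OF refl]) (simp only: wd[symmetric])
      finally show ?thesis using zero by (simp only:)
    qed
    show "wd b0 \<in> wd ` t0" using b0 b0x by (auto simp: t0_def)
  qed
  then have *: "u (mon (wd b0) g0) = 0" by (simp only:)
  have "b0 \<in> t0" using b0 b0x by (auto simp: t0_def)
  then show "u b0 = 0" using * by (simp only: wd[symmetric])
qed

end

section \<open>The kernel of the map to the crossed product\<close>

context corner_model
begin

text \<open>
  Pairs of a matrix over the tensor algebra and its value in the crossed product, built letter by
  letter. If the value is 0, reordering the words shows that the matrix has entries in the ideal
  generated by the commutators.
\<close>

inductive_set Gr :: "((nat \<Rightarrow> nat \<Rightarrow> 'r) \<times> ('g, 'n) gfun) set" where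
  zero: "(0, 0) \<in> Gr"
| add: "(A, y) \<in> Gr \<Longrightarrow> (B, z) \<in> Gr \<Longrightarrow> (A + B, y + z) \<in> Gr"
| scale: "(A, y) \<in> Gr \<Longrightarrow> (msc c A, gscale c y) \<in> Gr"
| base: "g \<in> carrier G \<Longrightarrow> (m0 (gel g), gel g) \<in> Gr"
| step: "(A, y) \<in> Gr \<Longrightarrow> (m1 (Xv i) \<diamondop> A, Xv i \<star> y) \<in> Gr"

lemma Gr_unital: "(A, y) \<in> Gr \<Longrightarrow> A \<in> unital"
proof (induction rule: Gr.induct)
  case zero
  show ?case by (rule M.subspace_0[OF subspace_unital])
next
  case (add A y B z)
  show ?case by (rule M.subspace_add[OF subspace_unital add(3,4)])
next
  case (scale A y c)
  show ?case by (rule M.subspace_scale[OF subspace_unital scale(2)])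
next
  case (base g)
  then show ?case by (intro m_unital gel_SA)
next
  case (step A y i)
  then show ?case by (intro mm_unital m_unital Xv_UA)
qed

lemma Gr_sum: "(\<And>a. a \<in> J \<Longrightarrow> (F a, y a) \<in> Gr) \<Longrightarrow> (\<Sum>a\<in>J. F a, \<Sum>a\<in>J. y a) \<in> Gr"
proof (induction J rule: infinite_finite_induct)
  case (insert a J)
  have "(F a, y a) \<in> Gr" "(sum F J, sum y J) \<in> Gr" using insert by blast+
  then show ?case unfolding sum.insert[OF insert.hyps] by (rule Gr.add)
next
  case (infinite J)
  show ?case unfolding sum.infinite[OF infinite(1)] by (rule Gr.zero)
next
  case empty
  show ?case unfolding sum.empty by (rule Gr.zero)
qed

lemma gel_m1: "h \<in> carrier G \<Longrightarrow> m0 (gel h) \<diamondop> m1 (Xv i) = (\<Sum>j\<in>UNIV. msc (vec_nth (vec_nth (\<rho> (inv h)) i) j) (m1 (Xv j) \<diamondop> m0 (gel h)))"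
proof -
  assume h: "h \<in> carrier G"
  have "m0 (gel h) \<diamondop> m1 (Xv i) = m1 (\<Sum>j\<in>UNIV. gscale (vec_nth (vec_nth (\<rho> (inv h)) i) j) (Xv j \<star> gel h))"
    using h by (simp only: m_mult gel_SA Xv_UA gel_Xv)
  also have "\<dots> = (\<Sum>j\<in>UNIV. msc (vec_nth (vec_nth (\<rho> (inv h)) i) j) (m1 (Xv j \<star> gel h)))"
    by (rule m1_sum) (use h in auto)
  finally show ?thesis using h by (simp only: m_mult gel_SA Xv_UA)
qed

text \<open>h passes a letter by the same formula in the matrices and in the crossed product, so the
  two components of a pair stay matched.\<close>

lemma Gr_gel: "(A, y) \<in> Gr \<Longrightarrow> h \<in> carrier G \<Longrightarrow> (m0 (gel h) \<diamondop> A, gel h \<star> y) \<in> Gr"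
proof (induction rule: Gr.induct)
  case zero
  then show ?case using Gr.zero by (simp only: mm_linear sm_linear)
next
  case (add A y B z)
  then show ?case by (simp only: mm_linear sm_linear) (rule Gr.add; blast)
next
  case (scale A y c)
  then show ?case by (simp only: mm_linear sm_linear) (rule Gr.scale; blast)
next
  case (base g)
  then have "(m0 (gel (h \<otimes> g)), gel (h \<otimes> g)) \<in> Gr" by (intro Gr.base) simp
  then show ?case using base by (simp only: m_mult gel_SA gel_mult)
next
  case (step A y i)
  have A: "A \<in> RM" using Gr_unital[OF step(1)] by (rule unital_RM)
  have 1: "m0 (gel h) \<diamondop> (m1 (Xv i) \<diamondop> A) = (\<Sum>j\<in>UNIV. msc (vec_nth (vec_nth (\<rho> (inv h)) i) j) (m1 (Xv j) \<diamondop> (m0 (gel h) \<diamondop> A)))"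
    by (simp only: mm_assoc[symmetric] m_RM gel_SA step(3) Xv_UA A gel_m1) (simp only: mm_sum mm_linear mm_assoc m_RM gel_SA step(3) Xv_UA A)
  have 2: "gel h \<star> (Xv i \<star> y) = (\<Sum>j\<in>UNIV. gscale (vec_nth (vec_nth (\<rho> (inv h)) i) j) (Xv j \<star> (gel h \<star> y)))"
    by (simp only: sm_assoc[symmetric] gel_Xv[OF step(3)]) (simp only: sm_sum sm_linear sm_assoc)
  show ?case unfolding 1 2 by (intro Gr_sum Gr.scale Gr.step step(2) step(3))
qed

lemma Gr_gel_right: "(A, y) \<in> Gr \<Longrightarrow> h \<in> carrier G \<Longrightarrow> (A \<diamondop> m0 (gel h), y \<star> gel h) \<in> Gr"
proof (induction rule: Gr.induct)
  case zero
  then show ?case using Gr.zero by (simp only: mm_linear sm_linear)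
next
  case (add A y B z)
  then show ?case by (simp only: mm_linear sm_linear) (rule Gr.add; blast)
next
  case (scale A y c)
  then show ?case by (simp only: mm_linear sm_linear) (rule Gr.scale; blast)
next
  case (base g)
  then have "(m0 (gel (g \<otimes> h)), gel (g \<otimes> h)) \<in> Gr" by (intro Gr.base) simp
  then show ?case using base by (simp only: m_mult gel_SA gel_mult)
next
  case (step A y i)
  have A: "A \<in> RM" using Gr_unital[OF step(1)] by (rule unital_RM)
  have "(m1 (Xv i) \<diamondop> (A \<diamondop> m0 (gel h)), Xv i \<star> (y \<star> gel h)) \<in> Gr"
    by (intro Gr.step step(2) step(3))
  then show ?case by (simp only: mm_assoc m_RM gel_SA step(3) Xv_UA A sm_assoc)
qed

lemma Gr_SA:
  assumes "(A, y) \<in> Gr" "s \<in> SA"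
  shows "(m0 s \<diamondop> A, s \<star> y) \<in> Gr" "(A \<diamondop> m0 s, y \<star> s) \<in> Gr"
proof -
  have "(\<Sum>g\<in>carrier G. msc (s g 0) (m0 (gel g) \<diamondop> A), \<Sum>g\<in>carrier G. gscale (s g 0) (gel g \<star> y)) \<in> Gr"
    "(\<Sum>g\<in>carrier G. msc (s g 0) (A \<diamondop> m0 (gel g)), \<Sum>g\<in>carrier G. gscale (s g 0) (y \<star> gel g)) \<in> Gr"
    by (intro Gr_sum Gr.scale Gr_gel Gr_gel_right assms(1); assumption)+
  then show "(m0 s \<diamondop> A, s \<star> y) \<in> Gr" "(A \<diamondop> m0 s, y \<star> s) \<in> Gr"
    by (simp_all only: m0_decomp[OF assms(2)] SA_induct_sum[OF assms(2)] mm_sum mm_linear)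
qed

lemma Gr_m0: "s \<in> SA \<Longrightarrow> (m0 s, s) \<in> Gr"
proof -
  assume s: "s \<in> SA"
  have "(m0 s \<diamondop> m0 (gel \<one>), s \<star> gel \<one>) \<in> Gr" by (intro Gr_SA Gr.base s) simp
  then show ?thesis using s by (simp add: m_mult SA_Fn)
qed

lemma Gr_UA:
  assumes "(A, y) \<in> Gr" "u \<in> UA"
  shows "(m1 u \<diamondop> A, u \<star> y) \<in> Gr"
proof -
  have A: "A \<in> RM" using Gr_unital[OF assms(1)] by (rule unital_RM)
  have "(\<Sum>g\<in>carrier G. \<Sum>i\<in>UNIV. msc (u g (axis i 1)) (m1 (Xv i) \<diamondop> (m0 (gel g) \<diamondop> A)),
    \<Sum>g\<in>carrier G. \<Sum>i\<in>UNIV. gscale (u g (axis i 1)) (Xv i \<star> (gel g \<star> y))) \<in> Gr"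
    by (intro Gr_sum Gr.scale Gr.step Gr_gel assms(1); assumption)
  moreover have "m1 u \<diamondop> A = (\<Sum>g\<in>carrier G. \<Sum>i\<in>UNIV. msc (u g (axis i 1)) (m1 (Xv i) \<diamondop> (m0 (gel g) \<diamondop> A)))"
    unfolding m1_decomp[OF assms(2)] mm_sum mm_linear
    by (rule sum.cong[OF refl], rule sum.cong[OF refl]) (simp add: mm_assoc A)
  moreover have "u \<star> y = (\<Sum>g\<in>carrier G. \<Sum>i\<in>UNIV. gscale (u g (axis i 1)) (Xv i \<star> (gel g \<star> y)))"
    by (subst UA_decomp[OF assms(2)]) (simp only: sm_sum sm_linear sm_assoc)
  ultimately show ?thesis by (simp only:)
qed

text \<open>The lift of \<open>mon x g\<close> to matrices; here the order of the letters
  matters.\<close>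

definition PW :: "'n list \<Rightarrow> 'g \<Rightarrow> nat \<Rightarrow> nat \<Rightarrow> 'r" where
  "PW x g = foldr (\<lambda>i A. m1 (Xv i) \<diamondop> A) x (m0 (gel g))"

lemma PW_simps [simp]: "PW [] g = m0 (gel g)" "PW (i # x) g = m1 (Xv i) \<diamondop> PW x g"
  by (simp_all add: PW_def)

lemma PW_RM [simp]: "g \<in> carrier G \<Longrightarrow> PW x g \<in> RM"
  by (induction x) simp_all

section \<open>Reordering words modulo an ideal that contains the commutators\<close>

context
  fixes I :: "'r set"
  assumes I_sub: "R.subspace I"
    and I_mult: "\<And>x y. x \<in> RC \<Longrightarrow> y \<in> I \<Longrightarrow> x \<odot>\<odot> y \<in> I" "\<And>x y. x \<in> RC \<Longrightarrow> y \<in> I \<Longrightarrow> y \<odot>\<odot> x \<in> I"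
    and I_cmt: "\<And>i j k l. (m1 (Xv i) \<diamondop> m1 (Xv j) - m1 (Xv j) \<diamondop> m1 (Xv i)) k l \<in> I"
begin

definition IM :: "(nat \<Rightarrow> nat \<Rightarrow> 'r) set" where "IM = {A. \<forall>k l. A k l \<in> I}"

lemma subspace_IM: "M.subspace IM"
  using I_sub by (auto simp: IM_def M.subspace_def R.subspace_def msc_entry)

lemma IM_mult: "A \<in> RM \<Longrightarrow> B \<in> IM \<Longrightarrow> A \<diamondop> B \<in> IM" "A \<in> RM \<Longrightarrow> B \<in> IM \<Longrightarrow> B \<diamondop> A \<in> IM"
proof -
  assume A: "A \<in> RM" and B: "B \<in> IM"
  then have *: "A k l \<in> RC" "B k l \<in> I" for k l by (auto simp: RM_def IM_def)
  show "A \<diamondop> B \<in> IM" "B \<diamondop> A \<in> IM"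
    unfolding IM_def mm_def by (intro CollectI allI R.subspace_sum[OF I_sub] I_mult *)+
qed

lemma IM_trans: "A - B \<in> IM \<Longrightarrow> B - C \<in> IM \<Longrightarrow> A - C \<in> IM"
  using M.subspace_add[OF subspace_IM, of "A - B" "B - C"] by simp

lemma PW_move:
  assumes g: "g \<in> carrier G"
  shows "PW (x @ i # y) g - PW (i # x @ y) g \<in> IM"
proof (induction x)
  case Nil
  show ?case by (simp only: append_Nil diff_self M.subspace_0[OF subspace_IM])
next
  case (Cons j x)
  have "m1 (Xv j) \<diamondop> (PW (x @ i # y) g - PW (i # x @ y) g) \<in> IM"
    by (rule IM_mult(1)[OF m_RM(2)[OF Xv_UA] Cons])
  then have 1: "PW ((j # x) @ i # y) g - m1 (Xv j) \<diamondop> (m1 (Xv i) \<diamondop> PW (x @ y) g) \<in> IM"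
    by (simp only: mm_diff PW_simps append_Cons)
  have "(m1 (Xv j) \<diamondop> m1 (Xv i) - m1 (Xv i) \<diamondop> m1 (Xv j)) \<diamondop> PW (x @ y) g \<in> IM"
    by (rule IM_mult(2)[OF PW_RM[OF g]]) (unfold IM_def, intro CollectI allI I_cmt)
  then have "m1 (Xv j) \<diamondop> (m1 (Xv i) \<diamondop> PW (x @ y) g) - PW (i # (j # x) @ y) g \<in> IM"
    by (simp only: mm_diff mm_assoc m_RM Xv_UA PW_RM[OF g] PW_simps append_Cons)
  then show ?case by (rule IM_trans[OF 1])
qed

text \<open>Insertion sort: the first letter of x is located in y and pulled to the front.\<close>

lemma PW_perm:
  assumes g: "g \<in> carrier G"
  shows "mset x = mset y \<Longrightarrow> PW x g - PW y g \<in> IM"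
proof (induction x arbitrary: y)
  case Nil
  then have "y = []" by simp
  then show ?case by (simp only: diff_self M.subspace_0[OF subspace_IM])
next
  case (Cons i x)
  have "i \<in> set y" using Cons.prems by (metis list.set_intros(1) set_mset_mset)
  then obtain u v where y: "y = u @ i # v" by (meson split_list)
  then have "mset x = mset (u @ v)" using Cons.prems by simp
  then have "m1 (Xv i) \<diamondop> (PW x g - PW (u @ v) g) \<in> IM"
    by (rule IM_mult(1)[OF m_RM(2)[OF Xv_UA] Cons.IH])
  then have 1: "PW (i # x) g - PW (i # u @ v) g \<in> IM" by (simp only: mm_diff PW_simps)
  have "PW (i # u @ v) g - PW y g \<in> IM"
    using M.subspace_neg[OF subspace_IM PW_move[OF g, of u i v]] by (simp only: y minus_diff_eq append_Cons)
  then show ?case by (rule IM_trans[OF 1])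
qed

text \<open>Because the monomials are independent, choosing one word for each defines a linear map L
  from the crossed product to matrices. Along the construction of a pair (A, y) the difference A - L
  y stays in the ideal, and L 0 = 0.\<close>

lemma Gr_kernel:
  assumes "(A, 0) \<in> Gr"
  shows "A k l \<in> I"
proof -
  interpret gp: vector_space_pair "gscale :: complex \<Rightarrow> ('g, 'n) gfun \<Rightarrow> _" msc ..
  \<comment> \<open>A monomial determines its word only up to order; \<open>ch\<close> fixes one of
    the words together with the group element.\<close>
  define ch where "ch b = (SOME z. b = mon (fst z) (snd z) \<and> snd z \<in> carrier G)" for b
  define L where "L = gp.construct mons (\<lambda>b. PW (fst (ch b)) (snd (ch b)))"
  have lin: "Vector_Spaces.linear gscale msc L"
    unfolding L_def by (rule gp.linear_construct[OF mons_independent])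
  note L_simps = gp.linear_add[OF lin] gp.linear_scale[OF lin] gp.linear_0[OF lin]
  have L_mon: "\<exists>x'. L (mon x g) = PW x' g \<and> mset x' = mset x" if g: "g \<in> carrier G" for x g
  proof -
    have "\<exists>z. mon x g = mon (fst z) (snd z) \<and> snd z \<in> carrier G" by (rule exI[of _ "(x, g)"]) (simp add: g)
    from someI_ex[OF this] have ch: "mon x g = mon (fst (ch (mon x g))) (snd (ch (mon x g))) \<and> snd (ch (mon x g)) \<in> carrier G"
      unfolding ch_def .
    note D = mon_eqD[OF conjunct1[OF ch] g conjunct2[OF ch]]
    have "L (mon x g) = PW (fst (ch (mon x g))) (snd (ch (mon x g)))"
      unfolding L_def by (rule gp.construct_basis[OF mons_independent]) (unfold mons_def, use g in blast)
    then have "L (mon x g) = PW (fst (ch (mon x g))) g" unfolding D(1)[symmetric] .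
    then show ?thesis using sym[OF D(2)] by (intro exI conjI)
  qed
  \<comment> \<open>Putting x_i in front of the chosen word of a monomial may give another word than
    the one chosen for the product; the two differ by a reordering, hence by an element of the
    ideal.\<close>
  have Lstep: "m1 (Xv i) \<diamondop> L y - L (Xv i \<star> y) \<in> IM \<and> Xv i \<star> y \<in> gfun.span mons" if "y \<in> gfun.span mons" for i y
    using that
  proof (induction rule: gfun.span_induct_alt)
    case base
    show ?case unfolding L_simps mm_linear sm_linear diff_self
      by (intro conjI M.subspace_0[OF subspace_IM] gfun.span_zero)
  next
    case (step c b y)
    then obtain x g where x: "b = mon x g" "g \<in> carrier G" by (auto simp: mons_def)
    obtain x' where x': "L (mon x g) = PW x' g" "mset x' = mset x" using L_mon[OF x(2)] by blast
    obtain x'' where x'': "L (mon (i # x) g) = PW x'' g" "mset x'' = mset (i # x)" using L_mon[OF x(2)] by blast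
    have "PW (i # x') g - PW x'' g \<in> IM" by (rule PW_perm[OF x(2)]) (simp add: x' x'')
    then have 1: "m1 (Xv i) \<diamondop> L b - L (Xv i \<star> b) \<in> IM"
      using x x'(1) x''(1) by (simp only: PW_simps mon_simps)
    have "m1 (Xv i) \<diamondop> L (gscale c b + y) - L (Xv i \<star> (gscale c b + y)) =
      msc c (m1 (Xv i) \<diamondop> L b - L (Xv i \<star> b)) + (m1 (Xv i) \<diamondop> L y - L (Xv i \<star> y))"
      by (simp only: L_simps mm_linear sm_linear M.scale_right_diff_distrib) (simp only: add_diff_add)
    then have "m1 (Xv i) \<diamondop> L (gscale c b + y) - L (Xv i \<star> (gscale c b + y)) \<in> IM"
      using 1 step(2) M.subspace_add[OF subspace_IM] M.subspace_scale[OF subspace_IM] by (simp only:)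
    moreover have "Xv i \<star> b \<in> mons" unfolding x(1) mon_simps(2)[symmetric] mons_def using x(2) by blast
    then have "Xv i \<star> (gscale c b + y) \<in> gfun.span mons"
      unfolding sm_linear by (intro gfun.span_add gfun.span_scale gfun.span_base conjunct2[OF step(2)])
    ultimately show ?case by blast
  qed
  have claim: "B - L y \<in> IM \<and> y \<in> gfun.span mons" if "(B, y) \<in> Gr" for B y
    using that
  proof (induction rule: Gr.induct)
    case zero
    show ?case unfolding L_simps diff_self by (intro conjI M.subspace_0[OF subspace_IM] gfun.span_zero)
  next
    case (add A y B z)
    have "A + B - L (y + z) = (A - L y) + (B - L z)" by (simp only: L_simps add_diff_add)
    then show ?case
      using M.subspace_add[OF subspace_IM conjunct1[OF add(3)] conjunct1[OF add(4)]]
        gfun.span_add[OF conjunct2[OF add(3)] conjunct2[OF add(4)]] by (simp only: simp_thms)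
  next
    case (scale A y c)
    have "msc c A - L (gscale c y) = msc c (A - L y)" by (simp only: L_simps M.scale_right_diff_distrib)
    then show ?case
      using M.subspace_scale[OF subspace_IM conjunct1[OF scale(2)]] gfun.span_scale[OF conjunct2[OF scale(2)]]
      by (simp only: simp_thms)
  next
    case (base g)
    obtain x' where "L (mon [] g) = PW x' g" "mset x' = mset []" using L_mon[OF base] by blast
    then have "L (gel g) = m0 (gel g)" by simp
    moreover have "gel g \<in> mons" unfolding mons_def using base mon_simps(1)[symmetric] by blast
    ultimately show ?case using M.subspace_0[OF subspace_IM] gfun.span_base[of "gel g" mons]
      by (simp only: diff_self simp_thms)
  next
    case (step A y i)
    have "m1 (Xv i) \<diamondop> (A - L y) \<in> IM"
      by (rule IM_mult(1)[OF m_RM(2)[OF Xv_UA]]) (use step in blast)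
    then have "m1 (Xv i) \<diamondop> A - m1 (Xv i) \<diamondop> L y \<in> IM" by (simp only: mm_diff)
    then show ?case using Lstep[of y i] step IM_trans by blast
  qed
  have "A - L 0 \<in> IM" using claim[OF assms] by blast
  then have "A \<in> IM" by (simp only: L_simps diff_zero)
  then show ?thesis by (simp add: IM_def)
qed

end

text \<open>A homomorphism with the right values in degrees 0 and 1 is determined on entries: in
  each product the inner sum over j collapses by the decomposition of 1.\<close>

lemma Gr_entry:
  fixes pi :: "'r \<Rightarrow> ('g, 'n) gfun"
  assumes add: "\<And>x y. pi (x + y) = pi x + pi y" and sc: "\<And>c x. pi (sc c x) = gscale c (pi x)"
    and mult: "\<And>x y. x \<in> RC \<Longrightarrow> y \<in> RC \<Longrightarrow> pi (x \<odot>\<odot> y) = pi x \<star> pi y"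
    and pi0: "\<And>s. s \<in> SA \<Longrightarrow> pi (n0 s) = e \<star> s \<star> e" and pi1: "\<And>u. u \<in> UA \<Longrightarrow> pi (n1 u) = e \<star> u \<star> e"
    and Gr: "(A, y) \<in> Gr"
  shows "pi (A k l) = e \<star> q k \<star> y \<star> p l \<star> e"
  using Gr
proof (induction arbitrary: k l rule: Gr.induct)
  case zero
  have "pi (sc 0 0) = gscale 0 (pi 0)" by (rule sc)
  then have "pi 0 = 0" by (simp only: R.scale_zero_left gfun.scale_zero_left)
  moreover have "(0 :: nat \<Rightarrow> nat \<Rightarrow> 'r) k l = 0" by simp
  ultimately show ?case by (simp only: sm_linear)
next
  case (add A y B z)
  moreover have "(A + B) k l = A k l + B k l" by simp
  ultimately show ?case by (simp only: assms(1) sm_linear)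
next
  case (scale A y c)
  then show ?case by (simp only: msc_entry assms(2) sm_linear)
next
  case (base g)
  then show ?case by (simp add: m0_def pi0 sm_assoc)
next
  case (step A y i)
  have sum: "pi (sum f J) = (\<Sum>a\<in>J. pi (f a))" for f and J :: "nat set"
  proof -
    have "pi 0 = 0" using sc[of 0 0] by (simp only: R.scale_zero_left gfun.scale_zero_left)
    then show ?thesis by (induction J rule: infinite_finite_induct) (simp_all add: assms(1))
  qed
  have RCs: "m1 (Xv i) k j \<in> RC" "A j l \<in> RC" for j
    using m_RM(2)[OF Xv_UA] unital_RM[OF Gr_unital[OF step(1)]] by (auto simp: RM_def)
  have p1: "pi (m1 (Xv i) k j) = e \<star> (q k \<star> Xv i \<star> p j) \<star> e" for j
    unfolding m1_def by (rule pi1) simp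
  have "pi ((m1 (Xv i) \<diamondop> A) k l) = (\<Sum>j<r. (e \<star> (q k \<star> Xv i \<star> p j) \<star> e) \<star> (e \<star> q j \<star> y \<star> p l \<star> e))"
    unfolding mm_def sum by (rule sum.cong[OF refl]) (simp only: mult[OF RCs] step(2) p1)
  also have "\<dots> = (\<Sum>j<r. (e \<star> (q k \<star> Xv i)) \<star> p j \<star> e \<star> (q j \<star> (y \<star> p l \<star> e)))"
  proof (rule sum.cong[OF refl])
    fix j
    have "(e \<star> (q k \<star> Xv i \<star> p j) \<star> e) \<star> (e \<star> q j \<star> y \<star> p l \<star> e) = (e \<star> (q k \<star> Xv i)) \<star> p j \<star> (e \<star> e) \<star> (q j \<star> (y \<star> p l \<star> e))"
      by (simp only: sm_assoc)
    then show "(e \<star> (q k \<star> Xv i \<star> p j) \<star> e) \<star> (e \<star> q j \<star> y \<star> p l \<star> e) = (e \<star> (q k \<star> Xv i)) \<star> p j \<star> e \<star> (q j \<star> (y \<star> p l \<star> e))"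
      by (simp only: e_idem)
  qed
  also have "\<dots> = (e \<star> (q k \<star> Xv i)) \<star> (y \<star> p l \<star> e)" by (rule full_insert) simp
  finally show ?case by (simp only: sm_assoc)
qed

end

context corner_pot
begin

text \<open>The value pairs antisymmetric coefficients with the products x_i x_j = x_j x_i, hence is
  its own negative.\<close>

lemma Gr_TS2:
  assumes b: "\<And>i j. b [i, j] = - b [j, i]" and a: "a \<in> SA" and y: "y \<in> SA"
  shows "(m0 a \<diamondop> TS 2 b \<diamondop> m0 y, 0) \<in> Gr"
proof -
  define F where "F i j = gscale (b [i, j]) (Xv i \<star> (Xv j \<star> y))" for i j
  have comm: "Xv i \<star> (Xv j \<star> y) = Xv j \<star> (Xv i \<star> y)" for i j
    by (intro ext) (simp add: Xv_sm)
  have F: "F i j = - F j i" for i j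
    unfolding F_def by (subst b) (simp only: comm[of i j] gfun.scale_minus_left)
  have "(\<Sum>i\<in>UNIV. \<Sum>j\<in>UNIV. F i j) = (\<Sum>j\<in>UNIV. \<Sum>i\<in>UNIV. F i j)" by (rule sum.swap)
  also have "\<dots> = (\<Sum>j\<in>UNIV. \<Sum>i\<in>UNIV. - F j i)"
    by (rule sum.cong[OF refl], rule sum.cong[OF refl], rule F)
  also have "\<dots> = - (\<Sum>i\<in>UNIV. \<Sum>j\<in>UNIV. F i j)" by (simp only: sum_negf)
  finally have neg: "(\<Sum>i\<in>UNIV. \<Sum>j\<in>UNIV. F i j) = - (\<Sum>i\<in>UNIV. \<Sum>j\<in>UNIV. F i j)" .
  have "x = 0" if "x = - x" for x :: "('g, 'n) gfun"
  proof (intro ext)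
    fix g v
    have "x g v = - x g v" using arg_cong[OF that, of "\<lambda>f. f g v"] by (simp only: fun_Compl_def)
    then show "x g v = 0 g v" by simp
  qed
  from this[OF neg] have F0: "(\<Sum>i\<in>UNIV. \<Sum>j\<in>UNIV. F i j) = 0" .
  have "(\<Sum>i\<in>UNIV. \<Sum>j\<in>UNIV. msc (b [i, j]) (m1 (Xv i) \<diamondop> (m1 (Xv j) \<diamondop> m0 y)), \<Sum>i\<in>UNIV. \<Sum>j\<in>UNIV. F i j) \<in> Gr"
    unfolding F_def by (intro Gr_sum Gr.scale Gr.step Gr_m0 y)
  then have "(TS 2 b \<diamondop> m0 y, 0) \<in> Gr"
    unfolding F0 TS2 by (simp only: mm_sum mm_linear mm_assoc m_RM Xv_UA y)
  from Gr_SA(1)[OF this a] show ?thesis by (simp only: sm_linear mm_assoc m_RM TS_RM a y)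
qed

lemma QS_vanish:
  fixes pi :: "'r \<Rightarrow> ('g, 'n) gfun"
  assumes add: "\<And>x y. pi (x + y) = pi x + pi y" and sc: "\<And>c x. pi (sc c x) = gscale c (pi x)"
    and mult: "\<And>x y. x \<in> RC \<Longrightarrow> y \<in> RC \<Longrightarrow> pi (om x y) = pi x \<star> pi y"
    and pi0: "\<And>s. s \<in> SA \<Longrightarrow> pi (n0 s) = e \<star> s \<star> e" and pi1: "\<And>u. u \<in> UA \<Longrightarrow> pi (n1 u) = e \<star> u \<star> e"
    and n: "CARD('n) \<ge> 2" and t: "t \<in> QS (CARD('n) - 2)"
  shows "pi t = 0"
proof -
  have zero: "pi 0 = 0" using sc[of 0 0] by (simp only: R.scale_zero_left gfun.scale_zero_left)
  have sub: "R.subspace {t. pi t = 0}"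
    unfolding R.subspace_def mem_Collect_eq by (simp only: zero add sc gfun.scale_zero_right add_0_right) simp
  have "pi ((m0 a \<diamondop> TS (CARD('n) - (CARD('n) - 2)) (\<lambda>x. eps (c @ x)) \<diamondop> m0 y) r r) = 0"
    if "a \<in> SA" "y \<in> SA" "length c = CARD('n) - 2" for a c y
  proof -
    have two: "CARD('n) - (CARD('n) - 2) = 2" using n by simp
    have "eps (c @ [i, j]) = - eps (c @ [j, i :: 'n])" for i j by (rule eps_swap) (use that(3) n in simp)
    from Gr_entry[OF add sc mult pi0 pi1 Gr_TS2[of "\<lambda>x. eps (c @ x)", OF this that(1,2)], of r r]
    show ?thesis unfolding two by (simp only: sm_linear)
  qed
  then have "QS (CARD('n) - 2) \<subseteq> {t. pi t = 0}"
    unfolding QS_def by (intro R.span_minimal[OF _ sub]) (clarify; simp only: mem_Collect_eq)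
  then show ?thesis using t by (rule subsetD[THEN CollectD])
qed

end

section \<open>Concrete corners of the crossed product\<close>

text \<open>S and V are copies, along a and b, of the corners e S e and e U e of the crossed
  product. From closure and compatibility of a and b with the operations all laws are transported,
  so each instance has only elementary identities to check.\<close>

locale concrete_corner = finite_rep G \<rho>
  for G :: "('g, 'm) monoid_scheme" (structure) and \<rho> :: "'g \<Rightarrow> complex^'n^'n" +
  fixes S :: "'s calgebra" and V :: "('s, 'v) bimodule" and Tr :: "'s \<Rightarrow> complex"
    and a :: "'s \<Rightarrow> ('g, 'n) gfun" and b :: "'v \<Rightarrow> ('g, 'n) gfun"
    and e :: "('g, 'n) gfun" and r :: nat and p q :: "nat \<Rightarrow> ('g, 'n) gfun"
    and w w' :: "('g, 'n) gfun"
  assumes c_e_SA [simp]: "e \<in> SA" and c_e_idem: "e \<star> e = e" and c_tw_e: "tw e = e"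
    and c_pq_SA [simp]: "\<And>k. p k \<in> SA" "\<And>k. q k \<in> SA"
    and c_full: "(\<Sum>k<r. p k \<star> e \<star> q k) = gel \<one>"
    and c_pq_r: "p r = gel \<one>" "q r = gel \<one>"
    and c_w_SA [simp]: "w \<in> SA" "w' \<in> SA" and c_ww': "w \<star> w' = gel \<one>" "w' \<star> w = gel \<one>"
    and c_w_central: "\<And>s. s \<in> SA \<Longrightarrow> w \<star> s = s \<star> w" and c_tw_w: "tw w = w"
    and a_bij: "bij_betw a (carrier S) {x \<in> SA. e \<star> x \<star> e = x}"
    and b_bij: "bij_betw b (bcarrier V) {u \<in> UA. e \<star> u \<star> e = u}"
    and c_S_closed [simp]:
      "\<And>s t. s \<in> carrier S \<Longrightarrow> t \<in> carrier S \<Longrightarrow> s \<otimes>\<^bsub>S\<^esub> t \<in> carrier S"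
      "\<And>s t. s \<in> carrier S \<Longrightarrow> t \<in> carrier S \<Longrightarrow> s \<oplus>\<^bsub>S\<^esub> t \<in> carrier S"
      "\<one>\<^bsub>S\<^esub> \<in> carrier S"
      "\<And>c s. s \<in> carrier S \<Longrightarrow> c \<odot>\<^bsub>S\<^esub> s \<in> carrier S"
    and c_V_closed [simp]:
      "\<And>v v'. v \<in> bcarrier V \<Longrightarrow> v' \<in> bcarrier V \<Longrightarrow> badd V v v' \<in> bcarrier V"
      "\<And>c v. v \<in> bcarrier V \<Longrightarrow> bscale V c v \<in> bcarrier V"
      "\<And>s v. s \<in> carrier S \<Longrightarrow> v \<in> bcarrier V \<Longrightarrow> lact V s v \<in> bcarrier V"
      "\<And>s v. s \<in> carrier S \<Longrightarrow> v \<in> bcarrier V \<Longrightarrow> ract V v s \<in> bcarrier V"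
    and a_hom:
      "\<And>s t. s \<in> carrier S \<Longrightarrow> t \<in> carrier S \<Longrightarrow> a (s \<otimes>\<^bsub>S\<^esub> t) = a s \<star> a t"
      "\<And>s t. s \<in> carrier S \<Longrightarrow> t \<in> carrier S \<Longrightarrow> a (s \<oplus>\<^bsub>S\<^esub> t) = a s + a t"
      "a \<one>\<^bsub>S\<^esub> = e"
      "\<And>c s. s \<in> carrier S \<Longrightarrow> a (c \<odot>\<^bsub>S\<^esub> s) = gscale c (a s)"
    and b_hom:
      "\<And>v v'. v \<in> bcarrier V \<Longrightarrow> v' \<in> bcarrier V \<Longrightarrow> b (badd V v v') = b v + b v'"
      "\<And>c v. v \<in> bcarrier V \<Longrightarrow> b (bscale V c v) = gscale c (b v)"
      "\<And>s v. s \<in> carrier S \<Longrightarrow> v \<in> bcarrier V \<Longrightarrow> b (lact V s v) = a s \<star> b v"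
      "\<And>s v. s \<in> carrier S \<Longrightarrow> v \<in> bcarrier V \<Longrightarrow> b (ract V v s) = b v \<star> a s"
    and c_Tr: "\<And>s. s \<in> carrier S \<Longrightarrow> Tr s = lam (w' \<star> a s)"
begin

lemma e_idem2: "e \<star> (e \<star> x) = e \<star> x"
  by (simp only: sm_assoc[symmetric] c_e_idem)

lemma cut_absorb:
  assumes "e \<star> x \<star> e = x"
  shows "e \<star> x = x" "x \<star> e = x"
proof -
  have "e \<star> (e \<star> x \<star> e) = e \<star> x \<star> e" "(e \<star> x \<star> e) \<star> e = e \<star> x \<star> e" by (simp_all only: sm_assoc e_idem2 c_e_idem)
  then show "e \<star> x = x" "x \<star> e = x" unfolding assms .
qed

lemma a_SA [simp]: "s \<in> carrier S \<Longrightarrow> a s \<in> SA" and a_cut: "s \<in> carrier S \<Longrightarrow> e \<star> a s \<star> e = a s"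
  using bij_betwE[OF a_bij] by blast+

lemma b_UA [simp]: "v \<in> bcarrier V \<Longrightarrow> b v \<in> UA" and b_cut: "v \<in> bcarrier V \<Longrightarrow> e \<star> b v \<star> e = b v"
  using bij_betwE[OF b_bij] by blast+

lemma ab_e [simp]:
  "s \<in> carrier S \<Longrightarrow> e \<star> a s = a s" "s \<in> carrier S \<Longrightarrow> a s \<star> e = a s"
  "v \<in> bcarrier V \<Longrightarrow> e \<star> b v = b v" "v \<in> bcarrier V \<Longrightarrow> b v \<star> e = b v"
  by (erule cut_absorb[OF a_cut] cut_absorb[OF b_cut])+

lemma ab_e2 [simp]:
  "s \<in> carrier S \<Longrightarrow> e \<star> (a s \<star> x) = a s \<star> x" "s \<in> carrier S \<Longrightarrow> a s \<star> (e \<star> x) = a s \<star> x"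
  "v \<in> bcarrier V \<Longrightarrow> e \<star> (b v \<star> x) = b v \<star> x" "v \<in> bcarrier V \<Longrightarrow> b v \<star> (e \<star> x) = b v \<star> x"
  by (simp_all only: sm_assoc[symmetric] ab_e)

lemma a_eqI: "s \<in> carrier S \<Longrightarrow> t \<in> carrier S \<Longrightarrow> a s = a t \<Longrightarrow> s = t"
  and b_eqI: "v \<in> bcarrier V \<Longrightarrow> v' \<in> bcarrier V \<Longrightarrow> b v = b v' \<Longrightarrow> v = v'"
  using bij_betw_imp_inj_on[OF a_bij] bij_betw_imp_inj_on[OF b_bij] by (meson inj_onD)+

definition cutS :: "('g, 'n) gfun \<Rightarrow> 's" where "cutS x = the_inv_into (carrier S) a (e \<star> x \<star> e)"
definition cutV :: "('g, 'n) gfun \<Rightarrow> 'v" where "cutV x = the_inv_into (bcarrier V) b (e \<star> x \<star> e)"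

lemma cut_cut: "e \<star> (e \<star> x \<star> e) \<star> e = e \<star> x \<star> e"
  by (simp only: sm_assoc e_idem2 c_e_idem)

lemma cutS_closed [simp]: "x \<in> SA \<Longrightarrow> cutS x \<in> carrier S" and a_cutS: "x \<in> SA \<Longrightarrow> a (cutS x) = e \<star> x \<star> e"
proof -
  assume "x \<in> SA"
  then have *: "e \<star> x \<star> e \<in> {x \<in> SA. e \<star> x \<star> e = x}" by (simp add: cut_cut)
  show "cutS x \<in> carrier S" "a (cutS x) = e \<star> x \<star> e"
    unfolding cutS_def
    using the_inv_into_into[OF bij_betw_imp_inj_on[OF a_bij] _ subset_refl] f_the_inv_into_f_bij_betw[OF a_bij] *
    by (simp_all only: bij_betw_imp_surj_on[OF a_bij] simp_thms)
qed

lemma cutV_closed [simp]: "x \<in> UA \<Longrightarrow> cutV x \<in> bcarrier V" and b_cutV: "x \<in> UA \<Longrightarrow> b (cutV x) = e \<star> x \<star> e"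
proof -
  assume "x \<in> UA"
  then have *: "e \<star> x \<star> e \<in> {x \<in> UA. e \<star> x \<star> e = x}" by (simp add: cut_cut)
  show "cutV x \<in> bcarrier V" "b (cutV x) = e \<star> x \<star> e"
    unfolding cutV_def
    using the_inv_into_into[OF bij_betw_imp_inj_on[OF b_bij] _ subset_refl] f_the_inv_into_f_bij_betw[OF b_bij] *
    by (simp_all only: bij_betw_imp_surj_on[OF b_bij] simp_thms)
qed

lemma cut_ab [simp]: "s \<in> carrier S \<Longrightarrow> cutS (a s) = s" "v \<in> bcarrier V \<Longrightarrow> cutV (b v) = v"
  by (rule a_eqI b_eqI; simp add: a_cutS b_cutV)+

lemma cutS_linear:
  "x \<in> SA \<Longrightarrow> y \<in> SA \<Longrightarrow> cutS (x + y) = cutS x \<oplus>\<^bsub>S\<^esub> cutS y" "x \<in> SA \<Longrightarrow> cutS (gscale c x) = c \<odot>\<^bsub>S\<^esub> cutS x"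
  by (rule a_eqI; simp add: a_cutS a_hom gfun.subspace_add[OF subspace_SA] gfun.subspace_scale[OF subspace_SA])+

lemma cutV_linear:
  "x \<in> UA \<Longrightarrow> y \<in> UA \<Longrightarrow> cutV (x + y) = badd V (cutV x) (cutV y)" "x \<in> UA \<Longrightarrow> cutV (gscale c x) = bscale V c (cutV x)"
  by (rule b_eqI; simp add: b_cutV b_hom gfun.subspace_add[OF subspace_UA] gfun.subspace_scale[OF subspace_UA])+

lemma cut_cong: "cutS (e \<star> x \<star> e) = cutS x" "cutV (e \<star> x \<star> e) = cutV x"
  by (simp_all only: cutS_def cutV_def cut_cut)

lemma cut_mult:
  "x \<in> SA \<Longrightarrow> y \<in> SA \<Longrightarrow> cutS x \<otimes>\<^bsub>S\<^esub> cutS y = cutS (x \<star> e \<star> y)"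
  "x \<in> SA \<Longrightarrow> u \<in> UA \<Longrightarrow> lact V (cutS x) (cutV u) = cutV (x \<star> e \<star> u)"
  "x \<in> SA \<Longrightarrow> u \<in> UA \<Longrightarrow> ract V (cutV u) (cutS x) = cutV (u \<star> e \<star> x)"
  by (rule a_eqI b_eqI; simp add: a_cutS b_cutV a_hom b_hom sm_assoc e_idem2)+

sublocale calg_bimodule S V
  by unfold_locales
    ((intro c_S_closed c_V_closed; assumption) |
     (rule a_eqI b_eqI; simp add: a_hom b_hom sm_assoc))+

lemma w'_central: "s \<in> SA \<Longrightarrow> w' \<star> s = s \<star> w'"
proof -
  assume s: "s \<in> SA"
  have "w' \<star> s = w' \<star> (s \<star> (w \<star> w'))" using s by (simp add: c_ww' SA_Fn)
  also have "\<dots> = w' \<star> (w \<star> s) \<star> w'" by (simp only: c_w_central[OF s] sm_assoc)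
  also have "\<dots> = (w' \<star> w) \<star> (s \<star> w')" by (simp only: sm_assoc)
  also have "\<dots> = s \<star> w'" by (simp add: c_ww')
  finally show ?thesis .
qed

lemma tw_w': "tw w' = w'"
proof -
  have "tw (w \<star> w') = gel \<one>" by (simp add: c_ww' twist_gel)
  then have "w \<star> tw w' = gel \<one>" by (simp only: twist_mult c_tw_w)
  then have "w' \<star> (w \<star> tw w') = w' \<star> gel \<one>" by (rule arg_cong)
  then show ?thesis by (simp add: sm_assoc[symmetric] c_ww' SA_Fn)
qed

lemma w_cancel: "w' \<star> (w \<star> x) = gel \<one> \<star> x" "w \<star> (w' \<star> x) = gel \<one> \<star> x"
  by (simp_all only: sm_assoc[symmetric] c_ww')

text \<open>By cyclicity of the trace an e at one end is absorbed at the other.\<close>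

lemma lam_cut: "x \<in> SA \<Longrightarrow> y \<in> SA \<Longrightarrow> e \<star> x = x \<Longrightarrow> lam (x \<star> (y \<star> e)) = lam (x \<star> y)"
  "x \<in> SA \<Longrightarrow> y \<in> SA \<Longrightarrow> x \<star> e = x \<Longrightarrow> lam (x \<star> (e \<star> y)) = lam (x \<star> y)"
  "x \<in> SA \<Longrightarrow> y \<in> SA \<Longrightarrow> y \<star> e = y \<Longrightarrow> lam (e \<star> (x \<star> y)) = lam (x \<star> y)"
  by (metis SA_mult c_e_SA lam_comm sm_assoc)+

text \<open>The factor w cancels the w' in the trace: whatever represents a functional by
  \<open>lam\<close> represents it by the given trace after multiplication by w.\<close>

lemma Tr_cutS: "x \<in> SA \<Longrightarrow> s \<in> carrier S \<Longrightarrow> Tr (cutS (w \<star> x) \<otimes>\<^bsub>S\<^esub> s) = lam (x \<star> a s)"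
  "x \<in> SA \<Longrightarrow> s \<in> carrier S \<Longrightarrow> Tr (s \<otimes>\<^bsub>S\<^esub> cutS (x \<star> w)) = lam (a s \<star> x)"
proof -
  assume x: "x \<in> SA" and s: "s \<in> carrier S"
  have "Tr (cutS (w \<star> x) \<otimes>\<^bsub>S\<^esub> s) = lam (w' \<star> (e \<star> w) \<star> (x \<star> a s))"
    using x s by (simp add: c_Tr a_hom a_cutS sm_assoc)
  also have "\<dots> = lam (e \<star> (x \<star> a s))"
    unfolding c_w_central[OF c_e_SA, symmetric] using x s by (simp add: sm_assoc w_cancel SA_Fn)
  also have "\<dots> = lam (x \<star> a s)" using x s by (simp add: lam_cut)
  finally show "Tr (cutS (w \<star> x) \<otimes>\<^bsub>S\<^esub> s) = lam (x \<star> a s)" .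
  have "Tr (s \<otimes>\<^bsub>S\<^esub> cutS (x \<star> w)) = lam (w' \<star> (a s \<star> (x \<star> (w \<star> e))))"
    using x s by (simp add: c_Tr a_hom a_cutS sm_assoc)
  also have "\<dots> = lam ((a s \<star> (x \<star> (w \<star> e))) \<star> w')" using x s by (intro lam_comm) simp_all
  also have "\<dots> = lam (a s \<star> (x \<star> (e \<star> (w \<star> w'))))" by (simp only: c_w_central[OF c_e_SA] sm_assoc)
  also have "\<dots> = lam (a s \<star> (x \<star> e))" by (simp add: c_ww' SA_Fn)
  also have "\<dots> = lam (a s \<star> x)" using x s by (simp add: lam_cut)
  finally show "Tr (s \<otimes>\<^bsub>S\<^esub> cutS (x \<star> w)) = lam (a s \<star> x)" .
qed

sublocale traced_bimodule S V Tr
proof unfold_locales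
  fix s t c assume s: "s \<in> carrier S"
  show "Tr (c \<odot>\<^bsub>S\<^esub> s) = c * Tr s" using s by (simp add: c_Tr a_hom)
  assume t: "t \<in> carrier S"
  show "Tr (s \<oplus>\<^bsub>S\<^esub> t) = Tr s + Tr t" using s t by (simp add: c_Tr a_hom)
  have "lam (w' \<star> (a s \<star> a t)) = lam ((w' \<star> a s) \<star> a t)" by (simp only: sm_assoc)
  also have "\<dots> = lam (a t \<star> (w' \<star> a s))" using s t by (intro lam_comm) simp_all
  also have "\<dots> = lam (w' \<star> (a t \<star> a s))" using t by (simp only: sm_assoc[symmetric] w'_central a_SA)
  finally show "Tr (s \<otimes>\<^bsub>S\<^esub> t) = Tr (t \<otimes>\<^bsub>S\<^esub> s)" using s t by (simp add: c_Tr a_hom)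
next
  fix f assume f: "\<And>s t. s \<in> carrier S \<Longrightarrow> t \<in> carrier S \<Longrightarrow> f (s \<oplus>\<^bsub>S\<^esub> t) = f s + f t"
    "\<And>c s. s \<in> carrier S \<Longrightarrow> f (c \<odot>\<^bsub>S\<^esub> s) = c * f s"
  obtain y where y: "y \<in> SA" "\<And>x. x \<in> SA \<Longrightarrow> lam (y \<star> x) = f (cutS x)"
    using lam_represent[of "\<lambda>x. f (cutS x)"] by (auto simp: cutS_linear f)
  show "\<exists>a\<in>carrier S. \<forall>s\<in>carrier S. Tr (a \<otimes>\<^bsub>S\<^esub> s) = f s"
    by (rule bexI[of _ "cutS (w \<star> y)"]) (use y in \<open>simp_all add: Tr_cutS\<close>)
next
  fix s t assume st: "s \<in> carrier S" "t \<in> carrier S"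
    and eq: "\<And>x. x \<in> carrier S \<Longrightarrow> Tr (s \<otimes>\<^bsub>S\<^esub> x) = Tr (t \<otimes>\<^bsub>S\<^esub> x)"
  have 1: "w' \<star> a s \<in> SA" "w' \<star> a t \<in> SA" using st by simp_all
  have tr: "Tr (s \<otimes>\<^bsub>S\<^esub> cutS x) = lam (w' \<star> a s \<star> x)" if "s \<in> carrier S" "x \<in> SA" for s x
  proof -
    have "Tr (s \<otimes>\<^bsub>S\<^esub> cutS x) = lam (w' \<star> a s \<star> (x \<star> e))" using that by (simp add: c_Tr a_hom a_cutS sm_assoc)
    also have "\<dots> = lam (w' \<star> a s \<star> x)"
    proof (rule lam_cut(1))
      have "e \<star> (w' \<star> a s) = w' \<star> (e \<star> a s)" by (simp only: sm_assoc[symmetric] w'_central[OF c_e_SA])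
      then show "e \<star> (w' \<star> a s) = w' \<star> a s" using that by simp
    qed (use that in simp_all)
    finally show ?thesis .
  qed
  have "(w' \<star> a s) h 0 = (w' \<star> a t) h 0" if h: "h \<in> carrier G" for h
    using eq[of "cutS (gel (inv h))"] h st by (simp add: tr lam_gel[OF _ h] del: sm_assoc)
  then have "(w' \<star> a s) h v = (w' \<star> a t) h v" for h v
    using SA_eval[OF 1(1), of h v] SA_eval[OF 1(2), of h v] SA_Fn[OF 1(1)] SA_Fn[OF 1(2)]
    by (cases "h \<in> carrier G") (simp_all add: Fn_def)
  then have "w' \<star> a s = w' \<star> a t" by (intro ext)
  then have "w \<star> (w' \<star> a s) = w \<star> (w' \<star> a t)" by (rule arg_cong)
  then have "a s = a t" using st by (simp add: w_cancel SA_Fn)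
  then show "s = t" using st by (intro a_eqI)
qed

definition n0 :: "('g, 'n) gfun \<Rightarrow> ('s, 'v) formal" where "n0 s = nf (pt (Scalar (cutS s)))"
definition n1 :: "('g, 'n) gfun \<Rightarrow> ('s, 'v) formal" where "n1 u = nf (pt (Tensor [cutV u]))"
definition hat :: "('v \<Rightarrow> complex) \<Rightarrow> ('g, 'n) gfun \<Rightarrow> complex" where "hat \<phi> u = \<phi> (cutV u)"
definition lcF :: "('v \<Rightarrow> complex) \<Rightarrow> ('s, 'v) formal \<Rightarrow> ('s, 'v) formal" where "lcF \<phi> f = nf (lc \<phi> f)"
definition rcF :: "('v \<Rightarrow> complex) \<Rightarrow> ('s, 'v) formal \<Rightarrow> ('s, 'v) formal" where "rcF \<phi> f = nf (rc \<phi> f)"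

lemma n_FC [simp]: "s \<in> SA \<Longrightarrow> n0 s \<in> FC" "u \<in> UA \<Longrightarrow> n1 u \<in> FC"
  by (simp_all add: n0_def n1_def nf_FC)

lemma hat_lin_on_UA: "\<phi> \<in> bdual V \<Longrightarrow> lin_on_UA (hat \<phi>)"
  by (simp add: lin_on_UA_def hat_def cutV_linear bdual_def)

lemma lp_cutV: "\<phi> \<in> bdual V \<Longrightarrow> u \<in> UA \<Longrightarrow> lp \<phi> (cutV u) = cutS (w \<star> Lam (hat \<phi>) u)"
  "\<phi> \<in> bdual V \<Longrightarrow> u \<in> UA \<Longrightarrow> rp (cutV u) \<phi> = cutS (Lamr (hat \<phi>) u \<star> w)"
proof -
  assume f: "\<phi> \<in> bdual V" and u: "u \<in> UA"
  show "lp \<phi> (cutV u) = cutS (w \<star> Lam (hat \<phi>) u)"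
  proof (rule lpair_eqI)
    fix s assume s: "s \<in> carrier S"
    have "ract V (cutV u) s = cutV (u \<star> a s)" using s u by (intro b_eqI) (simp_all add: b_hom b_cutV sm_assoc)
    then show "Tr (cutS (w \<star> Lam (hat \<phi>) u) \<otimes>\<^bsub>S\<^esub> s) = \<phi> (ract V (cutV u) s)"
      using s u by (simp add: Tr_cutS lam_Lam[OF hat_lin_on_UA[OF f]]) (simp add: hat_def)
  qed simp
  show "rp (cutV u) \<phi> = cutS (Lamr (hat \<phi>) u \<star> w)"
  proof (rule rpair_eqI)
    fix s assume s: "s \<in> carrier S"
    have "lact V s (cutV u) = cutV (a s \<star> u)" using s u by (intro b_eqI) (simp_all add: b_hom b_cutV sm_assoc)
    then show "Tr (s \<otimes>\<^bsub>S\<^esub> cutS (Lamr (hat \<phi>) u \<star> w)) = \<phi> (lact V s (cutV u))"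
      using s u by (simp add: Tr_cutS lam_Lam[OF hat_lin_on_UA[OF f]]) (simp add: hat_def)
  qed simp
qed

lemma n_linear:
  "s \<in> SA \<Longrightarrow> t \<in> SA \<Longrightarrow> n0 (s + t) = n0 s + n0 t" "u \<in> UA \<Longrightarrow> v \<in> UA \<Longrightarrow> n1 (u + v) = n1 u + n1 v"
  "s \<in> SA \<Longrightarrow> n0 (gscale c s) = formal_scale c (n0 s)" "u \<in> UA \<Longrightarrow> n1 (gscale c u) = formal_scale c (n1 u)"
  unfolding n0_def n1_def nf_linear(1,5)[symmetric] nf_eq_iff
  using TK_rel(1)[of "cutS s" "cutS t"] TK_rel(2)[of "cutS s" c] TK_rel_hd(1)[of "[]" "cutV u" "cutV v"] TK_rel_hd(2)[of "[]" "cutV u" c]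
  by (simp_all add: cutS_linear cutV_linear diff_diff_add)

lemma nf_om_pt: "x \<in> PT \<Longrightarrow> y \<in> PT \<Longrightarrow> om (nf (pt x)) (nf (pt y)) = nf (pt (pure_mult S V x y))"
  by (simp add: nf_FC) (simp add: om_def)

sublocale pot: corner_pot G \<rho> formal_scale om FC n0 n1 e r p q w w' "bdual V" hat lcF rcF
proof unfold_locales
  show "\<And>x y. x \<in> FC \<Longrightarrow> y \<in> FC \<Longrightarrow> om x y \<in> FC" by (rule om_FC)
  show "formal.subspace FC" by (rule subspace_FC)
  show "\<And>x y z. x \<in> FC \<Longrightarrow> y \<in> FC \<Longrightarrow> z \<in> FC \<Longrightarrow> om (om x y) z = om x (om y z)" by (rule om_assoc)
  show "\<And>s. s \<in> SA \<Longrightarrow> n0 (e \<star> s \<star> e) = n0 s" "\<And>u. u \<in> UA \<Longrightarrow> n1 (e \<star> u \<star> e) = n1 u"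
    by (simp_all only: n0_def n1_def cut_cong)
  show "\<And>s t. s \<in> SA \<Longrightarrow> t \<in> SA \<Longrightarrow> om (n0 s) (n0 t) = n0 (s \<star> e \<star> t)"
    "\<And>s u. s \<in> SA \<Longrightarrow> u \<in> UA \<Longrightarrow> om (n0 s) (n1 u) = n1 (s \<star> e \<star> u)"
    "\<And>s u. s \<in> SA \<Longrightarrow> u \<in> UA \<Longrightarrow> om (n1 u) (n0 s) = n1 (u \<star> e \<star> s)"
    unfolding n0_def n1_def by (subst nf_om_pt; simp add: cut_mult)+
  show "\<And>\<phi>. \<phi> \<in> bdual V \<Longrightarrow> lin_on_UA (hat \<phi>)" by (rule hat_lin_on_UA)
  fix \<psi> :: "('g, 'n) gfun \<Rightarrow> complex" assume \<psi>: "lin_on_UA \<psi>"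
  show "\<exists>\<phi>\<in>bdual V. \<forall>u\<in>UA. hat \<phi> u = \<psi> (e \<star> u \<star> e)"
    by (rule bexI[of _ "\<lambda>v. \<psi> (b v)"]) (use \<psi> in \<open>auto simp: hat_def b_cutV bdual_def b_hom lin_on_UA_def\<close>)
next
  fix \<phi> u t assume f: "\<phi> \<in> bdual V" and u: "u \<in> UA" and t: "t \<in> FC"
  have u': "pt (Tensor [cutV u]) \<in> FC" using u by simp
  show "lcF \<phi> (om (n1 u) t) = om (n0 (w \<star> Lam (hat \<phi>) u)) t"
  proof -
    have "lcF \<phi> (om (n1 u) t) = nf (lc \<phi> (fm (pt (Tensor [cutV u])) t))"
      unfolding lcF_def n1_def om_nf_absorb(1)[OF u' t] by (simp only: om_def nf_lc_nf[OF f])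
    also have "\<dots> = om (pt (Scalar (cutS (w \<star> Lam (hat \<phi>) u)))) t"
      using u t by (simp only: lc_fm[OF f] cutV_closed lp_cutV[OF f] om_def)
    also have "\<dots> = om (n0 (w \<star> Lam (hat \<phi>) u)) t"
      unfolding n0_def by (rule om_nf_absorb(1)[symmetric]) (use t in simp_all)
    finally show ?thesis .
  qed
  show "rcF \<phi> (om t (n1 u)) = om t (n0 (Lamr (hat \<phi>) u \<star> w))"
  proof -
    have "rcF \<phi> (om t (n1 u)) = nf (rc \<phi> (fm t (pt (Tensor [cutV u]))))"
      unfolding rcF_def n1_def om_nf_absorb(2)[OF t u'] by (simp only: om_def nf_lc_nf[OF f])
    also have "\<dots> = om t (pt (Scalar (cutS (Lamr (hat \<phi>) u \<star> w))))"
      using u t by (simp only: rc_fm[OF f] cutV_closed lp_cutV[OF f] om_def)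
    also have "\<dots> = om t (n0 (Lamr (hat \<phi>) u \<star> w))"
      unfolding n0_def by (rule om_nf_absorb(2)[symmetric]) (use t in simp_all)
    finally show ?thesis .
  qed
qed (simp_all add: n_linear c_e_idem c_tw_e c_full c_pq_r c_ww' c_w_central c_tw_w lcF_def rcF_def formal_vector_space)

section \<open>Evaluation of tensors in the crossed product\<close>

definition Pf :: "'v list \<Rightarrow> ('g, 'n) gfun \<Rightarrow> ('g, 'n) gfun" where
  "Pf vs x = foldr (\<lambda>v y. b v \<star> y) vs x"

lemma Pf_simps: "Pf [] x = x" "Pf (v # vs) x = b v \<star> Pf vs x" "Pf (us @ vs) x = Pf us (Pf vs x)"
  by (simp_all add: Pf_def)

lemma Pf_linear: "Pf us (x + y) = Pf us x + Pf us y" "Pf us (gscale c x) = gscale c (Pf us x)"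
  by (induction us) (simp_all only: Pf_simps sm_linear)

lemma Pf_e: "set vs \<subseteq> bcarrier V \<Longrightarrow> e \<star> x = x \<Longrightarrow> e \<star> Pf vs x = Pf vs x"
  "set vs \<subseteq> bcarrier V \<Longrightarrow> x \<star> e = x \<Longrightarrow> Pf vs x \<star> e = Pf vs x"
  by (induction vs) (simp_all add: Pf_simps sm_assoc)

lemma Pf_mult: "e \<star> x = x \<Longrightarrow> Pf us x = Pf us e \<star> x"
  by (induction us) (simp_all add: Pf_simps sm_assoc)

primrec ptm :: "('s, 'v) pure_tensor \<Rightarrow> ('g, 'n) gfun" where
  "ptm (Scalar s) = a s"
| "ptm (Tensor vs) = Pf vs e"

lemma ptm_mult:
  assumes x: "x \<in> PT" and y: "y \<in> PT"
  shows "ptm (pure_mult S V x y) = ptm x \<star> ptm y"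
proof (cases y)
  case (Tensor ws)
  with y obtain v vs where ws: "ws = v # vs" "v \<in> bcarrier V" "set vs \<subseteq> bcarrier V" by (cases ws) auto
  show ?thesis
  proof (cases x)
    case (Scalar s)
    then show ?thesis using x Tensor ws by (simp add: Pf_simps b_hom sm_assoc)
  next
    case (Tensor us)
    then show ?thesis using y \<open>y = Tensor ws\<close> Pf_mult[OF Pf_e(1)[OF _ c_e_idem, of ws], of us]
      by (simp add: Pf_simps)
  qed
next
  case (Scalar t)
  then have t: "t \<in> carrier S" using y by simp
  show ?thesis using x
  proof (cases rule: PT_rcases)
    case (1 s)
    then show ?thesis using t Scalar by (simp add: a_hom)
  next
    case (2 v vs)
    have "Pf (vs @ [ract V v t]) e = Pf vs (b v \<star> (a t \<star> e))" using 2 t by (simp add: Pf_simps b_hom sm_assoc)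
    also have "\<dots> = Pf (vs @ [v]) e \<star> a t"
      using Pf_mult[of "b v \<star> a t" vs] Pf_mult[of "b v" vs] 2 t by (simp add: Pf_simps sm_assoc)
    finally show ?thesis using 2 Scalar by simp
  qed
qed

definition ev :: "('s, 'v) formal \<Rightarrow> ('g, 'n) gfun" where "ev = lin_ext gscale ptm"

lemma ev_simps: "ev (f + g) = ev f + ev g" "ev (f - g) = ev f - ev g" "ev 0 = 0"
  "ev (formal_scale c f) = gscale c (ev f)" "ev (pt x) = ptm x"
proof -
  interpret vp: vector_space_pair "formal_scale :: complex \<Rightarrow> ('s, 'v) formal \<Rightarrow> _" "gscale :: complex \<Rightarrow> ('g, 'n) gfun \<Rightarrow> _" ..
  have lin: "Vector_Spaces.linear formal_scale gscale (lin_ext gscale ptm)"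
    by (rule linear_lin_ext) (rule gfun.vector_space_axioms)
  show "ev (f + g) = ev f + ev g" "ev (f - g) = ev f - ev g" "ev 0 = 0" "ev (formal_scale c f) = gscale c (ev f)"
    unfolding ev_def by (rule vp.linear_add[OF lin] vp.linear_diff[OF lin] vp.linear_0[OF lin] vp.linear_scale[OF lin])+
  show "ev (pt x) = ptm x"
    unfolding ev_def lin_ext_single[OF gfun.vector_space_axioms] by (rule gfun.scale_one)
qed

lemma ev_fm:
  assumes f: "f \<in> FC" and g: "g \<in> FC"
  shows "ev (fm f g) = ev f \<star> ev g"
proof -
  have 1: "ev (fm (pt x) g) = ev (pt x) \<star> ev g" if x: "x \<in> PT" for x
  proof -
    have "g \<in> {g. ev (fm (pt x) g) = ev (pt x) \<star> ev g}" using g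
    proof (induction rule: FC_induct)
      case subspace
      show ?case unfolding formal.subspace_def mem_Collect_eq by (simp only: fm_simps ev_simps sm_linear) simp
    next
      case (pt y)
      then show ?case using x by (simp only: mem_Collect_eq fm_pt ev_simps ptm_mult)
    qed
    then show ?thesis by simp
  qed
  have "f \<in> {f. ev (fm f g) = ev f \<star> ev g}" using f
  proof (induction rule: FC_induct)
    case subspace
    show ?case unfolding formal.subspace_def mem_Collect_eq by (simp only: fm_simps ev_simps sm_linear) simp
  next
    case (pt y)
    then show ?case using 1 by (simp only: mem_Collect_eq)
  qed
  then show ?thesis by simp
qed

lemma ev_TK: "k \<in> TK \<Longrightarrow> ev k = 0"
proof -
  have sub: "formal.subspace {k. ev k = 0}"
    unfolding formal.subspace_def mem_Collect_eq by (simp only: ev_simps gfun.scale_zero_right add_0_right) simp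
  have "tensor_relations S V \<subseteq> {k. ev k = 0}"
  proof
    fix f assume "f \<in> tensor_relations S V"
    then have "ev f = 0"
    proof (cases rule: rel_cases)
      case (sadd s t)
      then show ?thesis by (simp only: ev_simps ptm.simps a_hom add_diff_cancel_left' diff_self)
    next
      case (sscale c s)
      then show ?thesis by (simp only: ev_simps ptm.simps a_hom diff_self)
    next
      case (add us vs v w)
      then show ?thesis by (simp only: ev_simps ptm.simps Pf_simps Pf_linear b_hom sm_linear add_diff_cancel_left' diff_self)
    next
      case (scale us vs v c)
      then show ?thesis by (simp only: ev_simps ptm.simps Pf_simps Pf_linear b_hom sm_linear diff_self)
    next
      case (balanced us vs v w s)
      then show ?thesis by (simp only: ev_simps ptm.simps Pf_simps b_hom sm_assoc diff_self)
    qed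
    then show "f \<in> {k. ev k = 0}" by simp
  qed
  then have "TK \<subseteq> {k. ev k = 0}" unfolding TK_span by (rule formal.span_minimal[OF _ sub])
  then show "k \<in> TK \<Longrightarrow> ev k = 0" by (rule subsetD[THEN CollectD])
qed

lemma ev_cls: "f - g \<in> TK \<Longrightarrow> ev f = ev g"
  using ev_TK[of "f - g"] by (simp only: ev_simps right_minus_eq)

lemma ev_nf: "ev (nf f) = ev f"
  using ev_cls[OF nf_spec(3)[of f]] by (rule sym)

lemma n_ab: "s \<in> carrier S \<Longrightarrow> n0 (a s) = nf (pt (Scalar s))" "v \<in> bcarrier V \<Longrightarrow> n1 (b v) = nf (pt (Tensor [v]))"
  by (simp_all only: n0_def n1_def cut_ab)

lemma ev_n: "s \<in> SA \<Longrightarrow> ev (n0 s) = e \<star> s \<star> e" "u \<in> UA \<Longrightarrow> ev (n1 u) = e \<star> u \<star> e"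
  by (simp_all add: n0_def n1_def ev_nf ev_simps a_cutS b_cutV Pf_simps sm_assoc c_e_idem)

lemma ev_om: "f \<in> FC \<Longrightarrow> g \<in> FC \<Longrightarrow> ev (om f g) = ev f \<star> ev g"
  by (simp only: om_def ev_nf ev_fm)

lemma ev_Gr_entry: "(A, y) \<in> pot.Gr \<Longrightarrow> ev (A k l) = e \<star> q k \<star> y \<star> p l \<star> e"
  by (rule pot.Gr_entry[of ev, OF ev_simps(1) ev_simps(4) ev_om ev_n])

text \<open>Read from the right, a tensor is built from the corner unit e by multiplying with
  letters, and each multiplication is available for pairs while the (r, r) entry follows along. This
  brings results on matrices back to single tensors.\<close>

lemma ex_Gr:
  assumes "f \<in> FC"
  shows "\<exists>A. (A, ev f) \<in> pot.Gr \<and> A r r = nf f"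
proof -
  have tens: "\<exists>A. (A, Pf vs e) \<in> pot.Gr \<and> A r r = nf (pt (Tensor vs))" if "vs \<noteq> []" "set vs \<subseteq> bcarrier V" for vs
    using that
  proof (induction vs)
    case (Cons v vs)
    then have v: "v \<in> bcarrier V" and vs: "set vs \<subseteq> bcarrier V" by simp_all
    have step: "(pot.mm (pot.m1 (b v)) A, b v \<star> y) \<in> pot.Gr \<and> pot.mm (pot.m1 (b v)) A r r = om (n1 (b v)) (A r r)"
      if "(A, y) \<in> pot.Gr" for A y
      using pot.Gr_UA[OF that b_UA[OF v]] pot.n1_mult_entry[OF b_UA[OF v] pot.Gr_unital[OF that], of r]
      by (simp only: ab_e(4)[OF v] simp_thms)
    show ?case
    proof (cases "vs = []")
      case True
      \<comment> \<open>The unit of S corresponds to e, so the word ends in the scalar 1, which the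
        last letter absorbs.\<close>
      have m0e: "pot.m0 e r r = nf (pt (Scalar \<one>\<^bsub>S\<^esub>))"
        using n_ab(1)[of "\<one>\<^bsub>S\<^esub>"] by (simp add: pot.m0_def c_pq_r SA_Fn a_hom)
      have "om (n1 (b v)) (pot.m0 e r r) = nf (pt (Tensor [v]))"
        unfolding m0e n_ab(2)[OF v] by (subst nf_om_pt) (use v V_bimod in simp_all)
      then show ?thesis using step[OF pot.Gr_m0[OF c_e_SA]] True by (auto simp only: Pf_simps)
    next
      case False
      then obtain A where A: "(A, Pf vs e) \<in> pot.Gr" "A r r = nf (pt (Tensor vs))" using Cons.IH vs by blast
      have "om (n1 (b v)) (A r r) = nf (pt (Tensor (v # vs)))"
        unfolding A(2) n_ab(2)[OF v] by (subst nf_om_pt) (use v vs False in simp_all)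
      then show ?thesis using step[OF A(1)] by (auto simp only: Pf_simps)
    qed
  qed simp
  have "f \<in> {f. \<exists>A. (A, ev f) \<in> pot.Gr \<and> A r r = nf f}" using assms
  proof (induction rule: FC_induct)
    case subspace
    show ?case
    proof (rule formal.subspaceI; unfold mem_Collect_eq)
      show "\<exists>A. (A, ev 0) \<in> pot.Gr \<and> A r r = nf 0"
        by (rule exI[of _ 0]) (simp only: ev_simps pot.Gr.zero nf_linear zero_fun_apply simp_thms)
      show "\<exists>A. (A, ev (f + g)) \<in> pot.Gr \<and> A r r = nf (f + g)"
        if f: "\<exists>A. (A, ev f) \<in> pot.Gr \<and> A r r = nf f" and g: "\<exists>A. (A, ev g) \<in> pot.Gr \<and> A r r = nf g" for f g
      proof -
        obtain A B where A: "(A, ev f) \<in> pot.Gr" "A r r = nf f" and B: "(B, ev g) \<in> pot.Gr" "B r r = nf g"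
          using f g by blast
        have "(A + B) r r = A r r + B r r" by simp
        then show ?thesis using pot.Gr.add[OF A(1) B(1)]
          by (intro exI[of _ "A + B"]) (simp only: ev_simps nf_linear A(2) B(2) simp_thms)
      qed
      show "\<exists>A. (A, ev (formal_scale c f)) \<in> pot.Gr \<and> A r r = nf (formal_scale c f)"
        if f: "\<exists>A. (A, ev f) \<in> pot.Gr \<and> A r r = nf f" for f c
      proof -
        obtain A where A: "(A, ev f) \<in> pot.Gr" "A r r = nf f" using f by blast
        then show ?thesis using pot.Gr.scale[OF A(1), of c]
          by (intro exI[of _ "pot.msc c A"]) (simp only: ev_simps nf_linear pot.msc_entry simp_thms)
      qed
    qed
  next
    case (pt x)
    show ?case
    proof (cases x)
      case (Scalar s)
      then have s: "s \<in> carrier S" using pt by simp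
      have "pot.m0 (a s) r r = nf (pt (Scalar s))" using s n_ab(1)[OF s] by (simp add: pot.m0_def c_pq_r SA_Fn)
      then show ?thesis unfolding Scalar mem_Collect_eq ev_simps ptm.simps using pot.Gr_m0[OF a_SA[OF s]] by blast
    next
      case (Tensor vs)
      then show ?thesis using tens[of vs] pt by (simp only: mem_Collect_eq ev_simps ptm.simps PT_simps simp_thms)
    qed
  qed
  then show ?thesis by simp
qed

subsection \<open>Grading\<close>

definition Fd :: "nat \<Rightarrow> ('s, 'v) formal set" where
  "Fd d = {f. \<forall>x\<in>Poly_Mapping.keys f. x \<in> PT \<and> tensor_degree x = d}"

lemma subspace_Fd: "formal.subspace (Fd d)"
proof (rule formal.subspaceI)
  show "f + g \<in> Fd d" if "f \<in> Fd d" "g \<in> Fd d" for f g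
    using that Poly_Mapping.keys_add[of f g] unfolding Fd_def by blast
  show "formal_scale c f \<in> Fd d" if "f \<in> Fd d" for c f
  proof -
    have "Poly_Mapping.keys (formal_scale c f) \<subseteq> Poly_Mapping.keys f" by (auto simp: in_keys_iff)
    then show ?thesis using that unfolding Fd_def by blast
  qed
qed (simp add: Fd_def)

lemma degree_pure_mult: "x \<in> PT \<Longrightarrow> y \<in> PT \<Longrightarrow> tensor_degree (pure_mult S V x y) = tensor_degree x + tensor_degree y"
  by (elim PT_cases) auto

lemma fm_Fd: "f \<in> Fd i \<Longrightarrow> g \<in> Fd j \<Longrightarrow> fm f g \<in> Fd (i + j)"
  unfolding fm_eq
  by (intro fext_in_subspace[OF subspace_Fd]) (auto simp: Fd_def pure_mult_PT degree_pure_mult)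

text \<open>\<open>nf\<close> is an arbitrary linear choice and may mix degrees, so homogeneity is
  recorded as being the normal form of a homogeneous combination.\<close>

definition HD :: "nat \<Rightarrow> ('s, 'v) formal set" where "HD d = nf ` Fd d"

lemma Fd_FC: "f \<in> Fd d \<Longrightarrow> f \<in> FC"
  by (auto simp: FC_iff Fd_def)

lemma HD_add: "f \<in> HD d \<Longrightarrow> g \<in> HD d \<Longrightarrow> f + g \<in> HD d"
  unfolding HD_def by (auto simp: nf_linear(1)[symmetric] simp del: nf_linear intro!: imageI formal.subspace_add[OF subspace_Fd])

lemma HD_scale: "f \<in> HD d \<Longrightarrow> formal_scale c f \<in> HD d"
  unfolding HD_def by (auto simp: nf_linear(5)[symmetric] simp del: nf_linear intro!: imageI formal.subspace_scale[OF subspace_Fd])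

lemma HD_sum: "(\<And>x. x \<in> A \<Longrightarrow> F x \<in> HD d) \<Longrightarrow> sum F A \<in> HD d"
proof (induction A rule: infinite_finite_induct)
  case (insert x A)
  then show ?case by (simp add: HD_add)
qed (use formal.subspace_0[OF subspace_Fd] in \<open>force simp: HD_def\<close>)+

lemma HD_om: "f \<in> HD i \<Longrightarrow> g \<in> HD j \<Longrightarrow> om f g \<in> HD (i + j)"
  unfolding HD_def by (auto simp: Fd_FC) (auto simp: om_def intro!: imageI fm_Fd)

lemma HD_n: "s \<in> SA \<Longrightarrow> n0 s \<in> HD 0" "u \<in> UA \<Longrightarrow> n1 u \<in> HD 1"
  unfolding HD_def n0_def n1_def by (auto intro!: imageI simp: Fd_def)

lemma HD_mm: "(\<And>k l. A k l \<in> HD i) \<Longrightarrow> (\<And>k l. B k l \<in> HD j) \<Longrightarrow> pot.mm A B k l \<in> HD (i + j)"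
  unfolding pot.mm_def by (intro HD_sum HD_om)

lemma HD_TS: "pot.TS d c k l \<in> HD d"
proof (induction d arbitrary: c k l)
  case 0
  show ?case by (simp only: pot.TS.simps pot.msc_entry pot.m0_def) (intro HD_scale HD_n; simp)
next
  case (Suc d)
  have "pot.m1 (Xv i) k l \<in> HD 1" for i k l unfolding pot.m1_def by (rule HD_n) simp
  from HD_mm[OF this Suc] show ?case by (simp only: pot.TS.simps pot.sum_entry) (intro HD_sum, simp)
qed

lemma Omega_HD: "pot.Omega \<in> HD (CARD('n))"
proof -
  have "pot.m0 w k l \<in> HD 0" for k l unfolding pot.m0_def by (rule HD_n) simp
  from HD_mm[OF this HD_TS[of "CARD('n)" eps]] show ?thesis by (simp only: pot.Omega_def add_0_left)
qed

lemma Omega_power: "cls pot.Omega \<in> tensor_power S V (CARD('n))"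
proof -
  obtain f where f: "f \<in> Fd (CARD('n))" "pot.Omega = nf f" using Omega_HD unfolding HD_def by blast
  then have "cls pot.Omega = cls f" by (simp only: cls_nf)
  then show ?thesis using f(1) Fd_FC[OF f(1)] unfolding tensor_power_def Fd_def by blast
qed

lemma Omega_FC: "pot.Omega \<in> FC"
proof -
  obtain f where f: "f \<in> Fd (CARD('n))" "pot.Omega = nf f" using Omega_HD unfolding HD_def by blast
  show ?thesis unfolding f(2) by (rule nf_FC[OF Fd_FC[OF f(1)]])
qed

subsection \<open>The twist\<close>

definition f0 where "f0 s = cutS (tw (a s))"
definition g0 where "g0 s = cutS (itw (a s))"
definition f1 where "f1 v = cutV (tw (b v))"
definition g1 where "g1 v = cutV (itw (b v))"

lemma ab_twist:
  "s \<in> carrier S \<Longrightarrow> a (f0 s) = tw (a s)" "s \<in> carrier S \<Longrightarrow> a (g0 s) = itw (a s)"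
  "v \<in> bcarrier V \<Longrightarrow> b (f1 v) = tw (b v)" "v \<in> bcarrier V \<Longrightarrow> b (g1 v) = itw (b v)"
proof -
  have "e \<star> tw x \<star> e = tw (e \<star> x \<star> e)" "e \<star> itw x \<star> e = itw (e \<star> x \<star> e)" for x
    by (simp_all only: twist_mult c_tw_e pot.itw_e)
  then show "s \<in> carrier S \<Longrightarrow> a (f0 s) = tw (a s)" "s \<in> carrier S \<Longrightarrow> a (g0 s) = itw (a s)"
    "v \<in> bcarrier V \<Longrightarrow> b (f1 v) = tw (b v)" "v \<in> bcarrier V \<Longrightarrow> b (g1 v) = itw (b v)"
    unfolding f0_def g0_def f1_def g1_def by (simp_all only: a_cutS b_cutV a_SA b_UA twist_closed a_cut b_cut)
qed

lemma twist_carrier [simp]: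
  "s \<in> carrier S \<Longrightarrow> f0 s \<in> carrier S" "s \<in> carrier S \<Longrightarrow> g0 s \<in> carrier S"
  "v \<in> bcarrier V \<Longrightarrow> f1 v \<in> bcarrier V" "v \<in> bcarrier V \<Longrightarrow> g1 v \<in> bcarrier V"
  by (simp_all add: f0_def g0_def f1_def g1_def)

lemma twist_endo: "bimodule_endo f0 f1" "bimodule_endo g0 g1"
  unfolding bimodule_endo_def
  by (intro conjI ballI allI image_subsetI; (rule a_eqI b_eqI)?;
      simp only: twist_carrier c_S_closed c_V_closed ab_twist a_hom b_hom twist_linear twist_mult c_tw_e pot.itw_e)+

lemma twist_inv:
  "s \<in> carrier S \<Longrightarrow> g0 (f0 s) = s" "v \<in> bcarrier V \<Longrightarrow> g1 (f1 v) = v"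
  "s \<in> carrier S \<Longrightarrow> f0 (g0 s) = s" "v \<in> bcarrier V \<Longrightarrow> f1 (g1 v) = v"
  by (rule a_eqI b_eqI; simp only: twist_carrier ab_twist twist_inverse SA_Fn UA_Fn a_SA b_UA)+

abbreviation "\<tau> \<equiv> endo_map f0 f1"

lemma twist_emb: "\<tau> (scalar_emb S V s) = scalar_emb S V (f0 s)" "\<tau> (vector_emb S V v) = vector_emb S V (f1 v)"
  unfolding scalar_emb_def vector_emb_def endo_map_cls[OF twist_endo(1)] by simp_all

text \<open>Evaluation in the crossed product separates the elements of S and of V. Hence the vector
  described in \<open>twist_dual\<close> is unique.\<close>

lemma emb_inj:
  "s \<in> carrier S \<Longrightarrow> t \<in> carrier S \<Longrightarrow> scalar_emb S V s = scalar_emb S V t \<longleftrightarrow> s = t"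
  "u \<in> bcarrier V \<Longrightarrow> v \<in> bcarrier V \<Longrightarrow> vector_emb S V u = vector_emb S V v \<longleftrightarrow> u = v"
proof -
  show "s \<in> carrier S \<Longrightarrow> t \<in> carrier S \<Longrightarrow> scalar_emb S V s = scalar_emb S V t \<longleftrightarrow> s = t"
    unfolding scalar_emb_def cls_eq_iff by (auto dest!: ev_cls simp only: ev_simps ptm.simps diff_self TK_closed(4) intro: a_eqI)
  show "u \<in> bcarrier V \<Longrightarrow> v \<in> bcarrier V \<Longrightarrow> vector_emb S V u = vector_emb S V v \<longleftrightarrow> u = v"
    unfolding vector_emb_def cls_eq_iff by (auto dest!: ev_cls simp only: ev_simps ptm.simps Pf_simps ab_e diff_self TK_closed(4) intro: b_eqI)
qed

lemma twist_dual_eq: "v \<in> bcarrier V \<Longrightarrow> twist_dual S V \<tau> \<psi> v = \<psi> (g1 v)"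
proof -
  assume v: "v \<in> bcarrier V"
  have "(THE u. u \<in> bcarrier V \<and> \<tau> (vector_emb S V u) = vector_emb S V v) = g1 v"
  proof (rule the_equality)
    show "g1 v \<in> bcarrier V \<and> \<tau> (vector_emb S V (g1 v)) = vector_emb S V v" using v by (simp add: twist_emb twist_inv)
    fix u assume u: "u \<in> bcarrier V \<and> \<tau> (vector_emb S V u) = vector_emb S V v"
    then have "vector_emb S V (f1 u) = vector_emb S V v" by (simp only: twist_emb)
    then have "f1 u = v" using u v emb_inj(2)[of "f1 u" v] by simp
    then have "g1 (f1 u) = g1 v" by (rule arg_cong)
    then show "u = g1 v" using u twist_inv(2)[of u] by simp
  qed
  then show ?thesis by (simp add: twist_dual_def)
qed

lemma emb_mult:
  assumes "s \<in> carrier S" "t \<in> FC"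
  shows "scalar_emb S V s \<otimes>\<^bsub>TA\<^esub> cls t = cls (om (n0 (a s)) t)" "cls t \<otimes>\<^bsub>TA\<^esub> scalar_emb S V s = cls (om t (n0 (a s)))"
proof -
  have s: "pt (Scalar s) \<in> FC" using assms(1) by simp
  show "scalar_emb S V s \<otimes>\<^bsub>TA\<^esub> cls t = cls (om (n0 (a s)) t)" "cls t \<otimes>\<^bsub>TA\<^esub> scalar_emb S V s = cls (om t (n0 (a s)))"
    unfolding scalar_emb_def n_ab(1)[OF assms(1)] cls_mult[OF s assms(2)] cls_mult[OF assms(2) s]
      om_nf_absorb(1)[OF s assms(2)] om_nf_absorb(2)[OF assms(2) s]
    by (simp_all only: om_def cls_nf)
qed

lemma contract_Omega: "\<psi> \<in> bdual V \<Longrightarrow> lcontract S Tr V \<psi> (cls pot.Omega) = cls (lcF \<psi> pot.Omega)"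
  "\<psi> \<in> bdual V \<Longrightarrow> rcontract S Tr V (cls pot.Omega) \<psi> = cls (rcF \<psi> pot.Omega)"
  by (simp_all only: lcontract_cls rcontract_cls lcF_def rcF_def cls_nf)

lemma twisted_superpotential_Omega: "twisted_superpotential S Tr V \<tau> (CARD('n)) (cls pot.Omega)"
  unfolding twisted_superpotential_def graded_automorphism_def
proof (intro conjI ballI allI impI)
  show "\<tau> \<in> alg_iso TA TA" "\<tau> ` tensor_power S V d = tensor_power S V d" for d
    by (rule endo_map_alg_iso[OF twist_endo twist_inv]; assumption)+
  show "cls pot.Omega \<in> tensor_power S V (CARD('n))" by (rule Omega_power)
next
  fix s t assume s: "s \<in> carrier S" and t: "t \<in> carrier S" and eq: "\<tau> (scalar_emb S V s) = scalar_emb S V t"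
  then have t: "f0 s = t" using emb_inj(1)[of "f0 s" t] by (simp add: twist_emb)
  have "Tr t = lam (w' \<star> tw (a s))" using s c_Tr[of "f0 s"] unfolding t[symmetric] by (simp only: twist_carrier ab_twist)
  also have "\<dots> = lam (tw (w' \<star> a s))" by (simp only: twist_mult tw_w')
  also have "\<dots> = Tr s" using s by (simp only: lam_twist c_Tr)
  finally show "Tr t = Tr s" .
next
  fix s assume s: "s \<in> carrier S"
  show "\<tau> (scalar_emb S V s) \<otimes>\<^bsub>TA\<^esub> cls pot.Omega = cls pot.Omega \<otimes>\<^bsub>TA\<^esub> scalar_emb S V s"
    using s pot.Omega_twist[of "a s"] by (simp only: twist_emb emb_mult twist_carrier Omega_FC ab_twist a_SA ab_e)
next
  fix \<psi> assume \<psi>: "\<psi> \<in> bdual V"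
  have \<psi>': "twist_dual S V \<tau> \<psi> \<in> bdual V"
    using \<psi> twist_endo(2) by (auto simp: bdual_def twist_dual_eq bimodule_endo_def)
  have hat: "hat (twist_dual S V \<tau> \<psi>) u = hat \<psi> (itw u)" if u: "u \<in> UA" for u
  proof -
    have "g1 (cutV u) = cutV (itw u)"
      by (rule b_eqI) (use u in \<open>simp_all only: twist_carrier ab_twist cutV_closed twist_closed b_cutV twist_mult pot.itw_e\<close>)
    then show ?thesis using u by (simp only: hat_def twist_dual_eq cutV_closed)
  qed
  show "lcontract S Tr V (twist_dual S V \<tau> \<psi>) (cls pot.Omega) =
      (- 1) ^ (CARD('n) - 1) \<odot>\<^bsub>TA\<^esub> rcontract S Tr V (cls pot.Omega) \<psi>"
    unfolding contract_Omega(1)[OF \<psi>'] contract_Omega(2)[OF \<psi>] cls_smult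
    by (rule arg_cong[of _ _ cls], rule pot.Omega_superpotential[OF \<psi> \<psi>' hat])
qed

lemma superpotential_Omega:
  assumes det1: "\<forall>g\<in>carrier G. det (\<rho> g) = 1"
  shows "superpotential S Tr V (CARD('n)) (cls pot.Omega)"
  unfolding superpotential_def
proof (intro conjI ballI)
  show "cls pot.Omega \<in> tensor_power S V (CARD('n))" by (rule Omega_power)
next
  fix s assume s: "s \<in> carrier S"
  have "tw (a s) = a s" using det1 SA_Fn[OF a_SA[OF s]] by (auto simp: tw_def Fn_def fun_eq_iff)
  then show "scalar_emb S V s \<otimes>\<^bsub>TA\<^esub> cls pot.Omega = cls pot.Omega \<otimes>\<^bsub>TA\<^esub> scalar_emb S V s"
    using s pot.Omega_twist[of "a s"] by (simp only: emb_mult Omega_FC a_SA ab_e)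
next
  fix \<psi> assume \<psi>: "\<psi> \<in> bdual V"
  have hat: "hat \<psi> u = hat \<psi> (itw u)" if u: "u \<in> UA" for u
  proof -
    have "itw u = u" using det1 UA_Fn[OF u] by (auto simp: itw_def Fn_def fun_eq_iff)
    then show ?thesis by (simp only:)
  qed
  show "lcontract S Tr V \<psi> (cls pot.Omega) = (- 1) ^ (CARD('n) - 1) \<odot>\<^bsub>TA\<^esub> rcontract S Tr V (cls pot.Omega) \<psi>"
    unfolding contract_Omega(1)[OF \<psi>] contract_Omega(2)[OF \<psi>] cls_smult
    by (rule arg_cong[of _ _ cls], rule pot.Omega_superpotential[OF \<psi> \<psi> hat])
qed

subsection \<open>The relations\<close>

abbreviation "contr \<equiv> foldr lcF"

lemma lcF_FC: "\<phi> \<in> bdual V \<Longrightarrow> t \<in> FC \<Longrightarrow> lcF \<phi> t \<in> FC"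
  by (simp add: lcF_def nf_FC lc_FC)

lemma cls_lcF: "cls (lcF \<phi> t) = cls (lc \<phi> t)"
  by (simp only: lcF_def cls_nf)

lemma contr_cls:
  "set \<phi>s \<subseteq> bdual V \<Longrightarrow> t \<in> FC \<Longrightarrow> contr \<phi>s t \<in> FC \<and> foldr (lcontract S Tr V) \<phi>s (cls t) = cls (contr \<phi>s t)"
proof (induction \<phi>s)
  case (Cons \<phi> \<phi>s)
  then have "\<phi> \<in> bdual V" "contr \<phi>s t \<in> FC" "foldr (lcontract S Tr V) \<phi>s (cls t) = cls (contr \<phi>s t)" by simp_all
  then show ?case by (simp add: lcF_FC lcontract_cls cls_lcF)
qed simp

abbreviation "I \<equiv> Idl\<^bsub>TA\<^esub> (derivative_space S Tr V (cls pot.Omega) (CARD('n) - 2))"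

definition DS :: "nat \<Rightarrow> ('s, 'v) formal set" where
  "DS k = {t \<in> FC. cls t \<in> derivative_space S Tr V (cls pot.Omega) k}"

lemma multi_contract_Omega:
  assumes x: "x \<in> SA"
  shows "s \<in> carrier S \<Longrightarrow> multi_contract S Tr V (Scalar s) (cls pot.Omega \<otimes>\<^bsub>TA\<^esub> scalar_emb S V (cutS x)) =
      cls (om (n0 (a s)) (om pot.Omega (n0 x)))"
    "set \<phi>s \<subseteq> bdual V \<Longrightarrow> multi_contract S Tr V (Tensor \<phi>s) (cls pot.Omega \<otimes>\<^bsub>TA\<^esub> scalar_emb S V (cutS x)) =
      cls (contr \<phi>s (om pot.Omega (n0 x)))"
proof -
  have "n0 (a (cutS x)) = n0 x" using x by (simp only: a_cutS n0_def cut_cong)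
  then have 1: "cls pot.Omega \<otimes>\<^bsub>TA\<^esub> scalar_emb S V (cutS x) = cls (om pot.Omega (n0 x))"
    using x by (simp only: emb_mult cutS_closed Omega_FC)
  have 2: "om pot.Omega (n0 x) \<in> FC" using x by (simp add: om_FC Omega_FC)
  show "s \<in> carrier S \<Longrightarrow> multi_contract S Tr V (Scalar s) (cls pot.Omega \<otimes>\<^bsub>TA\<^esub> scalar_emb S V (cutS x)) =
      cls (om (n0 (a s)) (om pot.Omega (n0 x)))"
    by (simp only: multi_contract.simps 1 emb_mult 2)
  show "set \<phi>s \<subseteq> bdual V \<Longrightarrow> multi_contract S Tr V (Tensor \<phi>s) (cls pot.Omega \<otimes>\<^bsub>TA\<^esub> scalar_emb S V (cutS x)) =
      cls (contr \<phi>s (om pot.Omega (n0 x)))"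
    using contr_cls 2 by (simp only: multi_contract.simps 1)
qed

lemma om_Omega_FC: "x \<in> SA \<Longrightarrow> om pot.Omega (n0 x) \<in> FC"
  by (simp add: om_FC Omega_FC)

lemma subspace_DS: "formal.subspace (DS k)"
  unfolding DS_def derivative_space_def by (rule lin_span_TA_pre(1))

lemma DS_base: "x \<in> SA \<Longrightarrow> om pot.Omega (n0 x) \<in> DS 0"
proof -
  assume x: "x \<in> SA"
  have "cls (om (n0 (a \<one>\<^bsub>S\<^esub>)) (om pot.Omega (n0 x))) = cls (om pot.Omega (n0 x))"
    unfolding n_ab(1)[OF c_S_closed(3)] om_nf_absorb(1)[OF pt_one_FC om_Omega_FC[OF x]]
    by (simp only: om_def cls_nf fm_one[OF nf_FC[OF fm_FC[OF Omega_FC n_FC(1)[OF x]]]])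
  then have "multi_contract S Tr V (Scalar \<one>\<^bsub>S\<^esub>) (cls pot.Omega \<otimes>\<^bsub>TA\<^esub> scalar_emb S V (cutS x)) = cls (om pot.Omega (n0 x))"
    by (simp only: multi_contract_Omega(1)[OF x c_S_closed(3)])
  moreover have "(Scalar \<one>\<^bsub>S\<^esub> :: ('s, 'v \<Rightarrow> complex) pure_tensor) \<in> pure_tensors (carrier S) (bdual V)"
    by (simp add: pure_tensors_def)
  ultimately have "cls (om pot.Omega (n0 x)) \<in> {multi_contract S Tr V \<phi> (cls pot.Omega \<otimes>\<^bsub>TA\<^esub> scalar_emb S V x) | \<phi> x.
       \<phi> \<in> pure_tensors (carrier S) (bdual V) \<and> tensor_degree \<phi> = 0 \<and> x \<in> carrier S}"
    using cutS_closed[OF x] unfolding mem_Collect_eq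
    by (intro exI[of _ "Scalar \<one>\<^bsub>S\<^esub>"] exI[of _ "cutS x"]) (simp only: tensor_degree.simps simp_thms)
  from lin_span_TA_pre(2)[OF om_Omega_FC[OF x] this] show ?thesis
    unfolding DS_def derivative_space_def by (intro CollectI conjI om_Omega_FC[OF x])
qed

lemma DS_Tensor: "x \<in> SA \<Longrightarrow> \<phi>s \<noteq> [] \<Longrightarrow> set \<phi>s \<subseteq> bdual V \<Longrightarrow> contr \<phi>s (om pot.Omega (n0 x)) \<in> DS (length \<phi>s)"
proof -
  assume x: "x \<in> SA" and p: "\<phi>s \<noteq> []" "set \<phi>s \<subseteq> bdual V"
  have T: "Tensor \<phi>s \<in> pure_tensors (carrier S) (bdual V)" using p by (auto simp: pure_tensors_def)
  have F: "contr \<phi>s (om pot.Omega (n0 x)) \<in> FC" using contr_cls[OF p(2) om_Omega_FC[OF x]] by blast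
  have "cls (contr \<phi>s (om pot.Omega (n0 x))) \<in> {multi_contract S Tr V \<phi> (cls pot.Omega \<otimes>\<^bsub>TA\<^esub> scalar_emb S V x) | \<phi> x.
       \<phi> \<in> pure_tensors (carrier S) (bdual V) \<and> tensor_degree \<phi> = length \<phi>s \<and> x \<in> carrier S}"
    by (intro CollectI exI[of _ "Tensor \<phi>s"] exI[of _ "cutS x"] conjI T cutS_closed[OF x]
        multi_contract_Omega(2)[OF x p(2), symmetric] tensor_degree.simps)
  from lin_span_TA_pre(2)[OF F this] show ?thesis
    unfolding DS_def derivative_space_def by (intro CollectI conjI F)
qed

text \<open>The derivative space is spanned by contractions of right multiples of the potential by
  pure tensors of functionals, and prefixing \<phi> gives a pure tensor of length k + 1.\<close>

lemma DS_step:
  assumes "t \<in> DS k" "\<phi> \<in> bdual V"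
  shows "lcF \<phi> t \<in> DS (Suc k)"
proof -
  \<comment> \<open>The derivative space is a span of classes while the contraction acts on
    representatives; J collects representatives for which the claim holds.\<close>
  define J where "J = {t \<in> FC. lcF \<phi> t \<in> DS (Suc k)}"
  have J: "formal.subspace J" "J \<subseteq> FC"
    unfolding J_def formal.subspace_def mem_Collect_eq lcF_def
    by (auto simp only: fext_simps nf_linear intro!: FC_closed formal.subspace_0[OF subspace_DS]
        formal.subspace_add[OF subspace_DS] formal.subspace_scale[OF subspace_DS])
  have "multi_contract S Tr V \<Phi> (cls pot.Omega \<otimes>\<^bsub>TA\<^esub> scalar_emb S V x) \<in> cls ` J"
    if P: "\<Phi> \<in> pure_tensors (carrier S) (bdual V)" "tensor_degree \<Phi> = k" "x \<in> carrier S" for \<Phi> x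
  proof -
    have x: "cutS (a x) = x" "a x \<in> SA" using P(3) by simp_all
    show ?thesis
    proof (cases \<Phi>)
      case (Scalar s)
      then have s: "s \<in> carrier S" and k: "k = 0" using P by (auto simp: pure_tensors_def)
      have gs: "a (g0 s) = itw (a s)" "tw (itw (a s)) = a s" using s by (simp_all add: ab_twist SA_Fn)
      \<comment> \<open>For k = 0 a generator carries s on its left. The twist moves s to the right,
        so the generator becomes a right multiple of the potential, which \<phi> alone
        contracts.\<close>
      have "om (n0 (a s)) pot.Omega = om pot.Omega (n0 (itw (a s)))"
        using pot.Omega_twist[of "a (g0 s)"] s by (simp only: gs(2) ab_e a_SA twist_carrier gs(1)[symmetric]) (simp only: gs)
      then have "om (n0 (a s)) (om pot.Omega (n0 (a x))) = om pot.Omega (n0 (itw (a s) \<star> e \<star> a x))"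
        using s x by (simp only: om_assoc[symmetric] n_FC a_SA Omega_FC)
          (simp only: om_assoc n_FC a_SA Omega_FC twist_closed pot.n_mult)
      then have eq: "multi_contract S Tr V \<Phi> (cls pot.Omega \<otimes>\<^bsub>TA\<^esub> scalar_emb S V x) = cls (om pot.Omega (n0 (itw (a s) \<star> e \<star> a x)))"
        using multi_contract_Omega(1)[OF x(2) s] unfolding x Scalar by simp
      have y: "itw (a s) \<star> e \<star> a x \<in> SA" using s x by simp
      have "om pot.Omega (n0 (itw (a s) \<star> e \<star> a x)) \<in> J"
        unfolding J_def mem_Collect_eq k using DS_Tensor[OF y, of "[\<phi>]"] om_Omega_FC[OF y] assms(2) by simp
      then show ?thesis unfolding eq by (rule imageI)
    next
      case (Tensor \<phi>s)
      then have ps: "\<phi>s \<noteq> []" "set \<phi>s \<subseteq> bdual V" "length \<phi>s = k" using P by (auto simp: pure_tensors_def)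
      have "contr \<phi>s (om pot.Omega (n0 (a x))) \<in> J"
        unfolding J_def mem_Collect_eq
        using DS_Tensor[OF x(2), of "\<phi> # \<phi>s"] contr_cls[OF ps(2) om_Omega_FC[OF x(2)]] ps assms(2) by simp
      then show ?thesis using multi_contract_Omega(2)[OF x(2) ps(2)] unfolding x Tensor by (simp only: imageI)
    qed
  qed
  then have "derivative_space S Tr V (cls pot.Omega) k \<subseteq> cls ` J"
    unfolding derivative_space_def by (intro lin_span_TA_subset[OF J]) blast
  then obtain t' where t': "cls t = cls t'" "t' \<in> J" using assms(1) unfolding DS_def by blast
  \<comment> \<open>The contraction depends only on the class, so t may be replaced by the
    representative in J.\<close>
  then have "lcF \<phi> t = lcF \<phi> t'"
    using nf_lc_nf[OF assms(2)] unfolding lcF_def cls_eq_nf by metis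
  then show ?thesis using t'(2) by (simp add: J_def)
qed

lemma derivative_space_carrier: "derivative_space S Tr V (cls pot.Omega) k \<subseteq> carrier TA"
proof -
  have "multi_contract S Tr V \<Phi> (cls pot.Omega \<otimes>\<^bsub>TA\<^esub> scalar_emb S V x) \<in> cls ` FC"
    if P: "\<Phi> \<in> pure_tensors (carrier S) (bdual V)" "x \<in> carrier S" for \<Phi> x
  proof -
    have x: "cutS (a x) = x" "a x \<in> SA" using P(2) by simp_all
    show ?thesis
    proof (cases \<Phi>)
      case (Scalar s)
      then have "s \<in> carrier S" using P by (auto simp: pure_tensors_def)
      then show ?thesis using multi_contract_Omega(1)[OF x(2), of s] unfolding x Scalar
        by (simp add: om_FC om_Omega_FC x)
    next
      case (Tensor \<phi>s)
      then have ps: "set \<phi>s \<subseteq> bdual V" using P by (auto simp: pure_tensors_def)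
      show ?thesis using multi_contract_Omega(2)[OF x(2) ps] contr_cls[OF ps om_Omega_FC[OF x(2)]] unfolding x Tensor
        by simp
    qed
  qed
  then show ?thesis unfolding carrier_TA derivative_space_def
    by (intro lin_span_TA_subset[OF subspace_FC subset_refl]) blast
qed

lemma ideal_I: "ideal I TA"
  by (rule ring.genideal_ideal[OF ring_TA derivative_space_carrier])

lemma contr_QS:
  assumes "x \<in> SA" "set \<phi>s \<subseteq> bdual V" "length \<phi>s \<le> CARD('n)"
  shows "contr \<phi>s (om pot.Omega (n0 x)) \<in> pot.QS (length \<phi>s)"
  using assms(2,3)
proof (induction \<phi>s)
  case Nil
  then show ?case using pot.QS_0'[OF assms(1)] by simp
next
  case (Cons \<phi> \<phi>s)
  then show ?case using pot.QS_step[of \<phi> "length \<phi>s"] by simp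
qed

lemma kernel_ideal: "ideal (cls ` {f \<in> FC. ev f = 0}) TA"
proof (rule idealI[OF ring_TA])
  have sub: "formal.subspace {f \<in> FC. ev f = 0}"
    unfolding formal.subspace_def mem_Collect_eq
    by (auto simp only: ev_simps gfun.scale_zero_right add_0_right intro!: FC_closed)
  then show "subgroup (cls ` {f \<in> FC. ev f = 0}) (add_monoid TA)"
    by (intro submodule.axioms(1)[OF submodule_TA_image]) auto
  fix z x assume z: "z \<in> cls ` {f \<in> FC. ev f = 0}" and x: "x \<in> carrier TA"
  then obtain f g where fg: "z = cls f" "f \<in> FC" "ev f = 0" "x = cls g" "g \<in> FC" unfolding carrier_TA by blast
  show "x \<otimes>\<^bsub>TA\<^esub> z \<in> cls ` {f \<in> FC. ev f = 0}" "z \<otimes>\<^bsub>TA\<^esub> x \<in> cls ` {f \<in> FC. ev f = 0}"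
    unfolding fg(1,4) cls_mult[OF fg(2,5)] cls_mult[OF fg(5,2)]
    by (intro imageI CollectI conjI fm_FC fg; simp only: ev_fm fg sm_linear)+
qed

lemma kernel:
  assumes n: "CARD('n) \<ge> 2" and f: "f \<in> FC"
  shows "cls f \<in> I \<longleftrightarrow> ev f = 0"
proof
  assume fI: "cls f \<in> I"
  have "multi_contract S Tr V \<Phi> (cls pot.Omega \<otimes>\<^bsub>TA\<^esub> scalar_emb S V x) \<in> cls ` {f \<in> FC. ev f = 0}"
    if P: "\<Phi> \<in> pure_tensors (carrier S) (bdual V)" "tensor_degree \<Phi> = CARD('n) - 2" "x \<in> carrier S" for \<Phi> x
  proof -
    have x: "cutS (a x) = x" "a x \<in> SA" using P(3) by simp_all
    have vanish: "t \<in> pot.QS (CARD('n) - 2) \<Longrightarrow> ev t = 0" for t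
      by (rule pot.QS_vanish[of ev, OF ev_simps(1) ev_simps(4) ev_om ev_n n])
    show ?thesis
    proof (cases \<Phi>)
      case (Scalar s)
      \<comment> \<open>For n = 2 the order is 0 and a functional acts as left multiplication by an
        element of S.\<close>
      then have s: "s \<in> carrier S" and k: "CARD('n) - 2 = 0" using P by (auto simp: pure_tensors_def)
      have "ev (om (n0 (a s)) (om pot.Omega (n0 (a x)))) = 0"
        using vanish pot.QS_0[OF a_SA[OF s] x(2)] unfolding k by blast
      then show ?thesis using multi_contract_Omega(1)[OF x(2) s] s x unfolding x Scalar
        by (auto intro!: imageI om_FC om_Omega_FC)
    next
      case (Tensor \<phi>s)
      then have ps: "set \<phi>s \<subseteq> bdual V" "length \<phi>s = CARD('n) - 2" using P by (auto simp: pure_tensors_def)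
      have "ev (contr \<phi>s (om pot.Omega (n0 (a x)))) = 0"
        by (rule vanish) (use contr_QS[OF x(2) ps(1)] ps(2) in simp)
      then show ?thesis using multi_contract_Omega(2)[OF x(2) ps(1)] contr_cls[OF ps(1) om_Omega_FC[OF x(2)]] unfolding x Tensor
        by auto
    qed
  qed
  moreover have "formal.subspace {f \<in> FC. ev f = 0}"
    unfolding formal.subspace_def mem_Collect_eq
    by (auto simp only: ev_simps gfun.scale_zero_right add_0_right intro!: FC_closed)
  ultimately have "derivative_space S Tr V (cls pot.Omega) (CARD('n) - 2) \<subseteq> cls ` {f \<in> FC. ev f = 0}"
    unfolding derivative_space_def by (intro lin_span_TA_subset) blast+
  then have "I \<subseteq> cls ` {f \<in> FC. ev f = 0}" by (rule ring.genideal_minimal[OF ring_TA kernel_ideal])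
  then obtain g where "cls f = cls g" "ev g = 0" using fI by blast
  then show "ev f = 0" using ev_cls[of f g] by (simp add: cls_eq_iff)
next
  assume f0: "ev f = 0"
  define I' where "I' = {f \<in> FC. cls f \<in> I}"
  note pre = ideal_TA_pre[OF ideal_I]
  \<comment> \<open>As the (r, r) entry of a matrix of value 0, the normal form of f becomes
    accessible to the reordering of words.\<close>
  obtain A where A: "(A, ev f) \<in> pot.Gr" "A r r = nf f" using ex_Gr[OF f] by blast
  have cmt: "pot.cmt i j k l \<in> I'" for i j k l
  proof -
    have "pot.cmt i j k l \<in> DS (CARD('n) - 2)"
      by (rule pot.cmt_span[OF subspace_DS DS_base DS_step n]; assumption)
    then show ?thesis unfolding DS_def I'_def using ring.genideal_self[OF ring_TA derivative_space_carrier] by blast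
  qed
  have "A r r \<in> I'"
  proof (rule pot.Gr_kernel[of I' A r r])
    show "formal.subspace I'" unfolding I'_def by (rule pre(1))
    show "om x y \<in> I'" "om y x \<in> I'" if "x \<in> FC" "y \<in> I'" for x y
      using that pre(3)[of y x] pre(4)[of y x] unfolding I'_def by (simp_all add: om_FC) (simp_all add: om_def)
    show "(pot.mm (pot.m1 (Xv i)) (pot.m1 (Xv j)) - pot.mm (pot.m1 (Xv j)) (pot.m1 (Xv i))) k l \<in> I'" for i j k l
      using cmt by (simp only: pot.cmt_def)
    show "(A, 0) \<in> pot.Gr" using A(1) by (simp only: f0)
  qed
  then show "cls f \<in> I" unfolding A(2) I'_def by simp
qed

end

section \<open>Polynomial functions\<close>

lemma polynomial_functions_scale: "p \<in> polynomial_functions \<Longrightarrow> (\<lambda>v. c * p v) \<in> polynomial_functions"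
  by (rule polynomial_functions.intros(4)[OF polynomial_functions.intros(1)])

lemma polynomial_functions_zero: "0 \<in> polynomial_functions"
  using polynomial_functions.intros(1)[of 0] by (simp only: zero_fun_def)

lemma polynomial_functions_sum:
  "(\<And>a. a \<in> A \<Longrightarrow> f a \<in> polynomial_functions) \<Longrightarrow> (\<lambda>v. \<Sum>a\<in>A. f a v) \<in> polynomial_functions"
proof (induction A rule: infinite_finite_induct)
  case (insert a A)
  have "(\<lambda>v. f a v + (\<Sum>a\<in>A. f a v)) \<in> polynomial_functions"
    using insert by (intro polynomial_functions.intros(3)) auto
  then show ?case using insert.hyps by simp
qed (simp_all add: polynomial_functions.intros(1))

lemma polynomial_functions_subst:
  fixes M :: "complex^'n^'n"
  assumes "p \<in> polynomial_functions"
  shows "(\<lambda>v. p (M *v v)) \<in> polynomial_functions"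
  using assms
proof (induction)
  case (2 i)
  have "(\<lambda>v. \<Sum>j\<in>UNIV. vec_nth (vec_nth M i) j * vec_nth v j) \<in> polynomial_functions"
    by (intro polynomial_functions_sum polynomial_functions_scale polynomial_functions.intros(2))
  then show ?case by (simp add: matrix_vector_mult_def)
qed (rule polynomial_functions.intros; assumption)+

lemma abelian_monoid_polynomial_ring: "abelian_monoid polynomial_ring"
  by (rule abelian_monoidI)
    (auto simp: polynomial_ring_def polynomial_functions_zero plus_fun_def zero_fun_def fun_eq_iff
      intro: polynomial_functions.intros)

lemma finsum_polynomial_ring:
  "finite A \<Longrightarrow> f \<in> A \<rightarrow> polynomial_functions \<Longrightarrow> finsum polynomial_ring f A = (\<lambda>v. \<Sum>a\<in>A. f a v)"
proof (induction A rule: finite_induct)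
  case empty
  show ?case using abelian_monoid.finsum_empty[OF abelian_monoid_polynomial_ring]
    by (simp add: polynomial_ring_def zero_fun_def)
next
  case (insert a A)
  have "finsum polynomial_ring f (insert a A) = f a \<oplus>\<^bsub>polynomial_ring\<^esub> finsum polynomial_ring f A"
    by (rule abelian_monoid.finsum_insert[OF abelian_monoid_polynomial_ring insert.hyps])
      (use insert.prems in \<open>auto simp: polynomial_ring_def\<close>)
  then show ?case using insert by (simp add: polynomial_ring_def plus_fun_def fun_eq_iff)
qed

context finite_rep
begin

abbreviation "PS \<equiv> carrier (polynomial_smash G \<rho>)"

lemma PS_iff: "x \<in> PS \<longleftrightarrow> x \<in> Fn \<and> (\<forall>g\<in>carrier G. x g \<in> polynomial_functions)"
  by (auto simp: polynomial_smash_def smash_product_def polynomial_ring_def Fn_def)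

lemma PS_sel:
  "x \<oplus>\<^bsub>polynomial_smash G \<rho>\<^esub> y = x + y" "\<zero>\<^bsub>polynomial_smash G \<rho>\<^esub> = 0"
  "\<one>\<^bsub>polynomial_smash G \<rho>\<^esub> = gel \<one>" "c \<odot>\<^bsub>polynomial_smash G \<rho>\<^esub> x = gscale c x"
  by (auto simp: polynomial_smash_def smash_product_def polynomial_ring_def gel_def gscale_def fun_eq_iff)

lemma PS_mult:
  assumes x: "x \<in> PS" and y: "y \<in> PS"
  shows "x \<otimes>\<^bsub>polynomial_smash G \<rho>\<^esub> y = x \<star> y"
proof (rule ext)
  fix g
  show "(x \<otimes>\<^bsub>polynomial_smash G \<rho>\<^esub> y) g = (x \<star> y) g"
  proof (cases "g \<in> carrier G")
    case g: True
    have "(\<lambda>h. x h \<otimes>\<^bsub>polynomial_ring\<^esub> function_action G \<rho> h (y (inv h \<otimes> g))) \<in> carrier G \<rightarrow> polynomial_functions"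
    proof
      fix h assume h: "h \<in> carrier G"
      have "(\<lambda>v. y (inv h \<otimes> g) (\<rho> (inv h) *v v)) \<in> polynomial_functions"
        using y g h by (intro polynomial_functions_subst) (simp add: PS_iff)
      then show "x h \<otimes>\<^bsub>polynomial_ring\<^esub> function_action G \<rho> h (y (inv h \<otimes> g)) \<in> polynomial_functions"
        using x h by (simp add: PS_iff polynomial_ring_def function_action_def polynomial_functions.intros(4))
    qed
    from finsum_polynomial_ring[OF fin this] show ?thesis using g
      by (simp add: polynomial_smash_def smash_product_def sm_def) (simp add: polynomial_ring_def function_action_def)
  next
    case False
    then show ?thesis by (simp add: polynomial_smash_def smash_product_def sm_def polynomial_ring_def zero_fun_def)
  qed
qed

lemma SA_PS: "x \<in> SA \<Longrightarrow> x \<in> PS"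
proof -
  assume x: "x \<in> SA"
  have "x g \<in> polynomial_functions" for g
  proof -
    have "x g = (\<lambda>v. x g 0)" by (rule ext) (rule SA_eval[OF x])
    from sym[OF this] show ?thesis by (rule subst) (rule polynomial_functions.intros(1))
  qed
  then show "x \<in> PS" using SA_Fn[OF x] unfolding PS_iff by blast
qed

end

context concrete_corner
begin

lemma Gr_PS: "(A, y) \<in> pot.Gr \<Longrightarrow> y \<in> PS"
proof (induction rule: pot.Gr.induct)
  case zero
  show ?case unfolding PS_iff
    by (intro conjI ballI gfun.subspace_0[OF subspace_Fn]) (subst zero_fun_apply, rule polynomial_functions_zero)
next
  case (add A y B z)
  then show ?case using gfun.subspace_add[OF subspace_Fn, of y z]
    by (auto simp: PS_iff plus_fun_def intro: polynomial_functions.intros(3))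
next
  case (scale A y c)
  then show ?case using gfun.subspace_scale[OF subspace_Fn, of y c]
    by (auto simp: PS_iff gscale_def intro: polynomial_functions_scale)
next
  case (base g)
  then show ?case by (intro SA_PS gel_SA)
next
  case (step A y i)
  have "(Xv i \<star> y) g \<in> polynomial_functions" if g: "g \<in> carrier G" for g
  proof -
    have "(\<lambda>v. vec_nth v i * y g v) \<in> polynomial_functions"
      using step g by (intro polynomial_functions.intros(4,2)) (simp add: PS_iff)
    moreover have "(Xv i \<star> y) g = (\<lambda>v. vec_nth v i * y g v)" using g by (intro ext) (simp add: Xv_sm)
    ultimately show ?thesis by (simp only:)
  qed
  then show ?case by (simp add: PS_iff)
qed

text \<open>The pair is arbitrary in the induction over f, so that a product of functions is handled
  by multiplying twice.\<close>

lemma Gr_polynomial: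
  assumes "f \<in> polynomial_functions"
  shows "(A, y) \<in> pot.Gr \<Longrightarrow> \<exists>B. (B, \<lambda>g v. f v * y g v) \<in> pot.Gr"
  using assms
proof (induction arbitrary: A y)
  case (1 c)
  then show ?case using pot.Gr.scale[of A y c] unfolding gscale_def by blast
next
  case (2 i)
  have "Xv i \<star> y = (\<lambda>g v. vec_nth v i * y g v)"
    using Gr_PS[OF 2] by (intro ext) (auto simp: Xv_sm PS_iff Fn_def)
  then show ?case using pot.Gr.step[OF 2, of i] by (metis (no_types, lifting))
next
  case (3 f1 f2)
  obtain B C where B: "(B, \<lambda>g v. f1 v * y g v) \<in> pot.Gr" and C: "(C, \<lambda>g v. f2 v * y g v) \<in> pot.Gr"
    using 3 by meson
  have "(\<lambda>g v. f1 v * y g v) + (\<lambda>g v. f2 v * y g v) = (\<lambda>g v. (f1 v + f2 v) * y g v)"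
    by (intro ext) (simp add: algebra_simps)
  then show ?case using pot.Gr.add[OF B C] by (metis (no_types, lifting))
next
  case (4 f1 f2)
  obtain B where B: "(B, \<lambda>g v. f2 v * y g v) \<in> pot.Gr" using 4 by meson
  obtain C where "(C, \<lambda>g v. f1 v * (f2 v * y g v)) \<in> pot.Gr" using 4(3)[OF B] by blast
  then show ?case unfolding mult.assoc by blast
qed

text \<open>With \<open>Gr_entry\<close> this gives surjectivity of the evaluation: the element e x
  e of the corner is the value of an (r, r) entry.\<close>

lemma PS_Gr: "x \<in> PS \<Longrightarrow> \<exists>A. (A, x) \<in> pot.Gr"
proof -
  assume x: "x \<in> PS"
  have ex: "\<forall>g\<in>carrier G. \<exists>B. (B, \<lambda>h v. x g v * gel g h v) \<in> pot.Gr"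
  proof
    fix g assume g: "g \<in> carrier G"
    then have "x g \<in> polynomial_functions" using x by (simp add: PS_iff)
    from Gr_polynomial[OF this pot.Gr.base[OF g]] show "\<exists>B. (B, \<lambda>h v. x g v * gel g h v) \<in> pot.Gr" .
  qed
  define B where "B g = (SOME B. (B, \<lambda>h v. x g v * gel g h v) \<in> pot.Gr)" for g
  have B: "(B g, \<lambda>h v. x g v * gel g h v) \<in> pot.Gr" if "g \<in> carrier G" for g
    unfolding B_def by (rule someI_ex[OF bspec[OF ex that]])
  have eq: "x = (\<Sum>g\<in>carrier G. (\<lambda>h v. x g v * gel g h v))"
  proof (intro ext)
    fix h v
    have "(\<Sum>g\<in>carrier G. (\<lambda>h v. x g v * gel g h v)) h v = (\<Sum>g\<in>carrier G. if g = h then x h v else 0)"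
      unfolding sum_apply2 by (rule sum.cong) (auto simp: gel_def)
    then show "x h v = (\<Sum>g\<in>carrier G. (\<lambda>h v. x g v * gel g h v)) h v"
      using x fin by (simp add: PS_iff Fn_def sum.delta)
  qed
  have "(\<Sum>g\<in>carrier G. B g, \<Sum>g\<in>carrier G. (\<lambda>h v. x g v * gel g h v)) \<in> pot.Gr"
    using B by (rule pot.Gr_sum)
  then have "(\<Sum>g\<in>carrier G. B g, x) \<in> pot.Gr" by (subst eq)
  then show ?thesis by (rule exI[of "\<lambda>A. (A, x) \<in> pot.Gr"])
qed

lemma ev_PS: "f \<in> FC \<Longrightarrow> ev f \<in> PS" "f \<in> FC \<Longrightarrow> e \<star> ev f \<star> e = ev f"
proof -
  assume f: "f \<in> FC"
  obtain A where A: "(A, ev f) \<in> pot.Gr" "A r r = nf f" using ex_Gr[OF f] by blast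
  show PS: "ev f \<in> PS" by (rule Gr_PS[OF A(1)])
  have "ev (A r r) = e \<star> q r \<star> ev f \<star> p r \<star> e" by (rule ev_Gr_entry[OF A(1)])
  then show "e \<star> ev f \<star> e = ev f" using PS unfolding A(2) ev_nf c_pq_r by (simp add: sm_assoc PS_iff SA_Fn)
qed

lemma corner_isomorphic:
  assumes n: "CARD('n) \<ge> 2"
  shows "alg_isomorphic (corner (polynomial_smash G \<rho>) e) (derivation_quotient S Tr V (cls pot.Omega) (CARD('n) - 2))"
  unfolding derivation_quotient_def
proof (rule quotient_iso[OF ideal_I, of ev])
  have sel: "x \<oplus>\<^bsub>corner (polynomial_smash G \<rho>) e\<^esub> y = x + y" "\<zero>\<^bsub>corner (polynomial_smash G \<rho>) e\<^esub> = 0"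
    "c \<odot>\<^bsub>corner (polynomial_smash G \<rho>) e\<^esub> x = gscale c x" "\<one>\<^bsub>corner (polynomial_smash G \<rho>) e\<^esub> = e"
    "x \<otimes>\<^bsub>corner (polynomial_smash G \<rho>) e\<^esub> y = x \<otimes>\<^bsub>polynomial_smash G \<rho>\<^esub> y" for x y c
    using PS_sel by (simp_all add: corner_def)
  show "x \<oplus>\<^bsub>corner (polynomial_smash G \<rho>) e\<^esub> y = x + y" "\<zero>\<^bsub>corner (polynomial_smash G \<rho>) e\<^esub> = 0" for x y
    by (rule sel)+
  show "ev (f + g) = ev f + ev g" for f g by (rule ev_simps)
  show "ev (formal_scale c f) = c \<odot>\<^bsub>corner (polynomial_smash G \<rho>) e\<^esub> ev f" for c f by (simp only: ev_simps sel)
  show "ev (fm f g) = ev f \<otimes>\<^bsub>corner (polynomial_smash G \<rho>) e\<^esub> ev g" if "f \<in> FC" "g \<in> FC" for f g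
    using that by (simp only: ev_fm sel PS_mult ev_PS)
  show "ev (pt (Scalar \<one>\<^bsub>S\<^esub>)) = \<one>\<^bsub>corner (polynomial_smash G \<rho>) e\<^esub>" by (simp only: ev_simps ptm.simps a_hom sel)
  show "ev k = 0" if "k \<in> TK" for k using that by (rule ev_TK)
  show "cls f \<in> I \<longleftrightarrow> ev f = 0" if "f \<in> FC" for f by (rule kernel[OF n that])
  have PSm: "e \<otimes>\<^bsub>polynomial_smash G \<rho>\<^esub> x \<otimes>\<^bsub>polynomial_smash G \<rho>\<^esub> e = e \<star> x \<star> e" if x: "x \<in> PS" for x
  proof -
    obtain A where A: "(A, x) \<in> pot.Gr" using PS_Gr[OF x] by blast
    have "e \<star> x \<in> PS" by (rule Gr_PS[OF pot.Gr_SA(1)[OF A c_e_SA]])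
    then show ?thesis using x by (simp add: PS_mult SA_PS)
  qed
  show "carrier (corner (polynomial_smash G \<rho>) e) = ev ` FC"
  proof (intro Set.set_eqI iffI)
    fix y assume "y \<in> carrier (corner (polynomial_smash G \<rho>) e)"
    then obtain x where x: "x \<in> PS" "y = e \<star> x \<star> e" using PSm by (auto simp: corner_def)
    obtain A where A: "(A, x) \<in> pot.Gr" using PS_Gr[OF x(1)] by blast
    have "A r r \<in> FC" using pot.unital_RM[OF pot.Gr_unital[OF A]] by (simp add: pot.RM_def)
    moreover have "ev (A r r) = e \<star> q r \<star> x \<star> p r \<star> e" by (rule ev_Gr_entry[OF A])
    then have "ev (A r r) = y" using x unfolding c_pq_r by (simp add: sm_assoc PS_iff SA_Fn)
    ultimately show "y \<in> ev ` FC" by blast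
  next
    fix y assume "y \<in> ev ` FC"
    then obtain f where f: "f \<in> FC" "y = ev f" by blast
    have "y = e \<otimes>\<^bsub>polynomial_smash G \<rho>\<^esub> ev f \<otimes>\<^bsub>polynomial_smash G \<rho>\<^esub> e"
      unfolding f(2) PSm[OF ev_PS(1)[OF f(1)]] by (rule ev_PS(2)[OF f(1), symmetric])
    then show "y \<in> carrier (corner (polynomial_smash G \<rho>) e)" using ev_PS(1)[OF f(1)] by (auto simp: corner_def)
  qed
qed

end

section \<open>Matrix units in the group algebra\<close>

text \<open>T i j k x is the entry (j, k) of block i of x. The isomorphism with matrix blocks enters
  through these coordinates, \<open>T_eqI\<close> being its injectivity and \<open>T_surj\<close>
  its surjectivity.\<close>

locale wedderburn = finite_rep G \<rho>
  for G :: "('g, 'm) monoid_scheme" (structure) and \<rho> :: "'g \<Rightarrow> complex^'n^'n" +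
  fixes m :: nat and d :: "nat \<Rightarrow> nat" and T :: "nat \<Rightarrow> nat \<Rightarrow> nat \<Rightarrow> ('g, 'n) gfun \<Rightarrow> complex"
  assumes d_pos: "\<And>i. i < m \<Longrightarrow> 0 < d i"
    and T_add: "\<And>x y i j k. x \<in> SA \<Longrightarrow> y \<in> SA \<Longrightarrow> i < m \<Longrightarrow> j < d i \<Longrightarrow> k < d i \<Longrightarrow> T i j k (x + y) = T i j k x + T i j k y"
    and T_scale: "\<And>c x i j k. x \<in> SA \<Longrightarrow> i < m \<Longrightarrow> j < d i \<Longrightarrow> k < d i \<Longrightarrow> T i j k (gscale c x) = c * T i j k x"
    and T_mult: "\<And>x y i j k. x \<in> SA \<Longrightarrow> y \<in> SA \<Longrightarrow> i < m \<Longrightarrow> j < d i \<Longrightarrow> k < d i \<Longrightarrow>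
      T i j k (x \<star> y) = (\<Sum>l<d i. T i j l x * T i l k y)"
    and T_one: "\<And>i j k. i < m \<Longrightarrow> j < d i \<Longrightarrow> k < d i \<Longrightarrow> T i j k (gel \<one>) = (if j = k then 1 else 0)"
    and T_eqI: "\<And>x y. x \<in> SA \<Longrightarrow> y \<in> SA \<Longrightarrow> (\<And>i j k. i < m \<Longrightarrow> j < d i \<Longrightarrow> k < d i \<Longrightarrow> T i j k x = T i j k y) \<Longrightarrow> x = y"
    and T_surj: "\<And>c. \<exists>x\<in>SA. \<forall>i<m. \<forall>j<d i. \<forall>k<d i. T i j k x = c i j k"
begin

lemma SA_closed: "x \<in> SA \<Longrightarrow> y \<in> SA \<Longrightarrow> x + y \<in> SA" "x \<in> SA \<Longrightarrow> gscale c x \<in> SA" "0 \<in> SA"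
  "(\<And>a. a \<in> A \<Longrightarrow> F a \<in> SA) \<Longrightarrow> sum F A \<in> SA"
  by (rule gfun.subspace_add[OF subspace_SA] gfun.subspace_scale[OF subspace_SA]
      gfun.subspace_0[OF subspace_SA] gfun.subspace_sum[OF subspace_SA]; assumption)+

lemma T_zero: "i < m \<Longrightarrow> j < d i \<Longrightarrow> k < d i \<Longrightarrow> T i j k 0 = 0"
  using T_scale[OF SA_closed(3), of i j k 0] by (simp only: gfun.scale_zero_left mult_zero_left)

lemma T_sum:
  assumes "i < m" "j < d i" "k < d i"
  shows "(\<And>a. a \<in> A \<Longrightarrow> F a \<in> SA) \<Longrightarrow> T i j k (sum F A) = (\<Sum>a\<in>A. T i j k (F a))"
proof (induction A rule: infinite_finite_induct)
  case (insert a A)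
  have IH: "T i j k (sum F A) = (\<Sum>a\<in>A. T i j k (F a))" by (rule insert.IH) (rule insert.prems, rule insertI2)
  have "F a \<in> SA" "sum F A \<in> SA" using insert.prems by (auto intro: SA_closed(4))
  then show ?case using IH assms insert.hyps by (simp only: sum.insert T_add simp_thms)
next
  case empty
  show ?case by (simp only: sum.empty T_zero[OF assms])
next
  case (infinite A)
  show ?case by (simp only: sum.infinite[OF infinite(1)] T_zero[OF assms])
qed

definition U :: "nat \<Rightarrow> nat \<Rightarrow> nat \<Rightarrow> ('g, 'n) gfun" where
  "U i j k = (SOME x. x \<in> SA \<and> (\<forall>i'<m. \<forall>j'<d i'. \<forall>k'<d i'. T i' j' k' x = (if i' = i \<and> j' = j \<and> k' = k then 1 else 0)))"

lemma U_SA [simp]: "U i j k \<in> SA"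
  and T_U: "i' < m \<Longrightarrow> j' < d i' \<Longrightarrow> k' < d i' \<Longrightarrow> T i' j' k' (U i j k) = (if i' = i \<and> j' = j \<and> k' = k then 1 else 0)"
proof -
  have "\<exists>x. x \<in> SA \<and> (\<forall>i'<m. \<forall>j'<d i'. \<forall>k'<d i'. T i' j' k' x = (if i' = i \<and> j' = j \<and> k' = k then 1 else 0))"
    using T_surj[of "\<lambda>i' j' k'. if i' = i \<and> j' = j \<and> k' = k then 1 else 0"] by (simp only: Bex_def)
  from someI_ex[OF this]
  show "U i j k \<in> SA" "i' < m \<Longrightarrow> j' < d i' \<Longrightarrow> k' < d i' \<Longrightarrow> T i' j' k' (U i j k) = (if i' = i \<and> j' = j \<and> k' = k then 1 else 0)"
    unfolding U_def by blast+
qed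

lemma T_U_mult:
  assumes x: "x \<in> SA" and ik: "i' < m" "j' < d i'" "k' < d i'"
  shows "k < d i \<Longrightarrow> T i' j' k' (U i j k \<star> x) = (if i' = i \<and> j' = j then T i k k' x else 0)"
    "j < d i \<Longrightarrow> T i' j' k' (x \<star> U i j k) = (if i' = i \<and> k' = k then T i j' j x else 0)"
proof -
  assume k: "k < d i"
  have "T i' j' k' (U i j k \<star> x) = (\<Sum>l<d i'. T i' j' l (U i j k) * T i' l k' x)"
    by (rule T_mult[OF U_SA x ik])
  also have "\<dots> = (\<Sum>l<d i'. if l = k then (if i' = i \<and> j' = j then T i' k k' x else 0) else 0)"
    by (rule sum.cong[OF refl]) (use ik in \<open>simp add: T_U\<close>)
  also have "\<dots> = (if i' = i \<and> j' = j then T i k k' x else 0)" using k by (auto simp: sum.delta)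
  finally show "T i' j' k' (U i j k \<star> x) = (if i' = i \<and> j' = j then T i k k' x else 0)" .
next
  assume j: "j < d i"
  have "T i' j' k' (x \<star> U i j k) = (\<Sum>l<d i'. T i' j' l x * T i' l k' (U i j k))"
    by (rule T_mult[OF x U_SA ik])
  also have "\<dots> = (\<Sum>l<d i'. if l = j then (if i' = i \<and> k' = k then T i' j' j x else 0) else 0)"
    by (rule sum.cong[OF refl]) (use ik in \<open>simp add: T_U\<close>)
  also have "\<dots> = (if i' = i \<and> k' = k then T i j' j x else 0)" using j by (auto simp: sum.delta)
  finally show "T i' j' k' (x \<star> U i j k) = (if i' = i \<and> k' = k then T i j' j x else 0)" .
qed

lemma U_x_U:
  assumes "i < m" "j < d i" "k < d i" "j' < d i" "k' < d i" "x \<in> SA"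
  shows "U i j k \<star> x \<star> U i j' k' = gscale (T i k j' x) (U i j k')"
proof (rule T_eqI)
  fix i1 j1 k1 assume "i1 < m" "j1 < d i1" "k1 < d i1"
  then show "T i1 j1 k1 (U i j k \<star> x \<star> U i j' k') = T i1 j1 k1 (gscale (T i k j' x) (U i j k'))"
    using assms by (auto simp: T_U_mult T_scale T_U)
qed (use assms in \<open>simp_all add: SA_closed\<close>)

lemma one_decomp: "(\<Sum>i<m. \<Sum>j<d i. U i j j) = gel \<one>"
proof (rule T_eqI)
  fix i1 j1 k1 assume 1: "i1 < m" "j1 < d i1" "k1 < d i1"
  have "T i1 j1 k1 (\<Sum>i<m. \<Sum>j<d i. U i j j) = (\<Sum>i<m. \<Sum>j<d i. if i1 = i \<and> j1 = j \<and> k1 = j then 1 else 0)"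
    using 1 by (simp only: T_sum SA_closed(4) U_SA T_U)
  also have "\<dots> = (\<Sum>i<m. if i = i1 then (if j1 = k1 then 1 else 0) else 0)"
  proof (rule sum.cong[OF refl])
    fix i
    have "(\<Sum>j<d i. if i1 = i \<and> j1 = j \<and> k1 = j then 1 else 0) = (\<Sum>j<d i. if j = j1 then (if i = i1 \<and> j1 = k1 then 1 else 0) else (0::complex))"
      by (rule sum.cong) auto
    then show "(\<Sum>j<d i. if i1 = i \<and> j1 = j \<and> k1 = j then 1 else 0) = (if i = i1 then (if j1 = k1 then 1 else 0) else (0::complex))"
      using 1 by (auto simp: sum.delta)
  qed
  also have "\<dots> = T i1 j1 k1 (gel \<one>)" using 1 by (simp add: sum.delta T_one)
  finally show "T i1 j1 k1 (\<Sum>i<m. \<Sum>j<d i. U i j j) = T i1 j1 k1 (gel \<one>)" .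
qed (simp_all add: SA_closed)

lemma U_decomp:
  assumes x: "x \<in> SA"
  shows "x = (\<Sum>i<m. \<Sum>j<d i. \<Sum>k<d i. gscale (T i j k x) (U i j k))"
proof (rule T_eqI)
  fix i1 j1 k1 assume 1: "i1 < m" "j1 < d i1" "k1 < d i1"
  have "T i1 j1 k1 (\<Sum>i<m. \<Sum>j<d i. \<Sum>k<d i. gscale (T i j k x) (U i j k)) =
      (\<Sum>i<m. \<Sum>j<d i. \<Sum>k<d i. T i j k x * (if i1 = i \<and> j1 = j \<and> k1 = k then 1 else 0))"
    using 1 by (simp only: T_sum SA_closed U_SA T_scale T_U)
  also have "\<dots> = (\<Sum>i<m. \<Sum>j<d i. \<Sum>k<d i. if i1 = i \<and> j1 = j \<and> k1 = k then T i j k x else 0)"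
    by (rule sum.cong[OF refl], rule sum.cong[OF refl], rule sum.cong[OF refl]) simp
  also have "\<dots> = (\<Sum>i<m. if i = i1 then T i1 j1 k1 x else 0)"
  proof (rule sum.cong[OF refl])
    fix i
    have "(\<Sum>j<d i. \<Sum>k<d i. if i1 = i \<and> j1 = j \<and> k1 = k then T i j k x else 0) =
      (\<Sum>j<d i. if j = j1 then (\<Sum>k<d i. if k = k1 then (if i = i1 then T i1 j1 k1 x else 0) else 0) else 0)"
      by (rule sum.cong[OF refl]) (use 1 in \<open>auto simp: sum.delta sum.delta'\<close>)
    also have "\<dots> = (if i = i1 then T i1 j1 k1 x else 0)" using 1 by (auto simp: sum.delta)
    finally show "(\<Sum>j<d i. \<Sum>k<d i. if i1 = i \<and> j1 = j \<and> k1 = k then T i j k x else 0) = (if i = i1 then T i1 j1 k1 x else 0)" .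
  qed
  also have "\<dots> = T i1 j1 k1 x" using 1 by (simp add: sum.delta)
  finally show "T i1 j1 k1 x = T i1 j1 k1 (\<Sum>i<m. \<Sum>j<d i. \<Sum>k<d i. gscale (T i j k x) (U i j k))" ..
qed (use x in \<open>simp_all add: SA_closed\<close>)

definition TrT :: "('g, 'n) gfun \<Rightarrow> complex" where "TrT x = (\<Sum>i<m. \<Sum>j<d i. T i j j x)"

lemma TrT_linear: "x \<in> SA \<Longrightarrow> y \<in> SA \<Longrightarrow> TrT (x + y) = TrT x + TrT y" "x \<in> SA \<Longrightarrow> TrT (gscale c x) = c * TrT x"
  by (simp_all add: TrT_def T_add T_scale sum.distrib sum_distrib_left cong: sum.cong_simp)

lemma TrT_zero: "TrT 0 = 0"
  using TrT_linear(2)[OF SA_closed(3), of 0] by (simp only: gfun.scale_zero_left mult_zero_left)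

lemma TrT_comm: "x \<in> SA \<Longrightarrow> y \<in> SA \<Longrightarrow> TrT (x \<star> y) = TrT (y \<star> x)"
proof -
  assume x: "x \<in> SA" and y: "y \<in> SA"
  have "(\<Sum>j<d i. T i j j (x \<star> y)) = (\<Sum>j<d i. T i j j (y \<star> x))" if i: "i < m" for i
  proof -
    have "(\<Sum>j<d i. T i j j (x \<star> y)) = (\<Sum>j<d i. \<Sum>l<d i. T i j l x * T i l j y)"
      by (rule sum.cong[OF refl]) (use i x y in \<open>simp add: T_mult\<close>)
    also have "\<dots> = (\<Sum>l<d i. \<Sum>j<d i. T i j l x * T i l j y)" by (rule sum.swap)
    also have "\<dots> = (\<Sum>l<d i. T i l l (y \<star> x))"
      by (rule sum.cong[OF refl]) (use i x y in \<open>simp add: T_mult mult.commute\<close>)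
    finally show ?thesis .
  qed
  then show ?thesis by (simp add: TrT_def)
qed

lemma TrT_U: "i < m \<Longrightarrow> j < d i \<Longrightarrow> k < d i \<Longrightarrow> x \<in> SA \<Longrightarrow> TrT (U i j k \<star> x) = T i k j x"
proof -
  assume a: "i < m" "j < d i" "k < d i" "x \<in> SA"
  have "TrT (U i j k \<star> x) = (\<Sum>i'<m. \<Sum>j'<d i'. if i' = i \<and> j' = j then T i k j' x else 0)"
    unfolding TrT_def by (rule sum.cong[OF refl], rule sum.cong[OF refl]) (use a in \<open>simp add: T_U_mult\<close>)
  also have "\<dots> = (\<Sum>i'<m. if i' = i then (\<Sum>j'<d i. if j' = j then T i k j x else 0) else 0)"
    by (rule sum.cong[OF refl]) (auto intro!: sum.cong)
  also have "\<dots> = T i k j x" using a by (simp add: sum.delta)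
  finally show ?thesis .
qed

lemma lam_eqI: "x \<in> SA \<Longrightarrow> y \<in> SA \<Longrightarrow> (\<And>s. s \<in> SA \<Longrightarrow> lam (x \<star> s) = lam (y \<star> s)) \<Longrightarrow> x = y"
proof -
  assume x: "x \<in> SA" and y: "y \<in> SA" and eq: "\<And>s. s \<in> SA \<Longrightarrow> lam (x \<star> s) = lam (y \<star> s)"
  have "x h v = y h v" for h v
  proof (cases "h \<in> carrier G")
    case True
    have "x h 0 = y h 0" using eq[of "gel (inv h)"] lam_gel[OF x True] lam_gel[OF y True] True by simp
    then show ?thesis using SA_eval[OF x, of h v] SA_eval[OF y, of h v] by simp
  next
    case False
    then show ?thesis using SA_Fn[OF x] SA_Fn[OF y] by (simp add: Fn_def)
  qed
  then show "x = y" by (intro ext)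
qed

definition minI :: "('g, 'n) gfun \<Rightarrow> bool" where
  "minI f \<longleftrightarrow> f \<in> SA \<and> f \<noteq> 0 \<and> f \<star> f = f \<and>
    (\<forall>g\<in>SA. g \<star> g = g \<and> f \<star> g = g \<and> g \<star> f = g \<longrightarrow> g = 0 \<or> g = f)"

text \<open>
  A minimal idempotent \<open>f\<close> is a multiple of \<open>f \<star> U i j k \<star> f\<close> as soon as this is nonzero, since that
  multiple is an idempotent below \<open>f\<close>.
\<close>

lemma minI_cases:
  assumes f: "minI f"
  obtains i j k where "i < m" "j < d i" "k < d i" "T i k j f \<noteq> 0" "f \<star> U i j k \<star> f = gscale (T i k j f) f" "TrT f = 1"
proof -
  have fS: "f \<in> SA" and ff: "f \<star> f = f" using f by (auto simp: minI_def)
  have "\<exists>i<m. \<exists>j<d i. \<exists>k<d i. T i k j f \<noteq> 0"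
  proof (rule ccontr)
    assume "\<not> ?thesis"
    then have "f = 0" by (intro T_eqI[OF fS SA_closed(3)]) (auto simp: T_zero)
    then show False using f by (simp add: minI_def)
  qed
  then obtain i j k where ijk: "i < m" "j < d i" "k < d i" "T i k j f \<noteq> 0" by blast
  define c where "c = T i k j f"
  define u where "u = f \<star> U i j k \<star> f"
  have u: "u \<in> SA" using fS by (simp add: u_def)
  have "u \<star> u = f \<star> (U i j k \<star> (f \<star> f) \<star> U i j k) \<star> f" by (simp only: u_def sm_assoc)
  also have "\<dots> = f \<star> gscale c (U i j k) \<star> f" using ijk fS by (simp only: ff U_x_U c_def)
  finally have uu: "u \<star> u = gscale c u" by (simp only: sm_linear u_def)
  define g where "g = gscale (1 / c) u"
  have c0: "c \<noteq> 0" using ijk by (simp add: c_def)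
  have g: "g \<in> SA" using u by (simp add: g_def SA_closed)
  have "g \<star> g = g"
    using c0 unfolding g_def sm_linear uu gfun.scale_scale by simp
  moreover have "f \<star> u = u" "u \<star> f = u"
    unfolding u_def by (simp_all only: sm_assoc ff) (simp_all only: sm_assoc[symmetric] ff)
  then have "f \<star> g = g" "g \<star> f = g" by (simp_all only: g_def sm_linear)
  ultimately have "g = 0 \<or> g = f" using f g unfolding minI_def by blast
  have "TrT u = TrT (U i j k \<star> f \<star> f)"
    unfolding u_def using TrT_comm[of f "U i j k \<star> f"] fS by (simp add: sm_assoc)
  also have "\<dots> = c" using ijk fS by (simp add: sm_assoc ff TrT_U c_def)
  finally have Tg: "TrT g = 1" using c0 u by (simp add: g_def TrT_linear)
  have "g \<noteq> 0" using Tg TrT_zero by (metis zero_neq_one)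
  then have gf: "g = f" using \<open>g = 0 \<or> g = f\<close> by blast
  have "gscale c g = u" unfolding g_def gfun.scale_scale using c0 by simp
  then have "f \<star> U i j k \<star> f = gscale (T i k j f) f" unfolding gf u_def c_def by (rule sym)
  then show thesis using that ijk Tg gf by blast
qed

text \<open>With a matrix unit U such that f U f = c f and c nonzero, c^2 f x f = f U (f x f) U f,
  and a product U y U is a multiple of U.\<close>

lemma minI_corner:
  assumes f: "minI f" and x: "x \<in> SA"
  shows "\<exists>c. f \<star> x \<star> f = gscale c f"
proof -
  have fS: "f \<in> SA" using f by (simp add: minI_def)
  obtain i j k where ijk: "i < m" "j < d i" "k < d i" "T i k j f \<noteq> 0" and fUf: "f \<star> U i j k \<star> f = gscale (T i k j f) f"
    using f by (rule minI_cases)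
  define c where "c = T i k j f"
  have "gscale (c * c) (f \<star> x \<star> f) = (gscale c f) \<star> x \<star> (gscale c f)" by (simp only: sm_linear gfun.scale_scale)
  also have "\<dots> = f \<star> (U i j k \<star> (f \<star> x \<star> f) \<star> U i j k) \<star> f"
    unfolding c_def fUf[symmetric] by (simp only: sm_assoc)
  also have "\<dots> = gscale (T i k j (f \<star> x \<star> f) * c) f"
    using ijk fS x by (simp only: U_x_U SA_mult sm_linear fUf gfun.scale_scale c_def)
  finally have "gscale (1 / (c * c)) (gscale (c * c) (f \<star> x \<star> f)) = gscale (1 / (c * c) * (T i k j (f \<star> x \<star> f) * c)) f"
    by (simp only: gfun.scale_scale)
  then have "f \<star> x \<star> f = gscale (1 / (c * c) * (T i k j (f \<star> x \<star> f) * c)) f"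
    using ijk(4) unfolding gfun.scale_scale by (simp add: c_def)
  then show ?thesis by blast
qed

text \<open>An idempotent below U i j j is a multiple c of it with c^2 = c.\<close>

lemma minI_U: "i < m \<Longrightarrow> j < d i \<Longrightarrow> minI (U i j j)"
proof -
  assume i: "i < m" and j: "j < d i"
  have UU: "U i j j \<star> U i j j = U i j j"
    using U_x_U[OF i j j j j, of "gel \<one>"] i j by (simp add: SA_Fn T_one)
  have nz: "U i j j \<noteq> 0" using T_U[OF i j j, of i j j] T_zero[OF i j j] by (metis (full_types) zero_neq_one)
  have "g = 0 \<or> g = U i j j" if g: "g \<in> SA" "g \<star> g = g" "U i j j \<star> g = g" "g \<star> U i j j = g" for g
  proof -
    have "U i j j \<star> g \<star> U i j j = g" by (simp only: g)
    then have gs: "g = gscale (T i j j g) (U i j j)" using U_x_U[OF i j j j j g(1)] by simp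
    define c where "c = T i j j g"
    have "gscale (c * c) (U i j j) = gscale c (U i j j)"
      using g(2) by (subst (asm) (1 2 3) gs) (simp only: sm_linear gfun.scale_scale UU c_def)
    then have "c * c = c \<or> U i j j = 0" by (simp only: gfun.scale_cancel_right)
    then have "c = 0 \<or> c = 1" using nz by simp
    moreover have gs': "g = gscale c (U i j j)" using gs by (simp only: c_def)
    ultimately show ?thesis by (metis gfun.scale_zero_left gfun.scale_one)
  qed
  then show ?thesis using UU nz by (simp add: minI_def)
qed

lemma TrT_minI: "minI f \<Longrightarrow> TrT f = 1"
  by (erule minI_cases)

lemma minI_twist: "minI f \<Longrightarrow> minI (itw f)"
proof -
  assume f: "minI f"
  then have fS: "f \<in> SA" by (simp add: minI_def)
  have "g = 0 \<or> g = itw f" if g: "g \<in> SA" "g \<star> g = g" "itw f \<star> g = g" "g \<star> itw f = g" for g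
  proof -
    have eqs: "tw (g \<star> g) = tw g" "tw (itw f \<star> g) = tw g" "tw (g \<star> itw f) = tw g" by (simp_all only: g)
    then have "tw g = 0 \<or> tw g = f" using f g(1) fS unfolding minI_def by (simp only: twist_mult twist_inverse SA_Fn twist_closed)
    then have "itw (tw g) = itw 0 \<or> itw (tw g) = itw f" by (elim disjE) (simp_all only: simp_thms)
    moreover have "itw 0 = 0" by (auto simp: itw_def fun_eq_iff)
    ultimately show ?thesis using g(1) by (simp only: twist_inverse SA_Fn)
  qed
  moreover have "itw f \<noteq> 0"
  proof
    assume "itw f = 0"
    then have "tw (itw f) = tw 0" by (rule arg_cong)
    moreover have "tw 0 = 0" by (auto simp: tw_def fun_eq_iff)
    ultimately have "f = 0" using fS by (simp only: twist_inverse SA_Fn)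
    then show False using f unfolding minI_def by blast
  qed
  moreover have "itw f \<star> itw f = itw f" using f by (simp only: twist_mult[symmetric] minI_def)
  ultimately show ?thesis using fS by (simp add: minI_def)
qed

text \<open>
  The twist permutes the minimal idempotents, all of trace 1, and the off-diagonal matrix units are
  commutators.
\<close>

lemma TrT_twist:
  assumes x: "x \<in> SA"
  shows "TrT (itw x) = TrT x"
proof -
  have sum: "TrT (sum F A) = (\<Sum>a\<in>A. TrT (F a))" if "\<And>a. a \<in> A \<Longrightarrow> F a \<in> SA" for F and A :: "nat set"
    using that
  proof (induction A rule: infinite_finite_induct)
    case (insert a A)
    have IH: "TrT (sum F A) = (\<Sum>a\<in>A. TrT (F a))" by (rule insert.IH) (rule insert.prems, rule insertI2)
    have "F a \<in> SA" "sum F A \<in> SA" using insert.prems by (auto intro: SA_closed(4))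
    then show ?case using IH insert.hyps by (simp only: sum.insert TrT_linear simp_thms)
  qed (simp_all only: sum.infinite sum.empty TrT_zero simp_thms)
  have itw_sum: "itw (sum F A) = (\<Sum>a\<in>A. itw (F a))" for F and A :: "nat set"
  proof (induction A rule: infinite_finite_induct)
    case (insert a A)
    then show ?case by (simp only: sum.insert twist_linear simp_thms)
  qed (simp_all add: itw_def fun_eq_iff)
  have U: "TrT (itw (U i j k)) = TrT (U i j k)" if ij: "i < m" "j < d i" "k < d i" for i j k
  proof (cases "j = k")
    case True
    then show ?thesis using TrT_minI minI_twist minI_U ij by simp
  next
    case False
    have 1: "U i j j \<star> U i j k = U i j k" "U i j k \<star> U i j j = 0"
      using U_x_U[OF ij(1) ij(2,2) ij(2,3), of "gel \<one>"] U_x_U[OF ij(1) ij(2,3) ij(2,2), of "gel \<one>"] ij False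
      by (simp_all add: SA_Fn T_one)
    have i0: "itw 0 = 0" by (auto simp: itw_def fun_eq_iff)
    have "TrT (itw (U i j k)) = TrT (itw (U i j j) \<star> itw (U i j k))" by (simp only: twist_mult[symmetric] 1)
    also have "\<dots> = TrT (itw (U i j k) \<star> itw (U i j j))" by (rule TrT_comm) simp_all
    also have "\<dots> = TrT 0" by (simp only: twist_mult[symmetric] 1 i0)
    also have "\<dots> = TrT (U i j k \<star> U i j j)" by (simp only: 1)
    also have "\<dots> = TrT (U i j j \<star> U i j k)" by (rule TrT_comm) simp_all
    finally show ?thesis by (simp only: 1)
  qed
  have "TrT (itw (\<Sum>i<m. \<Sum>j<d i. \<Sum>k<d i. gscale (T i j k x) (U i j k))) =
      TrT (\<Sum>i<m. \<Sum>j<d i. \<Sum>k<d i. gscale (T i j k x) (U i j k))"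
    by (simp only: itw_sum twist_linear sum SA_closed U_SA twist_closed TrT_linear)
      (rule sum.cong[OF refl], rule sum.cong[OF refl], rule sum.cong[OF refl], simp only: U lessThan_iff)
  then show ?thesis by (simp only: U_decomp[OF x, symmetric])
qed

text \<open>w' represents the matrix trace by \<open>lam\<close> and w represents \<open>lam\<close>
  by the matrix trace, so they are inverse to each other. They are central because both traces are
  symmetric.\<close>

lemma trace_weight:
  obtains w w' where "w \<in> SA" "w' \<in> SA" "w \<star> w' = gel \<one>" "w' \<star> w = gel \<one>"
    "\<And>s. s \<in> SA \<Longrightarrow> w \<star> s = s \<star> w" "tw w = w" "\<And>x. x \<in> SA \<Longrightarrow> TrT x = lam (w' \<star> x)"
proof -
  obtain w' :: "('g, 'n) gfun" where w': "w' \<in> SA" and lam_w': "\<forall>x\<in>SA. lam (w' \<star> x) = TrT x"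
    using lam_represent[of TrT, OF TrT_linear] by blast
  have Tr: "TrT x = lam (w' \<star> x)" if "x \<in> SA" for x using lam_w' that by simp
  \<comment> \<open>The entries of w are the values of \<open>lam\<close> on the transposed matrix
    units, which makes TrT (w x) equal to lam x.\<close>
  obtain w where w: "w \<in> SA" and Tw: "\<And>i j k. i < m \<Longrightarrow> j < d i \<Longrightarrow> k < d i \<Longrightarrow> T i j k w = lam (U i k j)"
    using T_surj[of "\<lambda>i j k. lam (U i k j)"] by blast
  have lamw: "TrT (w \<star> x) = lam x" if x: "x \<in> SA" for x
  proof -
    have "lam x = (\<Sum>i<m. \<Sum>j<d i. \<Sum>k<d i. T i j k x * lam (U i j k))"
      by (subst U_decomp[OF x]) (simp only: lam_sum lam_linear)
    also have "\<dots> = (\<Sum>i<m. \<Sum>j<d i. T i j j (x \<star> w))"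
      by (rule sum.cong[OF refl], rule sum.cong[OF refl]) (use x w in \<open>simp add: T_mult Tw\<close>)
    finally show ?thesis using TrT_comm[OF w x] by (simp only: TrT_def)
  qed
  have w'w: "w' \<star> w = gel \<one>"
  proof (rule lam_eqI)
    fix s :: "('g, 'n) gfun" assume s: "s \<in> SA"
    then show "lam (w' \<star> w \<star> s) = lam (gel \<one> \<star> s)" using Tr[of "w \<star> s"] lamw[of s] w by (simp add: sm_assoc SA_Fn)
  qed (use w w' in simp_all)
  have w'c: "w' \<star> s = s \<star> w'" if s: "s \<in> SA" for s
  proof (rule lam_eqI)
    fix t :: "('g, 'n) gfun" assume t: "t \<in> SA"
    have "lam (w' \<star> s \<star> t) = lam (w' \<star> (t \<star> s))"
      using TrT_comm[OF s t] s t by (simp only: Tr SA_mult sm_assoc)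
    also have "\<dots> = lam (s \<star> (w' \<star> t))" using lam_comm[of "w' \<star> t" s] w' s t by (simp only: SA_mult sm_assoc)
    finally show "lam (w' \<star> s \<star> t) = lam (s \<star> w' \<star> t)" by (simp only: sm_assoc)
  qed (use w' s in simp_all)
  have ww': "w \<star> w' = gel \<one>" using w'c[OF w] w'w by simp
  have wc: "w \<star> s = s \<star> w" if s: "s \<in> SA" for s
  proof -
    have "w \<star> s = w \<star> (s \<star> (w' \<star> w))" using s by (simp add: w'w SA_Fn)
    also have "\<dots> = w \<star> (w' \<star> s) \<star> w" by (simp only: w'c[OF s] sm_assoc)
    also have "\<dots> = (w \<star> w') \<star> (s \<star> w)" by (simp only: sm_assoc)
    also have "\<dots> = s \<star> w" by (simp add: ww')
    finally show ?thesis .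
  qed
  \<comment> \<open>Both traces are invariant under the twist, hence so is the element that
    represents one by the other.\<close>
  have tww': "tw w' = w'"
  proof (rule lam_eqI)
    fix s :: "('g, 'n) gfun" assume s: "s \<in> SA"
    have "lam (tw w' \<star> s) = lam (tw (w' \<star> itw s))" using s by (simp only: twist_mult twist_inverse SA_Fn)
    also have "\<dots> = TrT (itw s)" using s by (simp only: lam_twist Tr twist_closed)
    finally show "lam (tw w' \<star> s) = lam (w' \<star> s)" using s by (simp only: TrT_twist Tr)
  qed (use w' in simp_all)
  have "tw w = w"
  proof -
    have "tw (w' \<star> w) = gel \<one>" by (simp add: w'w twist_gel)
    then have "w' \<star> tw w = gel \<one>" by (simp only: twist_mult tww')
    then have "w \<star> (w' \<star> tw w) = w \<star> gel \<one>" by (rule arg_cong)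
    then show ?thesis using w by (simp add: sm_assoc[symmetric] ww' SA_Fn)
  qed
  then show thesis using that[OF w w' ww' w'w wc _ Tr] by blast
qed

end

section \<open>Blocks of the group algebra\<close>

context finite_rep
begin

definition em :: "('g \<Rightarrow> complex) \<Rightarrow> ('g, 'n) gfun" where "em x = (\<lambda>g v. x g)"
definition un :: "('g, 'n) gfun \<Rightarrow> 'g \<Rightarrow> complex" where "un x = (\<lambda>g. x g 0)"

abbreviation "CG \<equiv> group_algebra G"

lemma em_SA [simp]: "x \<in> carrier CG \<Longrightarrow> em x \<in> SA"
  by (auto simp: SA_def Fn_def em_def group_algebra_def fun_eq_iff)

lemma un_carrier [simp]: "x \<in> SA \<Longrightarrow> un x \<in> carrier CG"
  by (elim SA_cases) (simp add: un_def group_algebra_def)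

lemma em_un [simp]: "x \<in> SA \<Longrightarrow> em (un x) = x"
  by (elim SA_cases) (simp add: un_def em_def)

lemma un_em [simp]: "un (em x) = x"
  by (simp add: un_def em_def)

lemma em_inj: "em x = em y \<longleftrightarrow> x = y"
  by (metis un_em)

lemma em_hom: "em (x \<otimes>\<^bsub>CG\<^esub> y) = em x \<star> em y" "em (x \<oplus>\<^bsub>CG\<^esub> y) = em x + em y" "em \<one>\<^bsub>CG\<^esub> = gel \<one>"
  "em (c \<odot>\<^bsub>CG\<^esub> x) = gscale c (em x)" "em \<zero>\<^bsub>CG\<^esub> = 0" "em (group_elem g) = gel g"
  by (auto simp: em_def group_algebra_def sm_def gel_def group_elem_def gscale_def fun_eq_iff)

lemma CG_closed [simp]:
  "x \<in> carrier CG \<Longrightarrow> y \<in> carrier CG \<Longrightarrow> x \<otimes>\<^bsub>CG\<^esub> y \<in> carrier CG"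
  "x \<in> carrier CG \<Longrightarrow> y \<in> carrier CG \<Longrightarrow> x \<oplus>\<^bsub>CG\<^esub> y \<in> carrier CG" "\<one>\<^bsub>CG\<^esub> \<in> carrier CG"
  "x \<in> carrier CG \<Longrightarrow> c \<odot>\<^bsub>CG\<^esub> x \<in> carrier CG"
  by (auto simp: group_algebra_def)

lemma group_elem_carrier: "g \<in> carrier G \<Longrightarrow> group_elem g \<in> carrier CG"
  by (auto simp: group_algebra_def group_elem_def)

lemma em_sum: "em (sum f A) = (\<Sum>a\<in>A. em (f a))"
  by (induction A rule: infinite_finite_induct) (auto simp: em_def fun_eq_iff)

lemma SA_induct [consumes 1, case_names zero step]:
  assumes x: "x \<in> SA" and "P 0" "\<And>c g y. g \<in> carrier G \<Longrightarrow> y \<in> SA \<Longrightarrow> P y \<Longrightarrow> P (gscale c (gel g) + y)"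
  shows "P x"
proof -
  have "P (\<Sum>g\<in>B. gscale (x g 0) (gel g)) \<and> (\<Sum>g\<in>B. gscale (x g 0) (gel g)) \<in> (SA :: ('g, 'n) gfun set)"
    if "finite B" "B \<subseteq> carrier G" for B
    using that
  proof (induction B rule: finite_induct)
    case empty
    then show ?case using assms(2) gfun.subspace_0[OF subspace_SA] by (simp only: sum.empty simp_thms)
  next
    case (insert g B)
    then have h: "g \<in> carrier G" "P (\<Sum>g\<in>B. gscale (x g 0) (gel g))" "(\<Sum>g\<in>B. gscale (x g 0) (gel g)) \<in> (SA :: ('g, 'n) gfun set)"
      by (simp_all only: insert_subset simp_thms)
    show ?case unfolding sum.insert[OF insert.hyps]
      by (intro conjI assms(3) gfun.subspace_add[OF subspace_SA] gfun.subspace_scale[OF subspace_SA] gel_SA h)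
  qed
  from this[OF fin subset_refl] show ?thesis using SA_decomp[OF x] by metis
qed

end

section \<open>Simple modules of the blocks\<close>

context wedderburn
begin

definition sig :: "nat \<Rightarrow> 'g \<Rightarrow> complex mat" where
  "sig i g = Matrix.mat (d i) (d i) (\<lambda>(j, k). T i j k (gel g))"

definition act :: "nat \<Rightarrow> ('g, 'n) gfun \<Rightarrow> complex vec \<Rightarrow> complex vec" where
  "act i x v = Matrix.vec (d i) (\<lambda>j. \<Sum>k<d i. T i j k x * vec_index v k)"

lemma act_simps:
  assumes i: "i < m" and v: "v \<in> carrier_vec (d i)"
  shows "act i 0 v = 0\<^sub>v (d i)"
    "g \<in> carrier G \<Longrightarrow> y \<in> SA \<Longrightarrow> act i (gscale c (gel g) + y) v = c \<cdot>\<^sub>v (sig i g *\<^sub>v v) + act i y v"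
    "act i x v \<in> carrier_vec (d i)"
proof -
  show "act i 0 v = 0\<^sub>v (d i)" by (rule eq_vecI) (use i in \<open>simp_all add: act_def T_zero\<close>)
  show "act i x v \<in> carrier_vec (d i)" by (simp add: act_def)
  assume g: "g \<in> carrier G" and y: "y \<in> SA"
  have gs: "gscale c (gel g) \<in> (SA :: ('g, 'n) gfun set)" using g by (intro SA_closed gel_SA)
  show "act i (gscale c (gel g) + y) v = c \<cdot>\<^sub>v (sig i g *\<^sub>v v) + act i y v"
  proof (rule eq_vecI)
    fix j assume "j < dim_vec (c \<cdot>\<^sub>v (sig i g *\<^sub>v v) + act i y v)"
    then have j: "j < d i" by (simp add: act_def)
    have "T i j k (gscale c (gel g) + y) = c * T i j k (gel g) + T i j k y" if "k < d i" for k
      using i j that gs g y by (simp only: T_add T_scale gel_SA)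
    then show "vec_index (act i (gscale c (gel g) + y) v) j = vec_index (c \<cdot>\<^sub>v (sig i g *\<^sub>v v) + act i y v) j"
      using j v by (simp add: act_def sig_def scalar_prod_def atLeast0LessThan algebra_simps sum.distrib sum_distrib_left
          cong: sum.cong_simp)
  qed (simp add: act_def)
qed

lemma sig_rep: "i < m \<Longrightarrow> sig i \<one> = 1\<^sub>m (d i)"
  "i < m \<Longrightarrow> g \<in> carrier G \<Longrightarrow> h \<in> carrier G \<Longrightarrow> sig i (g \<otimes> h) = sig i g * sig i h"
proof -
  assume i: "i < m"
  show "sig i \<one> = 1\<^sub>m (d i)" by (rule eq_matI) (use i in \<open>simp_all add: sig_def T_one\<close>)
  assume gh: "g \<in> carrier G" "h \<in> carrier G"
  have "T i j k (gel (g \<otimes> h)) = (\<Sum>l<d i. T i j l (gel g) * T i l k (gel h))" if "j < d i" "k < d i" for j k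
    using T_mult[OF gel_SA[OF gh(1)] gel_SA[OF gh(2)] i that] by (simp only: gel_mult[OF gh])
  then show "sig i (g \<otimes> h) = sig i g * sig i h"
    by (intro eq_matI) (simp_all add: sig_def scalar_prod_def atLeast0LessThan cong: sum.cong_simp)
qed

text \<open>Invariance under G extends linearly to the whole algebra, whose elements realise every
  matrix in block i; these carry any nonzero vector to any other vector.\<close>

lemma irreducible_sig: "i < m \<Longrightarrow> irreducible_rep G (d i) (sig i)"
  unfolding irreducible_rep_def
proof (intro conjI ballI allI impI)
  assume i: "i < m"
  show "0 < d i" by (rule d_pos[OF i])
  show "sig i \<in> carrier G \<rightarrow> carrier_mat (d i) (d i)" by (simp add: sig_def)
  show "sig i \<one> = 1\<^sub>m (d i)" by (rule sig_rep(1)[OF i])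
  show "sig i (g \<otimes> h) = sig i g * sig i h" if "g \<in> carrier G" "h \<in> carrier G" for g h by (rule sig_rep(2)[OF i that])
  fix M assume "submodule M (ring_of_type_algebra :: complex ring) (module_vec TYPE(complex) (d i)) \<and>
      (\<forall>g\<in>carrier G. \<forall>x\<in>M. sig i g *\<^sub>v x \<in> M)"
  then have sub: "submodule M (ring_of_type_algebra :: complex ring) (module_vec TYPE(complex) (d i))"
    and inv: "\<And>g x. g \<in> carrier G \<Longrightarrow> x \<in> M \<Longrightarrow> sig i g *\<^sub>v x \<in> M" by blast+
  interpret M: submodule M "ring_of_type_algebra :: complex ring" "module_vec TYPE(complex) (d i)" by (rule sub)
  have M: "M \<subseteq> carrier_vec (d i)" "0\<^sub>v (d i) \<in> M" "\<And>x y. x \<in> M \<Longrightarrow> y \<in> M \<Longrightarrow> x + y \<in> M" "\<And>c x. x \<in> M \<Longrightarrow> c \<cdot>\<^sub>v x \<in> M"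
    using M.subset M.one_closed M.m_closed M.smult_closed by (auto simp: module_vec_def ring_of_type_algebra_def)
  have act: "act i x v \<in> M" if x: "x \<in> SA" and v: "v \<in> M" for x v
    using x
  proof (induction rule: SA_induct)
    case zero
    show ?case using act_simps(1)[OF i] v M by (simp only: subsetD[OF M(1) v])
  next
    case (step c g y)
    then show ?case using act_simps(2)[OF i subsetD[OF M(1) v]] M(3)[OF M(4)[OF inv[OF _ v]]] by (simp only:)
  qed
  show "M = {0\<^sub>v (d i)} \<or> M = carrier_vec (d i)"
  proof (cases "M = {0\<^sub>v (d i)}")
    case False
    then obtain v where v: "v \<in> M" "v \<noteq> 0\<^sub>v (d i)" using M(2) by blast
    have "\<exists>k<d i. vec_index v k \<noteq> 0"
    proof (rule ccontr)
      assume "\<not> ?thesis"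
      then have "v = 0\<^sub>v (d i)" using subsetD[OF M(1) v(1)] by (intro eq_vecI) auto
      then show False using v(2) by blast
    qed
    then obtain k where k: "k < d i" "vec_index v k \<noteq> 0" by blast
    have "u \<in> M" if u: "u \<in> carrier_vec (d i)" for u
    proof -
      \<comment> \<open>In block i the only nonzero column of x is the k-th, equal to u divided by
        the k-th coordinate of v; such a matrix sends v to u.\<close>
      obtain x where x: "x \<in> SA" "\<forall>i'<m. \<forall>j<d i'. \<forall>l<d i'. T i' j l x = (if l = k then vec_index u j / vec_index v k else 0)"
        using T_surj[of "\<lambda>i' j l. if l = k then vec_index u j / vec_index v k else 0"] by blast
      have "act i x v = u"
      proof (rule eq_vecI)
        fix j assume "j < dim_vec u"
        then have j: "j < d i" using u by simp
        have "(\<Sum>l<d i. T i j l x * vec_index v l) = (\<Sum>l<d i. if l = k then vec_index u j else 0)"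
          by (rule sum.cong[OF refl]) (use x(2) i j k in simp)
        then show "vec_index (act i x v) j = vec_index u j" using j k by (simp add: act_def sum.delta)
      qed (use u in \<open>simp add: act_def\<close>)
      then show ?thesis using act[OF x(1) v(1)] by simp
    qed
    then show ?thesis using M(1) by blast
  qed simp
qed

lemma minI_em: "minimal_idempotent CG f \<Longrightarrow> minI (em f)"
proof -
  assume f: "minimal_idempotent CG f"
  have 1: "f \<in> carrier CG" "f \<noteq> \<zero>\<^bsub>CG\<^esub>" "f \<otimes>\<^bsub>CG\<^esub> f = f" using f by (auto simp: minimal_idempotent_def)
  have "g = 0 \<or> g = em f" if g: "g \<in> SA" "g \<star> g = g" "em f \<star> g = g" "g \<star> em f = g" for g
  proof -
    have "un g \<otimes>\<^bsub>CG\<^esub> un g = un g" "f \<otimes>\<^bsub>CG\<^esub> un g = un g" "un g \<otimes>\<^bsub>CG\<^esub> f = un g"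
      using g by (simp_all only: em_inj[symmetric] em_hom em_un)
    then have "un g = \<zero>\<^bsub>CG\<^esub> \<or> un g = f" using f un_carrier[OF g(1)] unfolding minimal_idempotent_def by blast
    then show ?thesis
    proof
      assume "un g = \<zero>\<^bsub>CG\<^esub>"
      then have "em (un g) = em \<zero>\<^bsub>CG\<^esub>" by (rule arg_cong)
      then show ?thesis using g(1) by (simp only: em_un em_hom simp_thms)
    next
      assume "un g = f"
      then have "em (un g) = em f" by (rule arg_cong)
      then show ?thesis using g(1) by (simp only: em_un simp_thms)
    qed
  qed
  moreover have "em f \<noteq> 0" using 1(2) by (metis em_hom(5) em_inj)
  moreover have "em f \<star> em f = em f" by (simp only: em_hom(1)[symmetric] 1)
  ultimately show ?thesis using em_SA[OF 1(1)] unfolding minI_def by blast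
qed

lemma left_ideal_iff:
  assumes "f \<in> carrier CG" "em f \<star> em f = em f"
  shows "{x \<otimes>\<^bsub>CG\<^esub> f | x. x \<in> carrier CG} = {x \<in> carrier CG. em x \<star> em f = em x}"
proof (intro Set.set_eqI iffI)
  fix y assume "y \<in> {x \<otimes>\<^bsub>CG\<^esub> f | x. x \<in> carrier CG}"
  then obtain x where "x \<in> carrier CG" "y = x \<otimes>\<^bsub>CG\<^esub> f" by blast
  then show "y \<in> {x \<in> carrier CG. em x \<star> em f = em x}" using assms by (simp add: em_hom sm_assoc)
next
  fix y assume y: "y \<in> {x \<in> carrier CG. em x \<star> em f = em x}"
  then have "y = y \<otimes>\<^bsub>CG\<^esub> f" by (simp add: em_inj[symmetric] em_hom)
  then show "y \<in> {x \<otimes>\<^bsub>CG\<^esub> f | x. x \<in> carrier CG}" using y by blast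
qed

text \<open>From f U f = c f follows c x = x U f for every x in the left ideal of f. Thus c x
  vanishes outside block i and there is its column j times row k of f. In particular f lies in one
  block, and taking column j is the isomorphism with the simple module.\<close>

lemma minI_block:
  assumes f: "minI (em f)" and fC: "f \<in> carrier CG"
  obtains i where "i < m" "\<And>i' j k. i' < m \<Longrightarrow> i' \<noteq> i \<Longrightarrow> j < d i' \<Longrightarrow> k < d i' \<Longrightarrow> T i' j k (em f) = 0"
    "left_ideal_iso_rep G f (d i) (sig i)"
    "\<exists>j<d i. \<exists>k<d i. T i j k (em f) \<noteq> 0"
proof -
  have fS: "em f \<in> SA" and ff: "em f \<star> em f = em f" using f by (auto simp: minI_def)
  obtain i j k where ijk: "i < m" "j < d i" "k < d i" "T i k j (em f) \<noteq> 0"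
    and fUf: "em f \<star> U i j k \<star> em f = gscale (T i k j (em f)) (em f)" using f by (rule minI_cases)
  define c where "c = T i k j (em f)"
  have c0: "c \<noteq> 0" using ijk by (simp add: c_def)
  have Tx: "c * T i' l l' x = (if i' = i then T i l j x * T i k l' (em f) else 0)"
    if x: "x \<in> SA" "x \<star> em f = x" and il: "i' < m" "l < d i'" "l' < d i'" for x i' l l'
  proof -
    have "gscale c x = gscale c (x \<star> em f)" by (simp only: x)
    also have "\<dots> = x \<star> (em f \<star> U i j k \<star> em f)" unfolding fUf c_def by (simp only: sm_linear)
    also have "\<dots> = (x \<star> em f) \<star> U i j k \<star> em f" by (simp only: sm_assoc)
    finally have eq: "gscale c x = x \<star> (U i j k \<star> em f)" by (simp only: x(2) sm_assoc)
    have "c * T i' l l' x = T i' l l' (x \<star> (U i j k \<star> em f))" unfolding eq[symmetric] using x il by (simp only: T_scale)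
    also have "\<dots> = (\<Sum>h<d i'. T i' l h x * (if i' = i \<and> h = j then T i k l' (em f) else 0))"
      unfolding T_mult[OF x(1) SA_mult[OF U_SA fS] il]
      by (rule sum.cong[OF refl]) (use il ijk fS in \<open>simp add: T_U_mult\<close>)
    also have "\<dots> = (\<Sum>h<d i'. if h = j then (if i' = i then T i l j x * T i k l' (em f) else 0) else 0)"
      by (rule sum.cong[OF refl]) auto
    also have "\<dots> = (if i' = i then T i l j x * T i k l' (em f) else 0)" using ijk by (auto simp: sum.delta)
    finally show ?thesis .
  qed
  have blk: "T i' l l' (em f) = 0" if "i' < m" "i' \<noteq> i" "l < d i'" "l' < d i'" for i' l l'
    using Tx[OF fS ff that(1,3,4)] that(2) c0 by simp
  define \<phi> where "\<phi> x = Matrix.vec (d i) (\<lambda>l. T i l j (em x))" for x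
  let ?L = "{x \<in> carrier CG. em x \<star> em f = em x}"
  have "left_ideal_iso_rep G f (d i) (sig i)"
    unfolding left_ideal_iso_rep_def Let_def left_ideal_iff[OF fC ff]
  proof (intro exI[of _ \<phi>] conjI ballI allI)
    show "bij_betw \<phi> ?L (carrier_vec (d i))"
      unfolding bij_betw_def
    proof
      show "inj_on \<phi> ?L"
      proof (rule inj_onI)
        fix x y assume x: "x \<in> ?L" and y: "y \<in> ?L" and eq: "\<phi> x = \<phi> y"
        have col: "T i l j (em x) = T i l j (em y)" if "l < d i" for l
          using arg_cong[OF eq, of "\<lambda>v. vec_index v l"] that by (simp add: \<phi>_def)
        have "em x = em y"
        proof (rule T_eqI)
          fix i' l l' assume il: "i' < m" "l < d i'" "l' < d i'"
          have "c * T i' l l' (em x) = c * T i' l l' (em y)"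
            using Tx[OF _ _ il, of "em x"] Tx[OF _ _ il, of "em y"] x y col il by auto
          then show "T i' l l' (em x) = T i' l l' (em y)" using c0 by simp
        qed (use x y in simp_all)
        then show "x = y" by (simp only: em_inj)
      qed
      show "\<phi> ` ?L = carrier_vec (d i)"
      proof (intro equalityI subsetI)
        fix v :: "complex vec" assume v: "v \<in> carrier_vec (d i)"
        \<comment> \<open>In block i the only nonzero column of y is the k-th, equal to v/c. As c is
          the entry (k, j) of f, column j of y f is v.\<close>
        obtain y where y: "y \<in> SA" "\<forall>i'<m. \<forall>l<d i'. \<forall>l'<d i'. T i' l l' y = (if l' = k then vec_index v l / c else 0)"
          using T_surj[of "\<lambda>i' l l'. if l' = k then vec_index v l / c else 0"] by blast
        have yf: "un (y \<star> em f) \<in> ?L" using y fS by (simp add: sm_assoc ff)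
        have "\<phi> (un (y \<star> em f)) = v"
        proof (rule eq_vecI)
          fix l assume "l < dim_vec v"
          then have l: "l < d i" using v by simp
          have "T i l j (y \<star> em f) = (\<Sum>h<d i. if h = k then vec_index v l else 0)"
            unfolding T_mult[OF y(1) fS ijk(1) l ijk(2)]
            by (rule sum.cong[OF refl]) (use y(2) ijk l c0 in \<open>simp add: c_def\<close>)
          then show "vec_index (\<phi> (un (y \<star> em f))) l = vec_index v l" using l ijk y fS by (simp add: \<phi>_def sum.delta)
        qed (use v in \<open>simp add: \<phi>_def\<close>)
        then show "v \<in> \<phi> ` ?L" using yf by blast
      qed (auto simp: \<phi>_def)
    qed
    fix x assume x: "x \<in> ?L"
    show "\<phi> (x \<oplus>\<^bsub>CG\<^esub> y) = \<phi> x + \<phi> y" if "y \<in> ?L" for y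
      by (rule eq_vecI) (use x that ijk in \<open>simp_all add: \<phi>_def em_hom T_add\<close>)
    show "\<phi> (z \<odot>\<^bsub>CG\<^esub> x) = z \<cdot>\<^sub>v \<phi> x" for z
      by (rule eq_vecI) (use x ijk in \<open>simp_all add: \<phi>_def em_hom T_scale\<close>)
    show "\<phi> (group_elem g \<otimes>\<^bsub>CG\<^esub> x) = sig i g *\<^sub>v \<phi> x" if g: "g \<in> carrier G" for g
      by (rule eq_vecI) (use x g ijk in \<open>simp_all add: \<phi>_def sig_def em_hom T_mult scalar_prod_def atLeast0LessThan cong: sum.cong_simp\<close>)
  qed
  then show thesis using that[OF ijk(1) blk] ijk by blast
qed

text \<open>
  Otherwise the identity of block \<open>i\<close> would annihilate the left ideal of \<open>f\<close>.
\<close>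

lemma iso_block:
  assumes f: "f \<in> carrier CG" "em f \<star> em f = em f" and i: "i < m" and iso: "left_ideal_iso_rep G f (d i) (sig i)"
  shows "\<exists>j<d i. \<exists>k<d i. T i j k (em f) \<noteq> 0"
proof (rule ccontr)
  assume neg: "\<not> ?thesis"
  let ?L = "{x \<in> carrier CG. em x \<star> em f = em x}"
  obtain \<phi> where bij: "bij_betw \<phi> ?L (carrier_vec (d i))"
    and add: "\<And>x y. x \<in> ?L \<Longrightarrow> y \<in> ?L \<Longrightarrow> \<phi> (x \<oplus>\<^bsub>CG\<^esub> y) = \<phi> x + \<phi> y"
    and smult: "\<And>c x. x \<in> ?L \<Longrightarrow> \<phi> (c \<odot>\<^bsub>CG\<^esub> x) = c \<cdot>\<^sub>v \<phi> x"
    and equi: "\<And>g x. g \<in> carrier G \<Longrightarrow> x \<in> ?L \<Longrightarrow> \<phi> (group_elem g \<otimes>\<^bsub>CG\<^esub> x) = sig i g *\<^sub>v \<phi> x"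
    using iso unfolding left_ideal_iso_rep_def Let_def left_ideal_iff[OF f] by blast
  have \<phi>c: "\<phi> x \<in> carrier_vec (d i)" if "x \<in> ?L" for x using bij_betwE[OF bij] that by blast
  have \<phi>0: "\<phi> (un 0) = 0\<^sub>v (d i)"
  proof -
    have 0: "un 0 \<in> ?L" using SA_closed(3) by (simp only: mem_Collect_eq un_carrier em_un sm_linear simp_thms)
    have "0 \<odot>\<^bsub>CG\<^esub> un 0 = un 0" by (simp add: group_algebra_def un_def)
    then have "\<phi> (un 0) = 0 \<cdot>\<^sub>v \<phi> (un 0)" using smult[OF 0, of 0] by simp
    also have "\<dots> = 0\<^sub>v (d i)" using \<phi>c[OF 0] by (intro eq_vecI) auto
    finally show ?thesis .
  qed
  have \<phi>act: "\<phi> (un (y \<star> em x)) = act i y (\<phi> x)" if y: "y \<in> SA" and x: "x \<in> ?L" for x y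
    using y
  proof (induction rule: SA_induct)
    case zero
    show ?case using \<phi>0 act_simps(1)[OF i \<phi>c[OF x]] by (simp only: sm_linear)
  next
    case (step c g y)
    have gx: "group_elem g \<otimes>\<^bsub>CG\<^esub> x \<in> ?L"
      using x group_elem_carrier[OF step(1)] by (simp add: em_hom sm_assoc)
    have yx: "un (y \<star> em x) \<in> ?L" using x step(2) by (simp add: sm_assoc)
    have cgx: "c \<odot>\<^bsub>CG\<^esub> (group_elem g \<otimes>\<^bsub>CG\<^esub> x) \<in> ?L" using gx by (simp add: em_hom)
    have "un ((gscale c (gel g) + y) \<star> em x) = c \<odot>\<^bsub>CG\<^esub> (group_elem g \<otimes>\<^bsub>CG\<^esub> x) \<oplus>\<^bsub>CG\<^esub> un (y \<star> em x)"
    proof -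
      have "(gscale c (gel g) + y) \<star> em x \<in> SA" using x step by (intro SA_mult SA_closed gel_SA em_SA) auto
      moreover have "y \<star> em x \<in> SA" using x step by simp
      ultimately show ?thesis by (simp only: em_inj[symmetric] em_hom em_un sm_linear)
    qed
    then show ?case
      using add[OF cgx yx] smult[OF gx] equi[OF step(1) x] step(3) act_simps(2)[OF i \<phi>c[OF x] step(1,2)] by (simp only:)
  qed
  define z where "z = (\<Sum>l<d i. U i l l)"
  have z: "z \<in> SA" by (simp add: z_def SA_closed)
  have "\<phi> x = 0\<^sub>v (d i)" if x: "x \<in> ?L" for x
  proof -
    have xS: "em x \<in> SA" "em f \<in> SA" using x f by simp_all
    have "z \<star> em x = 0"
    proof (rule T_eqI)
      fix i' l l' assume il: "i' < m" "l < d i'" "l' < d i'"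
      have Tx: "T i h l' (em x) = 0" if "h < d i" "i' = i" for h
      proof -
        have "T i h l' (em x \<star> em f) = (\<Sum>k<d i. T i h k (em x) * T i k l' (em f))"
          using xS i that il by (intro T_mult) auto
        then show ?thesis using x neg that il by simp
      qed
      have "T i' l l' (z \<star> em x) = (\<Sum>h<d i. T i' l l' (U i h h \<star> em x))"
        unfolding z_def sm_sum by (rule T_sum[OF il]) (use xS in simp)
      also have "\<dots> = 0" by (rule sum.neutral) (use il xS Tx in \<open>auto simp: T_U_mult\<close>)
      finally show "T i' l l' (z \<star> em x) = T i' l l' 0" by (simp only: T_zero[OF il])
    qed (use z xS in \<open>simp_all add: SA_closed\<close>)
    moreover have "act i z (\<phi> x) = \<phi> x"
    proof (rule eq_vecI)
      fix l assume "l < dim_vec (\<phi> x)"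
      then have l: "l < d i" using \<phi>c[OF x] by simp
      have Tz: "T i l h z = (if h = l then 1 else 0)" if h: "h < d i" for h
      proof -
        have "T i l h z = (\<Sum>k<d i. T i l h (U i k k))" unfolding z_def by (rule T_sum[OF i l h]) simp
        also have "\<dots> = (\<Sum>k<d i. if k = l then (if h = l then 1 else 0) else 0)"
          by (rule sum.cong[OF refl]) (use i l h in \<open>auto simp: T_U\<close>)
        finally show ?thesis using l by (simp add: sum.delta)
      qed
      have "(\<Sum>h<d i. T i l h z * vec_index (\<phi> x) h) = (\<Sum>h<d i. if h = l then vec_index (\<phi> x) l else 0)"
        by (rule sum.cong[OF refl]) (simp add: Tz)
      then show "vec_index (act i z (\<phi> x)) l = vec_index (\<phi> x) l" using l by (simp add: act_def sum.delta)
    qed (use \<phi>c[OF x] in \<open>simp add: act_def\<close>)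
    ultimately show ?thesis using \<phi>act[OF z x] \<phi>0 by simp
  qed
  moreover have "unit_vec (d i) 0 \<in> \<phi> ` ?L" unfolding bij_betw_imp_surj_on[OF bij] by simp
  ultimately have "unit_vec (d i) 0 = (0\<^sub>v (d i) :: complex vec)" by (elim imageE) (simp only:)
  then have "vec_index (unit_vec (d i) 0) 0 = vec_index (0\<^sub>v (d i) :: complex vec) 0" by simp
  then show False using d_pos[OF i] by simp
qed

text \<open>Each f in E is supported in a single block, and the uniqueness of the idempotent
  attached to a simple module makes this a bijection from E to the blocks. Finiteness of E,
  vanishing of f y f' and fullness of the sum are then read off block by block.\<close>

lemma simple_idempotents_corner:
  assumes E: "simple_idempotents G E"
  shows "finite E" "f \<in> E \<Longrightarrow> minI (em f)"
    "f \<in> E \<Longrightarrow> f' \<in> E \<Longrightarrow> f \<noteq> f' \<Longrightarrow> y \<in> SA \<Longrightarrow> em f \<star> y \<star> em f' = 0"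
    "\<exists>(r :: nat) p q. (\<forall>k. p k \<in> SA \<and> q k \<in> SA) \<and> (\<Sum>k<r. p k \<star> em (\<Sum>E) \<star> q k) = gel \<one> \<and> p r = gel \<one> \<and> q r = gel \<one>"
proof -
  have mf: "minimal_idempotent CG f" if "f \<in> E" for f using E that by (simp add: simple_idempotents_def)
  have fC: "f \<in> carrier CG" if "f \<in> E" for f using mf[OF that] by (simp add: minimal_idempotent_def)
  have min: "minI (em f)" if "f \<in> E" for f using mf[OF that] by (rule minI_em)
  then show "f \<in> E \<Longrightarrow> minI (em f)" .
  have "\<exists>i<m. (\<forall>i' j k. i' < m \<longrightarrow> i' \<noteq> i \<longrightarrow> j < d i' \<longrightarrow> k < d i' \<longrightarrow> T i' j k (em f) = 0) \<and> left_ideal_iso_rep G f (d i) (sig i)"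
    if f: "f \<in> E" for f
    by (rule minI_block[OF min[OF f] fC[OF f]]) blast
  then obtain blk where blk: "\<And>f. f \<in> E \<Longrightarrow> blk f < m"
    and blk0: "\<And>f i' j k. f \<in> E \<Longrightarrow> i' < m \<Longrightarrow> i' \<noteq> blk f \<Longrightarrow> j < d i' \<Longrightarrow> k < d i' \<Longrightarrow> T i' j k (em f) = 0"
    and blk_iso: "\<And>f. f \<in> E \<Longrightarrow> left_ideal_iso_rep G f (d (blk f)) (sig (blk f))" by metis
  have ex1: "\<exists>!f. f \<in> E \<and> left_ideal_iso_rep G f (d i) (sig i)" if "i < m" for i
    using E irreducible_sig[OF that] by (simp add: simple_idempotents_def)
  have inj: "f = f'" if "f \<in> E" "f' \<in> E" "blk f = blk f'" for f f'
    using ex1[OF blk[OF that(1)]] blk_iso[OF that(1)] blk_iso[OF that(2)] that by metis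
  have surj: "\<exists>f\<in>E. blk f = i" if i: "i < m" for i
  proof -
    obtain f where f: "f \<in> E" "left_ideal_iso_rep G f (d i) (sig i)" using ex1[OF i] by blast
    have "em f \<star> em f = em f" using min[OF f(1)] by (simp add: minI_def)
    from iso_block[OF fC[OF f(1)] this i f(2)] have "blk f = i" using blk0[OF f(1) i] by metis
    then show ?thesis using f(1) by blast
  qed
  have "inj_on blk E" using inj by (auto intro!: inj_onI)
  moreover have "finite (blk ` E)" by (rule finite_subset[of _ "{..<m}"]) (use blk in auto)
  ultimately show finE: "finite E" by (rule finite_imageD[rotated])
  show "f \<in> E \<Longrightarrow> f' \<in> E \<Longrightarrow> f \<noteq> f' \<Longrightarrow> y \<in> SA \<Longrightarrow> em f \<star> y \<star> em f' = 0"
  proof -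
    assume f: "f \<in> E" "f' \<in> E" "f \<noteq> f'" and y: "y \<in> SA"
    have S: "em f \<in> SA" "em f' \<in> SA" using fC f by simp_all
    show "em f \<star> y \<star> em f' = 0"
    proof (rule T_eqI)
      fix i j k assume ijk: "i < m" "j < d i" "k < d i"
      have "blk f \<noteq> blk f'" using inj f by blast
      then have "i \<noteq> blk f \<or> i \<noteq> blk f'" by blast
      then have "T i j k (em f \<star> (y \<star> em f')) = 0"
      proof
        assume "i \<noteq> blk f"
        then show ?thesis unfolding T_mult[OF S(1) SA_mult[OF y S(2)] ijk] using blk0[OF f(1)] ijk by simp
      next
        assume "i \<noteq> blk f'"
        then have "T i l k (y \<star> em f') = 0" if "l < d i" for l
          unfolding T_mult[OF y S(2) ijk(1) that ijk(3)] using blk0[OF f(2)] ijk by simp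
        then show ?thesis unfolding T_mult[OF S(1) SA_mult[OF y S(2)] ijk] by simp
      qed
      then show "T i j k (em f \<star> y \<star> em f') = T i j k 0" by (simp only: sm_assoc T_zero[OF ijk])
    qed (use S y in \<open>simp_all add: SA_closed\<close>)
  qed
  obtain F where F: "\<And>i. i < m \<Longrightarrow> F i \<in> E" "\<And>i. i < m \<Longrightarrow> blk (F i) = i" using surj by metis
  have "\<forall>i. \<exists>a b. i < m \<longrightarrow> a < d i \<and> b < d i \<and> T i a b (em (F i)) \<noteq> 0"
  proof (intro allI)
    fix i
    show "\<exists>a b. i < m \<longrightarrow> a < d i \<and> b < d i \<and> T i a b (em (F i)) \<noteq> 0"
    proof (cases "i < m")
      case i: True
      have "em (F i) \<star> em (F i) = em (F i)" using min[OF F(1)[OF i]] by (simp add: minI_def)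
      from iso_block[OF fC[OF F(1)[OF i]] this i] show ?thesis using blk_iso[OF F(1)[OF i]] F(2)[OF i] by auto
    qed simp
  qed
  then obtain \<alpha> \<beta> where ab: "\<And>i. i < m \<Longrightarrow> \<alpha> i < d i" "\<And>i. i < m \<Longrightarrow> \<beta> i < d i"
    "\<And>i. i < m \<Longrightarrow> T i (\<alpha> i) (\<beta> i) (em (F i)) \<noteq> 0" by metis
  define e where "e = em (\<Sum>E)"
  have eE: "e = (\<Sum>f\<in>E. em f)" by (simp add: e_def em_sum)
  have eS: "e \<in> SA" unfolding eE using fC by (intro SA_closed) auto
  have Te: "T i j k e = T i j k (em (F i))" if ijk: "i < m" "j < d i" "k < d i" for i j k
  proof -
    have "T i j k e = (\<Sum>f\<in>E. T i j k (em f))" unfolding eE by (rule T_sum[OF ijk]) (use fC in simp)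
    also have "\<dots> = (\<Sum>f\<in>E. if f = F i then T i j k (em (F i)) else 0)"
    proof (rule sum.cong[OF refl])
      fix f assume f: "f \<in> E"
      have "f \<noteq> F i \<Longrightarrow> i \<noteq> blk f" using inj[OF f F(1)[OF ijk(1)]] F(2)[OF ijk(1)] by metis
      then show "T i j k (em f) = (if f = F i then T i j k (em (F i)) else 0)" using blk0[OF f ijk(1) _ ijk(2,3)] by auto
    qed
    finally show ?thesis using finE F(1)[OF ijk(1)] by (simp add: sum.delta)
  qed
  define P where "P = Sigma {..<m} (\<lambda>i. {..<d i})"
  \<comment> \<open>Between U i j \<alpha> and U i \<beta> j the sum e becomes its (\<alpha>,
    \<beta>) entry in block i times U i j j. That entry was chosen nonzero, and the U i j j sum to
    1.\<close>
  define p0 where "p0 = (\<lambda>(i, j). U i j (\<alpha> i))"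
  define q0 where "q0 = (\<lambda>(i, j). gscale (1 / T i (\<alpha> i) (\<beta> i) (em (F i))) (U i (\<beta> i) j))"
  have "(\<Sum>z\<in>P. p0 z \<star> e \<star> q0 z) = (\<Sum>i<m. \<Sum>j<d i. p0 (i, j) \<star> e \<star> q0 (i, j))"
    unfolding P_def by (subst sum.Sigma) (auto intro!: sum.cong)
  also have "\<dots> = (\<Sum>i<m. \<Sum>j<d i. U i j j)"
  proof (rule sum.cong[OF refl], rule sum.cong[OF refl])
    fix i j assume "i \<in> {..<m}" "j \<in> {..<d i}"
    then have ij: "i < m" "j < d i" by simp_all
    have "p0 (i, j) \<star> e \<star> q0 (i, j) = gscale (1 / T i (\<alpha> i) (\<beta> i) (em (F i))) (U i j (\<alpha> i) \<star> e \<star> U i (\<beta> i) j)"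
      unfolding p0_def q0_def prod.case by (simp only: sm_linear)
    also have "\<dots> = U i j j"
      unfolding U_x_U[OF ij(1) ij(2) ab(1)[OF ij(1)] ab(2)[OF ij(1)] ij(2) eS] Te[OF ij(1) ab(1,2)[OF ij(1)]] gfun.scale_scale
      using ab(3)[OF ij(1)] by simp
    finally show "p0 (i, j) \<star> e \<star> q0 (i, j) = U i j j" .
  qed
  finally have sumP: "(\<Sum>z\<in>P. p0 z \<star> e \<star> q0 z) = gel \<one>" by (simp only: one_decomp)
  have "finite P" by (simp add: P_def)
  then obtain h where h: "bij_betw h {..<card P} P" using ex_bij_betw_nat_finite by (metis atLeast0LessThan)
  \<comment> \<open>The default value 1 is the one required at the extra index r = card P.\<close>
  define p where "p k = (if k < card P then p0 (h k) else gel \<one>)" for k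
  define q where "q k = (if k < card P then q0 (h k) else gel \<one>)" for k
  have pS: "p k \<in> SA" "q k \<in> SA" for k
    by (auto simp: p_def q_def p0_def q0_def split: prod.split intro: SA_closed)
  have pq1: "(\<Sum>k<card P. p k \<star> e \<star> q k) = gel \<one>"
  proof -
    have "(\<Sum>k<card P. p k \<star> e \<star> q k) = (\<Sum>k<card P. p0 (h k) \<star> e \<star> q0 (h k))"
      by (rule sum.cong[OF refl]) (simp add: p_def q_def)
    also have "\<dots> = (\<Sum>z\<in>P. p0 z \<star> e \<star> q0 z)" by (rule sum.reindex_bij_betw[OF h])
    finally show ?thesis by (simp only: sumP)
  qed
  have pr: "p (card P) = gel \<one>" "q (card P) = gel \<one>" by (simp_all add: p_def q_def)
  show "\<exists>(r :: nat) p q. (\<forall>k. p k \<in> SA \<and> q k \<in> SA) \<and> (\<Sum>k<r. p k \<star> em (\<Sum>E) \<star> q k) = gel \<one> \<and> p r = gel \<one> \<and> q r = gel \<one>"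
    unfolding e_def[symmetric] by (intro exI[of _ "card P"] exI[of _ p] exI[of _ q] conjI allI pS pq1 pr)
qed

end

section \<open>The group algebra and the path algebra as corners\<close>

context concrete_corner
begin

lemma derivation_quotient_corner:
  assumes "CARD('n) \<ge> 2"
  shows "\<exists>\<Omega>. (if \<forall>g\<in>carrier G. det (\<rho> g) = 1 then superpotential S Tr V (CARD('n)) \<Omega>
      else \<exists>\<tau>. twisted_superpotential S Tr V \<tau> (CARD('n)) \<Omega>) \<and>
    alg_isomorphic (corner (polynomial_smash G \<rho>) e) (derivation_quotient S Tr V \<Omega> (CARD('n) - 2))"
proof (intro exI[of _ "cls pot.Omega"] conjI corner_isomorphic[OF assms])
  show "if \<forall>g\<in>carrier G. det (\<rho> g) = 1 then superpotential S Tr V (CARD('n)) (cls pot.Omega)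
      else \<exists>\<tau>. twisted_superpotential S Tr V \<tau> (CARD('n)) (cls pot.Omega)"
    using superpotential_Omega twisted_superpotential_Omega by (auto intro: exI)
qed

end

context finite_rep
begin

lemma un_hom: "x \<in> SA \<Longrightarrow> y \<in> SA \<Longrightarrow> un (x \<star> y) = un x \<otimes>\<^bsub>CG\<^esub> un y"
  "un (x + y) = un x \<oplus>\<^bsub>CG\<^esub> un y" "un (gscale c x) = c \<odot>\<^bsub>CG\<^esub> un x" "un (gel \<one>) = \<one>\<^bsub>CG\<^esub>"
proof -
  show "x \<in> SA \<Longrightarrow> y \<in> SA \<Longrightarrow> un (x \<star> y) = un x \<otimes>\<^bsub>CG\<^esub> un y"
    by (simp only: em_inj[symmetric] em_hom em_un SA_mult)
qed (auto simp: un_def group_algebra_def gel_def fun_eq_iff)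

lemma wedderburn_exists:
  assumes "sum_of_matrix_traces CG Tr"
  obtains m d T where "wedderburn G \<rho> m d T"
    "\<And>x. x \<in> carrier CG \<Longrightarrow> Tr x = wedderburn.TrT m d T (em x)"
proof -
  obtain m d \<theta> where d: "\<And>i. i < m \<Longrightarrow> 0 < d i" and \<theta>: "\<theta> \<in> alg_iso CG (matrix_blocks m d)"
    and Tr: "\<And>x. x \<in> carrier CG \<Longrightarrow> Tr x = (\<Sum>i<m. \<Sum>j<d i. \<theta> x i $$ (j, j))"
    using assms unfolding sum_of_matrix_traces_def by blast
  have hom: "\<theta> \<in> Ring.ring_hom CG (matrix_blocks m d)" and bij: "bij_betw \<theta> (carrier CG) (carrier (matrix_blocks m d))"
    and sc: "\<And>c x. x \<in> carrier CG \<Longrightarrow> \<theta> (c \<odot>\<^bsub>CG\<^esub> x) = c \<odot>\<^bsub>matrix_blocks m d\<^esub> \<theta> x"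
    using \<theta> by (auto simp: alg_iso_def ring_iso_def)
  have mat: "\<theta> x i \<in> carrier_mat (d i) (d i)" if "x \<in> carrier CG" "i < m" for x i
    using bij_betwE[OF bij] that by (auto simp: matrix_blocks_def)
  have ext: "\<theta> x \<in> extensional {..<m}" if "x \<in> carrier CG" for x
    using bij_betwE[OF bij] that by (auto simp: matrix_blocks_def PiE_def)
  define T where "T i j k x = \<theta> (un x) i $$ (j, k)" for i j k and x :: "('g, 'n) gfun"
  have "wedderburn G \<rho> m d T"
  proof unfold_locales
    show "\<And>i. i < m \<Longrightarrow> 0 < d i" by (rule d)
  next
    fix x y :: "('g, 'n) gfun" and c i j k assume x: "x \<in> SA" and i: "i < m" and j: "j < d i" and k: "k < d i"
    show "T i j k (gscale c x) = c * T i j k x"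
      unfolding T_def un_hom sc[OF un_carrier[OF x]] using mat[OF un_carrier[OF x] i] i j k by (simp add: matrix_blocks_def)
    assume y: "y \<in> SA"
    note m = mat[OF un_carrier[OF x] i] mat[OF un_carrier[OF y] i]
    show "T i j k (x + y) = T i j k x + T i j k y"
      unfolding T_def un_hom ring_hom_add[OF hom un_carrier[OF x] un_carrier[OF y]]
      using m i j k by (simp add: matrix_blocks_def)
    show "T i j k (x \<star> y) = (\<Sum>l<d i. T i j l x * T i l k y)"
      unfolding T_def un_hom(1)[OF x y] ring_hom_mult[OF hom un_carrier[OF x] un_carrier[OF y]]
      using m i j k by (simp add: matrix_blocks_def scalar_prod_def atLeast0LessThan)
  next
    fix i j k assume "i < m" "j < d i" "k < d i"
    then show "T i j k (gel \<one>) = (if j = k then 1 else 0)"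
      unfolding T_def un_hom ring_hom_one[OF hom] by (simp add: matrix_blocks_def)
  next
    fix x y :: "('g, 'n) gfun" assume x: "x \<in> SA" and y: "y \<in> SA"
      and eq: "\<And>i j k. i < m \<Longrightarrow> j < d i \<Longrightarrow> k < d i \<Longrightarrow> T i j k x = T i j k y"
    have "\<theta> (un x) = \<theta> (un y)"
    proof (rule extensionalityI[OF ext[OF un_carrier[OF x]] ext[OF un_carrier[OF y]]])
      fix i assume "i \<in> {..<m}"
      then have i: "i < m" by simp
      show "\<theta> (un x) i = \<theta> (un y) i"
        by (rule eq_matI) (use mat[OF un_carrier[OF x] i] mat[OF un_carrier[OF y] i] eq[OF i] in \<open>simp_all add: T_def\<close>)
    qed
    then have "un x = un y" using bij_betw_imp_inj_on[OF bij] x y by (simp add: inj_onD)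
    then have "em (un x) = em (un y)" by (rule arg_cong)
    then show "x = y" using x y by (simp only: em_un)
  next
    fix c :: "nat \<Rightarrow> nat \<Rightarrow> nat \<Rightarrow> complex"
    have "(\<lambda>i\<in>{..<m}. Matrix.mat (d i) (d i) (\<lambda>(j, k). c i j k)) \<in> carrier (matrix_blocks m d)"
      by (simp add: matrix_blocks_def)
    then have "(\<lambda>i\<in>{..<m}. Matrix.mat (d i) (d i) (\<lambda>(j, k). c i j k)) \<in> \<theta> ` carrier CG"
      unfolding bij_betw_imp_surj_on[OF bij] .
    then obtain z where z: "(\<lambda>i\<in>{..<m}. Matrix.mat (d i) (d i) (\<lambda>(j, k). c i j k)) = \<theta> z" "z \<in> carrier CG"
      by (rule imageE)
    show "\<exists>x\<in>(SA :: ('g, 'n) gfun set). \<forall>i<m. \<forall>j<d i. \<forall>k<d i. T i j k x = c i j k"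
      by (rule bexI[of _ "em z"]) (simp_all only: T_def un_em z(1)[symmetric] em_SA z(2), simp)
  qed
  then interpret W: wedderburn G \<rho> m d T .
  have "Tr x = W.TrT (em x)" if "x \<in> carrier CG" for x
    unfolding W.TrT_def T_def using Tr[OF that] by simp
  then show thesis using that[OF W.wedderburn_axioms] by blast
qed

lemma mckay_sel: "bcarrier (mckay_bimodule G \<rho>) = UA" "badd (mckay_bimodule G \<rho>) = (+)"
  "bscale (mckay_bimodule G \<rho>) = gscale" "lact (mckay_bimodule G \<rho>) x u = em x \<star> u" "ract (mckay_bimodule G \<rho>) u x = u \<star> em x"
  by (auto simp: mckay_bimodule_def UA_def Fn_def gscale_def em_def sm_def function_action_def fun_eq_iff)

lemma corner_one: "corner (polynomial_smash G \<rho>) (gel \<one>) = polynomial_smash G \<rho>"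
proof -
  have "gel \<one> \<otimes>\<^bsub>polynomial_smash G \<rho>\<^esub> x \<otimes>\<^bsub>polynomial_smash G \<rho>\<^esub> gel \<one> = x" if x: "x \<in> PS" for x
  proof -
    have 1: "gel \<one> \<in> PS" by (rule SA_PS) simp
    have "gel \<one> \<otimes>\<^bsub>polynomial_smash G \<rho>\<^esub> x = x" using PS_mult[OF 1 x] x by (simp add: PS_iff)
    moreover have "x \<otimes>\<^bsub>polynomial_smash G \<rho>\<^esub> gel \<one> = x" using PS_mult[OF x 1] x by (simp add: PS_iff)
    ultimately show ?thesis by (simp only:)
  qed
  then have "{gel \<one> \<otimes>\<^bsub>polynomial_smash G \<rho>\<^esub> x \<otimes>\<^bsub>polynomial_smash G \<rho>\<^esub> gel \<one> | x. x \<in> PS} = PS" by force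
  then show ?thesis unfolding corner_def PS_sel(3)[symmetric] by simp
qed

lemma UA_finite_span: "UA \<subseteq> gfun.span ((\<lambda>(i, g). Xv i \<star> gel g) ` (UNIV \<times> carrier G))"
proof
  fix u :: "('g, 'n) gfun" assume u: "u \<in> UA"
  have "(\<Sum>g\<in>carrier G. \<Sum>i\<in>UNIV. gscale (u g (axis i 1)) (Xv i \<star> gel g)) \<in> gfun.span ((\<lambda>(i, g). Xv i \<star> gel g) ` (UNIV \<times> carrier G))"
    by (intro gfun.span_sum gfun.span_scale gfun.span_base) force
  then show "u \<in> gfun.span ((\<lambda>(i, g). Xv i \<star> gel g) ` (UNIV \<times> carrier G))"
    using UA_decomp[OF u] by metis
qed

text \<open>The dimension in \<open>mckay_quiver\<close> is formed inside the infinite-dimensional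
  space of all functions; bases of subspaces of U are finite because the x_i g span U.\<close>

lemma finite_basis:
  assumes W: "W \<subseteq> UA"
  obtains \<beta> :: "nat \<Rightarrow> ('g, 'n) gfun" where "inj_on \<beta> {..<gfun.dim W}" "\<beta> ` {..<gfun.dim W} \<subseteq> W"
    "gfun.independent (\<beta> ` {..<gfun.dim W})" "W \<subseteq> gfun.span (\<beta> ` {..<gfun.dim W})"
proof -
  obtain B where B: "B \<subseteq> W" "gfun.independent B" "W \<subseteq> gfun.span B" "card B = gfun.dim W"
    by (rule gfun.basis_exists)
  have "finite B"
    by (rule conjunct1[OF gfun.independent_span_bound[of "(\<lambda>(i, g). Xv i \<star> gel g) ` (UNIV \<times> carrier G)"]])
      (use B W UA_finite_span fin in auto)
  then obtain \<beta> where "bij_betw \<beta> {..<card B} B" using ex_bij_betw_nat_finite by (metis atLeast0LessThan)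
  then show thesis using that[of \<beta>] B unfolding bij_betw_def by simp
qed

end

lemma sum_delta2:
  assumes "finite E" "f0 \<in> E" "g0 \<in> E"
  shows "(\<Sum>f\<in>E. \<Sum>g\<in>E. if f = f0 \<and> g = g0 then F f g else 0) = F f0 (g0 :: 'a)"
proof -
  have "(\<Sum>f\<in>E. \<Sum>g\<in>E. if f = f0 \<and> g = g0 then F f g else 0) = (\<Sum>f\<in>E. if f = f0 then F f0 g0 else 0)"
  proof (rule sum.cong[OF refl])
    fix f assume "f \<in> E"
    show "(\<Sum>g\<in>E. if f = f0 \<and> g = g0 then F f g else 0) = (if f = f0 then F f0 g0 else 0)"
      using assms by (cases "f = f0") (simp_all add: sum.delta)
  qed
  then show ?thesis using assms by (simp add: sum.delta)
qed

context wedderburn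
begin

text \<open>Here 1 = 1 e 1 with e = 1 is a decomposition with one term, so r = 1 and the index 1 is
  the extra row and column.\<close>

lemma smash_corner:
  assumes Tr: "\<And>x. x \<in> carrier CG \<Longrightarrow> Tr x = TrT (em x)"
    and w: "w \<in> SA" "w' \<in> SA" "w \<star> w' = gel \<one>" "w' \<star> w = gel \<one>" "\<And>s. s \<in> SA \<Longrightarrow> w \<star> s = s \<star> w" "tw w = w"
    "\<And>x. x \<in> SA \<Longrightarrow> TrT x = lam (w' \<star> x)"
  shows "concrete_corner G \<rho> CG (mckay_bimodule G \<rho>) Tr em id (gel \<one>) 1 (\<lambda>_. gel \<one>) (\<lambda>_. gel \<one>) w w'"
proof unfold_locales
  have "{x \<in> SA. gel \<one> \<star> x \<star> gel \<one> = x} = SA" by (auto simp: SA_Fn)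
  then show "bij_betw em (carrier CG) {x \<in> SA. gel \<one> \<star> x \<star> gel \<one> = x}"
    by (simp only:) (intro bij_betw_byWitness[of _ un] ballI image_subsetI; simp)
  have "{u \<in> UA. gel \<one> \<star> u \<star> gel \<one> = u} = UA" by (auto simp: UA_Fn)
  then show "bij_betw id (bcarrier (mckay_bimodule G \<rho>)) {u \<in> UA. gel \<one> \<star> u \<star> gel \<one> = u}"
    by (simp only: mckay_sel) simp
  show "Tr s = lam (w' \<star> em s)" if "s \<in> carrier CG" for s using Tr[OF that] w(7)[OF em_SA[OF that]] by simp
  show "w \<in> SA" "w' \<in> SA" "w \<star> w' = gel \<one>" "w' \<star> w = gel \<one>" "\<And>s. s \<in> SA \<Longrightarrow> w \<star> s = s \<star> w" "tw w = w"
    by (rule w; assumption)+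
qed (use gfun.subspace_add[OF subspace_UA] gfun.subspace_scale[OF subspace_UA] in
    \<open>simp_all add: mckay_sel em_hom SA_Fn twist_gel del: gscale_apply\<close>)

text \<open>The map a sends a vertex to its idempotent, and b sends an arrow from f to g to a vector
  of a chosen basis of g U f. The weight is the one found for the trace of CG, which restricts to
  the vertex trace.\<close>

lemma path_corner:
  assumes E: "simple_idempotents G E" and tw_e: "det_twist \<rho> (\<Sum>E) = \<Sum>E" and Q: "Q = mckay_quiver G \<rho> E"
    and w: "w \<in> SA" "w' \<in> SA" "w \<star> w' = gel \<one>" "w' \<star> w = gel \<one>" "\<And>s. s \<in> SA \<Longrightarrow> w \<star> s = s \<star> w" "tw w = w"
    "\<And>x. x \<in> SA \<Longrightarrow> TrT x = lam (w' \<star> x)"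
  shows "\<exists>a b r p q. concrete_corner G \<rho> (vertex_algebra Q) (arrow_bimodule Q) (vertex_trace Q) a b (em (\<Sum>E)) r p q w w'"
proof -
  note EE = simple_idempotents_corner[OF E]
  have fS: "em f \<in> SA" if "f \<in> E" for f using EE(2)[OF that] by (simp add: minI_def)
  have ff: "em f \<star> em f = em f" if "f \<in> E" for f using EE(2)[OF that] by (simp add: minI_def)
  have orth: "em f \<star> em g = (if g = f then em f else 0)" if "f \<in> E" "g \<in> E" for f g
  proof (cases "g = f")
    case False
    then have "em f \<star> gel \<one> \<star> em g = 0" using that by (intro EE(3)) auto
    then show ?thesis using False fS[OF that(1)] by (simp add: SA_Fn)
  qed (use ff that in simp)
  define e where "e = em (\<Sum>E)"
  have eE: "e = (\<Sum>f\<in>E. em f)" by (simp add: e_def em_sum)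
  have eS: "e \<in> SA" unfolding eE using fS by (rule SA_closed(4))
  have ef: "e \<star> em f = em f" "em f \<star> e = em f" if f: "f \<in> E" for f
  proof -
    have "e \<star> em f = (\<Sum>g\<in>E. if g = f then em f else 0)"
      unfolding eE sm_sum by (rule sum.cong[OF refl]) (auto simp: orth f)
    then show "e \<star> em f = em f" using EE(1) f by (simp only: sum.delta simp_thms if_True)
    have "em f \<star> e = (\<Sum>g\<in>E. if g = f then em f else 0)"
      unfolding eE sm_sum by (rule sum.cong[OF refl]) (auto simp: orth f)
    then show "em f \<star> e = em f" using EE(1) f by (simp only: sum.delta simp_thms if_True)
  qed
  have ee: "e \<star> e = e"
  proof -
    have "e \<star> e = (\<Sum>f\<in>E. e \<star> em f)" by (subst (2) eE) (simp only: sm_sum)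
    also have "\<dots> = (\<Sum>f\<in>E. em f)" by (rule sum.cong[OF refl]) (rule ef)
    finally show ?thesis by (simp only: eE)
  qed
  have decomp: "e \<star> x \<star> e = (\<Sum>f\<in>E. \<Sum>g\<in>E. em g \<star> x \<star> em f)" for x
  proof -
    have "(\<Sum>g\<in>E. em g) \<star> x \<star> (\<Sum>f\<in>E. em f) = (\<Sum>f\<in>E. \<Sum>g\<in>E. em g \<star> x \<star> em f)" by (simp only: sm_sum)
    then show ?thesis by (simp only: eE)
  qed
  have tw: "tw e = e"
  proof -
    have "tw e = em (det_twist \<rho> (\<Sum>E))" unfolding e_def by (simp add: tw_def em_def det_twist_def)
    then show ?thesis by (simp only: tw_e e_def)
  qed
  define a where "a s = (\<Sum>f\<in>E. gscale (s f) (em f))" for s :: "('g \<Rightarrow> complex) \<Rightarrow> complex"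
  have aS: "a s \<in> SA" for s unfolding a_def using fS by (intro SA_closed) auto
  have fa: "em f \<star> a s = gscale (s f) (em f)" "a s \<star> em f = gscale (s f) (em f)" if f: "f \<in> E" for f s
  proof -
    have "em f \<star> a s = (\<Sum>g\<in>E. if g = f then gscale (s f) (em f) else 0)"
      unfolding a_def sm_sum sm_linear
      by (rule sum.cong[OF refl]) (auto simp only: orth f if_True if_False gfun.scale_zero_right split: if_split)
    then show "em f \<star> a s = gscale (s f) (em f)" using EE(1) f by (simp only: sum.delta simp_thms if_True)
    have "a s \<star> em f = (\<Sum>g\<in>E. if g = f then gscale (s f) (em f) else 0)"
      unfolding a_def sm_sum sm_linear
      by (rule sum.cong[OF refl]) (auto simp only: orth f if_True if_False gfun.scale_zero_right split: if_split)
    then show "a s \<star> em f = gscale (s f) (em f)" using EE(1) f by (simp only: sum.delta simp_thms if_True)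
  qed
  have a_mult: "a s \<star> a t = a (\<lambda>f. s f * t f)" for s t
  proof -
    have "a s \<star> a t = (\<Sum>f\<in>E. gscale (s f) (em f \<star> a t))" by (subst a_def[of s]) (simp only: sm_sum sm_linear)
    also have "\<dots> = (\<Sum>f\<in>E. gscale (s f * t f) (em f))"
      by (rule sum.cong[OF refl]) (simp only: fa gfun.scale_scale)
    finally show ?thesis by (simp only: a_def)
  qed
  have eae: "e \<star> a s \<star> e = a s" for s
  proof -
    have "e \<star> a s = a s" unfolding a_def sm_sum sm_linear by (rule sum.cong[OF refl]) (simp only: ef)
    moreover have "a s \<star> e = a s" unfolding a_def sm_sum sm_linear by (rule sum.cong[OF refl]) (simp only: ef)
    ultimately show ?thesis by (simp only:)
  qed
  have verts: "verts Q = E" by (simp add: Q mckay_quiver_def Let_def)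
  define W where "W f g = {em g \<star> (u \<star> em f) | u. u \<in> UA}" for f g
  define D where "D f g = gfun.dim (W f g)" for f g
  have arcs: "arcs Q = {(f, g, k). f \<in> E \<and> g \<in> E \<and> k < D f g}"
    unfolding D_def W_def by (simp add: Q mckay_quiver_def Let_def mckay_sel)
  have ends: "tail Q (f, g, k) = f" "head Q (f, g, k) = g" for f g k by (simp_all add: Q mckay_quiver_def Let_def)
  define basis where "basis f g \<beta> \<longleftrightarrow> inj_on \<beta> {..<D f g} \<and> \<beta> ` {..<D f g} \<subseteq> W f g \<and>
      gfun.independent (\<beta> ` {..<D f g}) \<and> W f g \<subseteq> gfun.span (\<beta> ` {..<D f g})" for f g and \<beta> :: "nat \<Rightarrow> ('g, 'n) gfun"
  \<comment> \<open>Arrows from f to g are only numbers below the dimension; a chosen basis of g U f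
    turns them into elements of U.\<close>
  define \<beta> where "\<beta> f g = (SOME \<beta>. basis f g \<beta>)" for f g
  have basis: "basis f g (\<beta> f g)" if "f \<in> E" "g \<in> E" for f g
  proof -
    have "W f g \<subseteq> UA" unfolding W_def using fS that by auto
    then have "\<exists>\<beta>. basis f g \<beta>" unfolding basis_def D_def by (rule finite_basis) blast
    from someI_ex[OF this] show ?thesis unfolding \<beta>_def .
  qed
  have \<beta>: "\<And>f g. f \<in> E \<Longrightarrow> g \<in> E \<Longrightarrow> inj_on (\<beta> f g) {..<D f g}"
    "\<And>f g. f \<in> E \<Longrightarrow> g \<in> E \<Longrightarrow> \<beta> f g ` {..<D f g} \<subseteq> W f g"
    "\<And>f g. f \<in> E \<Longrightarrow> g \<in> E \<Longrightarrow> gfun.independent (\<beta> f g ` {..<D f g})"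
    "\<And>f g. f \<in> E \<Longrightarrow> g \<in> E \<Longrightarrow> W f g \<subseteq> gfun.span (\<beta> f g ` {..<D f g})"
    using basis unfolding basis_def by blast+
  have \<beta>W: "\<exists>u\<in>UA. \<beta> f g k = em g \<star> (u \<star> em f)" if "f \<in> E" "g \<in> E" "k < D f g" for f g k
    using \<beta>(2)[OF that(1,2)] that(3) unfolding W_def by blast
  have \<beta>UA: "\<beta> f g k \<in> UA" if "f \<in> E" "g \<in> E" "k < D f g" for f g k
    using \<beta>W[OF that] fS that by auto
  have \<beta>f: "em g \<star> \<beta> f g k = \<beta> f g k" "\<beta> f g k \<star> em f = \<beta> f g k" if fgk: "f \<in> E" "g \<in> E" "k < D f g" for f g k
  proof -
    obtain u where u: "\<beta> f g k = em g \<star> (u \<star> em f)" using \<beta>W[OF fgk] by blast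
    show "em g \<star> \<beta> f g k = \<beta> f g k" unfolding u by (simp only: sm_assoc[symmetric] ff[OF fgk(2)])
    show "\<beta> f g k \<star> em f = \<beta> f g k" unfolding u by (simp only: sm_assoc ff[OF fgk(1)])
  qed
  have g\<beta>: "em g0 \<star> \<beta> f g k = (if g = g0 then \<beta> f g k else 0)" if "f \<in> E" "g \<in> E" "k < D f g" "g0 \<in> E" for f g k g0
  proof -
    have "em g0 \<star> \<beta> f g k = (em g0 \<star> em g) \<star> \<beta> f g k" by (simp only: sm_assoc \<beta>f[OF that(1-3)])
    also have "\<dots> = (if g = g0 then em g0 \<star> \<beta> f g k else 0)" unfolding orth[OF that(4,2)] by (auto simp only: sm_linear if_True if_False split: if_split)
    finally show ?thesis using \<beta>f(1)[OF that(1-3)] by (auto simp only: if_True if_False split: if_splits)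
  qed
  have \<beta>g: "\<beta> f g k \<star> em f0 = (if f = f0 then \<beta> f g k else 0)" if "f \<in> E" "g \<in> E" "k < D f g" "f0 \<in> E" for f g k f0
  proof -
    have "\<beta> f g k \<star> em f0 = \<beta> f g k \<star> (em f \<star> em f0)" by (simp only: sm_assoc[symmetric] \<beta>f[OF that(1-3)])
    also have "\<dots> = (if f = f0 then \<beta> f g k \<star> em f else 0)" unfolding orth[OF that(1,4)] by (auto simp only: sm_linear if_True if_False split: if_split)
    finally show ?thesis using \<beta>f(2)[OF that(1-3)] by (auto simp only: if_True if_False split: if_splits)
  qed
  have a\<beta>: "a s \<star> \<beta> f g k = gscale (s g) (\<beta> f g k)" "\<beta> f g k \<star> a s = gscale (s f) (\<beta> f g k)"
    if k: "f \<in> E" "g \<in> E" "k < D f g" for f g k s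
  proof -
    have "a s \<star> \<beta> f g k = a s \<star> em g \<star> \<beta> f g k" "\<beta> f g k \<star> a s = \<beta> f g k \<star> (em f \<star> a s)"
      by (simp_all only: sm_assoc \<beta>f[OF k]) (simp only: sm_assoc[symmetric] \<beta>f[OF k])
    then show "a s \<star> \<beta> f g k = gscale (s g) (\<beta> f g k)" "\<beta> f g k \<star> a s = gscale (s f) (\<beta> f g k)"
      by (simp_all only: fa[OF k(2)] fa[OF k(1)] sm_linear \<beta>f[OF k])
  qed
  define b where "b u = (\<Sum>f\<in>E. \<Sum>g\<in>E. \<Sum>k<D f g. gscale (u (f, g, k)) (\<beta> f g k))"
    for u :: "('g \<Rightarrow> complex) \<times> ('g \<Rightarrow> complex) \<times> nat \<Rightarrow> complex"
  have b_cong: "b u = b u'" if "\<And>f g k. f \<in> E \<Longrightarrow> g \<in> E \<Longrightarrow> k < D f g \<Longrightarrow> u (f, g, k) = u' (f, g, k)" for u u'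
    unfolding b_def by (rule sum.cong[OF refl], rule sum.cong[OF refl], rule sum.cong[OF refl]) (simp only: that lessThan_iff)
  have bUA: "b u \<in> UA" for u
    unfolding b_def by (intro gfun.subspace_sum[OF subspace_UA] gfun.subspace_scale[OF subspace_UA] \<beta>UA) auto
  have ab: "a s \<star> b u = b (\<lambda>(f, g, k). s g * u (f, g, k))" "b u \<star> a s = b (\<lambda>(f, g, k). u (f, g, k) * s f)" for s u
    unfolding b_def sm_sum sm_linear prod.case
    by (rule sum.cong[OF refl], rule sum.cong[OF refl], rule sum.cong[OF refl],
        simp only: a\<beta> lessThan_iff gfun.scale_scale mult.commute)+
  have be: "e \<star> b u = b u" "b u \<star> e = b u" for u
  proof -
    have e1: "e = a (\<lambda>_. 1)" by (simp only: a_def eE gfun.scale_one)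
    show "e \<star> b u = b u" "b u \<star> e = b u" unfolding e1 ab by (rule b_cong; simp)+
  qed
  \<comment> \<open>Cutting with the idempotents of two vertices isolates the arrows between them,
    so injectivity of b reduces to the independence of a single basis.\<close>
  have gbf: "em g0 \<star> b u \<star> em f0 = (\<Sum>k<D f0 g0. gscale (u (f0, g0, k)) (\<beta> f0 g0 k))" if "f0 \<in> E" "g0 \<in> E" for f0 g0 u
  proof -
    have "em g0 \<star> b u \<star> em f0 = (\<Sum>f\<in>E. \<Sum>g\<in>E. \<Sum>k<D f g. gscale (u (f, g, k)) (em g0 \<star> \<beta> f g k \<star> em f0))"
      unfolding b_def sm_sum sm_linear ..
    also have "\<dots> = (\<Sum>f\<in>E. \<Sum>g\<in>E. if f = f0 \<and> g = g0 then (\<Sum>k<D f g. gscale (u (f, g, k)) (\<beta> f g k)) else 0)"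
    proof (rule sum.cong[OF refl], rule sum.cong[OF refl])
      fix f g assume fg: "f \<in> E" "g \<in> E"
      have "em g0 \<star> \<beta> f g k \<star> em f0 = (if f = f0 \<and> g = g0 then \<beta> f g k else 0)" if k: "k < D f g" for k
      proof (cases "g = g0")
        case True
        have "em g0 \<star> \<beta> f g k = \<beta> f g k" using g\<beta>[OF fg k \<open>g0 \<in> E\<close>] by (simp only: True if_True simp_thms)
        then show ?thesis using \<beta>g[OF fg k \<open>f0 \<in> E\<close>] by (simp only: True simp_thms)
      next
        case False
        have "em g0 \<star> \<beta> f g k = 0" using g\<beta>[OF fg k \<open>g0 \<in> E\<close>] by (simp only: False if_False)
        then show ?thesis by (simp only: sm_linear False simp_thms if_False)
      qed
      then have "(\<Sum>k<D f g. gscale (u (f, g, k)) (em g0 \<star> \<beta> f g k \<star> em f0)) =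
          (\<Sum>k<D f g. gscale (u (f, g, k)) (if f = f0 \<and> g = g0 then \<beta> f g k else 0))"
        by (intro sum.cong[OF refl]) (simp only: lessThan_iff)
      also have "\<dots> = (if f = f0 \<and> g = g0 then (\<Sum>k<D f g. gscale (u (f, g, k)) (\<beta> f g k)) else 0)"
        by (cases "f = f0 \<and> g = g0") (simp_all only: if_True if_False simp_thms gfun.scale_zero_right sum.neutral_const)
      finally show "(\<Sum>k<D f g. gscale (u (f, g, k)) (em g0 \<star> \<beta> f g k \<star> em f0)) =
        (if f = f0 \<and> g = g0 then (\<Sum>k<D f g. gscale (u (f, g, k)) (\<beta> f g k)) else 0)" .
    qed
    also have "\<dots> = (\<Sum>k<D f0 g0. gscale (u (f0, g0, k)) (\<beta> f0 g0 k))" by (rule sum_delta2[OF EE(1) that])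
    finally show ?thesis .
  qed
  obtain r :: nat and p q where pq0: "(\<forall>k. p k \<in> SA \<and> q k \<in> SA) \<and> (\<Sum>k<r. p k \<star> e \<star> q k) = gel \<one> \<and> p r = gel \<one> \<and> q r = gel \<one>"
    using EE(4) unfolding e_def by (elim exE)
  then have pq: "\<And>k. p k \<in> SA" "\<And>k. q k \<in> SA" "(\<Sum>k<r. p k \<star> e \<star> q k) = gel \<one>" "p r = gel \<one>" "q r = gel \<one>"
    by simp_all
  have "concrete_corner G \<rho> (vertex_algebra Q) (arrow_bimodule Q) (vertex_trace Q) a b e r p q w w'"
  proof unfold_locales
    show "e \<in> SA" "e \<star> e = e" "tw e = e" by (rule eS ee tw)+
    show "\<And>k. p k \<in> SA" "\<And>k. q k \<in> SA" "(\<Sum>k<r. p k \<star> e \<star> q k) = gel \<one>" "p r = gel \<one>" "q r = gel \<one>"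
      by (rule pq)+
    show "w \<in> SA" "w' \<in> SA" "w \<star> w' = gel \<one>" "w' \<star> w = gel \<one>" "\<And>s. s \<in> SA \<Longrightarrow> w \<star> s = s \<star> w" "tw w = w"
      by (rule w; assumption)+
    show "bij_betw a (carrier (vertex_algebra Q)) {x \<in> SA. e \<star> x \<star> e = x}"
      unfolding bij_betw_def
    proof (intro conjI inj_onI equalityI subsetI)
      fix s t assume s: "s \<in> carrier (vertex_algebra Q)" and t: "t \<in> carrier (vertex_algebra Q)" and eq: "a s = a t"
      have "s f = t f" for f
      proof (cases "f \<in> E")
        case True
        have "gscale (s f) (em f) = gscale (t f) (em f)" using fa(1)[OF True] eq by metis
        moreover have "em f \<noteq> 0" using EE(2)[OF True] by (simp only: minI_def simp_thms)
        ultimately show ?thesis by (simp only: gfun.scale_cancel_right simp_thms)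
      qed (use s t in \<open>simp add: vertex_algebra_def verts\<close>)
      then show "s = t" by (rule ext)
    next
      fix x assume "x \<in> {x \<in> SA. e \<star> x \<star> e = x}"
      then have x: "x \<in> SA" "e \<star> x \<star> e = x" by blast+
      \<comment> \<open>Minimality makes each f S f one-dimensional, and the mixed terms vanish
        because distinct idempotents of E lie in distinct blocks. So e S e consists of the
        combinations of the idempotents.\<close>
      have "\<forall>f\<in>E. \<exists>c. em f \<star> x \<star> em f = gscale c (em f)" using minI_corner[OF EE(2) x(1)] by blast
      then obtain c where c: "\<And>f. f \<in> E \<Longrightarrow> em f \<star> x \<star> em f = gscale (c f) (em f)" by metis
      define s where "s f = (if f \<in> E then c f else 0)" for f
      have "x = (\<Sum>f\<in>E. \<Sum>g\<in>E. em g \<star> x \<star> em f)" using x(2) decomp by metis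
      also have "\<dots> = (\<Sum>f\<in>E. \<Sum>g\<in>E. if g = f then gscale (s f) (em f) else 0)"
      proof (rule sum.cong[OF refl], rule sum.cong[OF refl])
        fix f g assume fg: "f \<in> E" "g \<in> E"
        show "em g \<star> x \<star> em f = (if g = f then gscale (s f) (em f) else 0)"
        proof (cases "g = f")
          case True
          then show ?thesis using c[OF fg(1)] fg(1) by (simp only: True if_True s_def)
        next
          case False
          then show ?thesis using EE(3)[OF fg(2,1) False x(1)] by (simp only: if_False)
        qed
      qed
      also have "\<dots> = a s" unfolding a_def
        by (rule sum.cong[OF refl]) (use EE(1) in \<open>simp only: sum.delta if_True\<close>)
      finally have xs: "x = a s" .
      show "x \<in> a ` carrier (vertex_algebra Q)"
        unfolding xs by (rule imageI) (simp add: vertex_algebra_def verts s_def)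
    qed (use aS eae in blast)
    show "bij_betw b (bcarrier (arrow_bimodule Q)) {u \<in> UA. e \<star> u \<star> e = u}"
      unfolding bij_betw_def
    proof (intro conjI inj_onI equalityI subsetI)
      fix u v assume u: "u \<in> bcarrier (arrow_bimodule Q)" and v: "v \<in> bcarrier (arrow_bimodule Q)" and eq: "b u = b v"
      have "u (f, g, k) = v (f, g, k)" for f g k
      proof (cases "f \<in> E \<and> g \<in> E \<and> k < D f g")
        case True
        then have fg: "f \<in> E" "g \<in> E" and k: "k < D f g" by blast+
        have "(\<Sum>k<D f g. gscale (u (f, g, k)) (\<beta> f g k)) = (\<Sum>k<D f g. gscale (v (f, g, k)) (\<beta> f g k))"
          by (simp only: gbf[OF fg, symmetric] eq)
        then have 0: "(\<Sum>k<D f g. gscale (u (f, g, k) - v (f, g, k)) (\<beta> f g k)) = 0"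
          by (simp only: gfun.scale_left_diff_distrib sum_subtractf right_minus_eq)
        define h where "h = inv_into {..<D f g} (\<beta> f g)"
        have h: "h (\<beta> f g k) = k" if "k < D f g" for k
          unfolding h_def by (rule inv_into_f_f[OF \<beta>(1)[OF fg]]) (use that in simp)
        have "(\<Sum>x\<in>\<beta> f g ` {..<D f g}. gscale (u (f, g, h x) - v (f, g, h x)) x) = 0"
          unfolding sum.reindex[OF \<beta>(1)[OF fg]] o_def
          by (rule trans[OF sum.cong[OF refl] 0]) (simp only: h lessThan_iff)
        from gfun.independentD[OF \<beta>(3)[OF fg] _ subset_refl this, of "\<beta> f g k"]
        have "u (f, g, h (\<beta> f g k)) - v (f, g, h (\<beta> f g k)) = 0" using k by simp
        then show ?thesis unfolding h[OF k] by simp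
      qed (use u v in \<open>auto simp: arrow_bimodule_def arcs\<close>)
      then show "u = v" by (intro ext) (metis surj_pair)
    next
      fix x assume "x \<in> {u \<in> UA. e \<star> u \<star> e = u}"
      then have x: "x \<in> UA" "e \<star> x \<star> e = x" by blast+
      have "\<exists>c. em g \<star> x \<star> em f = (\<Sum>k<D f g. gscale (c k) (\<beta> f g k))" if fg: "f \<in> E" "g \<in> E" for f g
      proof -
        have "em g \<star> x \<star> em f \<in> W f g" unfolding W_def using x(1) by (auto simp only: sm_assoc mem_Collect_eq)
        then have "em g \<star> x \<star> em f \<in> gfun.span (\<beta> f g ` {..<D f g})" using \<beta>(4)[OF fg] by blast
        then obtain c where c: "em g \<star> x \<star> em f = (\<Sum>y\<in>\<beta> f g ` {..<D f g}. gscale (c y) y)"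
          unfolding gfun.span_finite[OF finite_imageI[OF finite_lessThan]] by blast
        have "em g \<star> x \<star> em f = (\<Sum>k<D f g. gscale (c (\<beta> f g k)) (\<beta> f g k))"
          unfolding c sum.reindex[OF \<beta>(1)[OF fg]] o_def ..
        then show ?thesis by (rule exI[of _ "\<lambda>k. c (\<beta> f g k)"])
      qed
      then obtain c where c: "\<And>f g. f \<in> E \<Longrightarrow> g \<in> E \<Longrightarrow> em g \<star> x \<star> em f = (\<Sum>k<D f g. gscale (c f g k) (\<beta> f g k))" by metis
      define u where "u z = (if z \<in> arcs Q then (case z of (f, g, k) \<Rightarrow> c f g k) else 0)" for z
      have "x = (\<Sum>f\<in>E. \<Sum>g\<in>E. em g \<star> x \<star> em f)" using x(2) decomp by metis
      also have "\<dots> = b u" unfolding b_def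
      proof (rule sum.cong[OF refl], rule sum.cong[OF refl])
        fix f g assume fg: "f \<in> E" "g \<in> E"
        have "u (f, g, k) = c f g k" if "k < D f g" for k using that fg by (simp add: u_def arcs)
        then show "em g \<star> x \<star> em f = (\<Sum>k<D f g. gscale (u (f, g, k)) (\<beta> f g k))"
          unfolding c[OF fg] by (intro sum.cong[OF refl]) (simp only: lessThan_iff)
      qed
      finally have xu: "x = b u" .
      show "x \<in> b ` bcarrier (arrow_bimodule Q)"
        unfolding xu by (rule imageI) (simp add: arrow_bimodule_def u_def)
    next
      fix x assume "x \<in> b ` bcarrier (arrow_bimodule Q)"
      then show "x \<in> {u \<in> UA. e \<star> u \<star> e = u}" using bUA be by (auto simp only: mem_Collect_eq)
    qed
    show "a \<one>\<^bsub>vertex_algebra Q\<^esub> = e" unfolding a_def eE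
      by (rule sum.cong[OF refl]) (simp add: vertex_algebra_def verts)
    fix s t c assume s: "s \<in> carrier (vertex_algebra Q)"
    \<comment> \<open>Minimal idempotents have matrix trace 1, which agrees with every vertex having
      trace 1.\<close>
    have TrTa: "TrT (a s) = (\<Sum>f\<in>E. s f)"
    proof -
      have "TrT (\<Sum>f\<in>B. gscale (s f) (em f)) = (\<Sum>f\<in>B. s f)" if "finite B" "B \<subseteq> E" for B
        using that
      proof (induction B rule: finite_induct)
        case empty
        show ?case by (simp only: sum.empty TrT_zero)
      next
        case (insert f B)
        have "gscale (s f) (em f) \<in> SA" "(\<Sum>f\<in>B. gscale (s f) (em f)) \<in> SA" "em f \<in> SA" "TrT (em f) = 1"
          using insert.prems fS TrT_minI[OF EE(2)] by (auto intro!: SA_closed)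
        then show ?case using insert by (simp only: sum.insert TrT_linear insert_subset simp_thms mult_1_right)
      qed
      from this[OF EE(1) subset_refl] show ?thesis by (simp only: a_def)
    qed
    show "vertex_trace Q s = lam (w' \<star> a s)" using w(7)[OF aS, of s] TrTa by (simp add: vertex_trace_def verts)
    show "a (c \<odot>\<^bsub>vertex_algebra Q\<^esub> s) = gscale c (a s)"
      unfolding a_def gfun.scale_sum_right gfun.scale_scale by (simp add: vertex_algebra_def)
    show "a (s \<otimes>\<^bsub>vertex_algebra Q\<^esub> t) = a s \<star> a t" unfolding a_mult by (simp add: vertex_algebra_def)
    show "a (s \<oplus>\<^bsub>vertex_algebra Q\<^esub> t) = a s + a t"
      unfolding a_def sum.distrib[symmetric] gfun.scale_left_distrib[symmetric] by (simp add: vertex_algebra_def)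
  next
    fix s :: "('g \<Rightarrow> complex) \<Rightarrow> complex" and u v c
    show "b (badd (arrow_bimodule Q) u v) = b u + b v"
      unfolding b_def sum.distrib[symmetric] gfun.scale_left_distrib[symmetric] by (simp add: arrow_bimodule_def)
    show "b (bscale (arrow_bimodule Q) c u) = gscale c (b u)"
      unfolding b_def gfun.scale_sum_right gfun.scale_scale by (simp add: arrow_bimodule_def)
    show "b (lact (arrow_bimodule Q) s u) = a s \<star> b u" "b (ract (arrow_bimodule Q) u s) = b u \<star> a s"
      unfolding ab by (rule b_cong; simp add: arrow_bimodule_def ends)+
  qed (auto simp: vertex_algebra_def arrow_bimodule_def)
  then show ?thesis unfolding e_def by blast
qed

end

theorem theorem3p2:
  fixes G :: "('g, 'm) monoid_scheme"
    and \<rho> :: "'g \<Rightarrow> complex^'n^'n"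
    and n :: nat
    and Tr :: "('g \<Rightarrow> complex) \<Rightarrow> complex"
  assumes "group G" and "finite (carrier G)"
    and "representation G \<rho>" and "CARD('n) = n" and "n \<ge> 2"
    and "sum_of_matrix_traces (group_algebra G) Tr"
  shows
    "(\<exists>\<Omega>.
        (if \<forall>g\<in>carrier G. det (\<rho> g) = 1
         then superpotential (group_algebra G) Tr (mckay_bimodule G \<rho>) n \<Omega>
         else \<exists>\<tau>. twisted_superpotential (group_algebra G) Tr (mckay_bimodule G \<rho>) \<tau> n \<Omega>) \<and>
        alg_isomorphic (polynomial_smash G \<rho>)
          (derivation_quotient (group_algebra G) Tr (mckay_bimodule G \<rho>) \<Omega> (n - 2)))
     \<and>
     (\<forall>E e Q.
        simple_idempotents G E \<and> e = \<Sum>E \<and> det_twist \<rho> e = e \<and> Q = mckay_quiver G \<rho> E \<longrightarrow>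
        (\<exists>\<Phi>.
          (if \<forall>g\<in>carrier G. det (\<rho> g) = 1
           then superpotential (vertex_algebra Q) (vertex_trace Q) (arrow_bimodule Q) n \<Phi>
           else \<exists>\<tau>. twisted_superpotential (vertex_algebra Q) (vertex_trace Q) (arrow_bimodule Q) \<tau> n \<Phi>) \<and>
          alg_isomorphic (corner (polynomial_smash G \<rho>) (group_algebra_emb e))
            (derivation_quotient (vertex_algebra Q) (vertex_trace Q) (arrow_bimodule Q) \<Phi> (n - 2))))"
proof (intro conjI allI impI)
  interpret finite_rep G \<rho> using assms(1-3) by (simp add: finite_rep_def finite_rep_axioms_def)
  obtain m d and T :: "nat \<Rightarrow> nat \<Rightarrow> nat \<Rightarrow> ('g, 'n) gfun \<Rightarrow> complex" where W: "wedderburn G \<rho> m d T"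
    and Tr: "\<And>x. x \<in> carrier CG \<Longrightarrow> Tr x = wedderburn.TrT m d T (em x)"
    using wedderburn_exists[OF assms(6)] by blast
  interpret W: wedderburn G \<rho> m d T by (rule W)
  obtain w w' where w: "w \<in> SA" "w' \<in> SA" "w \<star> w' = gel \<one>\<^bsub>G\<^esub>" "w' \<star> w = gel \<one>\<^bsub>G\<^esub>" "\<And>s. s \<in> SA \<Longrightarrow> w \<star> s = s \<star> w"
    "tw w = w" "\<And>x. x \<in> SA \<Longrightarrow> W.TrT x = lam (w' \<star> x)"
    using W.trace_weight by blast
  have n: "CARD('n) \<ge> 2" using assms(4,5) by simp
  show "\<exists>\<Omega>. (if \<forall>g\<in>carrier G. det (\<rho> g) = 1
         then superpotential (group_algebra G) Tr (mckay_bimodule G \<rho>) n \<Omega>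
         else \<exists>\<tau>. twisted_superpotential (group_algebra G) Tr (mckay_bimodule G \<rho>) \<tau> n \<Omega>) \<and>
        alg_isomorphic (polynomial_smash G \<rho>)
          (derivation_quotient (group_algebra G) Tr (mckay_bimodule G \<rho>) \<Omega> (n - 2))"
    using concrete_corner.derivation_quotient_corner[OF W.smash_corner[OF Tr w] n]
    unfolding corner_one assms(4) .
  fix E e and Q :: "('g \<Rightarrow> complex, ('g \<Rightarrow> complex) \<times> ('g \<Rightarrow> complex) \<times> nat) pre_digraph"
  assume A: "simple_idempotents G E \<and> e = \<Sum>E \<and> det_twist \<rho> e = e \<and> Q = mckay_quiver G \<rho> E"
  then have E: "simple_idempotents G E" and e: "e = \<Sum>E" and tw: "det_twist \<rho> (\<Sum>E) = \<Sum>E" and Q: "Q = mckay_quiver G \<rho> E"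
    by (blast, blast, metis, blast)
  obtain a b r p q where
    C: "concrete_corner G \<rho> (vertex_algebra Q) (arrow_bimodule Q) (vertex_trace Q) a b (em (\<Sum>E)) r p q w w'"
    using W.path_corner[OF E tw Q w] by blast
  have "group_algebra_emb e = em (\<Sum>E)" by (simp add: group_algebra_emb_def em_def e)
  then show "\<exists>\<Phi>. (if \<forall>g\<in>carrier G. det (\<rho> g) = 1
           then superpotential (vertex_algebra Q) (vertex_trace Q) (arrow_bimodule Q) n \<Phi>
           else \<exists>\<tau>. twisted_superpotential (vertex_algebra Q) (vertex_trace Q) (arrow_bimodule Q) \<tau> n \<Phi>) \<and>
          alg_isomorphic (corner (polynomial_smash G \<rho>) (group_algebra_emb e))
            (derivation_quotient (vertex_algebra Q) (vertex_trace Q) (arrow_bimodule Q) \<Phi> (n - 2))"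
    using concrete_corner.derivation_quotient_corner[OF C n] unfolding assms(4) by simp
qed

end
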